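(* For any positive integer $n$ and $1\le r\le n$, the $\mathfrak S_n$-equivariant Charney--Davis quantity of the Chow ring of the uniform matroid $U_{r,n}$ is given (as an identity of virtual $\mathfrak S_n$-representations) by $$\sum_{i=0}^{r-1}(-1)^iA^i(U_{r,n})_{\mathbb C}\cong_{\mathfrak S_n}\begin{cases}0&\text{if $r$ is even},\\(-1)^{\frac{r-1}{2}}S^{H_{\mathrm{Even}(r-1),n}}&\text{if $r$ is odd},\end{cases}$$ or, equivalently, as graded Frobenius series, $$\mathrm{grFrob}(A(U_{r,n})_{\mathbb C},-1)=\begin{cases}0&\text{if $r$ is even},\\(-1)^{\frac{r-1}{2}}s_{H_{\mathrm{Even}(r-1),n}}&\text{if $r$ is odd}.\end{cases}$$
   Context: The uniform matroid $U_{r,n}$ is the matroid on $[n]=\{1,\dots,n\}$ with flats $\{S\subseteq[n]:|S|\le r-1\}\cup\{[n]\}$. For a loopless matroid $M$ on $E$ with lattice of flats $\mathcal L(M)$, the Chow ring is the graded $\mathbb{Q}$-algebra (all variables in degree 1) $A(M)=\mathbb{Q}[x_F:F\in\mathcal L(M)\setminus\{\emptyset\}]/(I+J)$, where $I$ is generated by $x_Fx_{F'}$ for incomparable $F,F'$, and $J$ by $\sum_{F:\,i\in F}x_F$ for $i\in E$. $A^i(M)$ is the degree $i$ part, and the subscript $\mathbb C$ means $\mathbb C\otimes_{\mathbb Q}-$. $\mathfrak S_n$ acts on $A(U_{r,n})_{\mathbb C}$ by $\sigma x_F=x_{\sigma(F)}$. For a graded $\mathbb C[\mathfrak S_n]$-module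 $V=\bigoplus_iV^i$, $\mathrm{grFrob}(V,t)=\sum_i\mathrm{ch}(V^i)t^i$, where $\mathrm{ch}$ is the Frobenius characteristic (irreducible $\chi^\lambda\mapsto$ Schur function $s_\lambda$). The equivariant Charney--Davis quantity of a graded representation $A=\bigoplus_{i=0}^mA^i$ with top degree $m$ is, up to the sign $(-1)^{m/2}$ when $m$ is even, the alternating sum $\sum_i(-1)^iA^i$ in the representation ring. $\mathrm{Even}(k)=\{2,4,\dots,k\}$ for even $k$ (empty for $k=0$). A ribbon is a connected skew shape $\lambda/\mu$ in which any two consecutive rows overlap in exactly one cell. Number the cells of an $n$-cell ribbon $1,\dots,n$, left to right in each row, from the bottommost row to the topmost row (English notation); $i$ is a descent if cell $i+1$ is directly above cell $i$. For $R\subseteq[n-1]$, $H_{R,n}$ is the ribbon with $n$ cells and descent set $R$. $S^{\lambda/\mu}$ is the Specht module of skew shape $\lambda/\mu$ (over $\mathbb C$), whose Frobenius characteristic is the skew Schur function $s_{\lambda/\mu}$. *)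

theory Defs
  imports Complex_Main "HOL-Library.Poly_Mapping" "HOL-Combinatorics.Permutations"
    "HOL-Algebra.QuotRing" "HOL-Algebra.Module" "HOL-Algebra.Sym_Groups"
    "HOL-Algebra.Free_Abelian_Groups"
begin

section \<open>Representations of symmetric groups\<close>

text \<open>The fields \<open>mult\<close> and \<open>one\<close>, which HOL-Algebra modules inherit from rings, play no
  role for representations.  Only the operators \<open>act \<sigma>\<close> with \<open>\<sigma>\<close> in \<open>sym_group n\<close> matter.\<close>

record ('k, 'v) rep = "('k, 'v) module" +
  act :: "(nat \<Rightarrow> nat) \<Rightarrow> 'v \<Rightarrow> 'v"

definition rep_iso :: "nat \<Rightarrow> ('k, 'v) rep \<Rightarrow> ('k, 'w) rep \<Rightarrow> bool" where
  "rep_iso n V W \<longleftrightarrow> (\<exists>f \<in> iso (add_monoid V) (add_monoid W).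
     (\<forall>c. \<forall>v \<in> carrier V. f (c \<odot>\<^bsub>V\<^esub> v) = c \<odot>\<^bsub>W\<^esub> f v) \<and>
     (\<forall>\<sigma> \<in> carrier (sym_group n). \<forall>v \<in> carrier V. f (act V \<sigma> v) = act W \<sigma> (f v)))"

definition zero_rep :: "('k, 'v::zero) rep" where
  "zero_rep = \<lparr>carrier = {0}, monoid.mult = undefined, monoid.one = undefined, ring.zero = 0,
     ring.add = (\<lambda>_ _. 0), smult = (\<lambda>_ _. 0), act = (\<lambda>_ _. 0)\<rparr>"

definition rep_plus :: "('k, 'v) rep \<Rightarrow> ('k, 'w) rep \<Rightarrow> ('k, 'v \<times> 'w) rep" where
  "rep_plus V W = \<lparr>carrier = carrier V \<times> carrier W, monoid.mult = undefined, monoid.one = undefined,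
     ring.zero = (\<zero>\<^bsub>V\<^esub>, \<zero>\<^bsub>W\<^esub>),
     ring.add = (\<lambda>(v, w) (v', w'). (v \<oplus>\<^bsub>V\<^esub> v', w \<oplus>\<^bsub>W\<^esub> w')),
     smult = (\<lambda>c (v, w). (c \<odot>\<^bsub>V\<^esub> v, c \<odot>\<^bsub>W\<^esub> w)),
     act = (\<lambda>\<sigma> (v, w). (act V \<sigma> v, act W \<sigma> w))\<rparr>"

text \<open>The direct sum of a finite family (for infinite \<open>I\<close> this would be the direct product).\<close>

definition rep_Sum :: "'i set \<Rightarrow> ('i \<Rightarrow> ('k, 'v) rep) \<Rightarrow> ('k, 'i \<Rightarrow> 'v) rep" where
  "rep_Sum I V = \<lparr>carrier = (\<Pi>\<^sub>E i\<in>I. carrier (V i)), monoid.mult = undefined, monoid.one = undefined,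
     ring.zero = (\<lambda>i\<in>I. \<zero>\<^bsub>V i\<^esub>),
     ring.add = (\<lambda>v w. \<lambda>i\<in>I. v i \<oplus>\<^bsub>V i\<^esub> w i),
     smult = (\<lambda>c v. \<lambda>i\<in>I. c \<odot>\<^bsub>V i\<^esub> v i),
     act = (\<lambda>\<sigma> v. \<lambda>i\<in>I. act (V i) \<sigma> (v i))\<rparr>"

text \<open>A virtual representation is a formal difference \<open>V - W\<close>, written as the pair \<open>(V, W)\<close>.
  Two formal differences \<open>V - W\<close> and \<open>V' - W'\<close> are identified in the representation ring when
  \<open>V \<oplus> W'\<close> and \<open>V' \<oplus> W\<close> are isomorphic; finite-dimensional complex representations of a
  finite group cancel, so no stabilising summand is needed.\<close>

type_synonym 'v virt = "(complex, 'v) rep \<times> (complex, 'v) rep"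

definition virt_eq :: "nat \<Rightarrow> 'v virt \<Rightarrow> 'w virt \<Rightarrow> bool" where
  "virt_eq n P Q \<longleftrightarrow> rep_iso n (rep_plus (fst P) (snd Q)) (rep_plus (fst Q) (snd P))"

definition virt_of :: "(complex, 'v::zero) rep \<Rightarrow> 'v virt" where
  "virt_of V = (V, zero_rep)"

definition virt_uminus :: "'v virt \<Rightarrow> 'v virt" where
  "virt_uminus P = (snd P, fst P)"

text \<open>\<open>\<Sum>i=0..m. (-1) ^ i * V i\<close>\<close>

definition alternating_sum :: "nat \<Rightarrow> (nat \<Rightarrow> (complex, 'v) rep) \<Rightarrow> (nat \<Rightarrow> 'v) virt" where
  "alternating_sum m V = (rep_Sum {i. i \<le> m \<and> even i} V, rep_Sum {i. i \<le> m \<and> odd i} V)"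

section \<open>Extension of scalars from the rationals to the complex numbers\<close>

text \<open>The tensor product of \<open>\<complex>\<close> and \<open>V\<close> over the rationals: the free abelian group on
  \<open>\<complex> \<times> V\<close> modulo the subgroup generated by the bilinearity relations.\<close>

definition tensor_free :: "(rat, 'v) rep \<Rightarrow> ((complex \<times> 'v) \<Rightarrow>\<^sub>0 int) monoid" where
  "tensor_free V = free_Abelian_group (UNIV \<times> carrier V)"

definition tensor_relations :: "(rat, 'v) rep \<Rightarrow> ((complex \<times> 'v) \<Rightarrow>\<^sub>0 int) set" where
  "tensor_relations V = generate (tensor_free V)
     ({frag_of (c + d, v) - frag_of (c, v) - frag_of (d, v) | c d v. v \<in> carrier V} \<union>
      {frag_of (c, v \<oplus>\<^bsub>V\<^esub> w) - frag_of (c, v) - frag_of (c, w) | c v w.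
         v \<in> carrier V \<and> w \<in> carrier V} \<union>
      {frag_of (c * of_rat q, v) - frag_of (c, q \<odot>\<^bsub>V\<^esub> v) | c q v. v \<in> carrier V})"

text \<open>Endomorphisms \<open>\<phi>\<close> of the free group preserving the relations \<open>N\<close> induce
  \<open>N + x \<mapsto> N + \<phi> x\<close> on cosets, which is \<open>X \<mapsto> N + \<phi> ` X\<close>.  So \<open>z\<close> maps \<open>c \<otimes> v\<close> to
  \<open>z c \<otimes> v\<close>, and \<open>\<sigma>\<close> maps it to \<open>c \<otimes> \<sigma> v\<close>.\<close>

definition complexify :: "(rat, 'v) rep \<Rightarrow> (complex, ((complex \<times> 'v) \<Rightarrow>\<^sub>0 int) set) rep" where
  "complexify V = (let G = tensor_free V; N = tensor_relations V; Q = G Mod N in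
     \<lparr>carrier = carrier Q, monoid.mult = undefined, monoid.one = undefined, ring.zero = \<one>\<^bsub>Q\<^esub>,
      ring.add = (\<lambda>X Y. X \<otimes>\<^bsub>Q\<^esub> Y),
      smult = (\<lambda>z X. N <#>\<^bsub>G\<^esub> (frag_extend (\<lambda>(c, v). frag_of (z * c, v)) ` X)),
      act = (\<lambda>\<sigma> X. N <#>\<^bsub>G\<^esub> (frag_extend (\<lambda>(c, v). frag_of (c, act V \<sigma> v)) ` X))\<rparr>)"

section \<open>Chow rings\<close>

type_synonym 'a set_monom = "'a set \<Rightarrow>\<^sub>0 nat"
type_synonym 'a set_poly = "'a set_monom \<Rightarrow>\<^sub>0 rat"

definition Var :: "'a set \<Rightarrow> 'a set_poly" where
  "Var F = Poly_Mapping.single (Poly_Mapping.single F 1) 1"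

definition monom_degree :: "'a set_monom \<Rightarrow> nat" where
  "monom_degree m = (\<Sum>F \<in> Poly_Mapping.keys m. Poly_Mapping.lookup m F)"

definition flat_poly_ring :: "'a set set \<Rightarrow> 'a set_poly ring" where
  "flat_poly_ring L = \<lparr>carrier = {p. \<forall>m \<in> Poly_Mapping.keys p. Poly_Mapping.keys m \<subseteq> L - {{}}},
     monoid.mult = (*), monoid.one = 1, ring.zero = 0, ring.add = (+)\<rparr>"

text \<open>A loopless matroid enters through its ground set \<open>E\<close> and its set \<open>L\<close> of flats.\<close>

definition chow_ideal :: "'a set \<Rightarrow> 'a set set \<Rightarrow> 'a set_poly set" where
  "chow_ideal E L = Idl\<^bsub>flat_poly_ring L\<^esub>
     ({Var F * Var F' | F F'. F \<in> L - {{}} \<and> F' \<in> L - {{}} \<and> \<not> F \<subseteq> F' \<and> \<not> F' \<subseteq> F} \<union>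
      (\<lambda>i. \<Sum>F \<in> {F \<in> L. i \<in> F}. Var F) ` E)"

definition chow_ring :: "'a set \<Rightarrow> 'a set set \<Rightarrow> 'a set_poly set ring" where
  "chow_ring E L = flat_poly_ring L Quot chow_ideal E L"

definition chow_class :: "'a set \<Rightarrow> 'a set set \<Rightarrow> 'a set_poly \<Rightarrow> 'a set_poly set" where
  "chow_class E L p = chow_ideal E L +>\<^bsub>flat_poly_ring L\<^esub> p"

definition push_keys :: "('a \<Rightarrow> 'b) \<Rightarrow> ('a \<Rightarrow>\<^sub>0 'c) \<Rightarrow> ('b \<Rightarrow>\<^sub>0 'c::comm_monoid_add)" where
  "push_keys f p = (\<Sum>k \<in> Poly_Mapping.keys p. Poly_Mapping.single (f k) (Poly_Mapping.lookup p k))"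

text \<open>The degree \<open>i\<close> part of the Chow ring, with the action \<open>\<sigma> x\<^sub>F = x\<^bsub>\<sigma>(F)\<^esub>\<close>; elements are
  cosets of the Chow ideal, which is invariant when \<open>\<sigma>\<close> permutes the flats.\<close>

definition chow_graded :: "nat set \<Rightarrow> nat set set \<Rightarrow> nat \<Rightarrow> (rat, nat set_poly set) rep" where
  "chow_graded E L i = (let A = chow_ring E L in
     \<lparr>carrier = chow_class E L `
        {p \<in> carrier (flat_poly_ring L). \<forall>m \<in> Poly_Mapping.keys p. monom_degree m = i},
      monoid.mult = undefined, monoid.one = undefined, ring.zero = \<zero>\<^bsub>A\<^esub>, ring.add = (\<lambda>X Y. X \<oplus>\<^bsub>A\<^esub> Y),
      smult = (\<lambda>q X. chow_class E L (Poly_Mapping.single 0 q) \<otimes>\<^bsub>A\<^esub> X),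
      act = (\<lambda>\<sigma> X. push_keys (push_keys ((`) \<sigma>)) ` X)\<rparr>)"

definition uniform_flats :: "nat \<Rightarrow> nat \<Rightarrow> nat set set" where
  "uniform_flats r n = {S. S \<subseteq> {1..n} \<and> card S \<le> r - 1} \<union> {{1..n}}"

definition uniform_chow :: "nat \<Rightarrow> nat \<Rightarrow> nat \<Rightarrow>
    (complex, ((complex \<times> nat set_poly set) \<Rightarrow>\<^sub>0 int) set) rep" where
  "uniform_chow r n i = complexify (chow_graded {1..n} (uniform_flats r n) i)"

section \<open>Shapes\<close>

text \<open>Cells are pairs (row, column) counted from 0, in English notation: row 0 is on top.
  Partitions are weakly decreasing lists of positive integers.\<close>

type_synonym shape = "(nat \<times> nat) set"

definition is_partition :: "nat list \<Rightarrow> bool" where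
  "is_partition l \<longleftrightarrow> sorted_wrt (\<ge>) l \<and> 0 \<notin> set l"

definition partitions_of :: "nat \<Rightarrow> nat list set" where
  "partitions_of n = {l. is_partition l \<and> sum_list l = n}"

definition young :: "nat list \<Rightarrow> shape" where
  "young l = {(i, j). i < length l \<and> j < l ! i}"

definition is_skew_shape :: "shape \<Rightarrow> bool" where
  "is_skew_shape D \<longleftrightarrow> (\<exists>l m. is_partition l \<and> is_partition m \<and> young m \<subseteq> young l \<and>
     D = young l - young m)"

definition adjacent :: "nat \<times> nat \<Rightarrow> nat \<times> nat \<Rightarrow> bool" where
  "adjacent c d \<longleftrightarrow> d \<in> {(Suc (fst c), snd c), (fst c, Suc (snd c))} \<or>
                   c \<in> {(Suc (fst d), snd d), (fst d, Suc (snd d))}"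

definition is_connected :: "shape \<Rightarrow> bool" where
  "is_connected D \<longleftrightarrow> (\<forall>c \<in> D. \<forall>d \<in> D. (\<lambda>a b. a \<in> D \<and> b \<in> D \<and> adjacent a b)\<^sup>*\<^sup>* c d)"

definition is_ribbon :: "shape \<Rightarrow> bool" where
  "is_ribbon D \<longleftrightarrow> is_skew_shape D \<and> is_connected D \<and>
     (\<forall>i. (\<exists>j. (i, j) \<in> D) \<and> (\<exists>j. (Suc i, j) \<in> D) \<longrightarrow>
        card {j. (i, j) \<in> D \<and> (Suc i, j) \<in> D} = 1)"

text \<open>Cells are numbered from 1, left to right in each row, from the bottommost row upwards.\<close>

definition cell_number :: "shape \<Rightarrow> nat \<times> nat \<Rightarrow> nat" where
  "cell_number D c = card {d \<in> D. fst d > fst c \<or> fst d = fst c \<and> snd d \<le> snd c}"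

definition shape_descents :: "shape \<Rightarrow> nat set" where
  "shape_descents D = {k. \<exists>i j. (Suc i, j) \<in> D \<and> (i, j) \<in> D \<and>
     cell_number D (Suc i, j) = k \<and> cell_number D (i, j) = Suc k}"

text \<open>The ribbon with \<open>n\<close> cells and descent set \<open>R\<close>, up to translation.  Cell \<open>k + 1\<close> is directly
  above cell \<open>k\<close> if \<open>k\<close> is in \<open>R\<close>, and directly to its right otherwise; see
  \<open>ribbon_is_ribbon\<close>, \<open>card_ribbon\<close> and \<open>shape_descents_ribbon\<close> below.\<close>

definition ribbon_cell :: "nat set \<Rightarrow> nat \<Rightarrow> nat \<times> nat" where
  "ribbon_cell R k = (card {i \<in> R. k \<le> i}, card ({1..<k} - R))"

definition ribbon :: "nat set \<Rightarrow> nat \<Rightarrow> shape" where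
  "ribbon R n = ribbon_cell R ` {1..n}"

context
  fixes R :: "nat set" and n :: nat
  assumes R: "R \<subseteq> {1..<n}"
begin

lemma fin_R: "finite R"
  using R finite_subset by blast

lemma ribbon_cell_eq:
  assumes "1 \<le> k"
  shows "snd (ribbon_cell R k) + card R + 1 = k + fst (ribbon_cell R k)"
proof -
  have "R = {i \<in> R. k \<le> i} \<union> {i \<in> R. i < k}" by auto
  then have "card R = card {i \<in> R. k \<le> i} + card {i \<in> R. i < k}"
    using fin_R by (metis (no_types, lifting) card_Un_disjoint disjoint_iff finite_Un leD mem_Collect_eq)
  moreover have "{1..<k} \<inter> R = {i \<in> R. i < k}" using R by auto
  then have "card ({1..<k} - R) + card {i \<in> R. i < k} = k - 1"
    using card_Int_Diff[of "{1..<k}" R] by simp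
  ultimately show ?thesis using assms by (simp add: ribbon_cell_def)
qed

lemma ribbon_cell_mono:
  assumes "k \<le> k'"
  shows "fst (ribbon_cell R k') \<le> fst (ribbon_cell R k)"
    and "snd (ribbon_cell R k) \<le> snd (ribbon_cell R k')"
proof -
  show "fst (ribbon_cell R k') \<le> fst (ribbon_cell R k)"
    unfolding ribbon_cell_def fst_conv using assms fin_R by (intro card_mono) auto
  show "snd (ribbon_cell R k) \<le> snd (ribbon_cell R k')"
    unfolding ribbon_cell_def snd_conv using assms by (intro card_mono) auto
qed

lemma ribbon_cell_less:
  assumes "1 \<le> k" "k < k'"
  shows "fst (ribbon_cell R k') < fst (ribbon_cell R k) \<or>
    fst (ribbon_cell R k') = fst (ribbon_cell R k) \<and> snd (ribbon_cell R k) < snd (ribbon_cell R k')"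
  using ribbon_cell_eq[of k] ribbon_cell_eq[of k'] ribbon_cell_mono[of k k'] assms by linarith

lemma ribbon_cell_inj: "inj_on (ribbon_cell R) {1..n}"
proof (rule inj_onI)
  fix k k' assume "k \<in> {1..n}" "k' \<in> {1..n}" "ribbon_cell R k = ribbon_cell R k'"
  then show "k = k'" using ribbon_cell_eq[of k] ribbon_cell_eq[of k'] by simp
qed

lemma ribbon_cell_Suc_in:
  assumes "k \<in> R"
  shows "fst (ribbon_cell R k) = Suc (fst (ribbon_cell R (Suc k)))"
    and "snd (ribbon_cell R (Suc k)) = snd (ribbon_cell R k)"
proof -
  have "1 \<le> k" using assms R by auto
  have "{i \<in> R. k \<le> i} = insert k {i \<in> R. Suc k \<le> i}" using assms by auto
  then show *: "fst (ribbon_cell R k) = Suc (fst (ribbon_cell R (Suc k)))"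
    using fin_R by (simp add: ribbon_cell_def)
  show "snd (ribbon_cell R (Suc k)) = snd (ribbon_cell R k)"
    using * ribbon_cell_eq[of k] ribbon_cell_eq[of "Suc k"] \<open>1 \<le> k\<close> by linarith
qed

lemma ribbon_cell_Suc_notin:
  assumes "k \<notin> R" "1 \<le> k"
  shows "fst (ribbon_cell R (Suc k)) = fst (ribbon_cell R k)"
    and "snd (ribbon_cell R (Suc k)) = Suc (snd (ribbon_cell R k))"
proof -
  have "{i \<in> R. k \<le> i} = {i \<in> R. Suc k \<le> i}"
    using assms by (metis le_less Suc_le_eq)
  then show *: "fst (ribbon_cell R (Suc k)) = fst (ribbon_cell R k)"
    by (simp add: ribbon_cell_def)
  show "snd (ribbon_cell R (Suc k)) = Suc (snd (ribbon_cell R k))"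
    using * ribbon_cell_eq[of k] ribbon_cell_eq[of "Suc k"] assms by linarith
qed

lemma ribbon_cell_memI: "k \<in> {1..n} \<Longrightarrow> ribbon_cell R k \<in> ribbon R n"
  by (simp add: ribbon_def)

lemma card_ribbon: "card (ribbon R n) = n"
  using card_image[OF ribbon_cell_inj] by (simp add: ribbon_def)

lemma cell_number_ribbon:
  assumes "k \<in> {1..n}"
  shows "cell_number (ribbon R n) (ribbon_cell R k) = k"
proof -
  have "{d \<in> ribbon R n. fst d > fst (ribbon_cell R k) \<or>
      fst d = fst (ribbon_cell R k) \<and> snd d \<le> snd (ribbon_cell R k)} = ribbon_cell R ` {1..k}"
    (is "?A = ?B")
  proof (intro equalityI subsetI)
    fix d assume d: "d \<in> ?A"
    then obtain k' where k': "k' \<in> {1..n}" "d = ribbon_cell R k'" by (auto simp: ribbon_def)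
    have "k' \<le> k"
    proof (rule ccontr)
      assume "\<not> k' \<le> k"
      then show False using ribbon_cell_less[of k k'] d k'(2) assms by simp linarith
    qed
    with k' show "d \<in> ?B" by auto
  next
    fix d assume "d \<in> ?B"
    then obtain k' where k': "k' \<in> {1..k}" "d = ribbon_cell R k'" by auto
    moreover have "d \<in> ribbon R n" using k' assms by (auto intro: ribbon_cell_memI)
    ultimately show "d \<in> ?A" using ribbon_cell_mono[of k' k] k' by auto
  qed
  moreover have "inj_on (ribbon_cell R) {1..k}"
    by (rule inj_on_subset[OF ribbon_cell_inj]) (use assms in auto)
  ultimately show ?thesis by (simp add: cell_number_def card_image)
qed

lemma shape_descents_ribbon: "shape_descents (ribbon R n) = R"
proof (intro equalityI subsetI)
  fix k assume "k \<in> shape_descents (ribbon R n)"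
  then obtain i j where D: "(Suc i, j) \<in> ribbon R n" "(i, j) \<in> ribbon R n"
    and N: "cell_number (ribbon R n) (Suc i, j) = k" "cell_number (ribbon R n) (i, j) = Suc k"
    by (auto simp: shape_descents_def)
  obtain a where a: "a \<in> {1..n}" "ribbon_cell R a = (Suc i, j)"
    using D unfolding ribbon_def by (metis (no_types) imageE)
  obtain b where b: "b \<in> {1..n}" "ribbon_cell R b = (i, j)"
    using D unfolding ribbon_def by (metis (no_types) imageE)
  have "a = k" "b = Suc k" using cell_number_ribbon a b N by metis+
  then show "k \<in> R" using a b ribbon_cell_Suc_notin(1)[of k] by (metis atLeastAtMost_iff fst_conv n_not_Suc_n)
next
  fix k assume k: "k \<in> R"
  then have kn: "k \<in> {1..n}" "Suc k \<in> {1..n}" using R by auto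
  obtain i j where ij: "ribbon_cell R (Suc k) = (i, j)" by fastforce
  then have "ribbon_cell R k = (Suc i, j)"
    using ribbon_cell_Suc_in[OF k] by (metis fst_conv prod.collapse snd_conv)
  then show "k \<in> shape_descents (ribbon R n)"
    using ij kn cell_number_ribbon[OF kn(1)] cell_number_ribbon[OF kn(2)] ribbon_cell_memI[OF kn(1)]
      ribbon_cell_memI[OF kn(2)] unfolding shape_descents_def by auto
qed

lemma ribbon_row_gap:
  assumes "(i, j) \<in> ribbon R n" "(i, j') \<in> ribbon R n" "j \<le> t" "t \<le> j'"
  shows "(i, t) \<in> ribbon R n"
proof -
  obtain a where a: "a \<in> {1..n}" "ribbon_cell R a = (i, j)"
    using assms unfolding ribbon_def by (metis (no_types) imageE)
  obtain b where b: "b \<in> {1..n}" "ribbon_cell R b = (i, j')"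
    using assms unfolding ribbon_def by (metis (no_types) imageE)
  define k where "k = a + (t - j)"
  have ab: "b + j = a + j'"
    using ribbon_cell_eq[of a] ribbon_cell_eq[of b] a b by simp
  have k: "a \<le> k" "k \<le> b" using ab assms by (auto simp: k_def)
  have row: "fst (ribbon_cell R k) = i"
    using ribbon_cell_mono(1)[OF k(1)] ribbon_cell_mono(1)[OF k(2)] a b
    by (metis fst_conv le_antisym)
  have "snd (ribbon_cell R k) = t"
    using ribbon_cell_eq[of a] ribbon_cell_eq[of k] a row k assms
    by (simp add: k_def)
  with row have "ribbon_cell R k = (i, t)" by (simp add: prod_eq_iff)
  moreover have "k \<in> {1..n}" using k a b by auto
  ultimately show ?thesis by (force simp: ribbon_def)
qed

lemma ribbon_col_gap:
  assumes "(i, j) \<in> ribbon R n" "(i', j) \<in> ribbon R n" "i \<le> t" "t \<le> i'"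
  shows "(t, j) \<in> ribbon R n"
proof -
  obtain a where a: "a \<in> {1..n}" "ribbon_cell R a = (i, j)"
    using assms unfolding ribbon_def by (metis (no_types) imageE)
  obtain b where b: "b \<in> {1..n}" "ribbon_cell R b = (i', j)"
    using assms unfolding ribbon_def by (metis (no_types) imageE)
  define k where "k = b + (i' - t)"
  have ab: "a + i = b + i'"
    using ribbon_cell_eq[of a] ribbon_cell_eq[of b] a b by simp
  have k: "b \<le> k" "k \<le> a" using ab assms by (auto simp: k_def)
  have col: "snd (ribbon_cell R k) = j"
    using ribbon_cell_mono(2)[OF k(1)] ribbon_cell_mono(2)[OF k(2)] a b
    by (metis snd_conv le_antisym)
  have "fst (ribbon_cell R k) = t"
    using ribbon_cell_eq[of b] ribbon_cell_eq[of k] b col k assms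
    by (simp add: k_def)
  with col have "ribbon_cell R k = (t, j)" by (simp add: prod_eq_iff)
  moreover have "k \<in> {1..n}" using k a b by auto
  ultimately show ?thesis by (force simp: ribbon_def)
qed

lemma ribbon_cells_comparable:
  assumes "(i, j) \<in> ribbon R n" "(i', j') \<in> ribbon R n" "i' < i"
  shows "j \<le> j'"
proof -
  obtain a where a: "a \<in> {1..n}" "ribbon_cell R a = (i, j)"
    using assms unfolding ribbon_def by (metis (no_types) imageE)
  obtain b where b: "b \<in> {1..n}" "ribbon_cell R b = (i', j')"
    using assms unfolding ribbon_def by (metis (no_types) imageE)
  have "a \<le> b" using ribbon_cell_mono(1)[of b a] a b assms
    by (metis fst_conv leD nat_le_linear)
  then show ?thesis using ribbon_cell_mono(2)[of a b] a b by (metis snd_conv)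
qed

lemma is_connected_ribbon: "is_connected (ribbon R n)"
proof -
  let ?E = "\<lambda>a b. a \<in> ribbon R n \<and> b \<in> ribbon R n \<and> adjacent a b"
  have up: "?E\<^sup>*\<^sup>* (ribbon_cell R 1) (ribbon_cell R k)" if "1 \<le> k" "k \<le> n" for k
    using that
  proof (induction k rule: dec_induct)
    case (step k)
    have "adjacent (ribbon_cell R k) (ribbon_cell R (Suc k))"
      using ribbon_cell_Suc_in[of k] ribbon_cell_Suc_notin[of k] step
      unfolding adjacent_def by (cases "k \<in> R") (auto simp: prod_eq_iff)
    with step have "?E (ribbon_cell R k) (ribbon_cell R (Suc k))" by (auto simp: ribbon_def)
    moreover have "?E\<^sup>*\<^sup>* (ribbon_cell R 1) (ribbon_cell R k)" using step by simp
    ultimately show ?case by (rule rtranclp.rtrancl_into_rtrancl[rotated])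
  qed simp
  have sym: "symp ?E" by (auto simp: symp_def adjacent_def)
  show ?thesis unfolding is_connected_def
  proof (intro ballI)
    fix c d assume "c \<in> ribbon R n" "d \<in> ribbon R n"
    then have "?E\<^sup>*\<^sup>* (ribbon_cell R 1) c" "?E\<^sup>*\<^sup>* (ribbon_cell R 1) d"
      using up by (auto simp: ribbon_def)
    then show "?E\<^sup>*\<^sup>* c d"
      using sym by (meson rtranclp_trans symp_rtranclp sympD)
  qed
qed

end

lemma down_closed_young:
  assumes "finite Y" and down: "\<And>i j i' j'. (i, j) \<in> Y \<Longrightarrow> i' \<le> i \<Longrightarrow> j' \<le> j \<Longrightarrow> (i', j') \<in> Y"
  shows "\<exists>l. is_partition l \<and> young l = Y"
proof -
  have initial: "S = {..<card S}" if "finite S" "\<And>x y. x \<in> S \<Longrightarrow> y \<le> x \<Longrightarrow> y \<in> S" for S :: "nat set"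
  proof (cases "S = {}")
    case False
    then have "S = {..Max S}" using that by (auto intro: Max_in)
    then show ?thesis by (metis card_atMost lessThan_Suc_atMost)
  qed simp
  define c where "c i = card {j. (i, j) \<in> Y}" for i
  define h where "h = card {i. (i, 0) \<in> Y}"
  have fr: "finite {j. (i, j) \<in> Y}" for i
    by (rule finite_subset[OF _ finite_imageI[OF assms(1), of snd]]) force
  have fc: "finite {i. (i, 0) \<in> Y}"
    by (rule finite_subset[OF _ finite_imageI[OF assms(1), of fst]]) force
  have row: "(i, j) \<in> Y \<longleftrightarrow> j < c i" for i j
    using initial[OF fr[of i]] down unfolding c_def by blast
  have col: "(i, 0) \<in> Y \<longleftrightarrow> i < h" for i
    using initial[OF fc] down unfolding h_def by blast
  have anti: "c i' \<le> c i" if "i \<le> i'" for i i'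
    unfolding c_def using that down by (intro card_mono fr) auto
  define l where "l = map c [0..<h]"
  have pos: "0 < c i \<longleftrightarrow> i < h" for i using row[of i 0] col[of i] by simp
  have "0 \<notin> set l" 
  proof
    assume "0 \<in> set l"
    then obtain i where "i < h" "c i = 0" unfolding l_def by auto
    then show False using pos[of i] by simp
  qed
  moreover have "sorted_wrt (\<ge>) l"
    unfolding l_def using anti by (simp add: sorted_wrt_iff_nth_less)
  ultimately have "is_partition l" unfolding is_partition_def by blast
  moreover have "i < h" if "j < c i" for i j using that pos[of i] by simp
  then have "young l = Y" unfolding young_def l_def using row by auto
  ultimately show ?thesis by blast
qed

lemma ribbon_is_ribbon:
  assumes R: "R \<subseteq> {1..<n}"
  shows "is_ribbon (ribbon R n)"
proof -
  let ?D = "ribbon R n"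
  define Y where "Y = {(i, j). \<exists>c \<in> ?D. i \<le> fst c \<and> j \<le> snd c}"
  have fin: "finite ?D" by (simp add: ribbon_def)
  have "Y = (\<Union>c \<in> ?D. {..fst c} \<times> {..snd c})" unfolding Y_def by auto
  then have finY: "finite Y" using fin by auto
  have DY: "?D \<subseteq> Y" unfolding Y_def by force
  have Ydown: "(i', j') \<in> Y" if "(i, j) \<in> Y" "i' \<le> i" "j' \<le> j" for i j i' j'
  proof -
    from that(1) obtain c where c: "c \<in> ?D" "i \<le> fst c" "j \<le> snd c"
      unfolding Y_def mem_Collect_eq case_prod_conv by blast
    then have "i' \<le> fst c" "j' \<le> snd c" using that(2,3) by auto
    with c(1) show ?thesis unfolding Y_def mem_Collect_eq case_prod_conv by blast
  qed
  have Ddown: "(i', j') \<in> Y - ?D" if ij: "(i, j) \<in> Y - ?D" and le: "i' \<le> i" "j' \<le> j" for i j i' j'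
  proof (rule ccontr)
    assume "\<not> ?thesis"
    with Ydown[OF _ le] ij have D': "(i', j') \<in> ?D" by blast
    from ij obtain c where c: "c \<in> ?D" "i \<le> fst c" "j \<le> snd c"
      unfolding Y_def Diff_iff mem_Collect_eq case_prod_conv by blast
    then obtain a b where ab: "(a, b) \<in> ?D" "i \<le> a" "j \<le> b" by (metis prod.collapse)
    show False
    proof (cases "i' = a")
      case True
      then show ?thesis using ribbon_row_gap[OF R, of a j' b j] D' ab le ij by simp
    next
      case False
      then have "b \<le> j'" using ribbon_cells_comparable[OF R ab(1) D'] ab le by simp
      then have "b = j" "j' = j" using ab le by auto
      then show ?thesis using ribbon_col_gap[OF R, of i' j a i] D' ab le ij by simp
    qed
  qed
  have "\<exists>l. is_partition l \<and> young l = Y"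
    by (rule down_closed_young[OF finY]) (rule Ydown)
  then obtain l where l: "is_partition l" "young l = Y" by blast
  have "\<exists>m. is_partition m \<and> young m = Y - ?D"
    by (rule down_closed_young[OF finite_Diff[OF finY]]) (rule Ddown)
  then obtain m where m: "is_partition m" "young m = Y - ?D" by blast
  have skew: "is_skew_shape ?D"
    unfolding is_skew_shape_def using l m DY by (intro exI[of _ l] exI[of _ m]) auto
  have overlap: "card {j. (i, j) \<in> ?D \<and> (Suc i, j) \<in> ?D} = 1"
    if ex: "\<exists>j. (i, j) \<in> ?D" "\<exists>j. (Suc i, j) \<in> ?D" for i
  proof -
    let ?S = "{k \<in> {1..n}. Suc i \<le> fst (ribbon_cell R k)}"
    obtain j1 a where a: "a \<in> {1..n}" "ribbon_cell R a = (Suc i, j1)"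
      using ex(2) unfolding ribbon_def by (metis (no_types) imageE)
    then have ne: "?S \<noteq> {}" by auto
    define k where "k = Max ?S"
    have kS: "k \<in> ?S" unfolding k_def using ne by (intro Max_in) auto
    have kmax: "k' \<le> k" if "k' \<in> ?S" for k' unfolding k_def using that by (intro Max_ge) auto
    obtain j0 b where b: "b \<in> {1..n}" "ribbon_cell R b = (i, j0)"
      using ex(1) unfolding ribbon_def by (metis (no_types) imageE)
    have "k < b"
    proof (rule ccontr)
      assume "\<not> k < b"
      then show False using kS b ribbon_cell_mono(1)[OF R, of b k] by auto
    qed
    then have Sk: "Suc k \<in> {1..n}" using b by auto
    then have notS: "fst (ribbon_cell R (Suc k)) \<le> i" using kmax[of "Suc k"] by force
    have kR: "k \<in> R"
    proof (rule ccontr)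
      assume "k \<notin> R"
      then show False using ribbon_cell_Suc_notin(1)[OF R, of k] kS notS by auto
    qed
    define j where "j = snd (ribbon_cell R k)"
    have c1: "ribbon_cell R k = (Suc i, j)" and c2: "ribbon_cell R (Suc k) = (i, j)"
      using ribbon_cell_Suc_in[OF R kR] kS notS by (auto simp: j_def prod_eq_iff)
    have m1: "(Suc i, j) \<in> ?D" and m2: "(i, j) \<in> ?D"
      using c1 c2 Sk kS ribbon_cell_memI[OF R, of k] ribbon_cell_memI[OF R, of "Suc k"] by auto
    have "{j. (i, j) \<in> ?D \<and> (Suc i, j) \<in> ?D} = {j}"
    proof (intro equalityI subsetI)
      fix t assume t: "t \<in> {j. (i, j) \<in> ?D \<and> (Suc i, j) \<in> ?D}"
      have "t \<le> j" "j \<le> t"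
        using ribbon_cells_comparable[OF R, of "Suc i" t i j] ribbon_cells_comparable[OF R, of "Suc i" j i t]
          t m1 m2 by auto
      then show "t \<in> {j}" by simp
    qed (use m1 m2 in auto)
    then show ?thesis by simp
  qed
  show ?thesis
    unfolding is_ribbon_def using skew is_connected_ribbon[OF R] overlap by blast
qed

definition Even :: "nat \<Rightarrow> nat set" where
  "Even k = {i \<in> {1..k}. even i}"

section \<open>Specht modules\<close>

definition tableaux :: "shape \<Rightarrow> (nat \<times> nat \<Rightarrow> nat) set" where
  "tableaux D = {T \<in> D \<rightarrow>\<^sub>E {1..card D}. bij_betw T D {1..card D}}"

definition tableau_act :: "shape \<Rightarrow> (nat \<Rightarrow> nat) \<Rightarrow> (nat \<times> nat \<Rightarrow> nat) \<Rightarrow> (nat \<times> nat \<Rightarrow> nat)" where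
  "tableau_act D \<sigma> T = restrict (\<sigma> \<circ> T) D"

definition tabloid :: "shape \<Rightarrow> (nat \<times> nat \<Rightarrow> nat) \<Rightarrow> (nat \<times> nat \<Rightarrow> nat) set" where
  "tabloid D T = {T' \<in> tableaux D. \<forall>i. T' ` {c \<in> D. fst c = i} = T ` {c \<in> D. fst c = i}}"

definition column_group :: "shape \<Rightarrow> (nat \<times> nat \<Rightarrow> nat) \<Rightarrow> (nat \<Rightarrow> nat) set" where
  "column_group D T = {\<pi>. \<pi> permutes {1..card D} \<and>
     (\<forall>j. \<pi> ` T ` {c \<in> D. snd c = j} = T ` {c \<in> D. snd c = j})}"

definition polytabloid :: "shape \<Rightarrow> (nat \<times> nat \<Rightarrow> nat) \<Rightarrow>
    ((nat \<times> nat \<Rightarrow> nat) set \<Rightarrow>\<^sub>0 complex)" where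
  "polytabloid D T = (\<Sum>\<pi> \<in> column_group D T.
     Poly_Mapping.single (tabloid D (tableau_act D \<pi> T)) (of_int (sign \<pi>)))"

definition pm_scale :: "complex \<Rightarrow> ('a \<Rightarrow>\<^sub>0 complex) \<Rightarrow> ('a \<Rightarrow>\<^sub>0 complex)" where
  "pm_scale c = Poly_Mapping.map ((*) c)"

lemma lookup_pm_scale: "Poly_Mapping.lookup (pm_scale c p) k = c * Poly_Mapping.lookup p k"
  by (simp add: pm_scale_def Poly_Mapping.map.rep_eq when_def)

lemma vector_space_pm_scale: "vector_space pm_scale"
  by unfold_locales (auto intro!: poly_mapping_eqI simp: lookup_pm_scale lookup_add algebra_simps)

definition specht :: "shape \<Rightarrow> (complex, (nat \<times> nat \<Rightarrow> nat) set \<Rightarrow>\<^sub>0 complex) rep" where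
  "specht D = \<lparr>carrier = Modules.module.span pm_scale (polytabloid D ` tableaux D),
     monoid.mult = undefined, monoid.one = undefined, ring.zero = 0, ring.add = (+), smult = pm_scale,
     act = (\<lambda>\<sigma>. push_keys ((`) (tableau_act D \<sigma>)))\<rparr>"

section \<open>Schur functions and the Frobenius characteristic\<close>

text \<open>A symmetric function is given by its coefficients: \<open>f \<alpha>\<close> is the coefficient of the
  monomial \<open>\<Prod>k. x\<^sub>k ^ \<alpha> k\<close> in the variables \<open>x\<^sub>k\<close> with \<open>k\<close> a natural number.\<close>

type_synonym symfun = "(nat \<Rightarrow>\<^sub>0 nat) \<Rightarrow> int"

definition semistandard :: "shape \<Rightarrow> (nat \<times> nat \<Rightarrow> nat) set" where
  "semistandard D = {T \<in> D \<rightarrow>\<^sub>E UNIV.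
     (\<forall>i j j'. (i, j) \<in> D \<and> (i, j') \<in> D \<and> j < j' \<longrightarrow> T (i, j) \<le> T (i, j')) \<and>
     (\<forall>i i' j. (i, j) \<in> D \<and> (i', j) \<in> D \<and> i < i' \<longrightarrow> T (i, j) < T (i', j))}"

definition schur :: "shape \<Rightarrow> symfun" where
  "schur D \<alpha> = int (card {T \<in> semistandard D.
     \<forall>k. card {c \<in> D. T c = k} = Poly_Mapping.lookup \<alpha> k})"

text \<open>The additive extension of \<open>S\<^sup>\<lambda> \<mapsto> s\<^sub>\<lambda>\<close>: if \<open>V\<close> is the direct sum of \<open>m \<lambda>\<close> copies
  of \<open>S\<^sup>\<lambda>\<close> over all partitions \<open>\<lambda>\<close> of \<open>n\<close>, its characteristic is \<open>\<Sum>\<lambda>. m \<lambda> * s\<^sub>\<lambda>\<close>.\<close>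

definition frob_char :: "nat \<Rightarrow> (complex, 'v) rep \<Rightarrow> symfun" where
  "frob_char n V = (THE f. \<exists>m :: nat list \<Rightarrow> nat.
     rep_iso n V (rep_Sum (SIGMA l : partitions_of n. {..<m l}) (\<lambda>(l, j). specht (young l))) \<and>
     f = (\<lambda>\<alpha>. \<Sum>l \<in> partitions_of n. int (m l) * schur (young l) \<alpha>))"

text \<open>The sum runs over the degrees in which the graded representation \<open>V\<close> is nonzero.\<close>

definition grFrob :: "nat \<Rightarrow> (nat \<Rightarrow> (complex, 'v) rep) \<Rightarrow> int \<Rightarrow> symfun" where
  "grFrob n V t = (\<lambda>\<alpha>. \<Sum>i | carrier (V i) \<noteq> {\<zero>\<^bsub>V i\<^esub>}. frob_char n (V i) \<alpha> * t ^ i)"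

end

theory Submission
  imports Defs "HOL-Library.List_Lexorder"
begin

text \<open>
  Both sides of the identity are determined by the dimensions of the spaces of vectors fixed by
  Young subgroups, and these dimensions turn out to be numbers of combinatorial objects that can be
  compared by a sign-reversing argument.

  A word \<open>w\<close>, a colouring of the points \<open>{1..n}\<close> by letters, stands for the Young subgroup preserving it. For a
  representation with multiplicities \<open>m l\<close> of the Specht modules, the dimension of its fixed vectors is
  the sum of the \<open>m l\<close> times the Kostka numbers of \<open>l\<close> and the content of \<open>w\<close>. Kostka numbers are
  unitriangular, so the dimensions determine the multiplicities; moreover they are the coefficients of
  the Frobenius characteristic (\<open>specht_decomposition\<close>, \<open>kostka_cancel\<close>, \<open>frob_char_fdim\<close>). The
  decomposition itself rests on the identity \<open>sum_K_K\<close>, which counts the orbits on tabloids in two ways,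
  and on the fact that column antisymmetrisers kill all vectors fixed by Young subgroups with too
  small a letter sum (\<open>kappa_kills\<close>).

  The degree \<open>i\<close> part of the Chow ring has a basis of Feichtner--Yuzvinsky monomials, which the
  symmetric group permutes. They span since every other monomial is congruent to monomials with larger
  flats (\<open>nonstandard\<close>). They are independent for the Boolean matroid because the ring can be deformed
  to the ring of functions on the full flags, where independence is a matter of polynomials in one
  variable having few roots (\<open>fval_independent\<close>); multiplication by a power of the variable of the
  ground set carries this over to all uniform matroids (\<open>I_boolean\<close>). So the fixed vectors in degree
  \<open>i\<close> are counted by the types of such monomials, lists of blocks of letters with exponents
  (\<open>fdim_FYd\<close>). In the alternating sum over \<open>i\<close> the exponents of a block of odd size cancel, and
  those of a block of even size leave a sign; what remains satisfies a recursion (\<open>fy_sign_rec\<close>).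

  For the Specht module of the alternating ribbon, the fixed vectors are counted by fillings of its
  rows with the prescribed strict inequalities between consecutive rows. Upper and lower bound come
  from leading terms: exchanging the two cells of a column shows which words can lead, and the
  polytabloids of semistandard fillings realise all of them (\<open>fdim_S\<close>). These numbers satisfy the same
  recursion, by a telescoping sum (\<open>signed_ribbon_count\<close>), and the theorem follows.
\<close>

abbreviation "keys \<equiv> Poly_Mapping.keys"
abbreviation "lookup \<equiv> Poly_Mapping.lookup"
abbreviation "single \<equiv> Poly_Mapping.single"
abbreviation "ct w A \<equiv> image_mset w (mset_set A)"

section \<open>Finitely supported functions\<close>

interpretation PM: vector_space pm_scale
 by(rule vector_space_pm_scale)

interpretation PMP: vector_space_pair pm_scale pm_scale ..

abbreviation plin :: "(('x \<Rightarrow>\<^sub>0 complex) => ('y \<Rightarrow>\<^sub>0 complex)) => bool" where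
 "plin \<equiv> Vector_Spaces.linear pm_scale pm_scale"

lemma plinI:
 assumes "!!p q. f (p + q) = f p + f q" "!!c p. f (pm_scale c p) = pm_scale c (f p)"
 shows "plin f"
 using assms by(simp add: Vector_Spaces.linear_iff vector_space_pm_scale)
lemma plin_add: "plin f ==> f (p + q) = f p + f q"
 by(simp add: Vector_Spaces.linear_iff)
lemma plin_scale: "plin f ==> f (pm_scale c p) = pm_scale c (f p)"
 by(simp add: Vector_Spaces.linear_iff)

lemma plin_zero: "plin f ==> f 0 = 0"
 using plin_add[of f 0 0] by simp
lemma plin_sum: "plin f ==> f (sum g A) = (\<Sum>a\<in>A. f (g a))"
 by(induction A rule: infinite_finite_induct) (auto simp: plin_zero plin_add)

lemma plin_diff: "plin f ==> f (p - q) = f p - f q"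
 using plin_add[of f "p - q" q] by simp
lemma plin_comp: "plin f ==> plin g ==> plin (%v. g (f v))"
 by(simp add: Vector_Spaces.linear_iff)
lemma plin_sum_fun: "(!!a. a : A ==> plin (f a)) ==> plin (%v. \<Sum>a\<in>A. f a v)"
 by(rule plinI) (simp_all add: plin_add plin_scale sum.distrib PM.scale_sum_right)
lemma plin_scale_fun: "plin f ==> plin (%v. pm_scale c (f v))"
 by(rule plinI) (simp_all add: plin_add plin_scale PM.scale_right_distrib mult.commute)
lemma pm_scale_single: "pm_scale c (single x d) = single x (c * d)"
 by(rule poly_mapping_eqI) (simp add: lookup_pm_scale lookup_single when_def)

lemma keys_sum_subset: "keys (sum f A) \<subseteq> (\<Union>a\<in>A. keys (f a))"
proof
 fix x assume x: "x : keys (sum f A)"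
 show "x : (\<Union>a\<in>A. keys (f a))"
 proof (rule ccontr)
  assume "x \<notin> (\<Union>a\<in>A. keys (f a))"
  hence "lookup (f a) x = 0" if "a : A" for a
   using that by(meson UN_I in_keys_iff)
  hence "lookup (sum f A) x = 0" by(simp add: lookup_sum)
  with x show False by(simp add: in_keys_iff)
 qed
qed

lemma poly_mapping_as_sum:
 assumes "finite X" "keys p \<subseteq> X"
 shows "p = (\<Sum>x\<in>X. single x (lookup p x))"
proof (rule poly_mapping_eqI)
 fix k
 show "lookup p k = lookup (\<Sum>x\<in>X. single x (lookup p x)) k"
  using assms by(auto simp: lookup_sum lookup_single when_def in_keys_iff subset_iff)
qed

lemma push_keys_superset:
 assumes "finite X" "keys p \<subseteq> X"
 shows "push_keys f p = (\<Sum>k\<in>X. single (f k) (lookup p k))"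
 unfolding push_keys_def using assms
 by(intro sum.mono_neutral_left) (auto simp: in_keys_iff)
lemma push_keys_single [simp]: "push_keys f (single k c) = single (f k) c"
 by(subst push_keys_superset[of "{k}"]) auto
lemma push_keys_zero [simp]: "push_keys f 0 = 0"
 by(simp add: push_keys_def)

lemma push_keys_add: "push_keys f (p + q) = push_keys f p + push_keys f q"
proof -
 let ?X = "keys p \<union> keys q"
 have "keys (p + q) \<subseteq> ?X" by(rule Poly_Mapping.keys_add)
 thus ?thesis
  by(simp add: push_keys_superset[of ?X] lookup_add single_add sum.distrib)
qed
lemma push_keys_sum: "push_keys f (sum g A) = (\<Sum>a\<in>A. push_keys f (g a))"
 by(induction A rule: infinite_finite_induct) (auto simp: push_keys_add)

lemma push_keys_diff: "push_keys f (p - q :: _ \<Rightarrow>\<^sub>0 _ :: ab_group_add) = push_keys f p - push_keys f q"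
 using push_keys_add[of f "p - q" q] by(simp add: eq_diff_eq)

lemma push_keys_cong:
 "(!!k. k : keys p ==> f k = g k) ==> push_keys f p = push_keys g p"
 by(simp add: push_keys_def)
lemma push_keys_comp: "push_keys g (push_keys f p) = push_keys (%x. g (f x)) p"
 by(subst (2) push_keys_def) (simp add: push_keys_sum, simp add: push_keys_def)

lemma push_keys_id: "push_keys (%x. x) p = p"
 unfolding push_keys_def using poly_mapping_as_sum[of "keys p" p] by simp

lemma keys_push_keys: "keys (push_keys f p) \<subseteq> f ` keys p"
proof -
 have "keys (push_keys f p) \<subseteq> (\<Union>k\<in>keys p. keys
   (single (f k) (lookup p k)))"
  unfolding push_keys_def by(rule keys_sum_subset)
 thus ?thesis by(auto split: if_splits)
qed

lemma lookup_push_keys: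
 assumes "finite X" "keys p \<subseteq> X"
 shows "lookup (push_keys f p) y = (\<Sum>k\<in>{k\<in>X. f k = y}. lookup p k)"
proof -
 have "lookup (push_keys f p) y = (\<Sum>k\<in>X. if f k = y then lookup p k else 0)"
  by(simp add: push_keys_superset[OF assms] lookup_sum lookup_single when_def)
 thus ?thesis using assms by(simp add: sum.If_cases Int_def)
qed

lemma plin_push_keys: "plin (push_keys f)"
proof (rule plinI)
 fix c :: complex and p :: "'a \<Rightarrow>\<^sub>0 complex"
 have "keys (pm_scale c p) \<subseteq> keys p"
  by(auto simp: in_keys_iff lookup_pm_scale)
 thus "push_keys f (pm_scale c p) = pm_scale c (push_keys f p)"
  by(simp add: push_keys_superset[of "keys p"] PM.scale_sum_right lookup_pm_scale
   pm_scale_single)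
qed (rule push_keys_add)

definition supp_in :: "'x set => ('x \<Rightarrow>\<^sub>0 'c::zero) set" where
 "supp_in X = {p. keys p \<subseteq> X}"

lemma supp_in_lookup: "p : supp_in X \<longleftrightarrow> (\<forall>x. x \<notin> X \<longrightarrow> lookup p x = 0)"
 unfolding supp_in_def by(auto simp: in_keys_iff)
lemma subspace_supp_in: "PM.subspace (supp_in X)"
 by(rule PM.subspaceI) (auto simp: supp_in_lookup lookup_add lookup_pm_scale)

lemma supp_in_span:
 assumes "finite X"
 shows "supp_in X = PM.span ((%x. single x 1) ` X)"
proof
 show "supp_in X \<subseteq> PM.span ((%x. single x 1) ` X)"
 proof
  fix p :: "'a \<Rightarrow>\<^sub>0 complex" assume "p : supp_in X"
  hence "p = (\<Sum>x\<in>X. pm_scale (lookup p x) (single x 1))"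
   using poly_mapping_as_sum[of X p] assms by(simp add: supp_in_def pm_scale_single)
  thus "p : PM.span ((%x. single x 1) ` X)"
   by(metis (no_types, lifting) PM.span_sum PM.span_scale PM.span_base imageI)
 qed
 show "PM.span ((%x. single x 1) ` X) \<subseteq> (supp_in X :: ('a \<Rightarrow>\<^sub>0 complex) set)"
  by(rule PM.span_minimal[OF _ subspace_supp_in]) (auto simp: supp_in_def)
qed

lemma independent_in_supp_in:
 assumes "finite X" "S \<subseteq> supp_in X" "PM.independent S"
 shows "finite S"
 using PM.independent_span_bound[of "(%x. single x 1) ` X" S] assms
 by(simp add: supp_in_span)

lemma dim_inj_image:
 assumes f: "plin f" and S: "PM.subspace S" and inj: "inj_on f S"
 shows "PM.dim (f ` S) = PM.dim S"
proof -
 interpret lf: Vector_Spaces.linear pm_scale pm_scale f by fact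
 obtain B where B: "B \<subseteq> S" "PM.independent B" "S \<subseteq> PM.span B" "card B = PM.dim S"
  using PM.basis_exists[of S] by auto
 have SB: "PM.span B = S" using B S by(metis PM.span_minimal subset_antisym)
 have "PM.independent (f ` B)"
  using lf.independent_injective_image[OF B(2)] inj SB by simp
 moreover have "PM.span (f ` B) = f ` S" using SB by(simp add: lf.span_image)
 moreover have "card (f ` B) = card B" by(rule card_image) (use inj B(1) inj_on_subset in blast)
 ultimately show ?thesis using B(4) PM.dim_span_eq_card_independent by metis
qed

definition direct :: "('x \<Rightarrow>\<^sub>0 complex) set => ('x \<Rightarrow>\<^sub>0 complex) set => ('x \<Rightarrow>\<^sub>0 complex) set => bool" where
 "direct V A B \<longleftrightarrow> A \<inter> B = {0} & V = {a + b |a b. a : A & b : B}"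

lemma directD:
 assumes "direct V A B" "PM.subspace A" "PM.subspace B"
 shows "A \<subseteq> V" "B \<subseteq> V" "!!v. v : V ==> \<exists>a\<in>A. \<exists>b\<in>B. v = a + b"
  "!!a b. a : A ==> b : B ==> a + b : V" "!!v. v : A ==> v : B ==> v = 0"
proof -
 have 0: "0 : A" "0 : B" using assms PM.subspace_0 by blast+
 show "A \<subseteq> V" "B \<subseteq> V" using assms(1) 0 unfolding direct_def by force+
qed (use assms(1) in "auto simp: direct_def")

lemma direct_unique:
 assumes "direct V A B" "PM.subspace A" "PM.subspace B"
  "a : A" "b : B" "a' : A" "b' : B" "a + b = a' + b'"
 shows "a = a'" "b = b'"
proof -
 have "a - a' = b' - b" using assms(8) by(simp add: algebra_simps)
 moreover have "a - a' : A" "b' - b : B" using assms PM.subspace_diff by blast+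
 ultimately have "a - a' : A \<inter> B" by simp
 hence "a - a' = 0" using assms(1) unfolding direct_def by blast
 thus "a = a'" by simp
 thus "b = b'" using assms(8) by simp
qed

lemma dim_direct:
 assumes dir: "direct V A B" and A: "PM.subspace A" and B: "PM.subspace B"
  and fin: "finite X" "V \<subseteq> supp_in X"
 shows "PM.dim V = PM.dim A + PM.dim B"
proof -
 obtain S where S: "S \<subseteq> A" "PM.independent S" "A \<subseteq> PM.span S" "card S = PM.dim A"
  using PM.basis_exists[of A] by auto
 obtain T where T: "T \<subseteq> B" "PM.independent T" "B \<subseteq> PM.span T" "card T = PM.dim B"
  using PM.basis_exists[of B] by auto
 have sA: "PM.span S = A" using S A by(metis PM.span_minimal subset_antisym)
 have sB: "PM.span T = B" using T B by(metis PM.span_minimal subset_antisym)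
 note D = directD[OF dir A B]
 have fS: "finite S" and fT: "finite T"
  using independent_in_supp_in[OF fin(1)] S T D(1,2) fin(2) by(meson subset_trans)+
 have disj: "S \<inter> T = {}"
 proof (rule ccontr)
  assume "S \<inter> T ~= {}"
  then obtain x where "x : S" "x : T" by blast
  hence "x = 0" using D(5) S(1) T(1) by blast
  with \<open>x : S\<close> S(2) show False using PM.dependent_zero by blast
 qed
 have "PM.independent (S \<union> T)"
 proof
  assume "PM.dependent (S \<union> T)"
  then obtain u where u: "\<exists>v\<in>S \<union> T. u v ~= 0" "(\<Sum>v\<in>S \<union> T. pm_scale (u v) v) = 0"
   using PM.dependent_finite[of "S \<union> T"] fS fT by auto
  have eq: "(\<Sum>v\<in>S. pm_scale (u v) v) + (\<Sum>v\<in>T. pm_scale (u v) v) = 0 + 0"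
   using u(2) sum.union_disjoint[OF fS fT disj, of "%v. pm_scale (u v) v"] by simp
  have "(\<Sum>v\<in>S. pm_scale (u v) v) : A" unfolding sA[symmetric]
   by(intro PM.span_sum PM.span_scale PM.span_base)
  moreover have "(\<Sum>v\<in>T. pm_scale (u v) v) : B" unfolding sB[symmetric]
   by(intro PM.span_sum PM.span_scale PM.span_base)
  ultimately have "(\<Sum>v\<in>S. pm_scale (u v) v) = 0" "(\<Sum>v\<in>T. pm_scale (u v) v) = 0"
   using direct_unique[OF dir A B _ _ _ _ eq] PM.subspace_0 A B by blast+
  hence "\<forall>v\<in>S. u v = 0" "\<forall>v\<in>T. u v = 0"
   using PM.independentD[OF S(2) fS subset_refl] PM.independentD[OF T(2) fT subset_refl] by blast+
  with u(1) show False by blast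
 qed
 moreover have "V \<subseteq> PM.span (S \<union> T)"
 proof
  fix v assume "v : V"
  then obtain a b where "a : A" "b : B" "v = a + b" using D(3) by blast
  thus "v : PM.span (S \<union> T)" using sA sB
   by(metis PM.span_add PM.span_mono sup_ge1 sup_ge2 subsetD)
 qed
 ultimately have "card (S \<union> T) = PM.dim V"
  using S(1) T(1) D(1,2) by(intro PM.basis_card_eq_dim) auto
 thus ?thesis using card_Un_disjoint[OF fS fT disj] S(4) T(4) by simp
qed

lemma dim_pos_iff:
 assumes "PM.subspace V" "finite X" "V \<subseteq> supp_in X"
 shows "PM.dim V > 0 \<longleftrightarrow> V ~= {0}"
proof -
 obtain B where B: "B \<subseteq> V" "PM.independent B" "V \<subseteq> PM.span B" "card B = PM.dim V"
  using PM.basis_exists[of V] by auto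
 have fB: "finite B" using independent_in_supp_in[OF assms(2)] B assms(3) by(meson subset_trans)
 show ?thesis
 proof
  assume "PM.dim V > 0"
  then obtain x where "x : B" using B(4) by(metis card_gt_0_iff ex_in_conv)
  hence "x : V" "x ~= 0" using B(1,2) PM.dependent_zero by auto
  thus "V ~= {0}" by blast
 next
  assume "V ~= {0}"
  hence "B ~= {}" using B(3) PM.subspace_0[OF assms(1)] by auto
  thus "PM.dim V > 0" using B(4) fB by(metis card_gt_0_iff)
 qed
qed

lemma dim_supp_in:
 assumes "finite X"
 shows "PM.dim (supp_in X) = card X"
proof -
 have inj: "inj_on (%x. single x (1::complex)) X"
  by(intro inj_onI) (metis keys_single one_neq_zero singleton_inject)
 have "PM.independent ((%x. single x (1::complex)) ` X)"
 proof
  assume "PM.dependent ((%x. single x (1::complex)) ` X)"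
  then obtain u where u: "\<exists>v\<in>(%x. single x (1::complex)) ` X. u v ~= 0"
   "(\<Sum>v\<in>(%x. single x (1::complex)) ` X. pm_scale (u v) v) = 0"
   using PM.dependent_finite[of "(%x. single x (1::complex)) ` X"] assms by auto
  have "(\<Sum>x\<in>X. single x (u (single x 1))) = 0"
   using u(2) by(simp add: sum.reindex[OF inj] pm_scale_single)
  hence "lookup (\<Sum>x\<in>X. single x (u (single x 1))) y = 0" for y
   by simp
  hence "u (single x 1) = 0" if "x : X" for x
   using that assms by(simp add: lookup_sum lookup_single when_def split: if_splits) meson
  with u(1) show False by blast
 qed
 from PM.dim_span_eq_card_independent[OF this] show ?thesis
  by(simp only: supp_in_span[OF assms] card_image[OF inj])
qed

section \<open>Representations on spaces of finitely supported functions\<close>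

abbreviation pinv :: "('a => 'a) => 'a => 'a" where
 "pinv h \<equiv> inv_into UNIV h"

definition perms :: "nat => (nat => nat) set" where
 "perms n = {h. h permutes {1..n}}"
lemma carrier_sym_group: "carrier (sym_group n) = perms n"
 by(simp add: sym_group_def perms_def)
lemma finite_perms [simp]: "finite (perms n)"
 by(simp add: perms_def finite_permutations)
lemma perms_id [simp]: "id : perms n"
 by(simp add: perms_def permutes_id)
lemma perms_comp [simp]: "h : perms n ==> t : perms n ==> h \<circ> t : perms n"
 by(simp add: perms_def permutes_compose)
lemma perms_inv [simp]: "h : perms n ==> pinv h : perms n"
 by(simp add: perms_def permutes_inv)
lemma perms_inv_o: "h : perms n ==> pinv h \<circ> h = id" "h : perms n ==> h \<circ> pinv h = id"
 by(simp_all add: perms_def permutes_inv_o)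
lemma perms_inv_apply: "h : perms n ==> pinv h (h k) = k" "h : perms n ==> h (pinv h k) = k"
 by(simp_all add: perms_def permutes_inverses)
lemma perms_in: "h : perms n ==> h k : {1..n} \<longleftrightarrow> k : {1..n}"
 by(simp add: perms_def permutes_in_image del: atLeastAtMost_iff)

lemma perms_nonempty: "card (perms n) ~= 0"
 using perms_id[of n] by(metis card_eq_0_iff empty_iff finite_perms)

lemma bij_betw_perms_comp:
 assumes "t : perms n"
 shows "bij_betw (%h. t \<circ> h) (perms n) (perms n)"
proof (rule bij_betw_byWitness[where f' = "%h. pinv t \<circ> h"])
 show "\<forall>h\<in>perms n. pinv t \<circ> (t \<circ> h) = h" "\<forall>h\<in>perms n. t \<circ> (pinv t \<circ> h) = h"
  using perms_inv_o[OF assms] by(simp_all add: o_assoc)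
qed (use assms in auto)

locale sym_rep =
 fixes n :: nat and r :: "(nat => nat) => ('x \<Rightarrow>\<^sub>0 complex) => ('x \<Rightarrow>\<^sub>0 complex)"
  and V :: "('x \<Rightarrow>\<^sub>0 complex) set"
 assumes sub: "PM.subspace V"
  and fin: "\<exists>X. finite X & V \<subseteq> supp_in X"
  and lin: "h : perms n ==> plin (r h)"
  and closed: "h : perms n ==> v : V ==> r h v : V"
  and act_id: "v : V ==> r id v = v"
  and act_comp: "h : perms n ==> t : perms n ==> v : V ==> r (h \<circ> t) v = r h (r t v)"
begin

lemma zero_mem [simp]: "0 : V"
 using sub by(rule PM.subspace_0)

lemma subrep:
 assumes "PM.subspace A" "A \<subseteq> V" "!!h a. h : perms n ==> a : A ==> r h a : A"
 shows "sym_rep n r A"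
proof (rule sym_rep.intro)
 obtain X where "finite X" "V \<subseteq> supp_in X" using fin by blast
 thus "\<exists>X. finite X & A \<subseteq> supp_in X" using assms(2) by(meson subset_trans)
qed (use assms lin act_id act_comp in "simp_all add: subset_iff")

lemma act_inv:
 assumes "h : perms n" "v : V"
 shows "r (pinv h) (r h v) = v" "r h (r (pinv h) v) = v"
 using act_comp[of "pinv h" h v] act_comp[of h "pinv h" v] assms act_id by(simp_all add: perms_inv_o)

end

definition intertw where
 "intertw n V r r' f \<longleftrightarrow> plin f & (\<forall>h\<in>perms n. \<forall>v\<in>V. f (r h v) = r' h (f v))"

text \<open>Averaging a linear projection over the group makes it equivariant.\<close>

lemma maschke_projection:
 assumes V: "sym_rep n r V" and A: "sym_rep n r A" and AV: "A \<subseteq> V"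
 obtains p where "intertw n V r r p" "!!v. v : V ==> p v : A" "!!a. a : A ==> p a = a"
proof -
 interpret V: sym_rep n r V by fact
 interpret A: sym_rep n r A by fact
 obtain q where q: "range q \<subseteq> A" "plin q" "\<forall>a\<in>A. q a = a"
  using PMP.linear_exists_left_inverse_on[of "%x. x" A] PM.linear_ident A.sub by auto
 define N where "N = (of_nat (card (perms n)) :: complex)"
 have N: "N ~= 0" using perms_nonempty by(simp add: N_def)
 define p where "p v = pm_scale (1 / N) (\<Sum>h\<in>perms n. r h (q (r (pinv h) v)))" for v
 have "plin (%v. r h (q (r (pinv h) v)))" if "h : perms n" for h
  by(rule plin_comp[OF plin_comp[OF V.lin[OF perms_inv[OF that]] q(2)] V.lin[OF that]])
 hence lp: "plin p"
  unfolding p_def[abs_def] by(intro plin_scale_fun plin_sum_fun)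
 have pA: "p v : A" for v
  unfolding p_def using q(1) A.closed
  by(intro PM.subspace_scale[OF A.sub] PM.subspace_sum[OF A.sub]) auto
 have pa: "p a = a" if a: "a : A" for a
 proof -
  have "r h (q (r (pinv h) a)) = a" if "h : perms n" for h
   using q(3) a that A.act_inv A.closed by simp
  hence "(\<Sum>h\<in>perms n. r h (q (r (pinv h) a))) = (\<Sum>h\<in>perms n. a)" by simp
  also have "... = pm_scale N a" unfolding N_def by(rule PM.sum_constant_scale)
  finally show ?thesis using N by(simp add: p_def)
 qed
 have eq: "p (r t v) = r t (p v)" if t: "t : perms n" and v: "v : V" for t v
 proof -
  have "r t (p v) = pm_scale (1 / N) (\<Sum>h\<in>perms n. r t (r h (q (r (pinv h) v))))"
   unfolding p_def using V.lin[OF t] by(simp add: plin_scale plin_sum)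
  also have "(\<Sum>h\<in>perms n. r t (r h (q (r (pinv h) v)))) =
   (\<Sum>h\<in>perms n. r (t \<circ> h) (q (r (pinv (t \<circ> h)) (r t v))))"
  proof (rule sum.cong[OF refl])
   fix h assume h: "h : perms n"
   have "pinv (t \<circ> h) = pinv h \<circ> pinv t"
   using h t by(simp add: perms_def permutes_bij o_inv_distrib)
   hence "r (pinv (t \<circ> h)) (r t v) = r (pinv h) v"
   using h t v V.act_comp[of "pinv h" "pinv t" "r t v"] V.closed V.act_inv by simp
   moreover have "q (r (pinv h) v) : V" using q(1) AV by blast
   ultimately show "r t (r h (q (r (pinv h) v))) = r (t \<circ> h) (q (r (pinv (t \<circ> h)) (r t v)))"
   using V.act_comp[OF t h] by simp
  qed
  also have "... = (\<Sum>h\<in>perms n. r h (q (r (pinv h) (r t v))))"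
   by(rule sum.reindex_bij_betw[OF bij_betw_perms_comp[OF t],
   where g = "%h. r h (q (r (pinv h) (r t v)))"])
  finally show ?thesis by(simp add: p_def)
 qed
 show thesis by(rule that[of p]) (use lp pA pa eq in "auto simp: intertw_def")
qed

lemma subspace_kernel_on:
 assumes "PM.subspace V" "plin f"
 shows "PM.subspace {v : V. f v = 0}"
 using assms by(intro PM.subspaceI)
  (auto simp: plin_zero plin_add plin_scale PM.subspace_0 PM.subspace_add PM.subspace_scale)

lemma subspace_image:
 assumes "PM.subspace V" "plin f"
 shows "PM.subspace (f ` V)"
 using PMP.linear_subspace_image[OF assms(2,1)] .

lemma sym_rep_kernel:
 assumes V: "sym_rep n r V" and f: "intertw n V r r' f" and lin: "!!h. h : perms n ==> plin (r' h)"
 shows "sym_rep n r {v : V. f v = 0}"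
proof -
 interpret V: sym_rep n r V by fact
 show ?thesis
  by(rule V.subrep) (use f lin in \<open>auto simp: intertw_def V.closed plin_zero intro: subspace_kernel_on[OF V.sub]\<close>)
qed

lemma sym_rep_image:
 assumes V: "sym_rep n r V" and W: "sym_rep n r' W" and f: "intertw n V r r' f" and fV: "f ` V \<subseteq> W"
 shows "sym_rep n r' (f ` V)"
proof -
 interpret V: sym_rep n r V by fact
 interpret W: sym_rep n r' W by fact
 show ?thesis
 proof (rule W.subrep)
  show "f ` V \<subseteq> W" by(rule fV)
  show "PM.subspace (f ` V)" using f V.sub by(intro subspace_image) (auto simp: intertw_def)
  show "r' h a : f ` V" if "h : perms n" "a : f ` V" for h a
  proof -
   obtain v where v: "v : V" "a = f v" using \<open>a : f ` V\<close> by blast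
   have "r' h a = f (r h v)" using f v \<open>h : perms n\<close> by(simp add: intertw_def)
   thus ?thesis using V.closed[OF \<open>h : perms n\<close> v(1)] by blast
  qed
 qed
qed

lemma maschke_complement:
 assumes V: "sym_rep n r V" and A: "sym_rep n r A" and AV: "A \<subseteq> V"
 obtains B where "sym_rep n r B" "B \<subseteq> V" "direct V A B"
proof -
 interpret V: sym_rep n r V by fact
 interpret A: sym_rep n r A by fact
 obtain p where p: "intertw n V r r p" "!!v. v : V ==> p v : A" "!!a. a : A ==> p a = a"
  using maschke_projection[OF assms] by blast
 have lp: "plin p" using p(1) by(simp add: intertw_def)
 define B where "B = {v : V. p v = 0}"
 have "sym_rep n r B" unfolding B_def by(rule sym_rep_kernel[OF V p(1) V.lin])
 moreover have "direct V A B"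
  unfolding direct_def
 proof (intro conjI equalityI subsetI)
  fix v assume "v : V"
  hence pv: "p v : A" "p v : V" using p(2) AV by blast+
  hence "v - p v : V" using PM.subspace_diff[OF V.sub \<open>v : V\<close>] by blast
  moreover have "p (v - p v) = 0" using p(3)[OF pv(1)] by(simp add: plin_diff[OF lp])
  ultimately have "v - p v : B" by(simp add: B_def)
  with pv(1) show "v : {a + b |a b. a : A & b : B}" by(smt (verit) add.commute diff_add_cancel mem_Collect_eq)
 next
  fix v assume "v : {a + b |a b. a : A & b : B}"
  thus "v : V" using AV PM.subspace_add[OF V.sub] by(auto simp: B_def)
 qed (use p(3) AV in "auto simp: B_def plin_zero[OF lp]")
 ultimately show thesis using that by(auto simp: B_def)
qed

subsection \<open>Fixed vectors of Young subgroups\<close>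

text \<open>The letters of \<open>w\<close> colour the points, and \<open>stab n w\<close> is the
Young subgroup preserving the colouring.\<close>

definition stab :: "nat => (nat => nat) => (nat => nat) set" where
 "stab n w = {h : perms n. \<forall>k\<in>{1..n}. w (h k) = w k}"

definition fixed where
 "fixed n r w V = {v : V. \<forall>h\<in>stab n w. r h v = v}"

definition fdim where
 "fdim n r w V = PM.dim (fixed n r w V)"
lemma stab_perms: "h : stab n w ==> h : perms n"
 by(simp add: stab_def)

lemma stab_inv:
 assumes "h : stab n w" shows "pinv h : stab n w"
proof -
 have p: "h : perms n" using assms by(rule stab_perms)
 have "w (pinv h k) = w k" if "k : {1..n}" for k
 proof -
  have "pinv h k : {1..n}" using perms_in[OF perms_inv[OF p]] that by blast
  hence "w (h (pinv h k)) = w (pinv h k)" using assms by(auto simp: stab_def)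
  thus ?thesis by(simp add: perms_inv_apply[OF p])
 qed
 thus ?thesis using p by(simp add: stab_def)
qed

lemma stab_comp:
 assumes "h : stab n w" "t : stab n w" shows "h \<circ> t : stab n w"
 using assms perms_in[of t n] by(auto simp: stab_def)
lemma stab_id: "id : stab n w"
 by(simp add: stab_def)
lemma finite_stab: "finite (stab n w)"
 by(rule finite_subset[OF _ finite_perms]) (auto simp: stab_def)

lemma bij_betw_stab_comp:
 assumes "t : stab n w"
 shows "bij_betw (%h. t \<circ> h) (stab n w) (stab n w)"
proof (rule bij_betw_byWitness[where f' = "%h. pinv t \<circ> h"])
 show "\<forall>h\<in>stab n w. pinv t \<circ> (t \<circ> h) = h" "\<forall>h\<in>stab n w. t \<circ> (pinv t \<circ> h) = h"
  using perms_inv_o[OF stab_perms[OF assms]] by(simp_all add: o_assoc)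
qed (use assms stab_comp stab_inv in "auto intro!: stab_comp stab_inv")

context sym_rep
begin
lemma fixed_subset: "fixed n r w V \<subseteq> V"
 by(auto simp: fixed_def)

lemma subspace_fixed: "PM.subspace (fixed n r w V)"
 by(rule PM.subspaceI)
  (auto simp: fixed_def stab_def PM.subspace_add[OF sub] PM.subspace_scale[OF sub] plin_zero[OF lin]
   plin_add[OF lin] plin_scale[OF lin])

lemma fdim_pos_iff: "fdim n r w V > 0 \<longleftrightarrow> fixed n r w V ~= {0}"
proof -
 obtain X where "finite X" "V \<subseteq> supp_in X" using fin by blast
 thus ?thesis unfolding fdim_def
  using dim_pos_iff[OF subspace_fixed] fixed_subset by(metis subset_trans)
qed

lemma fdim_pos: "v : fixed n r w V ==> v ~= 0 ==> fdim n r w V > 0"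
 unfolding fdim_pos_iff by blast

lemma stab_average:
 assumes "v : V"
 shows "(\<Sum>h\<in>stab n w. r h v) : fixed n r w V"
proof -
 have "r t (\<Sum>h\<in>stab n w. r h v) = (\<Sum>h\<in>stab n w. r h v)" if t: "t : stab n w" for t
 proof -
  have "r t (\<Sum>h\<in>stab n w. r h v) = (\<Sum>h\<in>stab n w. r (t \<circ> h) v)"
   using t assms by(simp add: plin_sum[OF lin] stab_perms act_comp)
  also have "... = (\<Sum>h\<in>stab n w. r h v)"
   by(rule sum.reindex_bij_betw[OF bij_betw_stab_comp[OF t], where g = "%h. r h v"])
  finally show ?thesis .
 qed
 moreover have "(\<Sum>h\<in>stab n w. r h v) : V"
  using assms by(intro PM.subspace_sum[OF sub]) (auto simp: closed stab_perms)
 ultimately show ?thesis by(simp add: fixed_def)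
qed

end

lemma intertw_fixed:
 assumes "intertw n V r r' f" "f ` V \<subseteq> W" "v : fixed n r w V"
 shows "f v : fixed n r' w W"
proof -
 have "r' h (f v) = f v" if "h : stab n w" for h
 proof -
  have "h : perms n" "v : V" "r h v = v" using assms(3) that stab_perms by(auto simp: fixed_def)
  thus ?thesis using assms(1) unfolding intertw_def by metis
 qed
 thus ?thesis using assms by(auto simp: fixed_def)
qed

lemma fdim_direct:
 assumes V: "sym_rep n r V" and A: "sym_rep n r A" and B: "sym_rep n r B" and dir: "direct V A B"
 shows "fdim n r w V = fdim n r w A + fdim n r w B"
proof -
 interpret V: sym_rep n r V by fact
 interpret A: sym_rep n r A by fact
 interpret B: sym_rep n r B by fact
 note D = directD[OF dir A.sub B.sub]
 obtain X where X: "finite X" "V \<subseteq> supp_in X" using V.fin by blast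
 have "direct (fixed n r w V) (fixed n r w A) (fixed n r w B)"
  unfolding direct_def
 proof (intro conjI equalityI subsetI)
  fix v assume v: "v : fixed n r w V"
  hence "v : V" by(simp add: fixed_def)
  from D(3)[OF this] obtain a b where ab: "a : A" "b : B" "v = a + b" by blast
  have "r h a = a & r h b = b" if "h : stab n w" for h
  proof -
   have "r h a + r h b = a + b" using v that ab(3) plin_add[OF V.lin[OF stab_perms[OF that]], of a b]
   by(simp add: fixed_def)
   thus ?thesis
   using direct_unique[OF dir A.sub B.sub] ab A.closed B.closed stab_perms[OF that] by metis
  qed
  thus "v : {a + b |a b. a : fixed n r w A & b : fixed n r w B}"
   using ab by(auto simp: fixed_def)
 next
  fix v assume "v : {a + b |a b. a : fixed n r w A & b : fixed n r w B}"
  thus "v : fixed n r w V"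
   using D(4) by(auto simp: fixed_def plin_add[OF V.lin] stab_perms)
 next
  fix v assume "v : fixed n r w A \<inter> fixed n r w B"
  thus "v : {0}" using D(5) by(auto simp: fixed_def)
 next
  fix v :: "'a \<Rightarrow>\<^sub>0 complex" assume "v : {0}"
  thus "v : fixed n r w A \<inter> fixed n r w B"
   using PM.subspace_0[OF A.subspace_fixed] PM.subspace_0[OF B.subspace_fixed] by simp
 qed
 thus ?thesis
  unfolding fdim_def using dim_direct A.subspace_fixed B.subspace_fixed X V.fixed_subset
  by(metis subset_trans)
qed

lemma fdim_iso:
 assumes V: "sym_rep n r V" and f: "intertw n V r r' f" and inj: "inj_on f V" and im: "f ` V = W"
 shows "fdim n r' w W = fdim n r w V"
proof -
 interpret V: sym_rep n r V by fact
 have "fixed n r' w W = f ` fixed n r w V"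
 proof (intro equalityI subsetI)
  fix u assume u: "u : fixed n r' w W"
  then obtain v where v: "v : V" "u = f v" using im by(auto simp: fixed_def)
  have "r h v = v" if "h : stab n w" for h
  proof -
   have "r' h (f v) = f v" using u v(2) that by(simp add: fixed_def)
   hence "f (r h v) = f v" using f v(1) stab_perms[OF that] unfolding intertw_def by metis
   thus ?thesis using inj v V.closed[OF stab_perms[OF that]] by(auto dest: inj_onD)
  qed
  thus "u : f ` fixed n r w V" using v by(auto simp: fixed_def)
 qed (use intertw_fixed[OF f] im in auto)
 moreover have "inj_on f (fixed n r w V)" using inj V.fixed_subset by(rule inj_on_subset)
 ultimately show ?thesis
  unfolding fdim_def using dim_inj_image[of f, OF _ V.subspace_fixed] f by(simp add: intertw_def)
qed

subsection \<open>Permutation representations\<close>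

definition prho :: "((nat => nat) => 'x => 'x) => (nat => nat) => ('x \<Rightarrow>\<^sub>0 complex) => ('x \<Rightarrow>\<^sub>0 complex)" where
 "prho a h = push_keys (a h)"

locale perm_set =
 fixes n :: nat and X :: "'x set" and a :: "(nat => nat) => 'x => 'x"
 assumes fin_X: "finite X"
  and a_closed: "h : perms n ==> x : X ==> a h x : X"
  and a_id: "x : X ==> a id x = x"
  and a_comp: "h : perms n ==> t : perms n ==> x : X ==> a (h \<circ> t) x = a h (a t x)"
begin

lemma sym_rep_supp_in: "sym_rep n (prho a) (supp_in X)"
proof (rule sym_rep.intro)
 show "\<exists>Y. finite Y & (supp_in X :: (_ \<Rightarrow>\<^sub>0 complex) set) \<subseteq> supp_in Y" using fin_X by blast
 show "prho a h v : supp_in X" if "h : perms n" "v : supp_in X" for h v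
  using keys_push_keys[of "a h" v] that a_closed by(fastforce simp: supp_in_def prho_def)
 show "prho a id v = v" if "v : supp_in X" for v
  using push_keys_cong[of v "a id" "%x. x"] push_keys_id[of v] that a_id
  by(auto simp: supp_in_def prho_def)
 show "prho a (h \<circ> t) v = prho a h (prho a t v)"
  if "h : perms n" "t : perms n" "v : supp_in X" for h t v
  unfolding prho_def push_keys_comp using that a_comp
  by(intro push_keys_cong) (auto simp: supp_in_def)
qed (auto simp: prho_def subspace_supp_in plin_push_keys)

lemma a_inv:
 assumes "h : perms n" "x : X"
 shows "a (pinv h) (a h x) = x" "a h (a (pinv h) x) = x"
 using a_comp[of "pinv h" h x] a_comp[of h "pinv h" x] assms a_id by(simp_all add: perms_inv_o)

lemma lookup_prho:
 assumes "h : perms n" "v : supp_in X" "x : X"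
 shows "lookup (prho a h v) (a h x) = lookup v x"
proof -
 have "k = x" if "k : X" "a h k = a h x" for k
  using a_inv(1)[OF assms(1) that(1)] a_inv(1)[OF assms(1,3)] that(2) by metis
 hence eq: "{k : X. a h k = a h x} = {x}" using assms(3) by auto
 have "keys v \<subseteq> X" using assms(2) by(simp add: supp_in_def)
 from lookup_push_keys[OF fin_X this, of "a h" "a h x"] show ?thesis by(simp add: prho_def eq)
qed

text \<open>If \<open>c\<close> separates the orbits of the stabiliser of \<open>w\<close>, then pushing forward along \<open>c\<close>
 identifies the fixed vectors with the whole image: averaging does not change the push-forward,
 and a fixed vector is determined by its sums over orbits.\<close>

lemma fdim_eq_dim_push:
 assumes sep: "!!x y. x : X ==> y : X ==> c x = c y \<longleftrightarrow> (\<exists>h\<in>stab n w. y = a h x)"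
  and V: "sym_rep n (prho a) V" "V \<subseteq> supp_in X"
 shows "fdim n (prho a) w V = PM.dim (push_keys c ` V)"
proof -
 interpret V: sym_rep n "prho a" V by fact
 let ?q = "push_keys c :: _ => _ \<Rightarrow>\<^sub>0 complex"
 have inv: "?q (prho a h v) = ?q v" if "h : stab n w" "v : V" for h v
  unfolding prho_def push_keys_comp
 proof (rule push_keys_cong)
  fix k assume "k : keys v"
  hence "k : X" using that(2) V(2) by(auto simp: supp_in_def)
  thus "c (a h k) = c k"
   using sep[of k "a h k"] a_closed[OF stab_perms[OF that(1)]] that(1) by auto
 qed
 have "?q ` V = ?q ` fixed n (prho a) w V"
 proof (intro equalityI subsetI)
  fix u assume "u : ?q ` V"
  then obtain v where v: "v : V" "u = ?q v" by blast
  let ?N = "of_nat (card (stab n w)) :: complex"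
  have N: "?N ~= 0" using stab_id[of n w] finite_stab[of n w] by(metis card_eq_0_iff empty_iff of_nat_eq_0_iff)
  let ?s = "\<Sum>h\<in>stab n w. prho a h v"
  have "?q ?s = (\<Sum>h\<in>stab n w. ?q v)" using inv v by(simp add: push_keys_sum)
  also have "... = pm_scale ?N (?q v)" by(rule PM.sum_constant_scale)
  finally have "?q (pm_scale (1 / ?N) ?s) = u"
   using N v(2) by(simp add: plin_scale[OF plin_push_keys])
  moreover have "pm_scale (1 / ?N) ?s : fixed n (prho a) w V"
   by(rule PM.subspace_scale[OF V.subspace_fixed V.stab_average[OF v(1)]])
  ultimately show "u : ?q ` fixed n (prho a) w V" by blast
 qed (use V.fixed_subset in blast)
 moreover have inj: "inj_on ?q (fixed n (prho a) w V)"
 proof (rule inj_onI)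
  fix u v assume uv: "u : fixed n (prho a) w V" "v : fixed n (prho a) w V" and eq: "?q u = ?q v"
  define d where "d = u - v"
  have d: "d : fixed n (prho a) w V" unfolding d_def by(rule PM.subspace_diff[OF V.subspace_fixed uv])
  hence dX: "d : supp_in X" using V(2) V.fixed_subset by blast
  have "lookup d x = 0" if x: "x : X" for x
  proof -
   have const: "lookup d y = lookup d x" if y: "y : X" "c y = c x" for y
   proof -
   obtain h where h: "h : stab n w" "y = a h x" using sep[OF x y(1)] y(2) by auto
   have "lookup (prho a h d) y = lookup d x"
   unfolding h(2) by(rule lookup_prho[OF stab_perms[OF h(1)] dX x])
   thus ?thesis using d h(1) by(simp add: fixed_def)
   qed
   have "0 = lookup (?q d) (c x)" using eq by(simp add: d_def push_keys_diff)
   also have "... = (\<Sum>y\<in>{y\<in>X. c y = c x}. lookup d y)"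
   using lookup_push_keys[OF fin_X] dX by(auto simp: supp_in_def)
   also have "... = (\<Sum>y\<in>{y\<in>X. c y = c x}. lookup d x)" using const by(intro sum.cong) auto
   also have "... = of_nat (card {y\<in>X. c y = c x}) * lookup d x" by simp
   finally show ?thesis using x fin_X by auto
  qed
  hence "d = 0" using dX by(intro poly_mapping_eqI) (metis lookup_zero supp_in_lookup)
  thus "u = v" by(simp add: d_def)
 qed
 ultimately show ?thesis
  unfolding fdim_def by(simp only: dim_inj_image[OF plin_push_keys V.subspace_fixed inj])
qed

lemma push_keys_supp_in: "push_keys c ` supp_in X = (supp_in (c ` X) :: (_ \<Rightarrow>\<^sub>0 complex) set)"
proof (intro equalityI subsetI)
 fix u assume "u : push_keys c ` (supp_in X :: (_ \<Rightarrow>\<^sub>0 complex) set)"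
 thus "u : supp_in (c ` X)" using keys_push_keys[of c] by(fastforce simp: supp_in_def)
next
 fix u :: "_ \<Rightarrow>\<^sub>0 complex" assume u: "u : supp_in (c ` X)"
 define v where "v = push_keys (%y. SOME x. x : X & c x = y) u"
 have s: "(SOME x. x : X & c x = y) : X & c (SOME x. x : X & c x = y) = y" if "y : c ` X" for y
  using someI_ex[of "%x. x : X & c x = y"] that by blast
 have "v : supp_in X"
  using keys_push_keys[of "%y. SOME x. x : X & c x = y" u] u s by(fastforce simp: supp_in_def v_def)
 moreover have "push_keys c v = u"
  unfolding v_def push_keys_comp using u s
  by(subst push_keys_cong[where g = "%x. x"]) (auto simp: push_keys_id supp_in_def)
 ultimately show "u : push_keys c ` supp_in X" by blast
qed

lemma fdim_supp_in:
 assumes "!!x y. x : X ==> y : X ==> c x = c y \<longleftrightarrow> (\<exists>h\<in>stab n w. y = a h x)"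
 shows "fdim n (prho a) w (supp_in X) = card (c ` X)"
 using fdim_eq_dim_push[OF assms sym_rep_supp_in subset_refl] push_keys_supp_in[of c] fin_X
 by(simp add: dim_supp_in)

end

section \<open>Isomorphisms of representations\<close>

definition conc where
 "conc r V = \<lparr>carrier = V, monoid.mult = undefined, monoid.one = undefined, ring.zero = 0,
   ring.add = (+), smult = pm_scale, act = r\<rparr>"

lemma conc_simps [simp]: "carrier (conc r V) = V" "ring.zero (conc r V) = 0" "ring.add (conc r V) = (+)"
 "smult (conc r V) = pm_scale" "act (conc r V) = r"
 by(simp_all add: conc_def)

lemma specht_conc: "specht D = conc (prho (%s. (`) (tableau_act D s))) (PM.span (polytabloid D ` tableaux D))"
 by(simp add: specht_def conc_def prho_def fun_eq_iff)

definition closed_rep :: "nat => ('k, 'v) rep => bool" where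
 "closed_rep n R \<longleftrightarrow> (\<forall>c. \<forall>v\<in>carrier R. c \<odot>\<^bsub>R\<^esub> v : carrier R) \<and>
   (\<forall>s\<in>perms n. \<forall>v\<in>carrier R. act R s v : carrier R) \<and>
   (\<forall>v\<in>carrier R. \<forall>w\<in>carrier R. v \<oplus>\<^bsub>R\<^esub> w : carrier R)"

lemma rep_isoI:
 assumes "bij_betw f (carrier V) (carrier W)"
  "!!v w. v : carrier V ==> w : carrier V ==> f (v \<oplus>\<^bsub>V\<^esub> w) = f v \<oplus>\<^bsub>W\<^esub> f w"
  "!!c v. v : carrier V ==> f (c \<odot>\<^bsub>V\<^esub> v) = c \<odot>\<^bsub>W\<^esub> f v"
  "!!s v. s : perms n ==> v : carrier V ==> f (act V s v) = act W s (f v)"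
 shows "rep_iso n V W"
 unfolding rep_iso_def carrier_sym_group
proof (intro bexI conjI allI ballI)
 show "f : iso (add_monoid V) (add_monoid W)"
  using assms(1,2) by(auto simp: iso_def hom_def bij_betw_def)
qed (use assms in auto)

lemma rep_isoE:
 assumes "rep_iso n V W"
 obtains f where "bij_betw f (carrier V) (carrier W)"
  "!!v w. v : carrier V ==> w : carrier V ==> f (v \<oplus>\<^bsub>V\<^esub> w) = f v \<oplus>\<^bsub>W\<^esub> f w"
  "!!c v. v : carrier V ==> f (c \<odot>\<^bsub>V\<^esub> v) = c \<odot>\<^bsub>W\<^esub> f v"
  "!!s v. s : perms n ==> v : carrier V ==> f (act V s v) = act W s (f v)"
proof -
 obtain f where f: "f : iso (add_monoid V) (add_monoid W)"
  "\<forall>c. \<forall>v \<in> carrier V. f (c \<odot>\<^bsub>V\<^esub> v) = c \<odot>\<^bsub>W\<^esub> f v"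
  "\<forall>s \<in> perms n. \<forall>v \<in> carrier V. f (act V s v) = act W s (f v)"
  using assms unfolding rep_iso_def carrier_sym_group by blast
 from f(1) have "bij_betw f (carrier V) (carrier W)"
  "\<forall>v\<in>carrier V. \<forall>w\<in>carrier V. f (v \<oplus>\<^bsub>V\<^esub> w) = f v \<oplus>\<^bsub>W\<^esub> f w"
  by(auto simp: iso_def hom_def)
 with f(2,3) show thesis by(intro that) auto
qed

lemma rep_iso_trans:
 assumes "rep_iso n V W" "rep_iso n W U"
 shows "rep_iso n V U"
proof -
 obtain f where f: "bij_betw f (carrier V) (carrier W)"
  "!!v w. v : carrier V ==> w : carrier V ==> f (v \<oplus>\<^bsub>V\<^esub> w) = f v \<oplus>\<^bsub>W\<^esub> f w"
  "!!c v. v : carrier V ==> f (c \<odot>\<^bsub>V\<^esub> v) = c \<odot>\<^bsub>W\<^esub> f v"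
  "!!s v. s : perms n ==> v : carrier V ==> f (act V s v) = act W s (f v)"
  using rep_isoE[OF assms(1)] by metis
 obtain g where g: "bij_betw g (carrier W) (carrier U)"
  "!!v w. v : carrier W ==> w : carrier W ==> g (v \<oplus>\<^bsub>W\<^esub> w) = g v \<oplus>\<^bsub>U\<^esub> g w"
  "!!c v. v : carrier W ==> g (c \<odot>\<^bsub>W\<^esub> v) = c \<odot>\<^bsub>U\<^esub> g v"
  "!!s v. s : perms n ==> v : carrier W ==> g (act W s v) = act U s (g v)"
  using rep_isoE[OF assms(2)] by metis
 have W: "f v : carrier W" if "v : carrier V" for v using f(1) that by(auto simp: bij_betw_def)
 show ?thesis
  by(rule rep_isoI[of "%v. g (f v)"])
   (use bij_betw_trans[OF f(1) g(1)] f g W in "simp_all add: comp_def")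
qed

lemma rep_iso_sym:
 assumes "rep_iso n V W" "closed_rep n V"
 shows "rep_iso n W V"
proof -
 obtain f where f: "bij_betw f (carrier V) (carrier W)"
  "!!v w. v : carrier V ==> w : carrier V ==> f (v \<oplus>\<^bsub>V\<^esub> w) = f v \<oplus>\<^bsub>W\<^esub> f w"
  "!!c v. v : carrier V ==> f (c \<odot>\<^bsub>V\<^esub> v) = c \<odot>\<^bsub>W\<^esub> f v"
  "!!s v. s : perms n ==> v : carrier V ==> f (act V s v) = act W s (f v)"
  using rep_isoE[OF assms(1)] by metis
 define g where "g = the_inv_into (carrier V) f"
 have inj: "inj_on f (carrier V)" using f(1) by(simp add: bij_betw_def)
 have gf: "g (f v) = v" if "v : carrier V" for v
  unfolding g_def using that inj by(rule the_inv_into_f_f[rotated])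
 have obt: "\<exists>v\<in>carrier V. u = f v" if "u : carrier W" for u using f(1) that by(auto simp: bij_betw_def)
 show ?thesis
 proof (rule rep_isoI[of g])
  show "bij_betw g (carrier W) (carrier V)" unfolding g_def by(rule bij_betw_the_inv_into[OF f(1)])
 next
  fix v w assume "v : carrier W" "w : carrier W"
  then obtain v' w' where v': "v' : carrier V" "w' : carrier V" "v = f v'" "w = f w'" using obt by metis
  hence "v' \<oplus>\<^bsub>V\<^esub> w' : carrier V" using assms(2) by(simp add: closed_rep_def)
  thus "g (v \<oplus>\<^bsub>W\<^esub> w) = g v \<oplus>\<^bsub>V\<^esub> g w" using v' f(2)[OF v'(1,2)] gf by metis
 next
  fix c v assume "v : carrier W"
  then obtain v' where v': "v' : carrier V" "v = f v'" using obt by metis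
  hence "c \<odot>\<^bsub>V\<^esub> v' : carrier V" using assms(2) by(simp add: closed_rep_def)
  thus "g (c \<odot>\<^bsub>W\<^esub> v) = c \<odot>\<^bsub>V\<^esub> g v" using v' f(3)[OF v'(1)] gf by metis
 next
  fix s v assume s: "s : perms n" and "v : carrier W"
  then obtain v' where v': "v' : carrier V" "v = f v'" using obt by metis
  hence "act V s v' : carrier V" using assms(2) s by(simp add: closed_rep_def)
  thus "g (act W s v) = act V s (g v)" using v' f(4)[OF s v'(1)] gf by metis
 qed
qed

lemma rep_iso_conc:
 assumes "intertw n V r r' f" "inj_on f V" "f ` V = W"
 shows "rep_iso n (conc r V) (conc r' W)"
 by(rule rep_isoI[of f])
  (use assms in "auto simp: bij_betw_def intertw_def plin_add plin_scale")
lemma closed_rep_conc: "sym_rep n r V ==> closed_rep n (conc r V)"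
 by(simp add: closed_rep_def sym_rep.closed PM.subspace_scale PM.subspace_add sym_rep.sub)
lemma closed_rep_plus: "closed_rep n V ==> closed_rep n W ==> closed_rep n (rep_plus V W)"
 by(auto simp: closed_rep_def rep_plus_def)
lemma closed_rep_Sum: "(!!i. i : I ==> closed_rep n (V i)) ==> closed_rep n (rep_Sum I V)"
 by(simp add: closed_rep_def rep_Sum_def PiE_iff)
lemma closed_rep_zero: "closed_rep n zero_rep"
 by(auto simp: closed_rep_def zero_rep_def)

lemma rep_iso_plus_direct:
 assumes A: "sym_rep n r A" and B: "sym_rep n r B" and dir: "direct V A B"
 shows "rep_iso n (conc r V) (rep_plus (conc r A) (conc r B))"
proof (rule rep_iso_sym)
 interpret A: sym_rep n r A by fact
 interpret B: sym_rep n r B by fact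
 note D = directD[OF dir A.sub B.sub]
 show "rep_iso n (rep_plus (conc r A) (conc r B)) (conc r V)"
 proof (rule rep_isoI[of "%(a, b). a + b"])
  show "bij_betw (%(a, b). a + b) (carrier (rep_plus (conc r A) (conc r B))) (carrier (conc r V))"
   unfolding bij_betw_def
  proof
   show "inj_on (%(a, b). a + b) (carrier (rep_plus (conc r A) (conc r B)))"
   using direct_unique[OF dir A.sub B.sub] by(auto simp: inj_on_def rep_plus_def)
   show "(%(a, b). a + b) ` carrier (rep_plus (conc r A) (conc r B)) = carrier (conc r V)"
   using D(3,4) by(force simp: rep_plus_def)
  qed
 qed (auto simp: rep_plus_def PM.scale_right_distrib plin_add[OF A.lin] algebra_simps)
 show "closed_rep n (rep_plus (conc r A) (conc r B))"
  by(intro closed_rep_plus closed_rep_conc A B)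
qed

lemma rep_iso_plus_cong:
 assumes "rep_iso n V V'" "rep_iso n W W'"
 shows "rep_iso n (rep_plus V W) (rep_plus V' W')"
proof -
 obtain f where f: "bij_betw f (carrier V) (carrier V')"
  "!!v w. v : carrier V ==> w : carrier V ==> f (v \<oplus>\<^bsub>V\<^esub> w) = f v \<oplus>\<^bsub>V'\<^esub> f w"
  "!!c v. v : carrier V ==> f (c \<odot>\<^bsub>V\<^esub> v) = c \<odot>\<^bsub>V'\<^esub> f v"
  "!!s v. s : perms n ==> v : carrier V ==> f (act V s v) = act V' s (f v)"
  using rep_isoE[OF assms(1)] by metis
 obtain g where g: "bij_betw g (carrier W) (carrier W')"
  "!!v w. v : carrier W ==> w : carrier W ==> g (v \<oplus>\<^bsub>W\<^esub> w) = g v \<oplus>\<^bsub>W'\<^esub> g w"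
  "!!c v. v : carrier W ==> g (c \<odot>\<^bsub>W\<^esub> v) = c \<odot>\<^bsub>W'\<^esub> g v"
  "!!s v. s : perms n ==> v : carrier W ==> g (act W s v) = act W' s (g v)"
  using rep_isoE[OF assms(2)] by metis
 show ?thesis
 proof (rule rep_isoI[of "map_prod f g"])
  show "bij_betw (map_prod f g) (carrier (rep_plus V W)) (carrier (rep_plus V' W'))"
   using bij_betw_map_prod[OF f(1) g(1)] by(simp add: rep_plus_def)
 qed (use f g in "auto simp: rep_plus_def")
qed

lemma rep_iso_Sum_empty:
 assumes "carrier R = {z}" "closed_rep n R"
 shows "rep_iso n R (rep_Sum {} V)"
 by(rule rep_isoI[of "% _ _. undefined"])
  (use assms in \<open>auto simp: rep_Sum_def closed_rep_def bij_betw_def fun_eq_iff\<close>)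

lemma rep_iso_Sum_insert:
 assumes "i \<notin> I"
 shows "rep_iso n (rep_Sum (insert i I) V) (rep_plus (V i) (rep_Sum I V))"
proof (rule rep_isoI[of "%v. (v i, restrict v I)"])
 show "bij_betw (%v. (v i, restrict v I)) (carrier (rep_Sum (insert i I) V))
   (carrier (rep_plus (V i) (rep_Sum I V)))"
  by(rule bij_betw_byWitness[where f' = "%(x, v). \<lambda>j\<in>insert i I. if j = i then x else v j"])
   (use assms in \<open>auto simp: rep_Sum_def rep_plus_def fun_eq_iff PiE_iff extensional_def restrict_def
   split: if_splits\<close>)
qed (use assms in "auto simp: rep_Sum_def rep_plus_def fun_eq_iff")

lemma rep_iso_Sum_plus:
 fixes V1 :: "'a => ('k, 'v) rep" and V2 :: "'b => ('k, 'v) rep" and V :: "'c => ('k, 'v) rep"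
 assumes h1: "inj_on h1 I1" and h2: "inj_on h2 I2" and disj: "h1 ` I1 \<inter> h2 ` I2 = {}"
  and I: "I = h1 ` I1 \<union> h2 ` I2"
  and V1: "!!i. i : I1 ==> V (h1 i) = V1 i" and V2: "!!i. i : I2 ==> V (h2 i) = V2 i"
 shows "rep_iso n (rep_plus (rep_Sum I1 V1) (rep_Sum I2 V2)) (rep_Sum I V)"
proof -
 define f :: "('a => 'v) \<times> ('b => 'v) => 'c => 'v" where
  "f = (%(v, w). \<lambda>i\<in>I. if i : h1 ` I1 then v (the_inv_into I1 h1 i) else w (the_inv_into I2 h2 i))"
 have f1: "f (v, w) (h1 i) = v i" if "i : I1" for v w i
  using that the_inv_into_f_f[OF h1 that] by(simp add: f_def I)
 have f2: "f (v, w) (h2 i) = w i" if "i : I2" for v w i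
  using that the_inv_into_f_f[OF h2 that] disj by(auto simp: f_def I)
 have ext: "f x : extensional I" for x by(cases x) (simp add: f_def)
 have eqI: "x = y" if "x : extensional I" "y : extensional I" "!!i. i : I1 ==> x (h1 i) = y (h1 i)"
  "!!i. i : I2 ==> x (h2 i) = y (h2 i)" for x y :: "'c => 'v"
  by(rule extensionalityI[OF that(1,2)]) (use that(3,4) in "auto simp: I")
 show ?thesis
 proof (rule rep_isoI[of f])
  show "bij_betw f (carrier (rep_plus (rep_Sum I1 V1) (rep_Sum I2 V2))) (carrier (rep_Sum I V))"
  proof (rule bij_betw_byWitness[where f' = "%x. (\<lambda>i\<in>I1. x (h1 i), \<lambda>i\<in>I2. x (h2 i))"])
   show "\<forall>x\<in>carrier (rep_plus (rep_Sum I1 V1) (rep_Sum I2 V2)).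
   (\<lambda>i\<in>I1. f x (h1 i), \<lambda>i\<in>I2. f x (h2 i)) = x"
   using f1 f2 by(auto simp: rep_plus_def rep_Sum_def fun_eq_iff restrict_def PiE_iff extensional_def)
   show "\<forall>x\<in>carrier (rep_Sum I V). f (\<lambda>i\<in>I1. x (h1 i), \<lambda>i\<in>I2. x (h2 i)) = x"
   by(auto intro!: eqI ext simp: f1 f2 rep_Sum_def PiE_iff)
   show "f ` carrier (rep_plus (rep_Sum I1 V1) (rep_Sum I2 V2)) \<subseteq> carrier (rep_Sum I V)"
   proof clarify
   fix v w assume "(v, w) : carrier (rep_plus (rep_Sum I1 V1) (rep_Sum I2 V2))"
   hence "v i : carrier (V1 i)" if "i : I1" for i
   using that by(auto simp: rep_plus_def rep_Sum_def)
   moreover from \<open>(v, w) : _\<close> have "w i : carrier (V2 i)" if "i : I2" for i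
   using that by(auto simp: rep_plus_def rep_Sum_def)
   ultimately show "f (v, w) : carrier (rep_Sum I V)"
   using ext[of "(v, w)"] by(auto simp: rep_Sum_def PiE_iff I f1 f2 V1 V2)
   qed
   show "(%x. (\<lambda>i\<in>I1. x (h1 i), \<lambda>i\<in>I2. x (h2 i))) ` carrier (rep_Sum I V)
   \<subseteq> carrier (rep_plus (rep_Sum I1 V1) (rep_Sum I2 V2))"
   using V1 V2 by(force simp: rep_plus_def rep_Sum_def PiE_iff I)
  qed
 next
  fix x y assume "x : carrier (rep_plus (rep_Sum I1 V1) (rep_Sum I2 V2))"
   "y : carrier (rep_plus (rep_Sum I1 V1) (rep_Sum I2 V2))"
  show "f (x \<oplus>\<^bsub>rep_plus (rep_Sum I1 V1) (rep_Sum I2 V2)\<^esub> y) = f x \<oplus>\<^bsub>rep_Sum I V\<^esub> f y"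
   by(cases x; cases y) (auto intro!: eqI ext simp: rep_plus_def rep_Sum_def f1 f2 V1 V2 I)
 next
  fix c x
  show "f (c \<odot>\<^bsub>rep_plus (rep_Sum I1 V1) (rep_Sum I2 V2)\<^esub> x) = c \<odot>\<^bsub>rep_Sum I V\<^esub> f x"
   by(cases x) (auto intro!: eqI ext simp: rep_plus_def rep_Sum_def f1 f2 V1 V2 I)
 next
  fix s x
  show "f (act (rep_plus (rep_Sum I1 V1) (rep_Sum I2 V2)) s x) = act (rep_Sum I V) s (f x)"
   by(cases x) (auto intro!: eqI ext simp: rep_plus_def rep_Sum_def f1 f2 V1 V2 I)
 qed
qed

lemma rep_iso_Sum_single: "rep_iso n V (rep_Sum {i} (% _. V))"
 by(rule rep_isoI[of "%v. \<lambda>_\<in>{i}. v"])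
  (auto simp: rep_Sum_def fun_eq_iff bij_betw_def inj_on_def PiE_iff image_iff extensional_def
   split: if_splits intro!: bexI[of _ "_ i"])

subsection \<open>Multiplicities of Specht modules\<close>

definition specht_sum :: "nat => (nat list => nat) =>
  (complex, nat list \<times> nat => (nat \<times> nat => nat) set \<Rightarrow>\<^sub>0 complex) rep" where
 "specht_sum n m = rep_Sum (SIGMA l : partitions_of n. {..<m l}) (%(l, j). specht (young l))"

definition has_mult :: "nat => (complex, 'v) rep => (nat list => nat) => bool" where
 "has_mult n R m \<longleftrightarrow> rep_iso n R (specht_sum n m)"

lemma has_mult_zero:
 assumes "carrier R = {z}" "closed_rep n R"
 shows "has_mult n R (% _. 0)"
 using rep_iso_Sum_empty[OF assms] by(simp add: has_mult_def specht_sum_def)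

lemma specht_sum_plus: "rep_iso n (rep_plus (specht_sum n m) (specht_sum n m')) (specht_sum n (%l. m l + m' l))"
 unfolding specht_sum_def
proof (rule rep_iso_Sum_plus[where ?h1.0 = "%x. x" and ?h2.0 = "%(l, j). (l, m l + j)"])
 show "(SIGMA l:partitions_of n. {..<m l + m' l}) =
   (%x. x) ` (SIGMA l:partitions_of n. {..<m l}) \<union> (%(l, j). (l, m l + j)) ` (SIGMA l:partitions_of n. {..<m' l})"
 proof (intro equalityI subsetI)
  fix x assume "x : (SIGMA l:partitions_of n. {..<m l + m' l})"
  then obtain l j where x: "x = (l, j)" "l : partitions_of n" "j < m l + m' l" by blast
  show "x : (%x. x) ` (SIGMA l:partitions_of n. {..<m l}) \<union>
   (%(l, j). (l, m l + j)) ` (SIGMA l:partitions_of n. {..<m' l})"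
  proof (cases "j < m l")
   case False
   hence "x = (%(l, j). (l, m l + j)) (l, j - m l)" "(l, j - m l) : (SIGMA l:partitions_of n. {..<m' l})"
   using x by auto
   thus ?thesis by blast
  qed (use x in auto)
 qed auto
qed (auto simp: inj_on_def)

lemma has_mult_iso: "rep_iso n R R' ==> has_mult n R' m ==> has_mult n R m"
 unfolding has_mult_def by(rule rep_iso_trans)

lemma has_mult_plus:
 assumes "has_mult n R m" "has_mult n R' m'"
 shows "has_mult n (rep_plus R R') (%l. m l + m' l)"
 using rep_iso_trans[OF rep_iso_plus_cong specht_sum_plus] assms unfolding has_mult_def by blast

lemma has_mult_Sum:
 assumes "finite I" "!!i. i : I ==> has_mult n (R i) (m i)"
 shows "has_mult n (rep_Sum I R) (%l. \<Sum>i\<in>I. m i l)"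
 using assms
proof (induction I rule: finite_induct)
 case empty
 have "has_mult n (rep_Sum {} R) (% _. 0)"
  by(rule has_mult_zero[of _ "% _. undefined"]) (auto simp: rep_Sum_def closed_rep_def)
 thus ?case by simp
next
 case (insert i I)
 show ?case
  using has_mult_iso[OF rep_iso_Sum_insert[OF insert(2)] has_mult_plus[OF insert(4)[of i] insert(3)]]
   insert by simp
qed

lemma has_mult_specht:
 assumes "l : partitions_of n"
 shows "has_mult n (specht (young l)) (%l'. if l' = l then 1 else 0)"
proof -
 have eq: "(SIGMA l':partitions_of n. {..<if l' = l then 1 else 0::nat}) = {(l, 0)}"
  using assms by(auto split: if_splits)
 have "rep_Sum {(l, 0::nat)} (%(l, j). specht (young l)) = rep_Sum {(l, 0)} (% _. specht (young l))"
  by(auto simp: rep_Sum_def fun_eq_iff PiE_iff)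
 thus ?thesis
  unfolding has_mult_def specht_sum_def eq using rep_iso_Sum_single by metis
qed

section \<open>Counting semistandard tableaux\<close>

definition dg :: "(nat => nat) => shape" where
 "dg v = {(i, j). j < v i}"

definition par :: "(nat => nat) => bool" where
 "par v \<longleftrightarrow> (\<forall>i. v (Suc i) <= v i) & (\<exists>L. \<forall>i\<ge>L. v i = 0)"

definition psize :: "(nat => nat) => nat" where
 "psize v = card (dg v)"

definition Par :: "nat => (nat => nat) set" where
 "Par N = {v. par v & psize v = N}"

lemma dg_Sigma: "\<forall>i\<ge>L. v i = 0 ==> dg v = (SIGMA i:{..<L}. {..<v i})"
 unfolding dg_def by(auto simp: not_le[symmetric])
lemma psize_eq: "\<forall>i\<ge>L. v i = 0 ==> psize v = (\<Sum>i<L. v i)"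
 by(simp add: psize_def dg_Sigma)

lemma par_finite_dg: "par v ==> finite (dg v)"
 unfolding par_def using dg_Sigma by(metis finite_SigmaI finite_lessThan)

lemma par_antimono: "par v ==> i <= j ==> v j <= v i"
 unfolding par_def by(metis lift_Suc_antimono_le)

lemma par_bounds:
 assumes "par v"
 shows "v i <= psize v" "i \<ge> psize v ==> v i = 0"
proof -
 have "Pair i ` {..<v i} \<subseteq> dg v" by(auto simp: dg_def)
 hence "card (Pair i ` {..<v i}) <= psize v"
  unfolding psize_def using par_finite_dg[OF assms] by(rule card_mono[rotated])
 thus "v i <= psize v" by(simp add: card_image inj_on_def)
 show "v i = 0" if "i \<ge> psize v"
 proof (rule ccontr)
  assume "v i ~= 0"
  hence "(%k. (k, 0)) ` {..i} \<subseteq> dg v"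
   using par_antimono[OF assms] by(fastforce simp: dg_def)
  hence "card ((%k. (k, 0::nat)) ` {..i}) <= psize v"
   unfolding psize_def using par_finite_dg[OF assms] by(rule card_mono[rotated])
  thus False using that by(simp add: card_image inj_on_def)
 qed
qed

lemma finite_Par [simp]: "finite (Par N)"
proof (rule finite_subset)
 show "Par N \<subseteq> {v. \<forall>i. (i : {..<N} \<longrightarrow> v i : {..N}) & (i \<notin> {..<N} \<longrightarrow> v i = 0)}"
  using par_bounds by(auto simp: Par_def)
 show "finite {v::nat => nat. \<forall>i. (i : {..<N} \<longrightarrow> v i : {..N}) & (i \<notin> {..<N} \<longrightarrow> v i = 0)}"
  by(rule finite_set_of_finite_funs) auto
qed

text \<open>The difference of the two partitions is a horizontal strip.\<close>

definition interlaces :: "(nat => nat) => (nat => nat) => bool" where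
 "interlaces h v \<longleftrightarrow> (\<forall>i. v (Suc i) <= h i & h i <= v i)"

lemma interlaces_par:
 assumes "interlaces h v" "par v"
 shows "par h"
 unfolding par_def
proof
 show "\<forall>i. h (Suc i) <= h i" using assms(1) unfolding interlaces_def by(meson le_trans)
 obtain L where "\<forall>i\<ge>L. v i = 0" using assms(2) by(auto simp: par_def)
 hence "\<forall>i\<ge>L. h i = 0" using assms(1) unfolding interlaces_def by(metis le_zero_eq)
 thus "\<exists>L. \<forall>i\<ge>L. h i = 0" ..
qed

lemma interlaces_par_upper:
 assumes "interlaces h v" "par h"
 shows "par v"
 unfolding par_def
proof
 show "\<forall>i. v (Suc i) <= v i" using assms(1) unfolding interlaces_def by(meson le_trans)
 obtain L where "\<forall>i\<ge>L. h i = 0" using assms(2) by(auto simp: par_def)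
 hence "v (Suc i) = 0" if "i \<ge> L" for i using assms(1) that unfolding interlaces_def by(metis le_zero_eq)
 hence "\<forall>i\<ge>Suc L. v i = 0" by(metis Suc_le_D Suc_le_mono)
 thus "\<exists>L. \<forall>i\<ge>L. v i = 0" ..
qed

subsection \<open>The local exchange of horizontal strips\<close>

lemma exchange_size:
 assumes "par r" "par t" "par h" "par v"
  and eq: "!!i. v (Suc i) + h i = min (r i) (t i) + max (r (Suc i)) (t (Suc i))"
 shows "psize h + psize v + max (r 0) (t 0) = psize r + psize t + v 0"
proof -
 obtain L1 L2 L3 L4 where L: "\<forall>i\<ge>L1. r i = 0" "\<forall>i\<ge>L2. t i = 0" "\<forall>i\<ge>L3. h i = 0" "\<forall>i\<ge>L4. v i = 0"
  using assms(1-4) unfolding par_def by blast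
 define L where "L = max (max L1 L2) (max L3 L4)"
 have z: "\<forall>i\<ge>L. r i = 0" "\<forall>i\<ge>L. t i = 0" "\<forall>i\<ge>L. h i = 0" "\<forall>i\<ge>L. v i = 0" "\<forall>i\<ge>Suc L. v i = 0"
  using L by(auto simp: L_def)
 have shift: "(\<Sum>i<L. f (Suc i)) + f 0 = (\<Sum>i<L. f i) + f L" for f :: "nat => nat"
  using sum.lessThan_Suc_shift[of f L] by(simp add: add.commute)
 have "(\<Sum>i<L. v (Suc i)) + (\<Sum>i<L. h i) = (\<Sum>i<L. min (r i) (t i)) + (\<Sum>i<L. max (r (Suc i)) (t (Suc i)))"
  unfolding sum.distrib[symmetric] using eq by simp
 moreover have "(\<Sum>i<L. v (Suc i)) + v 0 = (\<Sum>i<L. v i)" using shift[of v] z(4) by simp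
 moreover have "(\<Sum>i<L. max (r (Suc i)) (t (Suc i))) + max (r 0) (t 0) = (\<Sum>i<L. max (r i) (t i))"
  using shift[of "%i. max (r i) (t i)"] z(1,2) by simp
 moreover have "(\<Sum>i<L. min (r i) (t i)) + (\<Sum>i<L. max (r i) (t i)) = (\<Sum>i<L. r i) + (\<Sum>i<L. t i)"
  unfolding sum.distrib[symmetric] by(intro sum.cong) auto
 ultimately show ?thesis using psize_eq[OF z(1)] psize_eq[OF z(2)] psize_eq[OF z(3)] psize_eq[OF z(4)]
  by linarith
qed

text \<open>Adding and then removing a strip can be traded for removing and then adding one, by
reflecting each part in the interval allowed for it.\<close>

lemma exchange:
 assumes r: "par r" and t: "par t"
 shows "card {v : Par N. interlaces r v & interlaces t v} =
  card {h. interlaces h r & interlaces h t & psize r + psize t <= psize h + N}"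
proof (rule bij_betw_same_card)
 define mn where "mn i = min (r i) (t i)" for i
 define mx where "mx i = max (r i) (t i)" for i
 define f where "f v i = mn i + mx (Suc i) - v (Suc i)" for v :: "nat => nat" and i
 define g where "g h i = (if i = 0 then mx 0 + (psize h + N - (psize r + psize t))
  else mn (i - 1) + mx i - h (i - 1))" for h :: "nat => nat" and i
 have g_Suc: "g h (Suc i) = mn i + mx (Suc i) - h i" for h i by(simp add: g_def)
 let ?A = "{v : Par N. interlaces r v & interlaces t v}"
 let ?B = "{h. interlaces h r & interlaces h t & psize r + psize t <= psize h + N}"
 have up: "interlaces r v & interlaces t v \<longleftrightarrow> (\<forall>i. v (Suc i) <= mn i & mx i <= v i)" for v
  by(auto simp: interlaces_def mn_def mx_def)
 have dn: "interlaces h r & interlaces h t \<longleftrightarrow> (\<forall>i. h i <= mn i & mx (Suc i) <= h i)" for h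
  by(auto simp: interlaces_def mn_def mx_def)
 have size: "psize h + psize v + mx 0 = psize r + psize t + v 0"
  if "interlaces h r" "interlaces r v" "!!i. v (Suc i) + h i = mn i + mx (Suc i)" for h v
  using exchange_size[OF r t interlaces_par[OF that(1) r] interlaces_par_upper[OF that(2) r]] that(3)
  by(simp add: mn_def mx_def)
 have A: "psize v = N" "v (Suc i) <= mn i" "mx i <= v i" if "v : ?A" for v i
  using that up[of v] by(auto simp: Par_def)
 have B: "h i <= mn i" "mx (Suc i) <= h i" "psize r + psize t <= psize h + N" if "h : ?B" for h i
  using that dn[of h] by auto
 have f: "interlaces (f v) r & interlaces (f v) t & psize (f v) + N + mx 0 = psize r + psize t + v 0"
  if l: "v : ?A" for v
 proof -
  have i: "f v i <= mn i" "mx (Suc i) <= f v i" "v (Suc i) + f v i = mn i + mx (Suc i)" for i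
   unfolding f_def using A(2)[OF l, of i] A(3)[OF l, of "Suc i"] by arith+
  hence il: "interlaces (f v) r" "interlaces (f v) t" using dn[of "f v"] by blast+
  have "interlaces r v" using l by blast
  from size[OF il(1) this i(3)] show ?thesis using il A(1)[OF l] by simp
 qed
 have g: "interlaces r (g h) & interlaces t (g h) & par (g h) & psize (g h) = N" if s: "h : ?B" for h
 proof -
  have i: "g h (Suc i) <= mn i" "mx (Suc i) <= g h (Suc i)" "g h (Suc i) + h i = mn i + mx (Suc i)" for i
   unfolding g_Suc using B(1,2)[OF s, of i] by arith+
  have "mx i <= g h i" for i by(cases i) (use i in "auto simp: g_def")
  hence il: "interlaces r (g h)" "interlaces t (g h)" using up[of "g h"] i(1) by blast+
  have "interlaces h r" using s by blast
  from size[OF this il(1) i(3)] have "psize h + psize (g h) + mx 0 = psize r + psize t + g h 0" .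
  moreover have "g h 0 = mx 0 + (psize h + N - (psize r + psize t))" by(simp add: g_def)
  ultimately have "psize (g h) = N" using B(3)[OF s] by linarith
  thus ?thesis using il interlaces_par_upper[OF il(1) r] by blast
 qed
 show "bij_betw f ?A ?B"
 proof (rule bij_betw_byWitness[where f' = g])
  show "\<forall>v\<in>?A. g (f v) = v"
  proof (intro ballI ext)
   fix v i assume l: "v : ?A"
   show "g (f v) i = v i"
   proof (cases i)
   case 0
   have "g (f v) 0 = mx 0 + (psize (f v) + N - (psize r + psize t))" by(simp add: g_def)
   moreover have "psize (f v) + N + mx 0 = psize r + psize t + v 0" using f[OF l] by blast
   ultimately show ?thesis using A(3)[OF l, of 0] 0 by simp
   next
   case (Suc k)
   show ?thesis unfolding Suc g_Suc f_def using A(2)[OF l, of k] by arith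
   qed
  qed
  show "\<forall>h\<in>?B. f (g h) = h"
  proof (intro ballI ext)
   fix h i assume s: "h : ?B"
   show "f (g h) i = h i" unfolding f_def g_Suc using B(1)[OF s, of i] by arith
  qed
  show "f ` ?A \<subseteq> ?B"
  proof
   fix h assume "h : f ` ?A"
   then obtain v where l: "v : ?A" "h = f v" by blast
   have "psize r + psize t <= psize (f v) + N" using f[OF l(1)] A(3)[OF l(1), of 0] by linarith
   thus "h : ?B" using f[OF l(1)] l(2) by blast
  qed
  show "g ` ?B \<subseteq> ?A"
  proof
   fix v assume "v : g ` ?B"
   then obtain h where s: "h : ?B" "v = g h" by blast
   thus "v : ?A" using g[OF s(1)] by(simp add: Par_def)
  qed
 qed
qed

subsection \<open>Removing the largest letter\<close>

definition KT :: "(nat => nat) => nat multiset => (nat \<times> nat => nat) set" where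
 "KT v B = {T : semistandard (dg v). image_mset T (mset_set (dg v)) = B}"

definition K :: "(nat => nat) => nat multiset => nat" where
 "K v B = card (KT v B)"

lemma finite_KT: "par v ==> finite (KT v B)"
proof (rule finite_subset)
 assume p: "par v"
 show "KT v B \<subseteq> dg v \<rightarrow>\<^sub>E set_mset B"
  using par_finite_dg[OF p] by(auto simp: KT_def semistandard_def)
 show "finite (dg v \<rightarrow>\<^sub>E set_mset B)"
  by(intro finite_PiE par_finite_dg[OF p]) auto
qed
lemma KT_size: "T : KT v B ==> size B = psize v"
 by(auto simp: KT_def psize_def)

lemma K_size: "size B ~= psize v ==> K v B = 0"
 unfolding K_def using KT_size by(metis card.empty ex_in_conv)

lemma KT_ge_row:
 assumes T: "T : KT v B" and p: "par v" and c: "(i, j) : dg v"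
 shows "i <= T (i, j)"
 using c
proof (induction i)
 case (Suc i)
 have "(i, j) : dg v" using Suc(2) p by(auto simp: dg_def par_def intro: order_less_le_trans)
 moreover have "T (i, j) < T (Suc i, j)"
  using T Suc(2) calculation by(auto simp: KT_def semistandard_def)
 ultimately show ?case using Suc(1) by linarith
qed simp

definition rowms :: "(nat => nat) => nat multiset" where
 "rowms v = image_mset fst (mset_set (dg v))"

lemma K_triangular:
 assumes p: "par v" and K: "K v B ~= 0"
 shows "sum_mset (rowms v) < sum_mset B \<or> B = rowms v"
proof -
 obtain T where T: "T : KT v B" using K unfolding K_def by(metis card.empty ex_in_conv)
 have B: "B = image_mset T (mset_set (dg v))" using T by(simp add: KT_def)
 have le: "\<forall>c\<in>dg v. fst c <= T c" using KT_ge_row[OF T p] by auto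
 show ?thesis
 proof (cases "\<forall>c\<in>dg v. T c = fst c")
  case True
  hence "B = rowms v" unfolding B rowms_def
   using par_finite_dg[OF p] by(intro image_mset_cong) auto
  thus ?thesis by simp
 next
  case False
  hence "\<exists>c\<in>dg v. fst c < T c" using le by(metis le_neq_implies_less)
  hence "(\<Sum>c\<in>dg v. fst c) < (\<Sum>c\<in>dg v. T c)"
   using le par_finite_dg[OF p] by(intro sum_strict_mono_ex1)
  thus ?thesis by(simp add: B rowms_def sum_unfold_sum_mset)
 qed
qed

lemma K_diagonal:
 assumes p: "par v"
 shows "K v (rowms v) = 1"
proof -
 have "KT v (rowms v) = {restrict fst (dg v)}"
 proof (intro equalityI subsetI)
  fix T assume T: "T : KT v (rowms v)"
  have le: "\<forall>c\<in>dg v. fst c <= T c" using KT_ge_row[OF T p] by auto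
  have "(\<Sum>c\<in>dg v. T c) = (\<Sum>c\<in>dg v. fst c)"
   using T by(simp add: KT_def rowms_def sum_unfold_sum_mset)
  hence "\<forall>c\<in>dg v. T c = fst c"
   using sum_strict_mono_ex1[OF par_finite_dg[OF p] le] le by(metis less_le nat_less_le)
  moreover have "T : extensional (dg v)" using T by(auto simp: KT_def semistandard_def PiE_iff)
  ultimately show "T : {restrict fst (dg v)}" by(auto simp: extensional_def fun_eq_iff)
 next
  fix T :: "nat \<times> nat => nat" assume "T : {restrict fst (dg v)}"
  hence T: "T = restrict fst (dg v)" by simp
  have "image_mset T (mset_set (dg v)) = rowms v"
   unfolding T rowms_def using par_finite_dg[OF p] by(intro image_mset_cong) auto
  thus "T : KT v (rowms v)" by(auto simp: KT_def semistandard_def T)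
 qed
 thus ?thesis by(simp add: K_def)
qed

lemma initial_segment:
 assumes "!!x y. x : S ==> y <= x ==> y : S" "S \<subseteq> {..<m::nat}"
 shows "S = {..<card S}"
proof (cases "S = {}")
 case False
 have f: "finite S" using assms(2) finite_subset by blast
 hence "S = {..Max S}" using assms(1) False by(auto intro: Max_in)
 thus ?thesis by(metis card_atMost lessThan_Suc_atMost)
qed simp

text \<open>The cells with the largest letter form a horizontal strip.\<close>

lemma K_rec:
 assumes p: "par v" and B: "!!x. x \<in># B ==> x < b" and size: "psize v = size B + k"
 shows "K v (B + replicate_mset k b) = (\<Sum>h\<in>{h\<in>Par (size B). interlaces h v}. K h B)"
proof -
 let ?S = "SIGMA h:{h\<in>Par (size B). interlaces h v}. KT h B"
 let ?B = "B + replicate_mset k b"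
 define sh where "sh T i = card {j. (i, j) : dg v & T (i, j) < b}" for T :: "nat \<times> nat => nat" and i
 define glue where "glue = (%(h, T'). \<lambda>c\<in>dg v. if c : dg h then T' c else b)"
 have fin: "finite (dg v)" by(rule par_finite_dg[OF p])
 have row: "{j. (i, j) : dg v & T (i, j) < b} = {..<sh T i}" if T: "T : KT v ?B" for T i
  unfolding sh_def
 proof (rule initial_segment)
  fix x y assume x: "x : {j. (i, j) : dg v & T (i, j) < b}" and "y <= x"
  hence y: "(i, y) : dg v" by(simp add: dg_def)
  have "T (i, y) <= T (i, x)"
   using T x y \<open>y <= x\<close> by(cases "y = x") (simp_all add: KT_def semistandard_def)
  thus "y : {j. (i, j) : dg v & T (i, j) < b}" using x y by simp
 qed (auto simp: dg_def)
 have dgsh: "dg (sh T) = {c : dg v. T c < b}" if T: "T : KT v ?B" for T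
  using row[OF T] by(auto simp: dg_def[of "sh T"] set_eq_iff)
 have le_b: "T c <= b" if "T : KT v ?B" "c : dg v" for T c
 proof -
  have "T c \<in># image_mset T (mset_set (dg v))" using that(2) fin by simp
  moreover have "image_mset T (mset_set (dg v)) = ?B" using that(1) by(simp add: KT_def)
  ultimately have "T c \<in># ?B" by(simp only:)
  thus ?thesis using B[of "T c"] by(auto split: if_splits)
 qed
 have fsh: "sh T : Par (size B) & interlaces (sh T) v & restrict T (dg (sh T)) : KT (sh T) B"
  if T: "T : KT v ?B" for T
 proof -
  have il: "interlaces (sh T) v"
   unfolding interlaces_def
  proof (intro allI conjI)
   fix i
   have "{..<v (Suc i)} \<subseteq> {..<sh T i}"
   proof (rule subsetI)
   fix j assume "j : {..<v (Suc i)}"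
   hence c: "(Suc i, j) : dg v" "(i, j) : dg v" using p by(auto simp: dg_def par_def intro: order_less_le_trans)
   hence "T (i, j) < T (Suc i, j)" using T by(auto simp: KT_def semistandard_def)
   hence "j : {j. (i, j) : dg v & T (i, j) < b}" using le_b[OF T c(1)] c(2) by simp
   thus "j : {..<sh T i}" using row[OF T] by simp
   qed
   thus "v (Suc i) <= sh T i" by simp
   have "{..<sh T i} \<subseteq> {..<v i}" unfolding row[OF T, symmetric] by(auto simp: dg_def)
   thus "sh T i <= v i" by simp
  qed
  have "image_mset (restrict T (dg (sh T))) (mset_set (dg (sh T))) = image_mset T (mset_set (dg (sh T)))"
   using par_finite_dg[OF interlaces_par[OF il p]] by(intro image_mset_cong) auto
  also have "... = filter_mset (%x. x < b) (image_mset T (mset_set (dg v)))"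
   unfolding dgsh[OF T] using fin by(simp add: filter_mset_image_mset filter_mset_mset_set)
  also have "... = filter_mset (%x. x < b) ?B" using T by(simp add: KT_def)
  also have "... = filter_mset (%x. x < b) B"
   by(simp add: filter_mset_eq_conv)
  also have "... = B" using B by(simp add: filter_mset_eq_conv)
  finally have ms: "image_mset (restrict T (dg (sh T))) (mset_set (dg (sh T))) = B" .
  have "T (i, j) <= T (i, j')" if "(i, j) : dg v" "(i, j') : dg v" "j < j'" for i j j'
   using T that by(simp add: KT_def semistandard_def)
  moreover have "T (i, j) < T (i', j)" if "(i, j) : dg v" "(i', j) : dg v" "i < i'" for i i' j
   using T that by(simp add: KT_def semistandard_def)
  ultimately have "restrict T (dg (sh T)) : semistandard (dg (sh T))"
   unfolding semistandard_def dgsh[OF T] by simp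
  hence KT: "restrict T (dg (sh T)) : KT (sh T) B" using ms by(simp add: KT_def)
  thus ?thesis using il interlaces_par[OF il p] KT_size[OF KT] by(simp add: Par_def)
 qed
 have "bij_betw (%T. (sh T, restrict T (dg (sh T)))) (KT v ?B) ?S"
 proof (rule bij_betw_byWitness[where f' = glue])
  show "\<forall>T\<in>KT v ?B. glue (sh T, restrict T (dg (sh T))) = T"
  proof (intro ballI ext)
   fix T c assume T: "T : KT v ?B"
   show "glue (sh T, restrict T (dg (sh T))) c = T c"
   proof (cases "c : dg v")
   case True
   thus ?thesis using le_b[OF T True] by(auto simp: glue_def dgsh[OF T])
   next
   case False
   thus ?thesis using T by(auto simp: glue_def KT_def semistandard_def extensional_def)
   qed
  qed
  show "(%T. (sh T, restrict T (dg (sh T)))) ` KT v ?B \<subseteq> ?S" using fsh by auto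
  have expand: "glue (h, T') : KT v ?B & sh (glue (h, T')) = h & restrict (glue (h, T')) (dg h) = T'"
   if s: "h : Par (size B)" "interlaces h v" "T' : KT h B" for h T'
  proof -
   have sub: "dg h \<subseteq> dg v" using s(2) by(auto simp: dg_def interlaces_def intro: order_less_le_trans)
   have finS: "finite (dg h)" using sub fin finite_subset by blast
   have T'b: "T' c < b" if "c : dg h" for c
   proof -
   have "T' c \<in># B" using s(3) that finS by(auto simp: KT_def)
   thus ?thesis by(rule B)
   qed
   have ss: "glue (h, T') : semistandard (dg v)"
   unfolding semistandard_def
   proof (intro CollectI conjI allI impI)
   show "glue (h, T') : dg v \<rightarrow>\<^sub>E UNIV" by(simp add: glue_def)
   next
   fix i j j' assume *: "(i, j) : dg v & (i, j') : dg v & j < j'"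
   show "glue (h, T') (i, j) <= glue (h, T') (i, j')"
   proof (cases "(i, j') : dg h")
   case True
   hence "(i, j) : dg h" using * by(auto simp: dg_def)
   thus ?thesis using True * s(3) by(simp add: glue_def KT_def semistandard_def)
   next
   case False
   thus ?thesis using * T'b[of "(i, j)"] by(auto simp: glue_def intro: less_imp_le)
   qed
   next
   fix i i' j assume *: "(i, j) : dg v & (i', j) : dg v & i < i'"
   have "Suc i <= i'" using * by simp
   from par_antimono[OF p this] have "v i' <= v (Suc i)" .
   also have "... <= h i" using s(2) by(simp add: interlaces_def)
   finally have "v i' <= h i" .
   moreover have "j < v i'" using * by(simp add: dg_def)
   ultimately have ij: "(i, j) : dg h" by(simp add: dg_def)
   show "glue (h, T') (i, j) < glue (h, T') (i', j)"
   proof (cases "(i', j) : dg h")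
   case True
   thus ?thesis using ij * s(3) by(simp add: glue_def KT_def semistandard_def)
   next
   case False
   thus ?thesis using ij * T'b[OF ij] by(simp add: glue_def)
   qed
   qed
   have "mset_set (dg v) = mset_set (dg h) + mset_set (dg v - dg h)"
   using mset_set_Union[OF finS finite_Diff[OF fin, of "dg h"]] sub by(simp add: Un_absorb1)
   hence "image_mset (glue (h, T')) (mset_set (dg v)) =
   image_mset (glue (h, T')) (mset_set (dg h)) + image_mset (glue (h, T')) (mset_set (dg v - dg h))" by simp
   also have "image_mset (glue (h, T')) (mset_set (dg h)) = image_mset T' (mset_set (dg h))"
   using finS sub by(intro image_mset_cong) (auto simp: glue_def)
   also have "... = B" using s(3) by(simp add: KT_def)
   also have "image_mset (glue (h, T')) (mset_set (dg v - dg h)) = image_mset (% _. b) (mset_set (dg v - dg h))"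
   using fin by(intro image_mset_cong) (auto simp: glue_def)
   also have "... = replicate_mset k b"
   using card_Diff_subset[OF finS sub] size s(1)
   by(simp add: image_mset_const_eq psize_def Par_def)
   finally have KT: "glue (h, T') : KT v ?B" using ss by(simp add: KT_def)
   have "dg (sh (glue (h, T'))) = dg h"
   unfolding dgsh[OF KT] using sub T'b by(auto simp: glue_def)
   hence "sh (glue (h, T')) i = h i" for i
   proof -
   have "(i, j) : dg (sh (glue (h, T'))) \<longleftrightarrow> (i, j) : dg h" for j
   using \<open>dg (sh _) = dg h\<close> by simp
   hence "j < sh (glue (h, T')) i \<longleftrightarrow> j < h i" for j unfolding dg_def by simp
   thus ?thesis by(meson less_irrefl linorder_neqE_nat)
   qed
   moreover have "restrict (glue (h, T')) (dg h) = T'"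
   using s(3) sub by(auto simp: glue_def KT_def semistandard_def fun_eq_iff extensional_def)
   ultimately show ?thesis using KT by auto
  qed
  show "\<forall>x\<in>?S. (sh (glue x), restrict (glue x) (dg (sh (glue x)))) = x" using expand by auto
  show "glue ` ?S \<subseteq> KT v ?B" using expand by auto
 qed
 hence "card (KT v ?B) = card ?S" by(rule bij_betw_same_card)
 also have "... = (\<Sum>h\<in>{h\<in>Par (size B). interlaces h v}. card (KT h B))"
 proof (rule card_SigmaI)
  show "finite {h\<in>Par (size B). interlaces h v}" by(rule finite_subset[OF _ finite_Par]) auto
 qed (auto simp: Par_def finite_KT)
 finally show ?thesis by(simp add: K_def)
qed

lemma finite_submultisets: "finite {C. C \<subseteq># (B :: 'a multiset)}"
proof (rule finite_subset)
 show "{C. C \<subseteq># B} \<subseteq> (\<Union>k\<le>size B. multisets_of_size (set_mset B) k)"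
  by(auto simp: multisets_of_size_def dest: size_mset_mono set_mset_mono)
qed auto

text \<open>Adding to \<open>r\<close> a horizontal strip is adjoint to deleting letters of the content.\<close>

lemma sum_K_upper:
 assumes "par r"
 shows "(\<Sum>v\<in>{v\<in>Par (size B). interlaces r v}. K v B) = (\<Sum>C\<in>{C. C \<subseteq># B}. K r C)"
proof -
 have "(\<Sum>v\<in>{v\<in>Par (size B). interlaces r v}. K v B) = (\<Sum>C\<in>{C. C \<subseteq># B}. K r C)"
  if "par r" "\<forall>x\<in>#B. x < b" for b B r
  using that
 proof (induction b arbitrary: B r)
  case 0
  hence B: "B = {#}" by(cases B) auto
  have Par0: "Par 0 = {% _. 0}"
  proof (intro equalityI subsetI)
   fix v assume "v : Par 0"
   hence "v i = 0" for i using par_bounds(1)[of v i] by(simp add: Par_def)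
   thus "v : {% _. 0}" by auto
  qed (auto simp: Par_def par_def psize_def dg_def)
  show ?case
  proof (cases "r = (% _. 0)")
   case True
   have "{v\<in>Par 0. interlaces r v} = {% _. 0}" unfolding Par0 True by(auto simp: interlaces_def)
   thus ?thesis by(simp add: B True)
  next
   case False
   hence e: "{v\<in>Par 0. interlaces r v} = {}" unfolding Par0 by(auto simp: interlaces_def)
   have "r \<notin> Par 0" using False Par0 by blast
   hence "K r {#} = 0" using 0 by(intro K_size) (simp add: Par_def)
   thus ?thesis unfolding B size_empty e by simp
  qed
 next
  case (Suc b)
  define B' where "B' = filter_mset (%x. x < b) B"
  define k where "k = count B b"
  have B: "B = B' + replicate_mset k b"
   using Suc.prems(2) by(intro multiset_eqI) (auto simp: B'_def k_def less_Suc_eq not_in_iff)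
  have B'b: "!!x. x \<in># B' ==> x < b" by(simp add: B'_def)
  have szB: "size B = size B' + k" by(simp add: B)
  define R where "R = {v\<in>Par (size B). interlaces r v}"
  define Q where "Q = {g. interlaces g r & psize r <= psize g + k}"
  have finR: "finite R" unfolding R_def by(rule finite_subset[OF _ finite_Par]) auto
  have finQ: "finite Q"
  proof (rule finite_subset)
   show "Q \<subseteq> (\<Union>N\<le>psize r. Par N)"
   proof
   fix g assume "g : Q"
   hence i: "interlaces g r" by(simp add: Q_def)
   hence "dg g \<subseteq> dg r" by(auto simp: dg_def interlaces_def intro: order_less_le_trans)
   hence "psize g <= psize r" unfolding psize_def by(rule card_mono[OF par_finite_dg[OF Suc.prems(1)]])
   thus "g : (\<Union>N\<le>psize r. Par N)" using interlaces_par[OF i Suc.prems(1)] by(auto simp: Par_def)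
   qed
  qed auto
  have "(\<Sum>v\<in>R. K v B) = (\<Sum>v\<in>R. \<Sum>h\<in>{h\<in>Par (size B'). interlaces h v}. K h B')"
   unfolding B by(rule sum.cong[OF refl], rule K_rec[OF _ B'b]) (auto simp: R_def Par_def szB)
  also have "... = (\<Sum>v\<in>R. \<Sum>h\<in>Par (size B'). if interlaces h v then K h B' else 0)"
   by(simp add: sum.inter_filter)
  also have "... = (\<Sum>h\<in>Par (size B'). \<Sum>v\<in>R. if interlaces h v then K h B' else 0)"
   by(rule sum.swap)
  also have "... = (\<Sum>h\<in>Par (size B'). \<Sum>g\<in>Q. if interlaces g h then K h B' else 0)"
  proof (rule sum.cong[OF refl])
   fix h assume h: "h : Par (size B')"
   have "{v\<in>R. interlaces h v} = {v : Par (size B). interlaces r v & interlaces h v}"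
   by(auto simp: R_def)
   moreover have "{g\<in>Q. interlaces g h} =
   {g. interlaces g r & interlaces g h & psize r + psize h <= psize g + size B}"
   using h by(auto simp: Q_def Par_def szB)
   ultimately have "card {v\<in>R. interlaces h v} = card {g\<in>Q. interlaces g h}"
   using exchange[OF Suc.prems(1), of h "size B"] h by(simp add: Par_def)
   thus "(\<Sum>v\<in>R. if interlaces h v then K h B' else 0) = (\<Sum>g\<in>Q. if interlaces g h then K h B' else 0)"
   using finR finQ by(simp flip: sum.inter_filter)
  qed
  also have "... = (\<Sum>g\<in>Q. \<Sum>h\<in>Par (size B'). if interlaces g h then K h B' else 0)"
   by(rule sum.swap)
  also have "... = (\<Sum>g\<in>Q. \<Sum>C\<in>{C. C \<subseteq># B'}. K g C)"
  proof (rule sum.cong[OF refl])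
   fix g assume "g : Q"
   hence "par g" using interlaces_par Suc.prems(1) by(auto simp: Q_def)
   from Suc.IH[OF this, of B'] B'b
   show "(\<Sum>h\<in>Par (size B'). if interlaces g h then K h B' else 0) = (\<Sum>C\<in>{C. C \<subseteq># B'}. K g C)"
   by(simp add: sum.inter_filter)
  qed
  also have "... = (\<Sum>C\<in>{C. C \<subseteq># B'}. \<Sum>g\<in>Q. K g C)"
   by(rule sum.swap)
  also have "... = (\<Sum>C\<in>{C. C \<subseteq># B'}. \<Sum>l\<le>k. K r (C + replicate_mset l b))"
  proof (rule sum.cong[OF refl])
   fix C assume "C : {C. C \<subseteq># B'}"
   hence Cb: "!!x. x \<in># C ==> x < b" using B'b by(auto dest: mset_subset_eqD)
   show "(\<Sum>g\<in>Q. K g C) = (\<Sum>l\<le>k. K r (C + replicate_mset l b))"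
   proof (cases "size C <= psize r & psize r <= size C + k")
   case True
   define l where "l = psize r - size C"
   have l: "l : {..k}" "psize r = size C + l" using True by(auto simp: l_def)
   have "(\<Sum>l\<le>k. K r (C + replicate_mset l b)) = K r (C + replicate_mset l b)"
   using l by(subst sum.remove[OF _ l(1)]) (auto intro!: sum.neutral K_size)
   also have "... = (\<Sum>g\<in>{g\<in>Par (size C). interlaces g r}. K g C)"
   by(rule K_rec[OF Suc.prems(1) Cb l(2)])
   also have "... = (\<Sum>g\<in>Q. K g C)"
   proof (rule sum.mono_neutral_left[OF finQ])
   show "{g\<in>Par (size C). interlaces g r} \<subseteq> Q" using True by(auto simp: Q_def Par_def)
   show "\<forall>g\<in>Q - {g\<in>Par (size C). interlaces g r}. K g C = 0"
   using interlaces_par[OF _ Suc.prems(1)] by(auto simp: Q_def Par_def intro!: K_size)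
   qed
   finally show ?thesis by simp
   next
   case False
   have "K r (C + replicate_mset l b) = 0" if "l <= k" for l
   using False that by(intro K_size) auto
   moreover have "K g C = 0" if "g : Q" for g
   proof (rule K_size)
   have i: "interlaces g r" using that by(simp add: Q_def)
   hence "dg g \<subseteq> dg r" by(auto simp: dg_def interlaces_def intro: order_less_le_trans)
   hence "psize g <= psize r" unfolding psize_def by(rule card_mono[OF par_finite_dg[OF Suc.prems(1)]])
   thus "size C ~= psize g" using that False by(auto simp: Q_def)
   qed
   ultimately show ?thesis by simp
   qed
  qed
  also have "... = (\<Sum>(C, l)\<in>{C. C \<subseteq># B'} \<times> {..k}. K r (C + replicate_mset l b))"
   by(simp add: sum.cartesian_product)
  also have "... = (\<Sum>C\<in>{C. C \<subseteq># B}. K r C)"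
  proof (rule sum.reindex_bij_witness[where i = "%C. (filter_mset (%x. x < b) C, count C b)"
   and j = "%(C, l). C + replicate_mset l b"])
   fix x assume "x : {C. C \<subseteq># B'} \<times> {..k}"
   then obtain C l where x: "x = (C, l)" "C \<subseteq># B'" "l <= k" by auto
   have Cb: "!!x. x \<in># C ==> x < b" using B'b x(2) by(auto dest: mset_subset_eqD)
   have "filter_mset (%x. x < b) C = C" using Cb by(simp add: filter_mset_eq_conv)
   moreover have "count C b = 0" using Cb by(meson less_irrefl not_in_iff)
   moreover have "filter_mset (%x. x < b) (replicate_mset l b) = {#}" by(auto simp: filter_mset_eq_conv)
   ultimately show "(%C. (filter_mset (%x. x < b) C, count C b)) ((%(C, l). C + replicate_mset l b) x) = x"
   by(simp add: x(1))
   show "(%(C, l). C + replicate_mset l b) x : {C. C \<subseteq># B}"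
   proof -
   have "replicate_mset l b \<subseteq># replicate_mset k b" using x(3) by(simp add: subseteq_mset_def)
   from subset_mset.add_mono[OF x(2) this] show ?thesis by(simp add: x(1) B)
   qed
  next
   fix C assume "C : {C. C \<subseteq># B}"
   hence C: "C \<subseteq># B" by simp
   hence Cb: "!!x. x \<in># C ==> x <= b" using Suc.prems(2) by(auto dest: mset_subset_eqD simp: less_Suc_eq_le)
   show "(%(C, l). C + replicate_mset l b) ((%C. (filter_mset (%x. x < b) C, count C b)) C) = C"
   proof -
   have "count C y = 0" if "b < y" for y using Cb that by(meson not_in_iff leD)
   thus ?thesis by(auto intro!: multiset_eqI simp: neq_iff)
   qed
   show "(%C. (filter_mset (%x. x < b) C, count C b)) C : {C. C \<subseteq># B'} \<times> {..k}"
   using C by(auto simp: B'_def k_def multiset_filter_mono mset_subset_eq_count)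
  qed auto
  finally show ?case by(simp add: R_def)
 qed
 thus ?thesis using assms by(metis Suc_n_not_le_n finite_set_mset finite_nat_set_iff_bounded)
qed

text \<open>The multisets of pairs with given marginals, that is, matrices with given row and column sums.\<close>

definition couplings :: "'a multiset => 'b multiset => ('a \<times> 'b) multiset set" where
 "couplings A B = {P. image_mset fst P = A & image_mset snd P = B}"

lemma finite_couplings: "finite (couplings A B)"
proof (rule finite_subset)
 show "couplings A B \<subseteq> multisets_of_size (set_mset A \<times> set_mset B) (size A)"
  by(force simp: couplings_def multisets_of_size_def)
qed auto
lemma couplings_empty: "couplings {#} B = (if B = {#} then {{#}} else {})"
 by(auto simp: couplings_def)

lemma card_couplings_rec:
 assumes A: "!!x. x \<in># A ==> x < (a::nat)" and size: "size B = size A + k"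
 shows "card (couplings (A + replicate_mset k a) B) = (\<Sum>C\<in>{C. C \<subseteq># B}. card (couplings A C))"
proof -
 let ?S = "SIGMA C:{C. C \<subseteq># B}. couplings A C"
 have "bij_betw (%P. (image_mset snd (filter_mset (%p. fst p < a) P), filter_mset (%p. fst p < a) P))
   (couplings (A + replicate_mset k a) B) ?S"
 proof (rule bij_betw_byWitness[where f' = "%(C, P). P + image_mset (Pair a) (B - C)"])
  show "\<forall>P\<in>couplings (A + replicate_mset k a) B. (%(C, P). P + image_mset (Pair a) (B - C))
   (image_mset snd (filter_mset (%p. fst p < a) P), filter_mset (%p. fst p < a) P) = P"
  proof
   fix P assume P: "P : couplings (A + replicate_mset k a) B"
   let ?F = "filter_mset (%p. fst p < a) P" and ?G = "filter_mset (%p. \<not> fst p < a) P"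
   have PFG: "P = ?F + ?G" by(rule multiset_partition)
   have "image_mset snd P = image_mset snd (?F + ?G)" by(rule arg_cong[OF PFG])
   also have "... = image_mset snd ?F + image_mset snd ?G" by(rule image_mset_union)
   also have "image_mset snd P = B" using P by(simp add: couplings_def)
   finally have e1: "B - image_mset snd ?F = image_mset snd ?G" by(metis add_diff_cancel_left')
   have e2: "image_mset (Pair a) (image_mset snd ?G) = ?G"
   proof -
   have "fst p = a" if "p \<in># ?G" for p
   proof -
   have "fst p \<in># image_mset fst P" using that by auto
   also have "image_mset fst P = A + replicate_mset k a" using P by(simp add: couplings_def)
   finally show ?thesis using A that by(auto split: if_splits)
   qed
   hence "image_mset (%p. (a, snd p)) ?G = image_mset (%p. p) ?G"
   by(intro image_mset_cong) (metis prod.collapse)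
   thus ?thesis by(simp add: image_mset.compositionality comp_def)
   qed
   show "(%(C, P). P + image_mset (Pair a) (B - C)) (image_mset snd ?F, ?F) = P"
   unfolding prod.case e1 e2 by(rule PFG[symmetric])
  qed
  show "(%P. (image_mset snd (filter_mset (%p. fst p < a) P), filter_mset (%p. fst p < a) P)) `
   couplings (A + replicate_mset k a) B \<subseteq> ?S"
  proof (rule image_subsetI)
   fix P assume P: "P : couplings (A + replicate_mset k a) B"
   let ?F = "filter_mset (%p. fst p < a) P"
   have sB: "image_mset snd ?F \<subseteq># B" using P image_mset_subseteq_mono[of ?F P snd] by(simp add: couplings_def)
   have "image_mset fst ?F = filter_mset (%x. x < a) (image_mset fst P)"
   by(simp add: filter_mset_image_mset)
   also have "... = filter_mset (%x. x < a) A"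
   using P by(simp add: couplings_def filter_mset_eq_conv)
   also have "... = A" using A by(simp add: filter_mset_eq_conv)
   finally have "image_mset fst ?F = A" .
   with sB show "(image_mset snd ?F, ?F) : ?S"
   by(simp add: couplings_def)
  qed
  have bk: "P + image_mset (Pair a) (B - C) : couplings (A + replicate_mset k a) B \<and>
   filter_mset (%p. fst p < a) (P + image_mset (Pair a) (B - C)) = P"
   if C: "C \<subseteq># B" and P: "P : couplings A C" for C P
  proof
   have szC: "size C = size A" using P by(metis (mono_tags, lifting) couplings_def mem_Collect_eq size_image_mset)
   have "image_mset fst (P + image_mset (Pair a) (B - C)) = A + replicate_mset (size (B - C)) a"
   using P by(simp add: couplings_def image_mset.compositionality comp_def image_mset_const_eq)
   moreover have "size (B - C) = k" using C size szC by(simp add: size_Diff_submset)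
   moreover have "image_mset snd (P + image_mset (Pair a) (B - C)) = B"
   using P C by(simp add: couplings_def image_mset.compositionality comp_def)
   ultimately show "P + image_mset (Pair a) (B - C) : couplings (A + replicate_mset k a) B"
   by(simp add: couplings_def)
   have "fst p < a" if "p \<in># P" for p using P A that by(force simp: couplings_def)
   hence "filter_mset (%p. fst p < a) P = P" by(simp add: filter_mset_eq_conv)
   moreover have "filter_mset (%p. fst p < a) (image_mset (Pair a) (B - C)) = {#}"
   by(auto simp: filter_mset_eq_conv)
   ultimately show "filter_mset (%p. fst p < a) (P + image_mset (Pair a) (B - C)) = P" by simp
  qed
  show "\<forall>x\<in>?S. (%P. (image_mset snd (filter_mset (%p. fst p < a) P), filter_mset (%p. fst p < a) P))
   ((%(C, P). P + image_mset (Pair a) (B - C)) x) = x"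
   using bk by(auto simp del: filter_union_mset) (auto simp: couplings_def)
  show "(%(C, P). P + image_mset (Pair a) (B - C)) ` ?S \<subseteq> couplings (A + replicate_mset k a) B"
   using bk by auto
 qed
 hence "card (couplings (A + replicate_mset k a) B) = card ?S" by(rule bij_betw_same_card)
 also have "... = (\<Sum>C\<in>{C. C \<subseteq># B}. card (couplings A C))"
  by(rule card_SigmaI) (auto simp: finite_couplings finite_submultisets)
 finally show ?thesis .
qed

lemma couplings_size: "P : couplings A B ==> size A = size B"
 by(auto simp: couplings_def)

text \<open>Cauchy's identity, obtained by removing the largest letter on both sides.\<close>

theorem sum_K_K:
 "(\<Sum>v\<in>Par (size A). K v A * K v B) = card (couplings A B)"
proof -
 have "(\<Sum>v\<in>Par (size A). K v A * K v B) = card (couplings A B)" if "\<forall>x\<in>#A. x < a" for a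
  using that
 proof (induction a arbitrary: A B)
  case 0
  hence A: "A = {#}" by(cases A) auto
  show ?case
  proof (cases "B = {#}")
   case True
   have Par0: "Par 0 = {% _. 0}"
   proof (intro equalityI subsetI)
   fix v assume "v : Par 0"
   hence "v i = 0" for i using par_bounds(1)[of v i] by(simp add: Par_def)
   thus "v : {% _. 0}" by auto
   qed (auto simp: Par_def par_def psize_def dg_def)
   have "rowms (% _. 0) = {#}" by(simp add: rowms_def dg_def)
   hence "K (% _. 0) {#} = 1" using K_diagonal[of "% _. 0"] by(simp add: par_def)
   thus ?thesis by(simp add: A True Par0 couplings_empty)
  next
   case False
   hence "K v B = 0" if "v : Par 0" for v using that by(intro K_size) (auto simp: Par_def)
   thus ?thesis using False by(simp add: A couplings_empty)
  qed
 next
  case (Suc a)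
  define A' where "A' = filter_mset (%x. x < a) A"
  define k where "k = count A a"
  have A: "A = A' + replicate_mset k a"
   using Suc.prems by(intro multiset_eqI) (auto simp: A'_def k_def less_Suc_eq not_in_iff)
  have A'a: "!!x. x \<in># A' ==> x < a" by(simp add: A'_def)
  have szA: "size A = size A' + k" by(simp add: A)
  show ?case
  proof (cases "size B = size A")
   case False
   hence "K v B = 0" if "v : Par (size A)" for v using that by(intro K_size) (auto simp: Par_def)
   moreover have "couplings A B = {}" using False couplings_size by fastforce
   ultimately show ?thesis by simp
  next
   case True
   have "(\<Sum>v\<in>Par (size A). K v A * K v B) =
   (\<Sum>v\<in>Par (size A). (\<Sum>g\<in>{g\<in>Par (size A'). interlaces g v}. K g A') * K v B)"
   unfolding A using K_rec[OF _ A'a] szA by(intro sum.cong refl) (auto simp: Par_def A)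
   also have "... = (\<Sum>v\<in>Par (size A). \<Sum>g\<in>Par (size A'). if interlaces g v then K g A' * K v B else 0)"
   unfolding sum_distrib_right by(simp add: sum.inter_filter)
   also have "... = (\<Sum>g\<in>Par (size A'). \<Sum>v\<in>Par (size A). if interlaces g v then K g A' * K v B else 0)"
   by(rule sum.swap)
   also have "... = (\<Sum>g\<in>Par (size A'). K g A' * (\<Sum>v\<in>{v\<in>Par (size B). interlaces g v}. K v B))"
   unfolding sum_distrib_left True by(simp add: sum.inter_filter)
   also have "... = (\<Sum>g\<in>Par (size A'). K g A' * (\<Sum>C\<in>{C. C \<subseteq># B}. K g C))"
   proof (rule sum.cong[OF refl])
   fix g assume "g : Par (size A')"
   hence "par g" by(simp add: Par_def)
   from sum_K_upper[OF this, of B] show "K g A' * (\<Sum>v\<in>{v\<in>Par (size B). interlaces g v}. K v B) =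
   K g A' * (\<Sum>C\<in>{C. C \<subseteq># B}. K g C)" by simp
   qed
   also have "... = (\<Sum>C\<in>{C. C \<subseteq># B}. \<Sum>g\<in>Par (size A'). K g A' * K g C)"
   unfolding sum_distrib_left by(rule sum.swap)
   also have "... = (\<Sum>C\<in>{C. C \<subseteq># B}. card (couplings A' C))"
   using Suc.IH A'a by(intro sum.cong refl) auto
   also have "... = card (couplings A B)"
   unfolding A by(rule card_couplings_rec[symmetric]) (use A'a True szA in auto)
   finally show ?thesis .
  qed
 qed
 thus ?thesis by(metis finite_set_mset finite_nat_set_iff_bounded)
qed

subsection \<open>Partitions as lists\<close>

definition row :: "nat list => nat => nat" where
 "row l i = (if i < length l then l ! i else 0)"
lemma young_row: "young l = dg (row l)"
 by(auto simp: young_def dg_def row_def split: if_splits)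

lemma par_row: "is_partition l ==> par (row l)"
 unfolding par_def is_partition_def row_def
 by(auto simp: sorted_wrt_iff_nth_less intro: exI[of _ "length l"])

lemma psize_row: "psize (row l) = sum_list l"
proof -
 have "psize (row l) = (\<Sum>i<length l. row l i)" by(rule psize_eq) (simp add: row_def)
 also have "... = sum_list l" by(simp add: row_def sum_list_sum_nth atLeast0LessThan)
 finally show ?thesis .
qed

lemma bij_betw_row: "bij_betw row (partitions_of n) (Par n)"
 unfolding bij_betw_def
proof
 have pos: "row l i > 0 \<longleftrightarrow> i < length l" if "is_partition l" for l i
  using that by(auto simp: row_def is_partition_def) (metis gr0I nth_mem)
 show "inj_on row (partitions_of n)"
 proof (rule inj_onI)
  fix l l' assume l: "l : partitions_of n" "l' : partitions_of n" "row l = row l'"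
  hence "i < length l \<longleftrightarrow> i < length l'" for i using pos[of l i] pos[of l' i] by(auto simp: partitions_of_def)
  hence len: "length l = length l'" by(meson less_irrefl linorder_neqE_nat)
  show "l = l'"
  proof (rule nth_equalityI[OF len])
   fix i assume "i < length l"
   thus "l ! i = l' ! i" using len fun_cong[OF l(3), of i] by(simp add: row_def)
  qed
 qed
 show "row ` partitions_of n = Par n"
 proof (intro equalityI subsetI)
  fix v assume "v : row ` partitions_of n"
  thus "v : Par n" by(auto simp: partitions_of_def Par_def par_row psize_row)
 next
  fix v assume n: "v : Par n"
  hence p: "par v" by(simp add: Par_def)
  have "\<exists>l. is_partition l & young l = dg v"
  proof (rule down_closed_young[OF par_finite_dg[OF p]])
   fix i j i' j' assume "(i, j) : dg v" "i' <= i" "j' <= j"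
   thus "(i', j') : dg v" using par_antimono[OF p, of i' i] by(simp add: dg_def)
  qed
  then obtain l where l: "is_partition l" "young l = dg v" by blast
  have "j < row l i \<longleftrightarrow> j < v i" for i j using l(2) unfolding young_row dg_def by blast
  hence "row l = v" by(meson ext less_irrefl linorder_neqE_nat)
  moreover have "l : partitions_of n"
   using n l(1) calculation psize_row[of l] by(simp add: partitions_of_def Par_def)
  ultimately show "v : row ` partitions_of n" by blast
 qed
qed

lemma finite_partitions_of: "finite (partitions_of n)"
 using bij_betw_finite[OF bij_betw_row] by simp

lemma schur_K: "schur (young l) \<alpha> = int (K (row l) (\<Sum>k\<in>keys \<alpha>. replicate_mset (lookup \<alpha> k) k))"
 if "is_partition l"
proof -
 let ?B = "\<Sum>k\<in>keys \<alpha>. replicate_mset (lookup \<alpha> k) k"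
 have B: "count ?B k = lookup \<alpha> k" for k
  by(auto simp: count_sum in_keys_iff)
 have fin: "finite (dg (row l))" by(rule par_finite_dg[OF par_row[OF that]])
 have "{T : semistandard (young l). \<forall>k. card {c : young l. T c = k} = lookup \<alpha> k} = KT (row l) ?B"
  unfolding KT_def young_row multiset_eq_iff B
  using fin by(auto simp: count_image_mset_eq_card_vimage)
 thus ?thesis by(simp add: schur_def K_def)
qed

section \<open>Tabloids and polytabloids\<close>

definition cw :: "nat => (nat => nat) => nat multiset" where
 "cw n w = (ct w {1..n})"
lemma size_cw [simp]: "size (cw n w) = n"
 by(simp add: cw_def)

lemma cw_exists:
 assumes "size B = n"
 obtains w where "cw n w = B"
proof -
 obtain xs where xs: "mset xs = B" using ex_mset by blast
 hence len: "length xs = n" using assms by auto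
 have "cw n (%k. xs ! (k - 1)) = mset (map (%k. xs ! (k - 1)) [1..<Suc n])"
  unfolding cw_def mset_map mset_upt by(simp add: atLeastLessThanSuc_atLeastAtMost)
 also have "map (%k. xs ! (k - 1)) [1..<Suc n] = xs"
  by(rule nth_equalityI) (use len in "auto simp del: upt_Suc")
 finally show thesis using that xs by simp
qed

lemma image_mset_perm:
 assumes "z : perms n"
 shows "image_mset (%k. f (z k)) (mset_set {1..n}) = image_mset f (mset_set {1..n})"
proof -
 have "image_mset (%k. f (z k)) (mset_set {1..n}) = image_mset f (image_mset z (mset_set {1..n}))"
  by(simp add: image_mset.compositionality comp_def)
 also have "image_mset z (mset_set {1..n}) = mset_set {1..n}"
  using assms unfolding perms_def by(intro permutes_image_mset) auto
 finally show ?thesis .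
qed

locale tab =
 fixes n :: nat and D :: shape
 assumes finD: "finite D" and cardD: "card D = n"
begin

definition X where "X = tabloid D ` tableaux D"
definition a where "a z = (`) (tableau_act D z)"
definition rw where "rw T k = fst (inv_into D T k)"
definition rwx where "rwx x = rw (SOME T. T : x)"
definition col where "col T = column_group D T"

lemma tabD:
 assumes "T : tableaux D"
 shows "bij_betw T D {1..n}" "inj_on T D" "T ` D = {1..n}" "T : extensional D"
 using assms by(auto simp: tableaux_def cardD bij_betw_def PiE_iff)

lemma tab_in: "T : tableaux D ==> c : D ==> T c : {1..n}"
 using tabD(3) by blast

lemma rw_T: "T : tableaux D ==> c : D ==> rw T (T c) = fst c"
 unfolding rw_def using inv_into_f_f[OF tabD(2)] by simp

lemma tab_cell:
 assumes "T : tableaux D" "k : {1..n}"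
 obtains c where "c : D" "T c = k" "rw T k = fst c"
proof -
 have "k : T ` D" using tabD(3)[OF assms(1)] assms(2) by simp
 then obtain c where c: "c : D" "k = T c" by(rule imageE) auto
 show thesis by(rule that[of c]) (use c rw_T[OF assms(1)] in simp_all)
qed

lemma act_tab:
 assumes z: "z : perms n" and T: "T : tableaux D"
 shows "tableau_act D z T : tableaux D"
proof -
 have "bij_betw z {1..n} {1..n}" using z by(simp add: perms_def permutes_imp_bij)
 from bij_betw_trans[OF tabD(1)[OF T] this] have "bij_betw (z \<circ> T) D {1..n}" .
 hence b: "bij_betw (tableau_act D z T) D {1..n}"
  by(rule bij_betw_cong[THEN iffD1, rotated]) (simp add: tableau_act_def)
 thus ?thesis by(auto simp: tableaux_def cardD tableau_act_def bij_betw_def)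
qed
lemma act_apply: "c : D ==> tableau_act D z T c = z (T c)"
 by(simp add: tableau_act_def)

lemma act_id: "T : tableaux D ==> tableau_act D id T = T"
 using tabD(4) by(simp add: tableau_act_def extensional_restrict)
lemma act_comp: "tableau_act D (z \<circ> t) T = tableau_act D z (tableau_act D t T)"
 by(auto simp: tableau_act_def fun_eq_iff)

lemma rw_act:
 assumes z: "z : perms n" and T: "T : tableaux D" and k: "k : {1..n}"
 shows "rw (tableau_act D z T) k = rw T (pinv z k)"
proof -
 obtain c where c: "c : D" "tableau_act D z T c = k" "rw (tableau_act D z T) k = fst c"
  using tab_cell[OF act_tab[OF z T] k] by blast
 hence "pinv z k = T c" using perms_inv_apply(1)[OF z, of "T c"] by(simp add: act_apply)
 thus ?thesis using c rw_T[OF T c(1)] by simp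
qed

lemma row_image:
 assumes T: "T : tableaux D"
 shows "T ` {c : D. fst c = i} = {k : {1..n}. rw T k = i}"
proof (intro equalityI subsetI)
 fix k assume "k : T ` {c : D. fst c = i}"
 thus "k : {k : {1..n}. rw T k = i}" using rw_T[OF T] tab_in[OF T] by auto
next
 fix k assume k: "k : {k : {1..n}. rw T k = i}"
 hence "k : {1..n}" by simp
 then obtain c where "c : D" "T c = k" "rw T k = fst c" using tab_cell[OF T] by blast
 thus "k : T ` {c : D. fst c = i}" using k by auto
qed

lemma tabloid_rw:
 assumes T: "T : tableaux D"
 shows "tabloid D T = {T' : tableaux D. \<forall>k\<in>{1..n}. rw T' k = rw T k}"
proof -
 have "(\<forall>i. T' ` {c : D. fst c = i} = T ` {c : D. fst c = i}) \<longleftrightarrow> (\<forall>k\<in>{1..n}. rw T' k = rw T k)"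
  if T': "T' : tableaux D" for T'
  unfolding row_image[OF T] row_image[OF T'] by(auto simp: set_eq_iff simp del: atLeastAtMost_iff)
 thus ?thesis unfolding tabloid_def by(intro Collect_cong conj_cong refl) simp
qed
lemma tabloid_self: "T : tableaux D ==> T : tabloid D T"
 by(simp add: tabloid_rw)

lemma tabloid_eq:
 assumes "T : tableaux D" "T' : tableaux D"
 shows "tabloid D T = tabloid D T' \<longleftrightarrow> (\<forall>k\<in>{1..n}. rw T k = rw T' k)"
proof
 assume "tabloid D T = tabloid D T'"
 hence "T : tabloid D T'" using tabloid_self[OF assms(1)] by simp
 thus "\<forall>k\<in>{1..n}. rw T k = rw T' k" by(simp add: tabloid_rw[OF assms(2)])
next
 assume "\<forall>k\<in>{1..n}. rw T k = rw T' k"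
 thus "tabloid D T = tabloid D T'" by(simp add: tabloid_rw assms)
qed

lemma rwx_tabloid:
 assumes "T : tableaux D" "k : {1..n}"
 shows "rwx (tabloid D T) k = rw T k"
proof -
 have "(SOME T'. T' : tabloid D T) : tabloid D T" 
  by(rule someI[of "%T'. T' : tabloid D T", OF tabloid_self[OF assms(1)]])
 thus ?thesis using assms by(simp add: rwx_def tabloid_rw)
qed

lemma a_tabloid:
 assumes z: "z : perms n" and T: "T : tableaux D"
 shows "a z (tabloid D T) = tabloid D (tableau_act D z T)"
proof (intro equalityI subsetI)
 fix U assume "U : a z (tabloid D T)"
 then obtain T' where T': "T' : tableaux D" "\<forall>k\<in>{1..n}. rw T' k = rw T k" "U = tableau_act D z T'"
  by(auto simp: a_def tabloid_rw[OF T])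
 have "rw U k = rw (tableau_act D z T) k" if k: "k : {1..n}" for k
 proof -
  have "pinv z k : {1..n}" using perms_in[OF perms_inv[OF z]] k by blast
  thus ?thesis using T' by(simp only: rw_act[OF z T'(1) k] rw_act[OF z T k])
 qed
 thus "U : tabloid D (tableau_act D z T)"
  using act_tab[OF z T'(1)] T'(3) by(simp add: tabloid_rw[OF act_tab[OF z T]])
next
 fix U assume "U : tabloid D (tableau_act D z T)"
 hence U: "U : tableaux D" "\<forall>k\<in>{1..n}. rw U k = rw T (pinv z k)"
  using rw_act[OF z T] by(auto simp: tabloid_rw[OF act_tab[OF z T]])
 let ?T = "tableau_act D (pinv z) U"
 have T': "?T : tableaux D" by(rule act_tab[OF perms_inv[OF z] U(1)])
 have "rw ?T k = rw T k" if k: "k : {1..n}" for k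
 proof -
  have s: "z k : {1..n}" using perms_in[OF z] k by blast
  have "bij z" using z by(simp add: perms_def permutes_bij)
  hence "rw ?T k = rw U (z k)" using rw_act[OF perms_inv[OF z] U(1) k] by(simp add: inv_inv_eq)
  also have "... = rw T (pinv z (z k))" using U(2) s by blast
  finally show ?thesis by(simp add: perms_inv_apply[OF z])
 qed
 hence "?T : tabloid D T" using T' by(simp add: tabloid_rw[OF T])
 moreover have "tableau_act D z ?T = U"
  unfolding act_comp[symmetric] perms_inv_o(2)[OF z] by(rule act_id[OF U(1)])
 ultimately show "U : a z (tabloid D T)" unfolding a_def by(metis imageI)
qed

lemma finite_tableaux: "finite (tableaux D)"
 by(rule finite_subset[of _ "D \<rightarrow>\<^sub>E {1..card D}"]) (auto simp: tableaux_def finD intro!: finite_PiE)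

sublocale perm_set n X a
proof
 show "finite X" unfolding X_def using finite_tableaux by simp
 show "a z x : X" if "z : perms n" "x : X" for z x
  using that act_tab by(auto simp: X_def a_tabloid)
 show "a id x = x" if "x : X" for x using that by(auto simp: X_def a_tabloid act_id)
 show "a (z \<circ> t) x = a z (a t x)" if "z : perms n" "t : perms n" "x : X" for z t x
  using that by(auto simp: X_def a_tabloid act_tab act_comp)
qed

lemma rwx_a:
 assumes "z : perms n" "x : X" "k : {1..n}"
 shows "rwx (a z x) k = rwx x (pinv z k)"
proof -
 have "pinv z k : {1..n}" using perms_in[OF perms_inv[OF assms(1)]] assms(3) by blast
 thus ?thesis using assms by(auto simp: X_def a_tabloid act_tab rwx_tabloid rw_act simp del: atLeastAtMost_iff)
qed

lemma X_eqI:
 assumes "x : X" "y : X" "!!k. k : {1..n} ==> rwx x k = rwx y k"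
 shows "x = y"
proof -
 obtain T where T: "T : tableaux D" "x = tabloid D T" using assms(1) by(auto simp: X_def)
 obtain T' where T': "T' : tableaux D" "y = tabloid D T'" using assms(2) by(auto simp: X_def)
 show ?thesis
  unfolding T(2) T'(2) tabloid_eq[OF T(1) T'(1)]
  using assms(3) unfolding T(2) T'(2) by(simp add: rwx_tabloid T(1) T'(1))
qed

definition rms :: "nat multiset" where "rms = image_mset fst (mset_set D)"

lemma tableau_exists: "tableaux D ~= {}"
proof -
 obtain T where "bij_betw T D {1..n}" using finite_same_card_bij[OF finD, of "{1..n}"] cardD by auto
 hence "bij_betw (restrict T D) D {1..n}" by(rule bij_betw_cong[THEN iffD1, rotated]) simp
 hence "restrict T D : tableaux D" by(auto simp: tableaux_def cardD bij_betw_def)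
 thus ?thesis by blast
qed

lemma rw_content:
 assumes T: "T : tableaux D"
 shows "image_mset (rw T) (mset_set {1..n}) = rms"
proof -
 have "mset_set {1..n} = image_mset T (mset_set D)"
  using tabD(2,3)[OF T] by(simp add: image_mset_mset_set)
 hence "image_mset (rw T) (mset_set {1..n}) = image_mset (%c. rw T (T c)) (mset_set D)"
  by(simp add: image_mset.compositionality comp_def)
 also have "... = rms" unfolding rms_def using rw_T[OF T] finD by(intro image_mset_cong) auto
 finally show ?thesis .
qed

lemma rwx_content:
 assumes "x : X"
 shows "cw n (rwx x) = rms"
proof -
 obtain T where T: "T : tableaux D" "x = tabloid D T" using assms by(auto simp: X_def)
 have "cw n (rwx x) = image_mset (rw T) (mset_set {1..n})"
  unfolding cw_def T(2) by(rule image_mset_cong) (simp add: rwx_tabloid[OF T(1)])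
 thus ?thesis using rw_content[OF T(1)] by simp
qed

lemma X_of_word:
 assumes "cw n u = rms"
 obtains x where "x : X" "!!k. k : {1..n} ==> rwx x k = u k"
proof -
 obtain T0 where T0: "T0 : tableaux D" using tableau_exists by blast
 have "image_mset u (mset_set {1..n}) = image_mset (rw T0) (mset_set {1..n})"
  using assms rw_content[OF T0] by(simp add: cw_def)
 then obtain p where p: "p permutes {1..n}" "\<forall>k\<in>{1..n}. u k = rw T0 (p k)"
  using image_mset_eq_implies_permutes[of "{1..n}" u "rw T0"] by blast
 have pp: "p : perms n" using p(1) by(simp add: perms_def)
 let ?T = "tableau_act D (pinv p) T0"
 have T: "?T : tableaux D" by(rule act_tab[OF perms_inv[OF pp] T0])
 have "bij p" using p(1) by(rule permutes_bij)
 have "rwx (tabloid D ?T) k = u k" if k: "k : {1..n}" for k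
  using p(2) k by(simp only: rwx_tabloid[OF T k] rw_act[OF perms_inv[OF pp] T0 k] inv_inv_eq[OF \<open>bij p\<close>])
 thus thesis using that T by(auto simp: X_def)
qed

definition pairing where
 "pairing w x = image_mset (%k. (rwx x k, w k)) (mset_set {1..n})"

lemma pairing_sep:
 assumes x: "x : X" and y: "y : X"
 shows "pairing w x = pairing w y \<longleftrightarrow> (\<exists>z\<in>stab n w. y = a z x)"
proof
 assume "pairing w x = pairing w y"
 then obtain p where p: "p permutes {1..n}" "\<forall>k\<in>{1..n}. (rwx x k, w k) = (rwx y (p k), w (p k))"
  unfolding pairing_def using image_mset_eq_implies_permutes[of "{1..n}"] by(metis (no_types, lifting) finite_atLeastAtMost)
 hence pp: "p : perms n" by(simp add: perms_def)
 have st: "p : stab n w" using p(2) pp by(simp add: stab_def)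
 have "y = a p x"
 proof (rule X_eqI[OF y a_closed[OF pp x]])
  fix k assume k: "k : {1..n}"
  have "pinv p k : {1..n}" using perms_in[OF perms_inv[OF pp]] k by blast
  hence "rwx x (pinv p k) = rwx y (p (pinv p k))" using p(2) by blast
  thus "rwx y k = rwx (a p x) k"
   by(simp only: rwx_a[OF pp x k] perms_inv_apply[OF pp])
 qed
 thus "\<exists>z\<in>stab n w. y = a z x" using st by blast
next
 assume "\<exists>z\<in>stab n w. y = a z x"
 then obtain z where z: "z : stab n w" "y = a z x" by blast
 have p: "z : perms n" using z(1) by(rule stab_perms)
 have "pairing w y = image_mset (%k. (rwx x (pinv z k), w (pinv z k))) (mset_set {1..n})"
  unfolding pairing_def z(2)
 proof (rule image_mset_cong)
  fix k assume "k \<in># mset_set {1..n}"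
  hence k: "k : {1..n}" by simp
  have "w (pinv z k) = w k" using stab_inv[OF z(1)] k by(simp add: stab_def)
  thus "(rwx (a z x) k, w k) = (rwx x (pinv z k), w (pinv z k))"
   by(simp only: rwx_a[OF p x k])
 qed
 also have "... = pairing w x"
  unfolding pairing_def by(rule image_mset_perm[OF perms_inv[OF p], of "%k. (rwx x k, w k)"])
 finally show "pairing w x = pairing w y" by simp
qed

lemma pairing_image: "pairing w ` X = couplings rms (cw n w)"
proof (intro equalityI subsetI)
 fix P assume "P : pairing w ` X"
 then obtain x where x: "x : X" "P = pairing w x" by blast
 have "image_mset fst P = rms" "image_mset snd P = cw n w"
  using rwx_content[OF x(1)] by(simp_all add: x(2) pairing_def cw_def image_mset.compositionality comp_def)
 thus "P : couplings rms (cw n w)" by(simp add: couplings_def)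
next
 fix P assume P: "P : couplings rms (cw n w)"
 hence szP: "size P = n" by(auto simp: couplings_def dest: arg_cong[of _ _ size])
 obtain xs where xs: "mset xs = P" using ex_mset by blast
 define q where "q k = xs ! (k - 1)" for k
 have "image_mset q (mset_set {1..n}) = mset (map q [1..<Suc n])"
  unfolding mset_map mset_upt by(simp add: atLeastLessThanSuc_atLeastAtMost)
 also have "map q [1..<Suc n] = xs"
  by(rule nth_equalityI) (use xs szP in "auto simp: q_def simp del: upt_Suc")
 finally have q: "image_mset q (mset_set {1..n}) = P" using xs by simp
 have "(ct w {1..n}) = image_mset (%k. snd (q k)) (mset_set {1..n})"
  using P by(simp add: couplings_def cw_def flip: q) (simp add: image_mset.compositionality comp_def)
 then obtain p where p: "p permutes {1..n}" "\<forall>k\<in>{1..n}. w k = snd (q (p k))"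
  using image_mset_eq_implies_permutes[of "{1..n}" w "%k. snd (q k)"] by blast
 have pp: "p : perms n" using p(1) by(simp add: perms_def)
 have qp: "image_mset (%k. q (p k)) (mset_set {1..n}) = P" using image_mset_perm[OF pp, of q] q by simp
 have "cw n (%k. fst (q (p k))) = image_mset fst (image_mset (%k. q (p k)) (mset_set {1..n}))"
  by(simp add: cw_def image_mset.compositionality comp_def)
 also have "... = rms" unfolding qp using P by(simp add: couplings_def)
 finally obtain x where x: "x : X" "!!k. k : {1..n} ==> rwx x k = fst (q (p k))" using X_of_word by blast
 have "pairing w x = image_mset (%k. q (p k)) (mset_set {1..n})"
  unfolding pairing_def
 proof (rule image_mset_cong)
  fix k assume "k \<in># mset_set {1..n}"
  hence k: "k : {1..n}" by simp
  have "w k = snd (q (p k))" using p(2) k by blast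
  thus "(rwx x k, w k) = q (p k)" using x(2)[OF k] by(simp only: prod.collapse)
 qed
 thus "P : pairing w ` X" using x(1) qp by auto
qed

text \<open>The orbit of a tabloid is given by the matrix that counts, for each row and each letter,
the entries of that row with that letter.\<close>

lemma fdim_tabloids: "fdim n (prho a) w (supp_in X) = card (couplings rms (cw n w))"
 using fdim_supp_in[of "pairing w" w, OF pairing_sep] by(simp add: pairing_image)

subsection \<open>Column antisymmetrisers\<close>

definition sg :: "(nat => nat) => complex" where "sg \<pi> = of_int (sign \<pi>)"

definition kappa where
 "kappa T v = (\<Sum>\<pi>\<in>col T. pm_scale (sg \<pi>) (prho a \<pi> v))"
lemma col_perms: "\<pi> : col T ==> \<pi> : perms n"
 by(simp add: col_def column_group_def perms_def cardD)
lemma col_iff: "\<pi> : col T \<longleftrightarrow> \<pi> : perms n & (\<forall>j. \<pi> ` T ` {c : D. snd c = j} = T ` {c : D. snd c = j})"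
 by(simp add: col_def column_group_def perms_def cardD)
lemma finite_col: "finite (col T)"
 by(rule finite_subset[OF _ finite_perms[of n]]) (auto dest: col_perms)
lemma col_id: "id : col T"
 by(simp add: col_iff)

lemma col_comp: "z : col T ==> t : col T ==> z \<circ> t : col T"
proof -
 assume *: "z : col T" "t : col T"
 have "(z \<circ> t) ` Y = z ` t ` Y" for Y by(simp only: image_comp)
 moreover have "z ` t ` T ` {c : D. snd c = j} = T ` {c : D. snd c = j}" for j
  using * by(simp add: col_iff)
 ultimately have "(z \<circ> t) ` T ` {c : D. snd c = j} = T ` {c : D. snd c = j}" for j by(simp only:)
 moreover have "z \<circ> t : perms n" by(rule perms_comp[OF *[THEN col_perms]])
 ultimately show ?thesis by(simp only: col_iff simp_thms)
qed

lemma col_inv: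
 assumes "z : col T" shows "pinv z : col T"
proof -
 have p: "z : perms n" using assms by(rule col_perms)
 have "pinv z ` T ` {c : D. snd c = j} = T ` {c : D. snd c = j}" for j
 proof -
  have "T ` {c : D. snd c = j} = z ` T ` {c : D. snd c = j}" using assms by(simp add: col_iff)
  hence "pinv z ` T ` {c : D. snd c = j} = (pinv z \<circ> z) ` T ` {c : D. snd c = j}"
   by(metis image_comp)
  thus ?thesis by(simp add: perms_inv_o[OF p])
 qed
 thus ?thesis using p by(simp add: col_iff)
qed

lemma sg_comp: "z : perms n ==> t : perms n ==> sg (z \<circ> t) = sg z * sg t"
 unfolding sg_def perms_def using sign_compose[of z t] permutes_imp_permutation[of "{1..n}"]
 by simp
lemma sg_sq: "sg z * sg z = 1"
 by(simp add: sg_def sign_def)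

lemma bij_betw_col_comp:
 assumes "t : col T"
 shows "bij_betw (%z. z \<circ> t) (col T) (col T)"
proof (rule bij_betw_byWitness[where f' = "%z. z \<circ> pinv t"])
 show "\<forall>z\<in>col T. z \<circ> t \<circ> pinv t = z" "\<forall>z\<in>col T. z \<circ> pinv t \<circ> t = z"
  using perms_inv_o[OF col_perms[OF assms]] by(simp_all add: comp_assoc)
qed (use assms col_comp col_inv in auto)
lemma plin_prho: "plin (prho a z)"
 by(simp add: prho_def plin_push_keys)

lemma plin_kappa: "plin (kappa T)"
 unfolding kappa_def[abs_def] by(intro plin_sum_fun plin_scale_fun plin_prho)

lemma kappa_right:
 assumes "t : col T" "v : supp_in X"
 shows "kappa T (prho a t v) = pm_scale (sg t) (kappa T v)"
proof -
 interpret M: sym_rep n "prho a" "supp_in X" by(rule sym_rep_supp_in)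
 have "pm_scale (sg t) (kappa T (prho a t v)) =
   (\<Sum>\<pi>\<in>col T. pm_scale (sg (\<pi> \<circ> t)) (prho a (\<pi> \<circ> t) v))"
  unfolding kappa_def PM.scale_sum_right
 proof (rule sum.cong[OF refl])
  fix \<pi> assume \<pi>: "\<pi> : col T"
  show "pm_scale (sg t) (pm_scale (sg \<pi>) (prho a \<pi> (prho a t v))) = pm_scale (sg (\<pi> \<circ> t)) (prho a (\<pi> \<circ> t) v)"
   using M.act_comp[OF col_perms[OF \<pi>] col_perms[OF assms(1)] assms(2)]
   by(simp add: sg_comp[OF col_perms[OF \<pi>] col_perms[OF assms(1)]] mult.commute)
 qed
 also have "... = kappa T v" unfolding kappa_def
  by(rule sum.reindex_bij_betw[OF bij_betw_col_comp[OF assms(1)], where g = "%\<pi>. pm_scale (sg \<pi>) (prho a \<pi> v)"])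
 finally have "pm_scale (sg t) (kappa T v) = pm_scale (sg t) (pm_scale (sg t) (kappa T (prho a t v)))" by simp
 thus ?thesis by(simp add: sg_sq)
qed
lemma single_in_supp: "T : tableaux D ==> single (tabloid D T) c : supp_in X"
 by(auto simp: supp_in_def X_def)

lemma polytabloid_kappa:
 assumes T: "T : tableaux D"
 shows "polytabloid D T = kappa T (single (tabloid D T) 1)"
 unfolding polytabloid_def kappa_def col_def[symmetric]
 by(rule sum.cong[OF refl]) (simp add: prho_def a_tabloid[OF col_perms T] pm_scale_single sg_def)

lemma kappa_polytabloid:
 assumes T: "T : tableaux D"
 shows "kappa T (polytabloid D T) = pm_scale (of_nat (card (col T))) (polytabloid D T)"
proof -
 let ?x = "single (tabloid D T) (1::complex)"
 have "kappa T (polytabloid D T) = (\<Sum>\<pi>\<in>col T. pm_scale (sg \<pi>) (kappa T (prho a \<pi> ?x)))"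
  unfolding polytabloid_kappa[OF T] by(subst (2) kappa_def) (simp add: plin_sum[OF plin_kappa] plin_scale[OF plin_kappa])
 also have "... = (\<Sum>\<pi>\<in>col T. kappa T ?x)"
  by(rule sum.cong[OF refl]) (simp add: kappa_right[OF _ single_in_supp[OF T]] sg_sq)
 also have "... = pm_scale (of_nat (card (col T))) (kappa T ?x)" by(rule PM.sum_constant_scale)
 finally show ?thesis by(simp add: polytabloid_kappa[OF T])
qed

text \<open>A permutation preserving all rows and all columns is the identity.\<close>

lemma col_row_trivial:
 assumes T: "T : tableaux D" and \<pi>: "\<pi> : col T" and eq: "tabloid D (tableau_act D \<pi> T) = tabloid D T"
 shows "\<pi> = id"
proof
 fix k
 have p: "\<pi> : perms n" using \<pi> by(rule col_perms)
 show "\<pi> k = id k"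
 proof (cases "k : {1..n}")
  case False
  thus ?thesis using p by(simp add: perms_def permutes_def)
 next
  case True
  then obtain c where c: "c : D" "T c = k" using tab_cell[OF T] by blast
  have "\<pi> (T c) : \<pi> ` T ` {d : D. snd d = snd c}" using c(1) by blast
  also have "... = T ` {d : D. snd d = snd c}" using \<pi> by(simp add: col_iff)
  finally obtain d where d: "d : D" "snd d = snd c" "\<pi> (T c) = T d" by blast
  have "rw (tableau_act D \<pi> T) (T d) = rw T (T d)"
   using eq[unfolded tabloid_eq[OF act_tab[OF p T] T]] tab_in[OF T d(1)] by blast
  moreover have "rw (tableau_act D \<pi> T) (T d) = fst c"
   using rw_T[OF act_tab[OF p T] c(1)] act_apply[OF c(1), of \<pi> T] d(3) by simp
  ultimately have "fst c = fst d" using rw_T[OF T d(1)] by simp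
  hence "c = d" using d(2) by(simp add: prod_eq_iff)
  thus ?thesis using d(3) c(2) by simp
 qed
qed

lemma polytabloid_nonzero:
 assumes T: "T : tableaux D"
 shows "polytabloid D T ~= 0"
proof -
 have "lookup (polytabloid D T) (tabloid D T) =
   (\<Sum>\<pi>\<in>col T. if \<pi> = id then 1 else 0)"
  unfolding polytabloid_def col_def[symmetric] lookup_sum
 proof (rule sum.cong[OF refl])
  fix \<pi> assume \<pi>: "\<pi> : col T"
  show "lookup (single (tabloid D (tableau_act D \<pi> T)) (of_int (sign \<pi>))) (tabloid D T) =
   (if \<pi> = id then 1 else (0::complex))"
  proof (cases "\<pi> = id")
   case True
   thus ?thesis by(simp add: act_id[OF T])
  next
   case False
   hence "tabloid D (tableau_act D \<pi> T) ~= tabloid D T" using col_row_trivial[OF T \<pi>] by blast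
   thus ?thesis using False by(simp add: lookup_single when_def)
  qed
 qed
 also have "... = 1" using col_id finite_col by simp
 finally show ?thesis by auto
qed

lemma polytabloid_act:
 assumes z: "z : perms n" and T: "T : tableaux D"
 shows "prho a z (polytabloid D T) = polytabloid D (tableau_act D z T)"
proof -
 interpret M: sym_rep n "prho a" "supp_in X" by(rule sym_rep_supp_in)
 let ?h = "%\<pi>. z \<circ> \<pi> \<circ> pinv z"
 have img: "tableau_act D z T ` {c : D. snd c = j} = z ` T ` {c : D. snd c = j}" for j
  by(auto simp: act_apply image_iff)
 have s: "sg (pinv z) = sg z" unfolding sg_def using z sign_inverse[of z]
   permutes_imp_permutation[of "{1..n}" z] by(simp add: perms_def)
 have h: "?h \<pi> : col (tableau_act D z T)" if "\<pi> : col T" for \<pi>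
 proof -
  have "?h \<pi> ` z ` T ` {c : D. snd c = j} = z ` T ` {c : D. snd c = j}" for j
  proof -
   have "?h \<pi> ` z ` Y = z ` \<pi> ` Y" for Y by(auto simp: image_iff perms_inv_apply[OF z])
   thus ?thesis using that by(simp add: col_iff)
  qed
  thus ?thesis unfolding col_iff img using z col_perms[OF that] by(simp add: perms_comp)
 qed
 have h': "pinv z \<circ> \<pi> \<circ> z : col T" if "\<pi> : col (tableau_act D z T)" for \<pi>
 proof -
  have "(pinv z \<circ> \<pi> \<circ> z) ` T ` {c : D. snd c = j} = T ` {c : D. snd c = j}" for j
  proof -
   have "\<pi> ` z ` T ` {c : D. snd c = j} = z ` T ` {c : D. snd c = j}" using that by(simp add: col_iff img)
   hence "pinv z ` \<pi> ` z ` T ` {c : D. snd c = j} = pinv z ` z ` T ` {c : D. snd c = j}" by simp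
   moreover have "pinv z ` z ` Y = Y" for Y by(auto simp: image_iff perms_inv_apply[OF z])
   ultimately have "pinv z ` \<pi> ` z ` T ` {c : D. snd c = j} = T ` {c : D. snd c = j}" by(simp only:)
   moreover have "(pinv z \<circ> \<pi> \<circ> z) ` Y = pinv z ` \<pi> ` z ` Y" for Y by(simp only: image_comp o_assoc)
   ultimately show ?thesis by(simp only:)
  qed
  thus ?thesis unfolding col_iff using z col_perms[OF that] by(simp add: perms_comp)
 qed
 have b: "bij_betw ?h (col T) (col (tableau_act D z T))"
 proof (rule bij_betw_byWitness[where f' = "%\<pi>. pinv z \<circ> \<pi> \<circ> z"])
  show "\<forall>\<pi>\<in>col T. pinv z \<circ> ?h \<pi> \<circ> z = \<pi>" by(auto simp: fun_eq_iff perms_inv_apply[OF z])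
  show "\<forall>\<pi>\<in>col (tableau_act D z T). ?h (pinv z \<circ> \<pi> \<circ> z) = \<pi>"
   by(auto simp: fun_eq_iff perms_inv_apply[OF z])
 qed (use h h' in auto)
 have "prho a z (polytabloid D T) = (\<Sum>\<pi>\<in>col T. pm_scale (sg \<pi>) (single (tabloid D (tableau_act D (z \<circ> \<pi>) T)) 1))"
  unfolding polytabloid_def col_def[symmetric] plin_sum[OF plin_prho]
  by(rule sum.cong[OF refl])
   (simp add: prho_def a_tabloid[OF z act_tab[OF col_perms T]] act_comp pm_scale_single sg_def)
 also have "... = (\<Sum>\<pi>\<in>col T. pm_scale (sg (?h \<pi>)) (single (tabloid D (tableau_act D (?h \<pi>) (tableau_act D z T))) 1))"
 proof (rule sum.cong[OF refl])
  fix \<pi> assume \<pi>: "\<pi> : col T"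
  have "sg (?h \<pi>) = sg z * sg \<pi> * sg z" using z col_perms[OF \<pi>] by(simp add: sg_comp perms_comp s)
  hence "sg (?h \<pi>) = sg \<pi>" using sg_sq[of z] by(simp add: mult.commute mult.left_commute)
  moreover have "?h \<pi> \<circ> z = z \<circ> \<pi>" by(auto simp: fun_eq_iff perms_inv_apply[OF z])
  ultimately show "pm_scale (sg \<pi>) (single (tabloid D (tableau_act D (z \<circ> \<pi>) T)) 1) =
   pm_scale (sg (?h \<pi>)) (single (tabloid D (tableau_act D (?h \<pi>) (tableau_act D z T))) 1)"
   by(simp only: act_comp[symmetric])
 qed
 also have "... = (\<Sum>\<pi>\<in>col (tableau_act D z T). pm_scale (sg \<pi>) (single (tabloid D (tableau_act D \<pi> (tableau_act D z T))) 1))"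
  by(rule sum.reindex_bij_betw[OF b, where g = "%\<pi>. pm_scale (sg \<pi>) (single (tabloid D (tableau_act D \<pi> (tableau_act D z T))) 1)"])
 also have "... = polytabloid D (tableau_act D z T)"
  by(simp add: polytabloid_def col_def pm_scale_single sg_def)
 finally show ?thesis .
qed

definition S where "S = PM.span (polytabloid D ` tableaux D)"
lemma specht_S: "specht D = conc (prho a) S"
 by(simp add: specht_conc S_def a_def[abs_def])

lemma polytabloid_supp:
 assumes T: "T : tableaux D"
 shows "polytabloid D T : supp_in X"
 unfolding polytabloid_def col_def[symmetric]
proof (rule PM.subspace_sum[OF subspace_supp_in])
 fix \<pi> assume "\<pi> : col T"
 from act_tab[OF col_perms[OF this] T]
 show "single (tabloid D (tableau_act D \<pi> T)) (complex_of_int (sign \<pi>)) : supp_in X"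
  by(auto simp: supp_in_def X_def)
qed

lemma S_supp: "S \<subseteq> supp_in X"
 unfolding S_def by(rule PM.span_minimal[OF _ subspace_supp_in]) (auto simp: polytabloid_supp)

lemma sym_rep_S: "sym_rep n (prho a) S"
proof -
 interpret M: sym_rep n "prho a" "supp_in X" by(rule sym_rep_supp_in)
 show ?thesis
 proof (rule M.subrep[OF _ S_supp])
  show "PM.subspace S" by(simp add: S_def)
  fix z v assume z: "z : perms n" and "v : S"
  have "prho a z ` S = PM.span (prho a z ` polytabloid D ` tableaux D)"
   unfolding S_def by(rule PMP.linear_span_image[OF plin_prho, symmetric])
  also have "... \<subseteq> S"
   unfolding S_def by(rule PM.span_mono) (auto simp: polytabloid_act[OF z] act_tab[OF z])
  finally show "prho a z v : S" using \<open>v : S\<close> by blast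
 qed
qed

end

section \<open>Permutation modules and Specht modules of partitions\<close>

context tab
begin

lemma rwx_word_fixed:
 assumes x: "x : X" and w: "!!k. k : {1..n} ==> rwx x k = w k" and h: "h : perms n"
 shows "a h x = x \<longleftrightarrow> h : stab n w"
proof
 assume eq: "a h x = x"
 have "w (h k) = w k" if k: "k : {1..n}" for k
 proof -
  have s: "h k : {1..n}" using perms_in[OF h] k by blast
  have "rwx x (h k) = rwx x k"
   using rwx_a[OF h x s] eq by(simp only: perms_inv_apply[OF h])
  thus ?thesis using w[OF s] w[OF k] by simp
 qed
 thus "h : stab n w" using h by(simp add: stab_def)
next
 assume st: "h : stab n w"
 show "a h x = x"
 proof (rule X_eqI[OF a_closed[OF h x] x])
  fix k assume k: "k : {1..n}"
  have s: "pinv h k : {1..n}" using perms_in[OF perms_inv[OF h]] k by blast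
  have "w (pinv h k) = w k" using stab_inv[OF st] k by(simp add: stab_def)
  thus "rwx (a h x) k = rwx x k" by(simp only: rwx_a[OF h x k] w[OF s] w[OF k])
 qed
qed

lemma transitive:
 assumes x: "x : X" and y: "y : X"
 shows "\<exists>h\<in>perms n. a h x = y"
proof -
 obtain T where T: "T : tableaux D" "x = tabloid D T" using x by(auto simp: X_def)
 obtain U where U: "U : tableaux D" "y = tabloid D U" using y by(auto simp: X_def)
 have "pairing (% _. 0::nat) z = image_mset (%i. (i, 0)) (cw n (rwx z))" for z
  by(simp add: pairing_def cw_def image_mset.compositionality comp_def)
 hence "pairing (% _. 0::nat) x = pairing (% _. 0) y" using rwx_content x y by simp
 thus ?thesis using pairing_sep[OF x y] stab_perms by blast
qed

text \<open>A vector fixed by the stabiliser of a tabloid is the image of that tabloid.\<close>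

lemma hom_from_permutation_module:
 assumes V: "sym_rep n \<rho> V" and x: "x0 : X" "!!k. k : {1..n} ==> rwx x0 k = w k"
  and v: "v : fixed n \<rho> w V"
 obtains \<phi> where "intertw n (supp_in X) (prho a) \<rho> \<phi>" "\<phi> ` supp_in X \<subseteq> V"
  "\<phi> (single x0 1) = v"
proof -
 interpret V: sym_rep n \<rho> V by fact
 define g where "g x = (SOME h. h : perms n & a h x0 = x)" for x
 have g: "g x : perms n & a (g x) x0 = x" if "x : X" for x
 proof -
  have "\<exists>h. h : perms n & a h x0 = x" using transitive[OF x(1) that] by auto
  thus ?thesis unfolding g_def by(rule someI_ex)
 qed
 define f where "f x = \<rho> (g x) v" for x
 have vV: "v : V" using v by(simp add: fixed_def)
 have fval: "f (a h x0) = \<rho> h v" if h: "h : perms n" for h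
 proof -
  define t where "t = g (a h x0)"
  have t: "t : perms n" "a t x0 = a h x0" using g[OF a_closed[OF h x(1)]] by(auto simp: t_def)
  have p: "pinv h \<circ> t : perms n" using h t(1) by simp
  have "a (pinv h \<circ> t) x0 = x0" using a_comp[of "pinv h" t x0] h t x(1) a_inv by simp
  hence "pinv h \<circ> t : stab n w" using rwx_word_fixed[OF x p] by simp
  hence "\<rho> (pinv h \<circ> t) v = v" using v by(simp add: fixed_def)
  hence "\<rho> h v = \<rho> (h \<circ> (pinv h \<circ> t)) v" using V.act_comp[OF h p vV] by simp
  also have "h \<circ> (pinv h \<circ> t) = t" by(simp add: fun_eq_iff perms_inv_apply[OF h])
  finally show ?thesis by(simp add: f_def t_def)
 qed
 have f_act: "f (a h x) = \<rho> h (f x)" if "h : perms n" "x : X" for h x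
 proof -
  have gx: "g x : perms n" "a (g x) x0 = x" using g[OF that(2)] by auto
  have "f (a h x) = f (a (h \<circ> g x) x0)" using a_comp[OF that(1) gx(1) x(1)] gx(2) by simp
  also have "... = \<rho> (h \<circ> g x) v" using fval that(1) gx(1) by simp
  also have "... = \<rho> h (\<rho> (g x) v)" by(rule V.act_comp[OF that(1) gx(1) vV])
  finally show ?thesis by(simp add: f_def)
 qed
 define \<phi> where "\<phi> p = (\<Sum>x\<in>X. pm_scale (lookup p x) (f x))" for p
 have lin: "plin \<phi>"
  by(rule plinI) (simp_all add: \<phi>_def lookup_add lookup_pm_scale PM.scale_left_distrib sum.distrib PM.scale_sum_right)
 have fV: "f x : V" if "x : X" for x using g[OF that] V.closed vV by(simp add: f_def)
 have "\<phi> (prho a h p) = \<rho> h (\<phi> p)" if h: "h : perms n" and p: "p : supp_in X" for h p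
 proof -
  have b: "bij_betw (a h) X X"
   by(rule bij_betw_byWitness[where f' = "a (pinv h)"]) (use h a_inv a_closed in auto)
  have "\<phi> (prho a h p) = (\<Sum>x\<in>X. pm_scale (lookup (prho a h p) (a h x)) (f (a h x)))"
   unfolding \<phi>_def by(rule sum.reindex_bij_betw[OF b, symmetric])
  also have "... = (\<Sum>x\<in>X. \<rho> h (pm_scale (lookup p x) (f x)))"
   by(rule sum.cong[OF refl]) (simp add: lookup_prho[OF h p] f_act[OF h] plin_scale[OF V.lin[OF h]])
  finally show ?thesis by(simp add: \<phi>_def plin_sum[OF V.lin[OF h]])
 qed
 hence "intertw n (supp_in X) (prho a) \<rho> \<phi>" using lin by(simp add: intertw_def)
 moreover have "\<phi> ` supp_in X \<subseteq> V"
  unfolding \<phi>_def using fV by(auto intro!: PM.subspace_sum[OF V.sub] PM.subspace_scale[OF V.sub])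
 moreover have "\<phi> (single x0 1) = v"
 proof -
  have "\<phi> (single x0 1) = (\<Sum>x\<in>X. if x = x0 then f x else 0)"
   unfolding \<phi>_def by(rule sum.cong) (auto simp: lookup_single when_def)
  also have "... = f x0" using fin_X x(1) by simp
  also have "... = v" using fval[of id] a_id[OF x(1)] V.act_id[OF vV] by simp
  finally show ?thesis .
 qed
 ultimately show thesis using that by blast
qed

lemma generated_by_tabloid:
 assumes A: "sym_rep n (prho a) A" and x: "x0 : X" "single x0 1 : A"
 shows "supp_in X \<subseteq> A"
proof -
 interpret A: sym_rep n "prho a" A by fact
 have "single y 1 : A" if y: "y : X" for y
 proof -
  obtain h where h: "h : perms n" "a h x0 = y" using transitive[OF x(1) y] by blast
  thus ?thesis using A.closed[OF h(1) x(2)] by(simp add: prho_def)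
 qed
 thus ?thesis unfolding supp_in_span[OF fin_X] by(intro PM.span_minimal[OF _ A.sub]) auto
qed

text \<open>A nonzero submodule is an equivariant image of the permutation module, so it contains the
 nonzero image of a tabloid.\<close>

lemma fdim_submodule_pos:
 assumes B: "sym_rep n (prho a) B" "B \<subseteq> supp_in X" "B ~= {0}" and w: "cw n w = rms"
 shows "fdim n (prho a) w B > 0"
proof -
 interpret M: sym_rep n "prho a" "supp_in X" by(rule sym_rep_supp_in)
 interpret B: sym_rep n "prho a" B by(rule B(1))
 obtain x0 where x0: "x0 : X" "!!k. k : {1..n} ==> rwx x0 k = w k" using X_of_word[OF w] by blast
 let ?x = "single x0 (1::complex)"
 have xM: "?x : supp_in X" using x0(1) by(simp add: supp_in_def)
 have "prho a h ?x = ?x" if "h : stab n w" for h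
  using rwx_word_fixed[OF x0 stab_perms[OF that]] that by(simp add: prho_def)
 hence xf: "?x : fixed n (prho a) w (supp_in X)" using xM by(simp add: fixed_def)
 obtain p where p: "intertw n (supp_in X) (prho a) (prho a) p" "!!v. v : supp_in X ==> p v : B"
  "!!b. b : B ==> p b = b"
  using maschke_projection[OF sym_rep_supp_in B(1,2)] by blast
 have "p ?x : fixed n (prho a) w B" using intertw_fixed[OF p(1) _ xf] p(2) by blast
 moreover have "p ?x ~= 0"
 proof
  assume "p ?x = 0"
  hence "supp_in X \<subseteq> {v : supp_in X. p v = 0}"
   using xM by(intro generated_by_tabloid[OF sym_rep_kernel[OF sym_rep_supp_in p(1) M.lin] x0(1)]) auto
  hence "b = 0" if "b : B" for b using that B(2) p(3) by auto
  thus False using B(3) B.zero_mem by auto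
 qed
 ultimately show ?thesis by(rule B.fdim_pos)
qed

end

lemma sum_distinct_ge:
 fixes A :: "nat set"
 assumes "finite A"
 shows "\<Sum>{..<card A} <= \<Sum>A"
 using assms
proof (induction A rule: finite_linorder_max_induct)
 case (insert b A)
 have "A \<subseteq> {..<b}" using insert(2) by auto
 hence "card A <= b" by(metis card_lessThan card_mono finite_lessThan)
 moreover have "b \<notin> A" using insert(2) by auto
 ultimately show ?case using insert by simp
qed simp

text \<open>The Specht module of a partition, its permutation module, and the submodule \<open>above\<close> of the
 latter, which is generated by the fixed vectors of the Young subgroups with smaller letter sum.\<close>

definition wsum :: "nat => (nat => nat) => nat" where
 "wsum n w = (\<Sum>k\<in>{1..n}. w k)"

lemma wsum_cw: "wsum n w = sum_mset (cw n w)"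
 by(simp add: wsum_def cw_def sum_unfold_sum_mset)

definition bw :: "nat list => nat" where
 "bw l = sum_mset (rowms (row l))"

definition above where
 "above n l = PM.span (\<Union>w\<in>{w. wsum n w < bw l}.
   fixed n (prho (tab.a (young l))) w (supp_in (tab.X (young l))))"

locale ptab =
 fixes n :: nat and l :: "nat list"
 assumes l: "l : partitions_of n"
begin

lemma part: "is_partition l" and suml: "sum_list l = n"
 using l by(auto simp: partitions_of_def)

lemma parl: "par (row l)"
 by(rule par_row[OF part])

sublocale tab n "young l"
proof
 show "finite (young l)" unfolding young_row by(rule par_finite_dg[OF parl])
 show "card (young l) = n" using psize_row[of l] suml by(simp add: young_row psize_def)
qed
lemma rms_rowms: "rms = rowms (row l)"
 by(subst rms_def) (simp only: rowms_def young_row)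
lemma sum_K_row: "(\<Sum>l'\<in>partitions_of n. K (row l') A * K (row l') B) = (\<Sum>\<nu>\<in>Par n. K \<nu> A * K \<nu> B)"
 by(rule sum.reindex_bij_betw[OF bij_betw_row, where g = "%\<nu>. K \<nu> A * K \<nu> B"])

lemma fdim_M: "fdim n (prho a) w (supp_in X) =
  (\<Sum>l'\<in>partitions_of n. K (row l') (rowms (row l)) * K (row l') (cw n w))"
proof -
 obtain w0 where "cw n w0 = rms" using rw_content tableau_exists by(metis cw_def ex_in_conv)
 hence "size (rowms (row l)) = n" using rms_rowms size_cw by metis
 hence "Par n = Par (size (rowms (row l)))" by simp
 thus ?thesis unfolding fdim_tabloids rms_rowms sum_K_row by(simp only: sum_K_K)
qed

text \<open>If the letters of \<open>w\<close> were distinct along each column of \<open>T\<close>, their sum would be at least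
 \<open>bw l\<close>; otherwise some transposition in the column group fixes \<open>v\<close>.\<close>

lemma kappa_kills:
 assumes T: "T : tableaux (young l)" and w: "wsum n w < bw l" and v: "v : fixed n (prho a) w (supp_in X)"
 shows "kappa T v = 0"
proof -
 define C where "C j = {i. (i, j) : young l}" for j
 have finC: "finite (C j)" for j
  by(rule finite_subset[OF _ finite_imageI[OF finD, of fst]]) (force simp: C_def)
 have "\<exists>j. \<not> inj_on (%i. w (T (i, j))) (C j)"
 proof (rule ccontr)
  assume "\<not> ?thesis"
  hence inj: "inj_on (%i. w (T (i, j))) (C j)" for j by blast
  have Cini: "C j = {..<card (C j)}" for j
  proof (rule initial_segment)
   fix x y assume "x : C j" "y <= x"
   thus "y : C j" using par_antimono[OF parl, of y x] by(auto simp: C_def young_row dg_def)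
  next
   obtain m where "\<forall>x\<in>C j. x < m" using finC finite_nat_set_iff_bounded by blast
   thus "C j \<subseteq> {..<Suc (Max (insert 0 (C j)))}" using finC by(auto simp: less_Suc_eq_le)
  qed
  define J where "J = snd ` young l"
  have finJ: "finite J" using finD by(simp add: J_def)
  have Y: "young l = (%(j, i). (i, j)) ` (SIGMA j:J. C j)"
   by(force simp: J_def C_def)
  have injp: "inj_on (%(j, i). (i, j)) (SIGMA j:J. C j)" by(auto simp: inj_on_def)
  have split: "(\<Sum>c\<in>young l. f c) = (\<Sum>j\<in>J. \<Sum>i\<in>C j. f (i, j))" for f :: "nat \<times> nat => nat"
   by(subst Y, subst sum.reindex[OF injp]) (simp add: sum.Sigma[OF finJ] finC case_prod_unfold comp_def)
  have "bw l = (\<Sum>c\<in>young l. fst c)"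
   by(simp add: bw_def rowms_def young_row sum_unfold_sum_mset)
  also have "... = (\<Sum>j\<in>J. \<Sum>i\<in>C j. i)" by(simp add: split)
  also have "... <= (\<Sum>j\<in>J. \<Sum>i\<in>C j. w (T (i, j)))"
  proof (rule sum_mono)
   fix j assume "j : J"
   have "(\<Sum>i\<in>C j. i) = \<Sum>{..<card ((%i. w (T (i, j))) ` C j)}"
   using Cini[of j] by(simp add: card_image[OF inj])
   also have "... <= \<Sum>((%i. w (T (i, j))) ` C j)" by(rule sum_distinct_ge) (simp add: finC)
   also have "... = (\<Sum>i\<in>C j. w (T (i, j)))" by(simp add: sum.reindex[OF inj])
   finally show "(\<Sum>i\<in>C j. i) <= (\<Sum>i\<in>C j. w (T (i, j)))" .
  qed
  also have "... = (\<Sum>c\<in>young l. w (T c))" by(simp add: split)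
  also have "... = wsum n w"
   unfolding wsum_def by(rule sum.reindex_bij_betw[OF tabD(1)[OF T]])
  finally show False using w by simp
 qed
 then obtain i i' j where ij: "(i, j) : young l" "(i', j) : young l" "i ~= i'" "w (T (i, j)) = w (T (i', j))"
  by(auto simp: inj_on_def C_def)
 define t where "t = Transposition.transpose (T (i, j)) (T (i', j))"
 have ne: "T (i, j) ~= T (i', j)" using inj_onD[OF tabD(2)[OF T], of "(i, j)" "(i', j)"] ij by auto
 have tp: "t : perms n" unfolding t_def perms_def using tab_in[OF T] ij by(simp add: permutes_swap_id)
 have "t ` T ` {c : young l. snd c = j'} = T ` {c : young l. snd c = j'}" for j'
 proof (cases "j' = j")
  case True
  hence "T (i, j) : T ` {c : young l. snd c = j'}" "T (i', j) : T ` {c : young l. snd c = j'}"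
   using ij by auto
  thus ?thesis unfolding t_def by(intro transpose_image_eq) simp
 next
  case False
  have "t k = k" if k: "k : T ` {c : young l. snd c = j'}" for k
  proof -
   obtain c where "c : young l" "snd c = j'" "k = T c" using k by blast
   hence "k ~= T (i, j)" "k ~= T (i', j)"
   using inj_onD[OF tabD(2)[OF T], of c] ij False by auto
   thus ?thesis by(simp add: t_def)
  qed
  thus ?thesis by(auto simp: image_iff)
 qed
 hence tc: "t : col T" using tp by(simp add: col_iff)
 have "w (t k) = w k" for k using ij(4) by(simp add: t_def Transposition.transpose_def)
 hence "t : stab n w" using tp by(simp add: stab_def)
 hence "prho a t v = v" using v by(simp add: fixed_def)
 moreover have "v : supp_in X" using v by(simp add: fixed_def)
 ultimately have "kappa T v = pm_scale (sg t) (kappa T v)" using kappa_right[OF tc] by metis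
 moreover have "sg t = -1" using ne by(simp add: sg_def t_def sign_swap_id)
 ultimately have "kappa T v = - kappa T v" by simp
 hence "pm_scale 2 (kappa T v) = 0"
  by(metis PM.scale_left_distrib PM.scale_one add.right_inverse one_add_one)
 thus ?thesis by simp
qed

lemma sym_rep_above: "sym_rep n (prho a) (above n l)"
 and above_supp: "above n l \<subseteq> supp_in X"
 and fixed_above: "wsum n w < bw l ==> fixed n (prho a) w (above n l) = fixed n (prho a) w (supp_in X)"
proof -
 interpret M: sym_rep n "prho a" "supp_in X" by(rule sym_rep_supp_in)
 let ?U = "\<Union>w\<in>{w. wsum n w < bw l}. fixed n (prho a) w (supp_in X)"
 have above: "above n l = PM.span ?U" by(simp add: above_def)
 show sub: "above n l \<subseteq> supp_in X"
  unfolding above by(rule PM.span_minimal[OF _ M.sub]) (auto simp: fixed_def)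
 show "sym_rep n (prho a) (above n l)"
 proof (rule M.subrep[OF _ sub])
  show "PM.subspace (above n l)" by(simp add: above)
  fix h v assume h: "h : perms n" and "v : above n l"
  have "prho a h u : ?U" if "u : ?U" for u
  proof -
   obtain w where w: "wsum n w < bw l" "u : fixed n (prho a) w (supp_in X)" using \<open>u : ?U\<close> by blast
   define w' where "w' = (%k. w (pinv h k))"
   have uX: "u : supp_in X" using w(2) by(simp add: fixed_def)
   have "wsum n w' = wsum n w"
   unfolding wsum_cw cw_def w'_def by(simp only: image_mset_perm[OF perms_inv[OF h], of w])
   moreover have "prho a t (prho a h u) = prho a h u" if t: "t : stab n w'" for t
   proof -
   have tp: "t : perms n" using t by(rule stab_perms)
   have q: "pinv h \<circ> t \<circ> h : perms n" using h tp by simp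
   have "w (pinv h (t (h k))) = w k" if k: "k : {1..n}" for k
   proof -
   have "h k : {1..n}" using perms_in[OF h] k by blast
   hence "w' (t (h k)) = w' (h k)" using t by(simp add: stab_def)
   thus ?thesis by(simp add: w'_def perms_inv_apply[OF h])
   qed
   hence "pinv h \<circ> t \<circ> h : stab n w" using q by(simp add: stab_def)
   hence "prho a (pinv h \<circ> t \<circ> h) u = u" using w(2) by(simp add: fixed_def)
   hence "prho a h u = prho a (h \<circ> (pinv h \<circ> t \<circ> h)) u" using M.act_comp[OF h q uX] by simp
   also have "h \<circ> (pinv h \<circ> t \<circ> h) = t \<circ> h" by(simp add: fun_eq_iff perms_inv_apply[OF h])
   finally have "prho a h u = prho a (t \<circ> h) u" .
   thus ?thesis by(rule trans[OF M.act_comp[OF tp h uX, symmetric] sym])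
   qed
   ultimately have "wsum n w' < bw l" "prho a h u : fixed n (prho a) w' (supp_in X)"
   using w(1) M.closed[OF h uX] by(simp_all add: fixed_def)
   thus ?thesis by blast
  qed
  hence "prho a h ` ?U \<subseteq> ?U" by blast
  hence "PM.span (prho a h ` ?U) \<subseteq> above n l" unfolding above by(rule PM.span_mono)
  moreover have "PM.span (prho a h ` ?U) = prho a h ` above n l"
   unfolding above by(rule PMP.linear_span_image[OF plin_prho])
  ultimately show "prho a h v : above n l" using \<open>v : above n l\<close> by blast
 qed
 show "fixed n (prho a) w (above n l) = fixed n (prho a) w (supp_in X)" if "wsum n w < bw l"
 proof
  have "fixed n (prho a) w (supp_in X) \<subseteq> above n l" unfolding above using that by(auto intro: PM.span_base)
  thus "fixed n (prho a) w (supp_in X) \<subseteq> fixed n (prho a) w (above n l)" by(auto simp: fixed_def)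
 qed (use sub in "auto simp: fixed_def")
qed

lemma kappa_above:
 assumes "T : tableaux (young l)" "v : above n l"
 shows "kappa T v = 0"
proof -
 have "PM.span (\<Union>w\<in>{w. wsum n w < bw l}. fixed n (prho a) w (supp_in X)) \<subseteq> {v. kappa T v = 0}"
 proof (rule PM.span_minimal)
  show "PM.subspace {v. kappa T v = 0}" by(rule PMP.linear_subspace_kernel[OF plin_kappa])
 qed (use kappa_kills[OF assms(1)] in blast)
 thus ?thesis using assms(2) by(auto simp: above_def)
qed

text \<open>The complement of the intersection with \<open>above\<close> already contains all polytabloids: these are
 rescaled by their column antisymmetrisers, which annihilate \<open>above\<close>.\<close>

lemma S_Int_above: "S \<inter> above n l = {0}"
proof -
 interpret S: sym_rep n "prho a" S by(rule sym_rep_S)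
 interpret A: sym_rep n "prho a" "above n l" by(rule sym_rep_above)
 have N: "sym_rep n (prho a) (S \<inter> above n l)"
  by(rule S.subrep) (auto simp: S.closed A.closed intro: PM.subspace_inter S.sub A.sub)
 interpret N: sym_rep n "prho a" "S \<inter> above n l" by(rule N)
 obtain N' where N': "sym_rep n (prho a) N'" "N' \<subseteq> S" "direct S (S \<inter> above n l) N'"
  using maschke_complement[OF sym_rep_S N] by blast
 interpret N': sym_rep n "prho a" N' by(rule N'(1))
 note D = directD[OF N'(3) N.sub N'.sub]
 have "polytabloid (young l) T : N'" if T: "T : tableaux (young l)" for T
 proof -
  have "polytabloid (young l) T : S" unfolding S_def using T by(intro PM.span_base) blast
  then obtain u v where uv: "u : S \<inter> above n l" "v : N'" "polytabloid (young l) T = u + v" using D(3) by blast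
  have "pm_scale (of_nat (card (col T))) (polytabloid (young l) T) = kappa T u + kappa T v"
   using kappa_polytabloid[OF T] uv(3) plin_add[OF plin_kappa] by simp
  also have "kappa T u = 0" using kappa_above[OF T] uv(1) by blast
  finally have "pm_scale (of_nat (card (col T))) (polytabloid (young l) T) = kappa T v" by simp
  moreover have "kappa T v : N'"
   unfolding kappa_def using uv(2)
   by(intro PM.subspace_sum[OF N'.sub] PM.subspace_scale[OF N'.sub] N'.closed col_perms) auto
  ultimately have "pm_scale (1 / of_nat (card (col T))) (pm_scale (of_nat (card (col T))) (polytabloid (young l) T)) : N'"
   by(metis PM.subspace_scale[OF N'.sub])
  moreover have "card (col T) ~= 0" using col_id finite_col by(metis card_eq_0_iff empty_iff)
  ultimately show ?thesis by simp
 qed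
 hence "S \<subseteq> N'" unfolding S_def by(intro PM.span_minimal[OF _ N'.sub]) blast
 thus ?thesis using D(5) N.zero_mem by blast
qed

lemma S_nonzero: "S ~= {0}"
proof
 obtain T where T: "T : tableaux (young l)" using tableau_exists by blast
 assume "S = {0}"
 moreover have "polytabloid (young l) T : S" unfolding S_def using T by(intro PM.span_base) blast
 ultimately show False using polytabloid_nonzero[OF T] by blast
qed

end

section \<open>Decomposition into Specht modules\<close>

lemma rowms_inj:
 assumes "rowms \<mu> = rowms \<nu>" "par \<mu>" "par \<nu>"
 shows "\<mu> = \<nu>"
proof
 have c: "count (rowms \<sigma>) i = \<sigma> i" if "par \<sigma>" for \<sigma> i
 proof -
  have "{c : dg \<sigma>. fst c = i} = Pair i ` {..<\<sigma> i}" by(auto simp: dg_def)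
  thus ?thesis
   using par_finite_dg[OF that]
   by(simp add: rowms_def count_image_mset_eq_card_vimage card_image inj_on_def)
 qed
 show "\<mu> i = \<nu> i" for i using c[OF assms(2), of i] c[OF assms(3), of i] assms(1) by simp
qed

lemma count_rowms:
 assumes "par \<sigma>"
 shows "count (rowms \<sigma>) i = \<sigma> i"
proof -
 have "{c : dg \<sigma>. fst c = i} = Pair i ` {..<\<sigma> i}" by(auto simp: dg_def)
 thus ?thesis
  using par_finite_dg[OF assms]
  by(simp add: rowms_def count_image_mset_eq_card_vimage card_image inj_on_def)
qed
lemma row_par: "l : partitions_of n ==> par (row l)"
 by(simp add: partitions_of_def par_row)

lemma size_rowms_row: "l : partitions_of n ==> size (rowms (row l)) = n"
 using psize_row[of l] by(simp add: rowms_def psize_def partitions_of_def)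

lemma K_row_triangular:
 assumes "l : partitions_of n" "K (row l) B ~= 0"
 shows "bw l < sum_mset B \<or> B = rowms (row l)"
 using K_triangular[OF row_par] assms unfolding bw_def by blast

lemma K_row_diagonal: "l : partitions_of n ==> K (row l) (rowms (row l)) = 1"
 using K_diagonal row_par by blast

lemma row_eqI:
 assumes "l : partitions_of n" "l' : partitions_of n" "rowms (row l) = rowms (row l')"
 shows "l = l'"
proof -
 have "row l = row l'" using rowms_inj[OF assms(3)] row_par assms(1,2) by blast
 thus ?thesis using bij_betw_row[of n] assms(1,2) by(auto simp: bij_betw_def inj_on_def)
qed

abbreviation "ksum n m w \<equiv> \<Sum>l\<in>partitions_of n. m l * K (row l) (cw n w)"

text \<open>Kostka numbers are unitriangular, so these sums determine the coefficients.\<close>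

lemma kostka_cancel:
 assumes eq: "!!w. wsum n w < c ==> (ksum n m w) =
   (ksum n m' w)"
  and l: "l : partitions_of n" "bw l < c"
 shows "m l = (m' l :: nat)"
 using l
proof (induction "bw l" arbitrary: l rule: less_induct)
 case less
 obtain w where w: "cw n w = rowms (row l)" using cw_exists size_rowms_row[OF less.prems(1)] by metis
 have ws: "wsum n w < c" using w less.prems(2) by(simp add: wsum_cw bw_def)
 have split: "(\<Sum>l'\<in>partitions_of n. f l' * K (row l') (cw n w)) =
   f l + (\<Sum>l'\<in>{l'\<in>partitions_of n. bw l' < bw l}. f l' * K (row l') (cw n w))" for f :: "nat list => nat"
 proof -
  have "(\<Sum>l'\<in>partitions_of n. f l' * K (row l') (cw n w)) =
   (\<Sum>l'\<in>insert l {l'\<in>partitions_of n. bw l' < bw l}. f l' * K (row l') (cw n w))"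
  proof (rule sum.mono_neutral_right[OF finite_partitions_of])
   show "insert l {l'\<in>partitions_of n. bw l' < bw l} \<subseteq> partitions_of n" using less.prems by auto
   show "\<forall>l'\<in>partitions_of n - insert l {l'\<in>partitions_of n. bw l' < bw l}. f l' * K (row l') (cw n w) = 0"
   proof
   fix l' assume l': "l' : partitions_of n - insert l {l'\<in>partitions_of n. bw l' < bw l}"
   have "K (row l') (cw n w) = 0"
   proof (rule ccontr)
   assume "K (row l') (cw n w) ~= 0"
   hence "bw l' < bw l \<or> rowms (row l) = rowms (row l')"
   using K_row_triangular[of l' n "cw n w"] l' unfolding w by(auto simp: bw_def)
   thus False using l' row_eqI[of l n l'] less.prems(1) by auto
   qed
   thus "f l' * K (row l') (cw n w) = 0" by simp
   qed
  qed
  also have "... = f l * K (row l) (cw n w) + (\<Sum>l'\<in>{l'\<in>partitions_of n. bw l' < bw l}. f l' * K (row l') (cw n w))"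
   by(rule sum.insert) (auto intro: finite_subset[OF _ finite_partitions_of[of n]])
  finally show ?thesis using K_row_diagonal[OF less.prems(1)] w by simp
 qed
 have "(\<Sum>l'\<in>{l'\<in>partitions_of n. bw l' < bw l}. m l' * K (row l') (cw n w)) =
   (\<Sum>l'\<in>{l'\<in>partitions_of n. bw l' < bw l}. m' l' * K (row l') (cw n w))"
 proof (rule sum.cong[OF refl])
  fix l' assume "l' : {l'\<in>partitions_of n. bw l' < bw l}"
  thus "m l' * K (row l') (cw n w) = m' l' * K (row l') (cw n w)"
   using less.hyps[of l'] less.prems(2) by auto
 qed
 thus ?case using eq[OF ws] split[of m] split[of m'] by simp
qed

text \<open>A word with minimal letter sum among those having fixed vectors has a partition as content:
 exchanging two letters does not change the stabiliser.\<close>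

lemma minimal_word_partition:
 assumes V: "v : fixed n r w V" "v ~= 0"
  and min: "\<forall>w' u. u : fixed n r w' V \<longrightarrow> u ~= 0 \<longrightarrow> wsum n w <= wsum n w'"
 obtains l where "l : partitions_of n" "cw n w = rowms (row l)"
proof -
 define \<nu> where "\<nu> = count (cw n w)"
 have \<nu>: "\<nu> i = card {k : {1..n}. w k = i}" for i
  by(simp add: \<nu>_def cw_def count_image_mset_eq_card_vimage)
 have dec: "\<nu> (Suc i) <= \<nu> i" for i
 proof -
  define w' where "w' k = (if w k = i then Suc i else if w k = Suc i then i else w k)" for k
  have "w' x = w' y \<longleftrightarrow> w x = w y" for x y by(auto simp: w'_def split: if_splits)
  hence "stab n w' = stab n w" by(simp add: stab_def)
  hence "v : fixed n r w' V" using V(1) by(simp add: fixed_def)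
  hence le: "wsum n w <= wsum n w'" using min V(2) by blast
  have "w' k + (if w k = Suc i then 1 else 0) = w k + (if w k = i then 1 else 0)" for k
   by(auto simp: w'_def)
  hence "(\<Sum>k\<in>{1..n}. w' k + (if w k = Suc i then 1 else 0)) = (\<Sum>k\<in>{1..n}. w k + (if w k = i then 1 else 0))"
   by simp
  moreover have "(\<Sum>k\<in>{1..n}. if w k = j then 1 else 0) = card {k : {1..n}. w k = j}" for j
   by(simp add: sum.If_cases Int_def)
  ultimately have "wsum n w' + card {k : {1..n}. w k = Suc i} = wsum n w + card {k : {1..n}. w k = i}"
   unfolding sum.distrib wsum_def by metis
  thus ?thesis using le \<nu> by simp
 qed
 have zero: "\<nu> i = 0" if "i \<ge> Suc (Max (insert 0 (w ` {1..n})))" for i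
 proof -
  have "w k ~= i" if k: "k : {1..n}" for k
  proof -
   have "w k <= Max (insert 0 (w ` {1..n}))" using k by(intro Max_ge) auto
   thus ?thesis using \<open>i \<ge> _\<close> by linarith
  qed
  thus ?thesis unfolding \<nu> by(simp del: atLeastAtMost_iff)
 qed
 have p: "par \<nu>" unfolding par_def using dec zero by blast
 have eq: "cw n w = rowms \<nu>" by(rule multiset_eqI) (simp add: count_rowms[OF p], simp add: \<nu>_def)
 have "psize \<nu> = size (rowms \<nu>)" by(simp add: psize_def rowms_def)
 also have "... = n" using eq size_cw by metis
 finally have "\<nu> : Par n" using p by(simp add: Par_def)
 hence "\<nu> : row ` partitions_of n" using bij_betw_row[of n] by(simp add: bij_betw_def)
 then obtain l where "l : partitions_of n" "row l = \<nu>" by blast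
 thus thesis using that eq by blast
qed

definition splits where
 "splits n l \<longleftrightarrow> direct (supp_in (tab.X (young l))) (above n l) (tab.S (young l)) \<and>
  (\<forall>w. fdim n (prho (tab.a (young l))) w (tab.S (young l)) = K (row l) (cw n w)) \<and>
  (\<forall>B. sym_rep n (prho (tab.a (young l))) B \<longrightarrow> B \<subseteq> tab.S (young l) \<longrightarrow> B = {0} \<or> B = tab.S (young l))"

lemma embed_specht:
 assumes l: "l : partitions_of n" and spl: "splits n l" and V: "sym_rep n r V"
  and w: "cw n w = rowms (row l)" and v: "v : fixed n r w V" "v ~= 0"
  and min: "\<forall>w' u. u : fixed n r w' V \<longrightarrow> u ~= 0 \<longrightarrow> wsum n w <= wsum n w'"
 obtains ph where "intertw n (tab.S (young l)) (prho (tab.a (young l))) r ph"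
  "inj_on ph (tab.S (young l))" "ph ` tab.S (young l) \<subseteq> V"
proof -
 interpret ptab n l by unfold_locales (rule l)
 interpret V: sym_rep n r V by fact
 interpret S: sym_rep n "prho a" S by(rule sym_rep_S)
 interpret A: sym_rep n "prho a" "above n l" by(rule sym_rep_above)
 obtain x0 where x0: "x0 : X" "!!k. k : {1..n} ==> rwx x0 k = w k"
  using X_of_word[of w] w rms_rowms by metis
 obtain ph where ph: "intertw n (supp_in X) (prho a) r ph" "ph ` supp_in X \<subseteq> V" "ph (single x0 1) = v"
  using hom_from_permutation_module[OF V x0 v(1)] by blast
 have lin: "plin ph" using ph(1) by(simp add: intertw_def)
 have ker: "ph u = 0" if "u : above n l" for u
 proof -
  have "PM.span (\<Union>w\<in>{w. wsum n w < bw l}. fixed n (prho a) w (supp_in X)) \<subseteq> {v. ph v = 0}"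
  proof (rule PM.span_minimal)
   show "PM.subspace {v. ph v = 0}" by(rule PMP.linear_subspace_kernel[OF lin])
   show "(\<Union>w\<in>{w. wsum n w < bw l}. fixed n (prho a) w (supp_in X)) \<subseteq> {v. ph v = 0}"
   proof clarify
   fix w' u assume u: "wsum n w' < bw l" "u : fixed n (prho a) w' (supp_in X)"
   have "ph u : fixed n r w' V" by(rule intertw_fixed[OF ph(1,2) u(2)])
   moreover have "wsum n w' < wsum n w" using u(1) w by(simp add: wsum_cw[of n w] bw_def)
   ultimately show "ph u = 0" using min by(meson not_le)
   qed
  qed
  thus ?thesis using that by(auto simp: above_def)
 qed
 have iS: "intertw n S (prho a) r ph" using ph(1) S_supp unfolding intertw_def by blast
 have "sym_rep n (prho a) {s : S. ph s = 0}" by(rule sym_rep_kernel[OF sym_rep_S iS V.lin])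
 hence "{s : S. ph s = 0} = {0} \<or> {s : S. ph s = 0} = S" using spl unfolding splits_def by blast
 moreover have "{s : S. ph s = 0} ~= S"
 proof
  assume eq: "{s : S. ph s = 0} = S"
  have "direct (supp_in X) (above n l) S" using spl by(simp add: splits_def)
  moreover have "single x0 1 : (supp_in X :: (_ \<Rightarrow>\<^sub>0 complex) set)" using x0(1) by(simp add: supp_in_def)
  ultimately obtain t s where "t : above n l" "s : S" "single x0 1 = t + s"
   using directD(3)[OF _ A.sub S.sub] by blast
  hence "v = 0" using ph(3) ker eq plin_add[OF lin, of t s] by auto
  thus False using v(2) by simp
 qed
 ultimately have "{s : S. ph s = 0} = {0}" by blast
 hence "inj_on ph S"
  using PMP.linear_inj_on_iff_eq_0[OF lin S.sub] by blast
 thus thesis using that iS ph(2) S_supp by blast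
qed

lemma sum_split_one:
 assumes "finite P" "l : P"
 shows "(\<Sum>l'\<in>P. (m l' + (if l' = l then 1 else 0)) * (f l' :: nat)) = (\<Sum>l'\<in>P. m l' * f l') + f l"
proof -
 have "(\<Sum>l'\<in>P. (m l' + (if l' = l then 1 else 0)) * f l') = (\<Sum>l'\<in>P. m l' * f l' + (if l' = l then f l' else 0))"
  by(rule sum.cong) (auto simp: algebra_simps)
 also have "... = (\<Sum>l'\<in>P. m l' * f l') + f l" using assms by(simp add: sum.distrib)
 finally show ?thesis .
qed

lemma decompose:
 assumes spl: "!!l. l : partitions_of n ==> bw l < c ==> splits n l"
  and V: "sym_rep n r V"
  and hyp: "!!V'. sym_rep n r V' ==> V' \<subseteq> V ==> V' ~= {0} ==> \<exists>w. wsum n w < c & fixed n r w V' ~= {0}"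
 shows "\<exists>m. has_mult n (conc r V) m & (\<forall>w. fdim n r w V = (ksum n m w)) \<and>
  (\<forall>l. m l ~= 0 \<longrightarrow> bw l < c)"
 using V hyp
proof (induction "PM.dim V" arbitrary: V rule: less_induct)
 case less
 interpret V: sym_rep n r V by(rule less.prems(1))
 show ?case
 proof (cases "V = {0}")
  case True
  have "has_mult n (conc r V) (% _. 0)"
   by(rule has_mult_zero[of _ 0]) (simp_all add: True closed_rep_conc[OF less.prems(1), unfolded True])
  moreover have "fdim n r w V = 0" for w
   using V.fdim_pos_iff[of w] V.fixed_subset[of w] PM.subspace_0[OF V.subspace_fixed[of w]] True by auto
  ultimately show ?thesis by(intro exI[of _ "% _. 0"]) simp
 next
  case False
  define P where "P w \<longleftrightarrow> fixed n r w V ~= {0}" for w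
  obtain w1 where w1: "wsum n w1 < c" "P w1" using less.prems(2)[OF less.prems(1) subset_refl False] by(auto simp: P_def)
  define w where "w = arg_min (wsum n) P"
  have Pw: "P w" unfolding w_def by(rule arg_min_natI[of P w1 "wsum n", OF w1(2)])
  have wmin: "wsum n w <= wsum n w'" if "P w'" for w' unfolding w_def by(rule arg_min_nat_le[of P w' "wsum n", OF that])
  obtain v where v: "v : fixed n r w V" "v ~= 0"
   using Pw PM.subspace_0[OF V.subspace_fixed[of w]] unfolding P_def by blast
  have min: "\<forall>w' u. u : fixed n r w' V \<longrightarrow> u ~= 0 \<longrightarrow> wsum n w <= wsum n w'"
   using wmin unfolding P_def by blast
  obtain l where ll: "l : partitions_of n" "cw n w = rowms (row l)"
   using minimal_word_partition[OF v min] by blast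
  have bl: "bw l < c" using wmin[OF w1(2)] w1(1) ll(2) by(simp add: wsum_cw[of n w] bw_def)
  interpret ptab n l by unfold_locales (rule ll(1))
  obtain ph where ph: "intertw n S (prho a) r ph" "inj_on ph S" "ph ` S \<subseteq> V"
   using embed_specht[OF ll(1) spl[OF ll(1) bl] less.prems(1) ll(2) v min] by blast
  have V1: "sym_rep n r (ph ` S)" by(rule sym_rep_image[OF sym_rep_S less.prems(1) ph(1,3)])
  interpret V1: sym_rep n r "ph ` S" by(rule V1)
  obtain V2 where V2: "sym_rep n r V2" "V2 \<subseteq> V" "direct V (ph ` S) V2"
   using maschke_complement[OF less.prems(1) V1 ph(3)] by blast
  interpret V2: sym_rep n r V2 by(rule V2(1))
  obtain Y where Y: "finite Y" "V \<subseteq> supp_in Y" using V.fin by blast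
  have "PM.dim V = PM.dim (ph ` S) + PM.dim V2" by(rule dim_direct[OF V2(3) V1.sub V2.sub Y])
  moreover have "PM.dim (ph ` S) > 0"
  proof -
   have "ph ` S ~= {0}"
   proof
   assume e: "ph ` S = {0}"
   interpret S: sym_rep n "prho a" S by(rule sym_rep_S)
   have "s = 0" if "s : S" for s
   proof -
   have "ph s = 0" "ph 0 = 0" using e that S.zero_mem by blast+
   thus ?thesis using inj_onD[OF ph(2), of s 0] that S.zero_mem by simp
   qed
   thus False using S_nonzero S.zero_mem by blast
   qed
   thus ?thesis using dim_pos_iff[OF V1.sub Y(1)] ph(3) Y(2) by blast
  qed
  ultimately have d: "PM.dim V2 < PM.dim V" by simp
  have hyp2: "\<exists>w. wsum n w < c & fixed n r w V' ~= {0}"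
   if "sym_rep n r V'" "V' \<subseteq> V2" "V' ~= {0}" for V'
   by(rule less.prems(2)[OF that(1) subset_trans[OF that(2) V2(2)] that(3)])
  from less.hyps[OF d V2(1) hyp2] obtain m where m: "has_mult n (conc r V2) m" "\<forall>w. fdim n r w V2 = (ksum n m w)"
   "\<forall>l. m l ~= 0 \<longrightarrow> bw l < c" by blast
  define m' where "m' l' = m l' + (if l' = l then 1 else 0)" for l'
  have "rep_iso n (conc (prho a) S) (conc r (ph ` S))" by(rule rep_iso_conc[OF ph(1,2) refl])
  hence "rep_iso n (conc r (ph ` S)) (specht (young l))"
   unfolding specht_S using rep_iso_sym closed_rep_conc[OF sym_rep_S] by blast
  hence h1: "has_mult n (conc r (ph ` S)) (%l'. if l' = l then 1 else 0)"
   by(rule has_mult_iso[OF _ has_mult_specht[OF ll(1)]])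
  have "has_mult n (conc r V) (%l'. (if l' = l then 1 else 0) + m l')"
   by(rule has_mult_iso[OF rep_iso_plus_direct[OF V1 V2(1) V2(3)] has_mult_plus[OF h1 m(1)]])
  hence "has_mult n (conc r V) m'" by(simp add: m'_def[abs_def] add.commute)
  moreover have "fdim n r w' V = (\<Sum>l\<in>partitions_of n. m' l * K (row l) (cw n w'))" for w'
  proof -
   have "fdim n r w' V = fdim n r w' (ph ` S) + fdim n r w' V2"
   by(rule fdim_direct[OF less.prems(1) V1 V2(1) V2(3)])
   also have "fdim n r w' (ph ` S) = fdim n (prho a) w' S" by(rule fdim_iso[OF sym_rep_S ph(1,2) refl])
   also have "... = K (row l) (cw n w')" using spl[OF ll(1) bl] by(simp add: splits_def)
   finally show ?thesis using m(2) sum_split_one[OF finite_partitions_of ll(1), of m] by(simp add: m'_def)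
  qed
  moreover have "\<forall>l. m' l ~= 0 \<longrightarrow> bw l < c" using m(3) bl by(auto simp: m'_def)
  ultimately show ?thesis by blast
 qed
qed

text \<open>Induction on the letter sum. By induction \<open>above\<close> decomposes into Specht modules; comparing
 fixed vectors, the identity \<open>sum_K_K\<close> forces their multiplicities to be Kostka numbers, and then
 leaves exactly \<open>K (row l)\<close> for a complement of \<open>above\<close>.\<close>

lemma splits: "l : partitions_of n ==> splits n l"
proof (induction "bw l" arbitrary: l rule: less_induct)
 case less
 interpret ptab n l by unfold_locales (rule less.prems)
 interpret M: sym_rep n "prho a" "supp_in X" by(rule sym_rep_supp_in)
 interpret S: sym_rep n "prho a" S by(rule sym_rep_S)
 interpret A: sym_rep n "prho a" "above n l" by(rule sym_rep_above)
 have hyp: "\<exists>w. wsum n w < bw l & fixed n (prho a) w V' ~= {0}"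
  if V': "sym_rep n (prho a) V'" "V' \<subseteq> above n l" "V' ~= {0}" for V'
 proof (rule ccontr)
  assume none: "\<not> ?thesis"
  interpret V': sym_rep n "prho a" V' by(rule V'(1))
  obtain p where p: "intertw n (above n l) (prho a) (prho a) p" "!!v. v : above n l ==> p v : V'"
   "!!v. v : V' ==> p v = v" using maschke_projection[OF sym_rep_above V'(1,2)] by blast
  have lp: "plin p" using p(1) by(simp add: intertw_def)
  have "PM.span (\<Union>w\<in>{w. wsum n w < bw l}. fixed n (prho a) w (supp_in X)) \<subseteq> {v. p v = 0}"
  proof (rule PM.span_minimal)
   show "PM.subspace {v. p v = 0}" by(rule PMP.linear_subspace_kernel[OF lp])
   show "(\<Union>w\<in>{w. wsum n w < bw l}. fixed n (prho a) w (supp_in X)) \<subseteq> {v. p v = 0}"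
   proof clarify
   fix w u assume u: "wsum n w < bw l" "u : fixed n (prho a) w (supp_in X)"
   hence "u : fixed n (prho a) w (above n l)" using fixed_above by simp
   hence "p u : fixed n (prho a) w V'" using intertw_fixed[OF p(1)] p(2) by blast
   thus "p u = 0" using none u(1) by blast
   qed
  qed
  hence p0: "p v = 0" if "v : above n l" for v using that by(auto simp: above_def)
  have "v = 0" if v: "v : V'" for v using p0[OF subsetD[OF V'(2) v]] p(3)[OF v] by simp
  thus False using V'(3) V'.zero_mem by blast
 qed
 obtain m where m: "\<forall>w. fdim n (prho a) w (above n l) = (\<Sum>l'\<in>partitions_of n. m l' * K (row l') (cw n w))"
  "\<forall>l'. m l' ~= 0 \<longrightarrow> bw l' < bw l"
  using decompose[OF less.hyps sym_rep_above hyp] by blast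
 let ?k = "%l'. K (row l') (rowms (row l))"
 have mk: "m l' = ?k l'" if "l' : partitions_of n" "bw l' < bw l" for l'
 proof (rule kostka_cancel[OF _ that])
  fix w assume "wsum n w < bw l"
  hence "fdim n (prho a) w (above n l) = fdim n (prho a) w (supp_in X)"
   using fixed_above by(simp add: fdim_def)
  thus "(\<Sum>l'\<in>partitions_of n. m l' * K (row l') (cw n w)) = (\<Sum>l'\<in>partitions_of n. ?k l' * K (row l') (cw n w))"
   using m(1) fdim_M by simp
 qed
 have dimM: "fdim n (prho a) w (supp_in X) = fdim n (prho a) w (above n l) + K (row l) (cw n w)" for w
 proof -
  have "?k l' * K (row l') (cw n w) = (m l' + (if l' = l then 1 else 0)) * K (row l') (cw n w)"
   if l': "l' : partitions_of n" for l'
  proof (cases "l' = l")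
   case True
   have "m l = 0" using m(2) by(meson less_irrefl)
   thus ?thesis using True K_row_diagonal[OF l'] by simp
  next
   case False
   have "m l' = ?k l'"
   proof (cases "bw l' < bw l")
   case True
   thus ?thesis by(rule mk[OF l'])
   next
   case b: False
   hence "?k l' = 0" using K_row_triangular[OF l', of "rowms (row l)"] row_eqI[OF less.prems l'] False
   by(auto simp: bw_def)
   moreover have "m l' = 0" using m(2) b by blast
   ultimately show ?thesis by simp
   qed
   thus ?thesis using False by simp
  qed
  hence "(\<Sum>l'\<in>partitions_of n. ?k l' * K (row l') (cw n w)) =
   (\<Sum>l'\<in>partitions_of n. (m l' + (if l' = l then 1 else 0)) * K (row l') (cw n w))"
   by(rule sum.cong[OF refl])
  also have "... = (\<Sum>l'\<in>partitions_of n. m l' * K (row l') (cw n w)) + K (row l) (cw n w)"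
   by(rule sum_split_one[OF finite_partitions_of less.prems])
  finally show ?thesis unfolding fdim_M using m(1) by simp
 qed
 define TS where "TS = {t + s |t s. t : above n l & s : S}"
 have dTS: "direct TS (above n l) S" unfolding direct_def TS_def using S_Int_above by(simp add: Int_commute)
 note D = directD[OF dTS A.sub S.sub]
 have TSM: "TS \<subseteq> supp_in X" unfolding TS_def using above_supp S_supp PM.subspace_add[OF M.sub] by blast
 have repTS: "sym_rep n (prho a) TS"
 proof (rule M.subrep[OF _ TSM])
  show "PM.subspace TS" unfolding TS_def by(rule PM.subspace_sums[OF A.sub S.sub])
  fix \<sigma> v assume \<sigma>: "\<sigma> : perms n" and "v : TS"
  then obtain t s where "t : above n l" "s : S" "v = t + s" using D(3) by blast
  thus "prho a \<sigma> v : TS" using plin_add[OF plin_prho] A.closed[OF \<sigma>] S.closed[OF \<sigma>] D(4) by simp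
 qed
 interpret TS: sym_rep n "prho a" TS by(rule repTS)
 obtain Q where Q: "sym_rep n (prho a) Q" "Q \<subseteq> supp_in X" "direct (supp_in X) TS Q"
  using maschke_complement[OF sym_rep_supp_in repTS TSM] by blast
 interpret Q: sym_rep n "prho a" Q by(rule Q(1))
 have SQ: "fdim n (prho a) w S + fdim n (prho a) w Q = K (row l) (cw n w)" for w
  using dimM[of w] fdim_direct[OF sym_rep_supp_in repTS Q(1) Q(3), of w]
   fdim_direct[OF repTS sym_rep_above sym_rep_S dTS, of w] by simp
 obtain w where w: "cw n w = rms" using rwx_content rw_content tableau_exists by(metis cw_def ex_in_conv)
 have one: "fdim n (prho a) w S + fdim n (prho a) w Q = 1"
  unfolding SQ w rms_rowms by(rule K_row_diagonal[OF less.prems])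
 have Spos: "fdim n (prho a) w S > 0" by(rule fdim_submodule_pos[OF sym_rep_S S_supp S_nonzero w])
 have "Q = {0}"
 proof (rule ccontr)
  assume "Q ~= {0}"
  hence "fdim n (prho a) w Q > 0" by(rule fdim_submodule_pos[OF Q(1,2) _ w])
  thus False using one Spos by linarith
 qed
 hence Q0: "fdim n (prho a) w Q = 0" and MTS: "supp_in X = TS" for w
 proof -
  show "fdim n (prho a) w Q = 0"
   using Q.fdim_pos_iff[of w] Q.fixed_subset[of w] PM.subspace_0[OF Q.subspace_fixed[of w]] \<open>Q = {0}\<close> by auto
  show "supp_in X = TS" using Q(3) \<open>Q = {0}\<close> by(simp add: direct_def)
 qed
 have irr: "B = {0} \<or> B = S" if B: "sym_rep n (prho a) B" "B \<subseteq> S" for B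
 proof (rule ccontr)
  assume "\<not> ?thesis"
  hence B0: "B ~= {0}" "B ~= S" by auto
  interpret B: sym_rep n "prho a" B by(rule B(1))
  obtain B' where B': "sym_rep n (prho a) B'" "B' \<subseteq> S" "direct S B B'"
   using maschke_complement[OF sym_rep_S B] by blast
  interpret B': sym_rep n "prho a" B' by(rule B'(1))
  have "B' ~= {0}" using B'(3) B0(2) by(auto simp: direct_def)
  hence "fdim n (prho a) w B' > 0" using fdim_submodule_pos[OF B'(1) _ _ w] B'(2) S_supp by blast
  moreover have "fdim n (prho a) w B > 0" using fdim_submodule_pos[OF B(1) _ B0(1) w] B(2) S_supp by blast
  ultimately show False using one fdim_direct[OF sym_rep_S B(1) B'(1) B'(3), of w] by linarith
 qed
 show ?case
  unfolding splits_def using dTS MTS SQ Q0 irr by auto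
qed

text \<open>Split off a Specht module generated by a fixed vector for a word of least letter sum,
take a complement by averaging, and repeat.\<close>

theorem specht_decomposition:
 assumes V: "sym_rep n r V"
 obtains m where "has_mult n (conc r V) m"
  "!!w. fdim n r w V = (ksum n m w)"
proof -
 interpret V: sym_rep n r V by fact
 define c where "c = Suc (wsum n (%k. k) + (\<Sum>l\<in>partitions_of n. bw l))"
 have hyp: "\<exists>w. wsum n w < c & fixed n r w V' ~= {0}"
  if V': "sym_rep n r V'" "V' \<subseteq> V" "V' ~= {0}" for V'
 proof -
  interpret V': sym_rep n r V' by(rule V'(1))
  have st: "\<sigma> = id" if "\<sigma> : stab n (%k. k)" for \<sigma>
  proof
   fix k show "\<sigma> k = id k"
   using that by(cases "k : {1..n}") (auto simp: stab_def perms_def permutes_def)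
  qed
  have "x : fixed n r (%k. k) V'" if x: "x : V'" for x
  proof -
   have "r \<sigma> x = x" if "\<sigma> : stab n (%k. k)" for \<sigma> using st[OF that] V'.act_id[OF x] by simp
   thus ?thesis using x by(simp add: fixed_def)
  qed
  hence "fixed n r (%k. k) V' = V'" using V'.fixed_subset by auto
  thus ?thesis using V'(3) by(intro exI[of _ "%k. k"]) (simp add: c_def)
 qed
 obtain m where "has_mult n (conc r V) m"
  "\<forall>w. fdim n r w V = (ksum n m w)"
  using decompose[OF splits V hyp] by blast
 thus thesis using that by blast
qed

section \<open>The Frobenius characteristic counts fixed vectors\<close>

lemma linear_extension:
 fixes f :: "('x \<Rightarrow>\<^sub>0 complex) => ('y \<Rightarrow>\<^sub>0 complex)"
 assumes V: "PM.subspace V" and add: "!!u v. u : V ==> v : V ==> f (u + v) = f u + f v"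
  and scale: "!!c v. v : V ==> f (pm_scale c v) = pm_scale c (f v)"
 obtains g where "plin g" "!!v. v : V ==> g v = f v"
proof -
 obtain B where B: "B \<subseteq> V" "PM.independent B" "V \<subseteq> PM.span B" using PM.basis_exists[of V] by metis
 obtain g where g: "plin g" "\<forall>x\<in>B. g x = f x" using PMP.linear_independent_extend[OF B(2), of f] by blast
 have f0: "f 0 = 0" using scale[of 0 0] PM.subspace_0[OF V] by simp
 have "PM.span B \<subseteq> {v : V. g v = f v}"
 proof (rule PM.span_minimal)
  show "B \<subseteq> {v : V. g v = f v}" using B(1) g(2) by blast
  show "PM.subspace {v : V. g v = f v}"
   by(rule PM.subspaceI)
   (auto simp: PM.subspace_0[OF V] f0 plin_zero[OF g(1)] PM.subspace_add[OF V] PM.subspace_scale[OF V]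
   plin_add[OF g(1)] plin_scale[OF g(1)] add scale)
 qed
 thus thesis using that[of g] g(1) B(3) by blast
qed

definition iso_map where
 "iso_map n V W f \<longleftrightarrow> bij_betw f (carrier V) (carrier W) \<and>
  (\<forall>u\<in>carrier V. \<forall>v\<in>carrier V. f (u \<oplus>\<^bsub>V\<^esub> v) = f u \<oplus>\<^bsub>W\<^esub> f v) \<and>
  (\<forall>c. \<forall>v\<in>carrier V. f (c \<odot>\<^bsub>V\<^esub> v) = c \<odot>\<^bsub>W\<^esub> f v) \<and>
  (\<forall>\<sigma>\<in>perms n. \<forall>v\<in>carrier V. f (act V \<sigma> v) = act W \<sigma> (f v))"
lemma rep_iso_ex: "rep_iso n V W ==> \<exists>f. iso_map n V W f"
 by(erule rep_isoE) (auto simp: iso_map_def)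

lemma split_summand:
 assumes V: "sym_rep n r V" and W: "sym_rep n r' W"
  and iso: "rep_iso n (conc r V) (rep_plus (conc r' W) R)"
 obtains V1 V2 where "sym_rep n r V1" "sym_rep n r V2" "direct V V1 V2"
  "!!w. fdim n r w V1 = fdim n r' w W" "rep_iso n (conc r V2) R"
proof -
 interpret V: sym_rep n r V by fact
 interpret W: sym_rep n r' W by fact
 let ?V = "conc r V" and ?P = "rep_plus (conc r' W) R"
 obtain f where f: "iso_map n ?V ?P f" using rep_iso_ex[OF iso] by(rule exE)
 have bij: "bij_betw f V (W \<times> carrier R)" using f by(simp add: iso_map_def rep_plus_def)
 have f2: "f (u + v) = (%(x, y) (x', y'). (x + x', y \<oplus>\<^bsub>R\<^esub> y')) (f u) (f v)" if "u : V" "v : V" for u v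
  using f that by(simp add: iso_map_def rep_plus_def)
 have f3: "f (pm_scale c v) = (%(x, y). (pm_scale c x, c \<odot>\<^bsub>R\<^esub> y)) (f v)" if "v : V" for c v
  using f that by(simp add: iso_map_def rep_plus_def)
 have f4: "f (r \<sigma> v) = (%(x, y). (r' \<sigma> x, act R \<sigma> y)) (f v)" if "\<sigma> : perms n" "v : V" for \<sigma> v
  using f that by(simp add: iso_map_def rep_plus_def)
 define g where "g v = fst (f v)" for v
 define h where "h v = snd (f v)" for v
 have fgh: "f v = (g v, h v)" for v by(simp add: g_def h_def)
 have inj: "u = v" if "u : V" "v : V" "g u = g v" "h u = h v" for u v
  using inj_onD[OF bij_betw_imp_inj_on[OF bij], of u v] that fgh by simp
 have onto: "\<exists>v\<in>V. g v = x & h v = y" if "x : W" "y : carrier R" for x y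
 proof -
  have "(x, y) : f ` V" using bij that by(simp add: bij_betw_def)
  then obtain v where "v : V" "(x, y) = f v" by(rule imageE) auto
  thus ?thesis using fgh[of v] by(intro bexI[of _ v]) simp_all
 qed
 have gW: "g v : W" and hR: "h v : carrier R" if "v : V" for v
 proof -
  have "f v : W \<times> carrier R" using bij_betwE[OF bij] that by blast
  thus "g v : W" "h v : carrier R" by(simp_all add: fgh)
 qed
 have g2: "g (u + v) = g u + g v" and h2: "h (u + v) = h u \<oplus>\<^bsub>R\<^esub> h v" if "u : V" "v : V" for u v
  using f2[OF that] by(simp_all add: fgh)
 have g3: "g (pm_scale c v) = pm_scale c (g v)" and h3: "h (pm_scale c v) = c \<odot>\<^bsub>R\<^esub> h v" if "v : V" for c v
  using f3[OF that, of c] by(simp_all add: fgh)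
 have g4: "g (r \<sigma> v) = r' \<sigma> (g v)" and h4: "h (r \<sigma> v) = act R \<sigma> (h v)" if "\<sigma> : perms n" "v : V" for \<sigma> v
  using f4[OF that] by(simp_all add: fgh)
 define z where "z = h 0"
 have g0: "g 0 = 0" using g2[of 0 0] by simp
 have zz: "z \<oplus>\<^bsub>R\<^esub> h v = h v" "h v \<oplus>\<^bsub>R\<^esub> z = h v" if "v : V" for v
  using h2[of 0 v] h2[of v 0] that by(simp_all add: z_def)
 have cz: "c \<odot>\<^bsub>R\<^esub> z = z" for c using h3[of 0 c] by(simp add: z_def)
 have az: "act R \<sigma> z = z" if "\<sigma> : perms n" for \<sigma>
  using h4[OF that, of 0] plin_zero[OF V.lin[OF that]] by(simp add: z_def)
 define V1 where "V1 = {v : V. h v = z}"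
 define V2 where "V2 = {v : V. g v = 0}"
 have V1: "sym_rep n r V1"
 proof (rule V.subrep)
  show "PM.subspace V1"
   unfolding V1_def using zz(1)[of 0]
   by(intro PM.subspaceI)
   (auto simp: PM.subspace_add[OF V.sub] PM.subspace_scale[OF V.sub] h2 h3 cz z_def[symmetric])
 qed (auto simp: V1_def V.closed h4 az)
 have V2: "sym_rep n r V2"
 proof (rule V.subrep)
  show "PM.subspace V2"
   unfolding V2_def
   by(intro PM.subspaceI) (auto simp: PM.subspace_add[OF V.sub] PM.subspace_scale[OF V.sub] g2 g3 g0)
 qed (auto simp: V2_def V.closed g4 plin_zero[OF W.lin])
 interpret V1: sym_rep n r V1 by(rule V1)
 interpret V2: sym_rep n r V2 by(rule V2)
 have dir: "direct V V1 V2"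
  unfolding direct_def
 proof (intro conjI equalityI subsetI)
  fix v assume v: "v : V"
  obtain u1 where u1: "u1 : V" "g u1 = g v" "h u1 = z" using onto[OF gW[OF v] hR[of 0]] z_def by auto
  obtain u2 where u2: "u2 : V" "g u2 = 0" "h u2 = h v" using onto[OF W.zero_mem hR[OF v]] by auto
  have "v = u1 + u2"
   using u1 u2 v PM.subspace_add[OF V.sub u1(1) u2(1)] zz[OF v] by(intro inj) (simp_all add: g2 h2)
  thus "v : {a + b |a b. a : V1 & b : V2}" using u1 u2 by(auto simp: V1_def V2_def)
 next
  fix v assume "v : {a + b |a b. a : V1 & b : V2}"
  thus "v : V" using PM.subspace_add[OF V.sub] by(auto simp: V1_def V2_def)
 next
  fix v assume "v : V1 \<inter> V2"
  thus "v : {0}" using inj[of v 0] g0 by(auto simp: V1_def V2_def z_def)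
 qed auto
 have V1V: "V1 \<subseteq> V" by(auto simp: V1_def)
 have V2V: "V2 \<subseteq> V" by(auto simp: V2_def)
 obtain G where G: "plin G" "!!v. v : V1 ==> G v = g v"
  using linear_extension[OF V1.sub, of g] g2 g3 V1V by blast
 have iG: "intertw n V1 r r' G"
  unfolding intertw_def using G V1.closed g4 V1V by(simp add: subset_iff)
 have injG: "inj_on G V1"
 proof (rule inj_onI)
  fix u v assume "u : V1" "v : V1" "G u = G v"
  thus "u = v" using G(2) inj[of u v] by(simp add: V1_def)
 qed
 have imG: "G ` V1 = W"
 proof (intro equalityI subsetI)
  fix x assume "x : W"
  then obtain v where "v : V" "g v = x" "h v = z" using onto[OF _ hR[of 0]] z_def by auto
  thus "x : G ` V1" using G(2) by(force simp: V1_def)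
 qed (use G(2) gW V1V in auto)
 have "rep_iso n (conc r V2) R"
 proof (rule rep_isoI[of h])
  show "bij_betw h (carrier (conc r V2)) (carrier R)"
   unfolding bij_betw_def
  proof
   show "inj_on h (carrier (conc r V2))" using inj by(auto simp: inj_on_def V2_def)
   show "h ` carrier (conc r V2) = carrier R"
   proof (intro equalityI subsetI)
   fix y assume "y : carrier R"
   then obtain v where "v : V" "g v = 0" "h v = y" using onto[OF W.zero_mem] by blast
   thus "y : h ` carrier (conc r V2)" by(auto simp: V2_def)
   qed (use hR V2V in auto)
  qed
 qed (use h2 h3 h4 V2V in "auto simp: subset_iff")
 thus thesis using that[OF V1 V2 dir] fdim_iso[OF V1 iG injG imG] by simp
qed

lemma fdim_specht_sum:
 fixes I :: "(nat list \<times> 'j) set"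
 assumes "finite I" "\<forall>i\<in>I. fst i : partitions_of n" "sym_rep n r V"
  "rep_iso n (conc r V) (rep_Sum I (%(l, j). specht (young l)))"
 shows "fdim n r w V = (\<Sum>i\<in>I. K (row (fst i)) (cw n w))"
 using assms
proof (induction I arbitrary: V rule: finite_induct)
 case empty
 interpret V: sym_rep n r V by(rule empty(2))
 obtain f where "iso_map n (conc r V) (rep_Sum ({} :: (nat list \<times> 'j) set) (%(l, j). specht (young l))) f"
  using rep_iso_ex[OF empty(3)] by(rule exE)
 hence f: "bij_betw f V {% _. undefined}" by(simp add: iso_map_def rep_Sum_def)
 have "v = 0" if "v : V" for v
  using inj_onD[OF bij_betw_imp_inj_on[OF f], of v 0] bij_betwE[OF f] that V.zero_mem by simp
 hence "V = {0}" using V.zero_mem by blast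
 thus ?case
  using V.fdim_pos_iff[of w] V.fixed_subset[of w] PM.subspace_0[OF V.subspace_fixed[of w]] by auto
next
 case (insert i I)
 obtain l j where i: "i = (l, j)" by fastforce
 have l: "l : partitions_of n" using insert.prems(1) i by simp
 interpret ptab n l by unfold_locales (rule l)
 have "rep_iso n (conc r V) (rep_plus (conc (prho a) S) (rep_Sum I (%(l, j). specht (young l))))"
  using rep_iso_trans[OF insert.prems(3) rep_iso_Sum_insert[OF insert.hyps(2)]] by(simp add: i specht_S)
 then obtain V1 V2 where V: "sym_rep n r V1" "sym_rep n r V2" "direct V V1 V2"
  "fdim n r w V1 = fdim n (prho a) w S" "rep_iso n (conc r V2) (rep_Sum I (%(l, j). specht (young l)))"
  using split_summand[OF insert.prems(2) sym_rep_S] by metis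
 have "fdim n r w V = fdim n r w V1 + fdim n r w V2" by(rule fdim_direct[OF insert.prems(2) V(1-3)])
 also have "fdim n r w V1 = K (row l) (cw n w)" using splits[OF l] V(4) by(simp add: splits_def)
 also have "fdim n r w V2 = (\<Sum>i\<in>I. K (row (fst i)) (cw n w))"
  by(rule insert.IH) (use insert.prems(1) V in auto)
 finally show ?case using insert.hyps by(simp add: i)
qed

lemma fdim_has_mult:
 assumes "sym_rep n r V" "has_mult n (conc r V) m"
 shows "fdim n r w V = (ksum n m w)"
proof -
 have "fdim n r w V = (\<Sum>i\<in>(SIGMA l : partitions_of n. {..<m l}). K (row (fst i)) (cw n w))"
  using assms finite_partitions_of by(intro fdim_specht_sum) (auto simp: has_mult_def specht_sum_def)
 also have "... = (\<Sum>l\<in>partitions_of n. \<Sum>j<m l. K (row l) (cw n w))"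
  using finite_partitions_of by(subst sum.Sigma) (auto simp: case_prod_unfold)
 finally show ?thesis by simp
qed

definition mset_of :: "(nat \<Rightarrow>\<^sub>0 nat) => nat multiset" where
 "mset_of \<alpha> = (\<Sum>k\<in>keys \<alpha>. replicate_mset (lookup \<alpha> k) k)"

lemma schur_young: "l : partitions_of n ==> schur (young l) \<alpha> = int (K (row l) (mset_of \<alpha>))"
 unfolding mset_of_def by(rule schur_K) (simp add: partitions_of_def)

text \<open>A Schur function has Kostka numbers as coefficients, and so has the count of fixed
vectors of a Specht module.\<close>

lemma frob_char_fdim:
 assumes R: "rep_iso n R (conc r V)" "closed_rep n R" and V: "sym_rep n r V"
 shows "frob_char n R \<alpha> = (if size (mset_of \<alpha>) = n then int (fdim n r (SOME w. cw n w = mset_of \<alpha>) V) else 0)"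
proof -
 define F where "F = (%\<alpha>. if size (mset_of \<alpha>) = n then int (fdim n r (SOME w. cw n w = mset_of \<alpha>) V) else 0)"
 have eq: "(%\<alpha>. \<Sum>l\<in>partitions_of n. int (m l) * schur (young l) \<alpha>) = F"
  if m: "has_mult n (conc r V) m" for m
 proof
  fix \<alpha>
  have "(\<Sum>l\<in>partitions_of n. int (m l) * schur (young l) \<alpha>) =
   (\<Sum>l\<in>partitions_of n. int (m l * K (row l) (mset_of \<alpha>)))"
   by(rule sum.cong) (simp_all add: schur_young)
  also have "... = F \<alpha>"
  proof (cases "size (mset_of \<alpha>) = n")
   case True
   hence "\<exists>w. cw n w = mset_of \<alpha>" using cw_exists by metis
   hence "cw n (SOME w. cw n w = mset_of \<alpha>) = mset_of \<alpha>" by(rule someI_ex)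
   thus ?thesis using fdim_has_mult[OF V m, of "SOME w. cw n w = mset_of \<alpha>"] True by(simp add: F_def)
  next
   case False
   have "K (row l) (mset_of \<alpha>) = 0" if "l : partitions_of n" for l
   using that False by(intro K_size) (simp add: psize_row partitions_of_def)
   thus ?thesis using False by(simp add: F_def)
  qed
  finally show "(\<Sum>l\<in>partitions_of n. int (m l) * schur (young l) \<alpha>) = F \<alpha>" .
 qed
 obtain m where m: "has_mult n (conc r V) m" using specht_decomposition[OF V] by blast
 have "frob_char n R = F"
  unfolding frob_char_def specht_sum_def[symmetric] has_mult_def[symmetric]
 proof (rule the_equality)
  show "\<exists>m. has_mult n R m & F = (%\<alpha>. \<Sum>l\<in>partitions_of n. int (m l) * schur (young l) \<alpha>)"
   using has_mult_iso[OF R(1) m] eq[OF m] by metis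
  fix f assume "\<exists>m. has_mult n R m & f = (%\<alpha>. \<Sum>l\<in>partitions_of n. int (m l) * schur (young l) \<alpha>)"
  then obtain m' where m': "has_mult n R m'" "f = (%\<alpha>. \<Sum>l\<in>partitions_of n. int (m' l) * schur (young l) \<alpha>)" by blast
  have "has_mult n (conc r V) m'" by(rule has_mult_iso[OF rep_iso_sym[OF R] m'(1)])
  from eq[OF this] show "f = F" using m'(2) by simp
 qed
 thus ?thesis by(simp add: F_def)
qed

lemma has_mult_unique_iso:
 assumes "has_mult n R m" "has_mult n R' m'" "closed_rep n R'" "!!l. l : partitions_of n ==> m l = m' l"
 shows "rep_iso n R R'"
proof -
 have "(SIGMA l : partitions_of n. {..<m l}) = (SIGMA l : partitions_of n. {..<m' l})" using assms(4) by auto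
 hence "specht_sum n m = specht_sum n m'" by(simp add: specht_sum_def)
 thus ?thesis using rep_iso_trans[OF _ rep_iso_sym] assms(1-3) unfolding has_mult_def by metis
qed

section \<open>Leading terms\<close>

lemma dim_ge_independent:
 assumes "finite Y" "W \<subseteq> supp_in Y" "B \<subseteq> W" "PM.independent B"
 shows "card B <= PM.dim W"
proof -
 obtain C where C: "C \<subseteq> W" "PM.independent C" "W \<subseteq> PM.span C" "card C = PM.dim W"
  using PM.basis_exists[of W] by auto
 have "finite C" by(rule independent_in_supp_in[OF assms(1) _ C(2)]) (use C(1) assms(2) in auto)
 thus ?thesis using PM.independent_span_bound[of C B] assms(3,4) C(3,4) by auto
qed

text \<open>A vector whose coefficients at all possible leading terms vanish has no leading term, so
it is zero.\<close>

lemma dim_le_leading: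
 fixes Y L :: "'k::linorder set"
 assumes Y: "finite Y" "W \<subseteq> supp_in Y" and W: "PM.subspace W" and L: "finite L"
  and lead: "!!p. p : W ==> p ~= 0 ==> Max (keys p) : L"
 shows "PM.dim W <= card L"
proof -
 define r :: "('k \<Rightarrow>\<^sub>0 complex) => ('k \<Rightarrow>\<^sub>0 complex)" where
  "r p = (\<Sum>y\<in>L. single y (lookup p y))" for p
 have lr: "lookup (r p) y = (if y : L then lookup p y else 0)" for p y
  using L by(simp add: r_def lookup_sum lookup_single when_def)
 have lin: "plin r"
  by(rule plinI) (simp_all add: r_def lookup_add single_add sum.distrib lookup_pm_scale PM.scale_sum_right pm_scale_single)
 have inj: "inj_on r W"
 proof (rule inj_onI)
  fix p q assume pq: "p : W" "q : W" "r p = r q"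
  have d: "p - q : W" by(rule PM.subspace_diff[OF W pq(1,2)])
  show "p = q"
  proof (rule ccontr)
   assume "p ~= q"
   hence nz: "p - q ~= 0" by simp
   let ?y = "Max (keys (p - q))"
   have "keys (p - q) ~= {}" using nz by simp
   hence "?y : keys (p - q)" by(intro Max_in) auto
   hence "lookup (p - q) ?y ~= 0" by(simp add: in_keys_iff)
   moreover have "lookup (r (p - q)) ?y = 0"
   using pq(3) by(simp add: plin_diff[OF lin])
   ultimately show False using lead[OF d nz] by(simp add: lr)
  qed
 qed
 have "PM.dim W = PM.dim (r ` W)" by(rule dim_inj_image[OF lin W inj, symmetric])
 also have "r ` W \<subseteq> PM.span ((%y. single y 1) ` L)"
  unfolding supp_in_span[OF L, symmetric] by(auto simp: supp_in_lookup lr)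
 hence "PM.dim (r ` W) <= card ((%y. single y (1::complex)) ` L)"
  by(rule PM.dim_le_card) (use L in simp)
 also have "... <= card L" by(rule card_image_le[OF L])
 finally show ?thesis .
qed

lemma dim_ge_leading:
 fixes Y L :: "'k::linorder set"
 assumes Y: "finite Y" "W \<subseteq> supp_in Y" and L: "finite L"
  and lead: "!!y. y : L ==> \<exists>p\<in>W. p ~= 0 & Max (keys p) = y"
 shows "card L <= PM.dim W"
proof -
 obtain g where g: "!!y. y : L ==> g y : W & g y ~= 0 & Max (keys (g y)) = y"
  using lead by metis
 have top: "lookup (g y) y ~= 0" if "y : L" for y
 proof -
  have "Max (keys (g y)) : keys (g y)" using g[OF that] by(intro Max_in) auto
  thus ?thesis using g[OF that] by(simp add: in_keys_iff)
 qed
 have above: "lookup (g y) z = 0" if "y : L" "y < z" for y z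
 proof (rule ccontr)
  assume "lookup (g y) z ~= 0"
  hence "z : keys (g y)" by(simp add: in_keys_iff)
  hence "z <= y" using g[OF that(1)] Max_ge[OF finite_keys] by metis
  thus False using that(2) by simp
 qed
 have inj: "inj_on g L" by(rule inj_onI) (metis g)
 have "PM.independent (g ` L)"
 proof
  assume "PM.dependent (g ` L)"
  then obtain u where u: "\<exists>v\<in>g ` L. u v ~= 0" "(\<Sum>v\<in>g ` L. pm_scale (u v) v) = 0"
   using PM.dependent_finite[of "g ` L"] L by auto
  define N where "N = {y : L. u (g y) ~= 0}"
  have N: "finite N" "N ~= {}" using u(1) L by(auto simp: N_def)
  define z where "z = Max N"
  have z: "z : L" "u (g z) ~= 0" using Max_in[OF N] by(auto simp: z_def N_def)
  have "(\<Sum>y\<in>L. u (g y) * lookup (g y) z) = 0"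
   using arg_cong[OF u(2), of "%p. lookup p z"]
   by(simp add: lookup_sum lookup_pm_scale sum.reindex[OF inj])
  also have "(\<Sum>y\<in>L. u (g y) * lookup (g y) z) = (\<Sum>y\<in>{z}. u (g y) * lookup (g y) z)"
  proof (rule sum.mono_neutral_right[OF L])
   show "\<forall>y\<in>L - {z}. u (g y) * lookup (g y) z = 0"
   proof
   fix y assume y: "y : L - {z}"
   show "u (g y) * lookup (g y) z = 0"
   proof (cases "u (g y) = 0")
   case False
   hence "y : N" using y by(simp add: N_def)
   hence "y <= z" unfolding z_def using N(1) by(intro Max_ge)
   hence "y < z" using y by(simp add: order.strict_iff_order)
   thus ?thesis using above[of y z] y by simp
   qed simp
   qed
  qed (use z in auto)
  finally show False using z top by simp
 qed
 hence "card (g ` L) <= PM.dim W" using g by(intro dim_ge_independent[OF Y]) auto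
 thus ?thesis by(simp add: card_image[OF inj])
qed

lemma image_mset_eq_bij:
 assumes "finite A" "finite B" "image_mset f (mset_set A) = image_mset g (mset_set B)"
 obtains h where "bij_betw h A B" "!!x. x : A ==> f x = g (h x)"
proof -
 have "card A = card B" using arg_cong[OF assms(3), of size] by simp
 then obtain e where e: "bij_betw e A B" using finite_same_card_bij assms(1,2) by blast
 hence "image_mset (%x. g (e x)) (mset_set A) = image_mset g (mset_set B)"
  using image_mset_mset_set[of e A] by(simp add: bij_betw_def image_mset.compositionality[symmetric, unfolded comp_def])
 then obtain p where p: "p permutes A" "\<forall>x\<in>A. f x = g (e (p x))"
  using image_mset_eq_implies_permutes[OF assms(1), of f "%x. g (e x)"] assms(3) by metis
 have "bij_betw (%x. e (p x)) A B"
  using bij_betw_trans[OF permutes_imp_bij[OF p(1)] e] by(simp add: comp_def)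
 thus thesis using that p(2) by blast
qed

section \<open>The alternating ribbon\<close>

text \<open>Fillings of the ribbon with descent set \<open>{2, 4, ..., 2 * m}\<close>, listed by rows from the bottom.\<close>

definition SSL :: "nat => nat multiset => nat list list set" where
 "SSL m W = {y. length y = Suc m & (\<forall>j<m. length (y ! j) = 2) & (\<forall>j<Suc m. sorted (y ! j)) \<and>
   mset (concat y) = W & (\<forall>j<m. y ! Suc j ! 0 < y ! j ! 1)}"

lemma finite_lists_by_concat: "finite {y. length y = k & mset (concat y) = W}"
proof (rule finite_subset)
 let ?L = "{xs. set xs \<subseteq> set_mset W & length xs <= size W}"
 show "{y. length y = k & mset (concat y) = W} \<subseteq> {y. set y \<subseteq> ?L & length y = k}"
 proof
  fix y assume y: "y : {y. length y = k & mset (concat y) = W}"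
  have "x : ?L" if "x : set y" for x
  proof -
   obtain ys zs where "y = ys @ x # zs" using \<open>x : set y\<close> by(meson split_list)
   hence "mset (concat y) = mset (concat ys) + mset x + mset (concat zs)" by simp
   hence "W = mset (concat ys) + mset x + mset (concat zs)" using y by simp
   thus ?thesis by auto
  qed
  thus "y : {y. set y \<subseteq> ?L & length y = k}" using y by auto
 qed
 show "finite {y. set y \<subseteq> ?L & length y = k}"
  by(intro finite_lists_length_eq finite_lists_length_le) auto
qed

lemma finite_SSL: "finite (SSL m W)"
 by(rule finite_subset[OF _ finite_lists_by_concat[of "Suc m" W]]) (auto simp: SSL_def)

locale even_ribbon =
 fixes n m :: nat
 assumes nm: "2 * m < n"
begin

definition len where "len j = (if j < m then 2 else n - 2 * m)"
abbreviation D where "D \<equiv> ribbon (Even (2 * m)) n"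

lemma even_sub: "Even (2 * m) \<subseteq> {1..<n}"
 using nm by(auto simp: Even_def)

lemma len_pos: "len j > 0"
 using nm by(simp add: len_def)
lemma even_image: "Even (2 * m) = (%i. 2 * i) ` {1..m}"
 by(auto simp: Even_def image_iff elim!: evenE)

lemma cell_coord:
 assumes "j <= m" "p < len j"
 shows "ribbon_cell (Even (2 * m)) (2 * j + p + 1) = (m - j, j + p)"
proof -
 have "{i : Even (2 * m). 2 * j + p + 1 <= i} = (%i. 2 * i) ` {j + 1..m}"
  using assms by(auto simp: even_image len_def split: if_splits)
 hence f: "fst (ribbon_cell (Even (2 * m)) (2 * j + p + 1)) = m - j"
  by(simp add: ribbon_cell_def card_image inj_on_def)
 have "card (Even (2 * m)) = m" by(simp add: even_image card_image inj_on_def)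
 hence "snd (ribbon_cell (Even (2 * m)) (2 * j + p + 1)) = j + p"
  using ribbon_cell_eq[OF even_sub, of "2 * j + p + 1"] f assms(1) by simp
 with f show ?thesis by(simp add: prod_eq_iff)
qed

definition coords where "coords = (SIGMA j:{..m}. {..<len j})"
definition cell where "cell = (%(j, p). (m - j, j + p))"

lemma D_coords: "D = cell ` coords"
proof (intro equalityI subsetI)
 fix c assume "c : D"
 then obtain k where k: "k : {1..n}" "c = ribbon_cell (Even (2 * m)) k" by(auto simp: ribbon_def)
 define j where "j = min m ((k - 1) div 2)"
 define p where "p = k - 1 - 2 * j"
 have "j <= m" by(simp add: j_def)
 moreover have "k = 2 * j + p + 1" using k(1) by(auto simp: j_def p_def min_def)
 moreover have "p < len j"
  using k(1) by(auto simp: len_def p_def j_def min_def split: if_splits)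
 ultimately show "c : cell ` coords" using cell_coord k(2) by(force simp: coords_def cell_def)
next
 fix c assume "c : cell ` coords"
 then obtain j p where jp: "j <= m" "p < len j" "c = (m - j, j + p)" by(auto simp: coords_def cell_def)
 have "2 * j + p + 1 : {1..n}" using jp nm by(auto simp: len_def split: if_splits)
 thus "c : D" using cell_coord[OF jp(1,2)] jp(3) by(metis imageI ribbon_def)
qed
lemma cell_inj: "inj_on cell coords"
 by(auto simp: inj_on_def cell_def coords_def)

lemma cell_D: "j <= m ==> p < len j ==> (m - j, j + p) : D"
 unfolding D_coords by(force simp: coords_def cell_def)

lemma D_cases:
 assumes "c : D"
 obtains j p where "j <= m" "p < len j" "c = (m - j, j + p)"
 using assms unfolding D_coords coords_def cell_def by auto

sublocale tab n D
proof
 show "finite D" by(simp add: ribbon_def)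
 show "card D = n" by(rule card_ribbon[OF even_sub])
qed

lemma row_cells:
 assumes "j <= m"
 shows "{c : D. fst c = m - j} = (%p. (m - j, j + p)) ` {..<len j}"
proof (intro equalityI subsetI)
 fix c assume "c : {c : D. fst c = m - j}"
 hence c: "c : D" "fst c = m - j" by auto
 obtain j' p where jp: "j' <= m" "p < len j'" "c = (m - j', j' + p)" using c(1) by(rule D_cases)
 have "j' = j" using jp(1,3) c(2) assms by simp
 thus "c : (%p. (m - j, j + p)) ` {..<len j}" using jp by simp
qed (use cell_D[OF assms] in auto)

definition blocks where
 "blocks T = map (%j. map (%p. T (m - j, j + p)) [0..<len j]) [0..<Suc m]"
lemma length_blocks [simp]: "length (blocks T) = Suc m"
 by(simp add: blocks_def del: upt_Suc)
lemma blocks_nth: "j <= m ==> blocks T ! j = map (%p. T (m - j, j + p)) [0..<len j]"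
 by(simp add: blocks_def del: upt_Suc)

lemma mset_concat_blocks: "mset (concat (blocks T)) = image_mset T (mset_set D)"
proof -
 have "image_mset T (mset_set D) = image_mset (%x. T (cell x)) (mset_set coords)"
  unfolding D_coords image_mset_mset_set[OF cell_inj, symmetric]
  by(simp add: image_mset.compositionality comp_def)
 also have "mset_set coords = mset (concat (map (%j. map (Pair j) [0..<len j]) [0..<Suc m]))"
 proof -
  have "distinct (concat (map (%j. map (Pair j) [0..<len j]) [0..<Suc m]))"
  proof (rule distinct_concat)
   have hd_eq: "hd (map (Pair x) [0..<len x]) = (x, 0)" for x
   using len_pos[of x] by(simp add: hd_map)
   have "inj_on (%j. map (Pair j) [0..<len j]) (set [0..<Suc m])"
   proof (rule inj_onI)
   fix x y assume "map (Pair x) [0..<len x] = map (Pair y) [0..<len y]"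
   hence "hd (map (Pair x) [0..<len x]) = hd (map (Pair y) [0..<len y])" by(rule arg_cong)
   hence "(x, 0::nat) = (y, 0)" unfolding hd_eq .
   thus "x = y" by simp
   qed
   thus "distinct (map (%j. map (Pair j) [0..<len j]) [0..<Suc m])"
   unfolding distinct_map by simp
  next
   fix ys assume "ys : set (map (%j. map (Pair j) [0..<len j]) [0..<Suc m])"
   then obtain j where "ys = map (Pair j) [0..<len j]" unfolding set_map by blast
   thus "distinct ys" by(simp add: distinct_map inj_on_def)
  next
   fix ys zs assume "ys : set (map (%j. map (Pair j) [0..<len j]) [0..<Suc m])"
   "zs : set (map (%j. map (Pair j) [0..<len j]) [0..<Suc m])" "ys ~= zs"
   then obtain j j' where "ys = map (Pair j) [0..<len j]" "zs = map (Pair j') [0..<len j']" "j ~= j'"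
   unfolding set_map by blast
   thus "set ys \<inter> set zs = {}" by auto
  qed
  moreover have "set (concat (map (%j. map (Pair j) [0..<len j]) [0..<Suc m])) = coords"
   by(auto simp: coords_def image_iff less_Suc_eq_le simp del: upt_Suc)
  ultimately show ?thesis by(metis mset_set_set)
 qed
 also have "image_mset (%x. T (cell x)) ... = mset (concat (blocks T))"
  by(simp add: blocks_def mset_map[symmetric] map_concat cell_def comp_def del: upt_Suc mset_map)
 finally show ?thesis by simp
qed
lemma len_lt: "j < m ==> len j = 2"
 by(simp add: len_def)

lemma semistandard_blocks:
 assumes T: "T : D \<rightarrow>\<^sub>E UNIV"
 shows "T : semistandard D \<longleftrightarrow> (\<forall>j<Suc m. sorted (blocks T ! j)) & (\<forall>j<m. blocks T ! Suc j ! 0 < blocks T ! j ! 1)"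
proof -
 have rows: "(\<forall>i q q'. (i, q) : D & (i, q') : D & q < q' \<longrightarrow> T (i, q) <= T (i, q')) \<longleftrightarrow>
   (\<forall>j<Suc m. sorted (blocks T ! j))"
 proof
  assume *: "\<forall>i q q'. (i, q) : D & (i, q') : D & q < q' \<longrightarrow> T (i, q) <= T (i, q')"
  show "\<forall>j<Suc m. sorted (blocks T ! j)"
  proof (intro allI impI)
   fix j assume "j < Suc m"
   hence j: "j <= m" by simp
   have "T (m - j, j + p) <= T (m - j, j + p')" if "p < p'" "p' < len j" for p p'
   using *[rule_format, of "m - j" "j + p" "j + p'"] that cell_D[OF j] by simp
   thus "sorted (blocks T ! j)"
   by(simp add: blocks_nth[OF j] sorted_iff_nth_mono_less)
  qed
 next
  assume *: "\<forall>j<Suc m. sorted (blocks T ! j)"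
  show "\<forall>i q q'. (i, q) : D & (i, q') : D & q < q' \<longrightarrow> T (i, q) <= T (i, q')"
  proof (intro allI impI)
   fix i q q' assume h: "(i, q) : D & (i, q') : D & q < q'"
   obtain j p where c: "j <= m" "p < len j" "(i, q) = (m - j, j + p)" using h D_cases by blast
   obtain j' p' where c': "j' <= m" "p' < len j'" "(i, q') = (m - j', j' + p')" using h D_cases by blast
   have jj: "j' = j" using c c' by auto
   have "sorted (blocks T ! j)" using * c(1) by simp
   hence "blocks T ! j ! p <= blocks T ! j ! p'"
   by(rule sorted_nth_mono) (use c c' h jj in "auto simp: blocks_nth")
   thus "T (i, q) <= T (i, q')" using c c' jj by(simp add: blocks_nth)
  qed
 qed
 have cols: "(\<forall>i i' q. (i, q) : D & (i', q) : D & i < i' \<longrightarrow> T (i, q) < T (i', q)) \<longleftrightarrow>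
   (\<forall>j<m. blocks T ! Suc j ! 0 < blocks T ! j ! 1)"
 proof
  assume *: "\<forall>i i' q. (i, q) : D & (i', q) : D & i < i' \<longrightarrow> T (i, q) < T (i', q)"
  show "\<forall>j<m. blocks T ! Suc j ! 0 < blocks T ! j ! 1"
  proof (intro allI impI)
   fix j assume j: "j < m"
   have "(m - Suc j, Suc j) : D" "(m - j, Suc j) : D"
   using cell_D[of "Suc j" 0] cell_D[of j 1] j len_pos len_lt[OF j] by auto
   hence "T (m - Suc j, Suc j) < T (m - j, Suc j)" using * j by simp
   thus "blocks T ! Suc j ! 0 < blocks T ! j ! 1"
   using j len_pos[of "Suc j"] len_lt[OF j] by(simp add: blocks_nth)
  qed
 next
  assume *: "\<forall>j<m. blocks T ! Suc j ! 0 < blocks T ! j ! 1"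
  show "\<forall>i i' q. (i, q) : D & (i', q) : D & i < i' \<longrightarrow> T (i, q) < T (i', q)"
  proof (intro allI impI)
   fix i i' q assume h: "(i, q) : D & (i', q) : D & i < i'"
   obtain j p where c: "j <= m" "p < len j" "(i, q) = (m - j, j + p)" using h D_cases by blast
   obtain j' p' where c': "j' <= m" "p' < len j'" "(i', q) = (m - j', j' + p')" using h D_cases by blast
   have lt: "j' < j" "j' < m" using c c' h by auto
   hence "p' < 2" using c'(2) by(simp add: len_def)
   hence e: "j = Suc j'" "p' = 1" "p = 0" using c c' lt by auto
   have "blocks T ! Suc j' ! 0 < blocks T ! j' ! 1" using * lt by blast
   thus "T (i, q) < T (i', q)"
   using c c' lt len_pos[of "Suc j'"] unfolding e by(simp add: blocks_nth len_lt)
  qed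
 qed
 show ?thesis unfolding semistandard_def using T rows cols by blast
qed

lemma blocks_in_SSL:
 assumes "T : semistandard D"
 shows "blocks T : SSL m (image_mset T (mset_set D))"
proof -
 have "T : D \<rightarrow>\<^sub>E UNIV" using assms by(simp add: semistandard_def)
 from semistandard_blocks[OF this] assms show ?thesis
  by(auto simp: SSL_def mset_concat_blocks blocks_nth len_lt)
qed

lemma SSL_length_last:
 assumes "y : SSL m W" "size W = n" "j <= m"
 shows "length (y ! j) = len j"
proof (cases "j < m")
 case True
 thus ?thesis using assms(1) by(simp add: SSL_def len_def)
next
 case False
 have "n = (\<Sum>j<Suc m. length (y ! j))"
 proof -
  have "n = length (concat y)" using assms(1,2) by(auto simp: SSL_def simp flip: size_mset)
  also have "... = (\<Sum>j<Suc m. length (y ! j))"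
   using assms(1) by(simp add: SSL_def length_concat sum_list_sum_nth atLeast0LessThan)
  finally show ?thesis .
 qed
 also have "... = (\<Sum>j<m. 2) + length (y ! m)" using assms(1) by(simp add: SSL_def)
 finally have "length (y ! m) = n - 2 * m" by simp
 thus ?thesis using False assms(3) by(simp add: len_def)
qed

lemma blocks_surj:
 assumes y: "y : SSL m W" and W: "size W = n"
 obtains T where "T : semistandard D" "blocks T = y"
proof -
 define T where "T = (\<lambda>c\<in>D. y ! (m - fst c) ! (snd c - (m - fst c)))"
 have val: "T (m - j, j + p) = y ! j ! p" if "j <= m" "p < len j" for j p
  using that cell_D[OF that] by(simp add: T_def)
 have bl: "blocks T = y"
 proof (rule nth_equalityI)
  show "length (blocks T) = length y" using y by(simp add: SSL_def)
  fix j assume "j < length (blocks T)"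
  hence j: "j <= m" by simp
  show "blocks T ! j = y ! j"
   by(rule nth_equalityI) (simp_all add: blocks_nth[OF j] SSL_length_last[OF y W j] val[OF j])
 qed
 have "T : D \<rightarrow>\<^sub>E UNIV" by(simp add: T_def)
 from semistandard_blocks[OF this] y have "T : semistandard D" by(simp add: bl SSL_def)
 thus thesis using that bl by blast
qed

lemma card_semistandard:
 assumes W: "size W = n"
 shows "card {T : semistandard D. image_mset T (mset_set D) = W} = card (SSL m W)"
proof (rule bij_betw_same_card[where f = blocks], unfold bij_betw_def, intro conjI)
 show "inj_on blocks {T : semistandard D. image_mset T (mset_set D) = W}"
 proof (rule inj_onI)
  fix T U assume T: "T : {T : semistandard D. image_mset T (mset_set D) = W}"
   and U: "U : {T : semistandard D. image_mset T (mset_set D) = W}" and eq: "blocks T = blocks U"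
  show "T = U"
  proof (rule extensionalityI[of _ D])
   show "T : extensional D" "U : extensional D" using T U by(auto simp: semistandard_def PiE_iff)
   fix c assume "c : D"
   then obtain j p where c: "j <= m" "p < len j" "c = (m - j, j + p)" by(rule D_cases)
   have "blocks T ! j ! p = blocks U ! j ! p" using eq by simp
   thus "T c = U c" using c by(simp add: blocks_nth)
  qed
 qed
 show "blocks ` {T : semistandard D. image_mset T (mset_set D) = W} = SSL m W"
 proof (intro equalityI subsetI)
  fix y assume y: "y : SSL m W"
  obtain T where T: "T : semistandard D" "blocks T = y" by(rule blocks_surj[OF y W])
  have "image_mset T (mset_set D) = W" using mset_concat_blocks[of T] y T(2) by(simp add: SSL_def)
  thus "y : blocks ` {T : semistandard D. image_mset T (mset_set D) = W}" using T by blast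
 qed (use blocks_in_SSL in auto)
qed

lemma schur_ribbon: "schur D \<alpha> = (if size (mset_of \<alpha>) = n then int (card (SSL m (mset_of \<alpha>))) else 0)"
proof -
 have B: "count (mset_of \<alpha>) k = lookup \<alpha> k" for k
  by(auto simp: mset_of_def count_sum in_keys_iff)
 have eq: "{T : semistandard D. \<forall>k. card {c : D. T c = k} = lookup \<alpha> k} =
   {T : semistandard D. image_mset T (mset_set D) = mset_of \<alpha>}"
  unfolding multiset_eq_iff B using finD by(auto simp: count_image_mset_eq_card_vimage)
 show ?thesis
 proof (cases "size (mset_of \<alpha>) = n")
  case True
  thus ?thesis unfolding schur_def eq by(simp add: card_semistandard)
 next
  case False
  have "image_mset T (mset_set D) ~= mset_of \<alpha>" for T
   using False cardD by(metis size_image_mset size_mset_set)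
  thus ?thesis unfolding schur_def eq using False by simp
 qed
qed

end

lemma sorted_pair: "length xs = 2 ==> xs = [xs ! 0, xs ! (1::nat)]"
 by(cases xs; cases "tl xs") auto

text \<open>Among the sorted pairs drawn from \<open>a \<le> b\<close> and further letters \<open>\<ge> b\<close>, \<open>[a, b]\<close> is least.\<close>

lemma least_pair:
 fixes a b a' b' :: nat
 assumes "a <= b" "\<forall>x\<in>#Z. b <= x" "{#a', b'#} + Z' = {#a, b#} + Z" "a' <= b'" "[a', b'] ~= [a, b]"
 shows "[a, b] < [a', b']"
proof -
 have "a' \<in># {#a, b#} + Z" using assms(3)[symmetric] by simp
 hence "a <= a'" using assms(1,2) by auto
 moreover have "b < b'" if "a' = a"
 proof -
  have "{#b'#} + Z' = {#b#} + Z" using assms(3) that by simp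
  hence "b' \<in># {#b#} + Z" by(metis add_mset_add_single union_commute union_single_eq_member)
  hence "b <= b'" using assms(2) by auto
  thus ?thesis using assms(5) that by auto
 qed
 ultimately show ?thesis by auto
qed

text \<open>Lists of lists are compared at the first place where they differ.\<close>

lemma lex_less_at:
 fixes y y' :: "'a::linorder list"
 assumes "length y = length y'" "i < length y" "!!j. j < i ==> y ! j = y' ! j" "y ! i < y' ! i"
 shows "y < y'"
 using assms
proof (induction y y' arbitrary: i rule: list_induct2)
 case (Cons x xs y ys)
 show ?case
 proof (cases i)
  case 0
  thus ?thesis using Cons.prems(3) by simp
 next
  case (Suc k)
  have "x = y" using Cons.prems(2)[of 0] Suc by simp
  moreover have "xs < ys"
  proof (rule Cons.IH[of k])
   show "xs ! j = ys ! j" if "j < k" for j using Cons.prems(2)[of "Suc j"] that Suc by simp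
  qed (use Cons.prems Suc in auto)
  ultimately show ?thesis by simp
 qed
qed simp

context even_ribbon
begin

definition rm where
 "rm w x j = image_mset w (mset_set {k : {1..n}. rwx x k = m - j})"

definition key where
 "key w x = map (%j. sorted_list_of_multiset (rm w x j)) [0..<Suc m]"
lemma length_key [simp]: "length (key w x) = Suc m"
 by(simp add: key_def del: upt_Suc)
lemma key_nth: "j <= m ==> key w x ! j = sorted_list_of_multiset (rm w x j)"
 by(simp add: key_def del: upt_Suc)

lemma rm_tabloid:
 assumes T: "T : tableaux D" and j: "j <= m"
 shows "rm w (tabloid D T) j = image_mset (%p. w (T (m - j, j + p))) (mset_set {..<len j})"
proof -
 have "{k : {1..n}. rwx (tabloid D T) k = m - j} = {k : {1..n}. rw T k = m - j}"
  using rwx_tabloid[OF T] by auto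
 also have "... = T ` {c : D. fst c = m - j}" by(rule row_image[OF T, symmetric])
 also have "... = (%p. T (m - j, j + p)) ` {..<len j}" unfolding row_cells[OF j] by(simp add: image_image)
 finally have e: "{k : {1..n}. rwx (tabloid D T) k = m - j} = (%p. T (m - j, j + p)) ` {..<len j}" .
 have "inj_on (%p. T (m - j, j + p)) {..<len j}"
 proof (rule inj_onI)
  fix p p' assume "p : {..<len j}" "p' : {..<len j}" "T (m - j, j + p) = T (m - j, j + p')"
  thus "p = p'" using inj_onD[OF tabD(2)[OF T], of "(m - j, j + p)" "(m - j, j + p')"] cell_D[OF j] by simp
 qed
 thus ?thesis unfolding rm_def e
  by(simp add: image_mset_mset_set[symmetric] image_mset.compositionality comp_def)
qed

lemma rwx_le:
 assumes "x : X" "k : {1..n}"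
 shows "rwx x k <= m"
proof -
 obtain T where T: "T : tableaux D" "x = tabloid D T" using assms(1) by(auto simp: X_def)
 obtain c where c: "c : D" "T c = k" "rw T k = fst c" using tab_cell[OF T(1) assms(2)] by blast
 from c(1) obtain j p where "c = (m - j, j + p)" by(rule D_cases)
 thus ?thesis using c(3) rwx_tabloid[OF T(1) assms(2)] T(2) by simp
qed

lemma pairing_count:
 "count (pairing w x) (i, b) = card {k : {1..n}. rwx x k = i & w k = b}"
 by(simp add: pairing_def count_image_mset_eq_card_vimage conj_assoc)
lemma rm_count: "count (rm w x j) b = card {k : {1..n}. rwx x k = m - j & w k = b}"
 by(simp add: rm_def count_image_mset_eq_card_vimage conj_assoc)

lemma key_sep:
 assumes x: "x : X" and y: "y : X"
 shows "key w x = key w y \<longleftrightarrow> (\<exists>\<sigma>\<in>stab n w. y = a \<sigma> x)"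
proof -
 have "key w x = key w y \<longleftrightarrow> (\<forall>j\<le>m. rm w x j = rm w y j)"
 proof
  assume e: "key w x = key w y"
  show "\<forall>j\<le>m. rm w x j = rm w y j"
  proof (intro allI impI)
   fix j assume j: "j <= m"
   have "sorted_list_of_multiset (rm w x j) = sorted_list_of_multiset (rm w y j)"
   using e key_nth[OF j] by metis
   thus "rm w x j = rm w y j" by(metis mset_sorted_list_of_multiset)
  qed
 qed (simp add: key_def del: upt_Suc)
 also have "... \<longleftrightarrow> pairing w x = pairing w y"
 proof
  assume e: "\<forall>j\<le>m. rm w x j = rm w y j"
  show "pairing w x = pairing w y"
  proof (rule multiset_eqI)
   fix q :: "nat \<times> nat"
   obtain i b where q: "q = (i, b)" by fastforce
   show "count (pairing w x) q = count (pairing w y) q"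
   proof (cases "i <= m")
   case True
   hence "rm w x (m - i) = rm w y (m - i)" using e by simp
   hence "count (rm w x (m - i)) b = count (rm w y (m - i)) b" by simp
   thus ?thesis using True unfolding q pairing_count rm_count by simp
   next
   case False
   hence e0: "{k : {1..n}. rwx z k = i & w k = b} = {}" if "z : X" for z
   using rwx_le[OF that] by auto
   show ?thesis unfolding q pairing_count by(simp only: e0[OF x] e0[OF y])
   qed
  qed
 next
  assume e: "pairing w x = pairing w y"
  show "\<forall>j\<le>m. rm w x j = rm w y j"
  proof (intro allI impI multiset_eqI)
   fix j b
   have "count (pairing w x) (m - j, b) = count (pairing w y) (m - j, b)" using e by simp
   thus "count (rm w x j) b = count (rm w y j) b" unfolding pairing_count rm_count .
  qed
 qed
 also have "... \<longleftrightarrow> (\<exists>\<sigma>\<in>stab n w. y = a \<sigma> x)" by(rule pairing_sep[OF x y])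
 finally show ?thesis .
qed

text \<open>Merging rows \<open>i\<close> and \<open>i + 1\<close> kills every polytabloid, since the two cells of the column
 joining these rows can be exchanged.\<close>

definition merge where
 "merge i f = (%j. if j = i \<or> j = Suc i then f i + f (Suc i) else if j <= m then f j else {#})"

lemma merge_polytabloid:
 assumes i: "i < m" and T: "T : tableaux D"
 shows "push_keys (%x. merge i (rm w x)) (polytabloid D T) = 0"
proof -
 define c1 where "c1 = (m - i, Suc i)"
 define c2 where "c2 = (m - Suc i, Suc i)"
 have cD: "c1 : D" "c2 : D" using cell_D[of i 1] cell_D[of "Suc i" 0] i len_pos len_lt[OF i]
  by(auto simp: c1_def c2_def)
 have cne: "c1 ~= c2" using i by(auto simp: c1_def c2_def)
 have two: "c = c1 \<or> c = c2" if "c : D" "snd c = Suc i" for c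
 proof -
  from that(1) obtain j p where c: "j <= m" "p < len j" "c = (m - j, j + p)" by(rule D_cases)
  have jp: "j + p = Suc i" using that(2) c(3) by simp
  hence "p < 2" using c(2) i by(auto simp: len_def split: if_splits)
  hence "(j = i & p = 1) \<or> (j = Suc i & p = 0)" using jp by auto
  thus ?thesis using c(3) by(auto simp: c1_def c2_def)
 qed
 define \<tau> where "\<tau> = Transposition.transpose (T c1) (T c2)"
 have Tne: "T c1 ~= T c2" using inj_onD[OF tabD(2)[OF T] _ cD] cne by blast
 have tp: "\<tau> : perms n" unfolding \<tau>_def perms_def using tab_in[OF T] cD by(simp add: permutes_swap_id)
 have tc: "\<tau> : col T"
 proof -
  have "\<tau> ` T ` {c : D. snd c = j} = T ` {c : D. snd c = j}" for j
  proof (cases "j = Suc i")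
   case True
   hence "T c1 : T ` {c : D. snd c = j}" "T c2 : T ` {c : D. snd c = j}"
   using cD by(auto simp: c1_def c2_def)
   thus ?thesis unfolding \<tau>_def by(intro transpose_image_eq) simp
  next
   case False
   have "\<tau> k = k" if k: "k : T ` {c : D. snd c = j}" for k
   proof -
   obtain c where c: "c : D" "snd c = j" "k = T c" using k by blast
   hence "c ~= c1" "c ~= c2" using False by(auto simp: c1_def c2_def)
   hence "k ~= T c1" "k ~= T c2"
   using inj_onD[OF tabD(2)[OF T] _ c(1) cD(1)] inj_onD[OF tabD(2)[OF T] _ c(1) cD(2)] c(3) by auto
   thus ?thesis by(simp add: \<tau>_def)
   qed
   thus ?thesis by(auto simp: image_iff)
  qed
  thus ?thesis using tp by(simp add: col_iff)
 qed
 have sg: "sg \<tau> = -1" using Tne by(simp add: sg_def \<tau>_def sign_swap_id)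
 have bij: "bij_betw (%\<pi>. \<pi> \<circ> \<tau>) (col T) (col T)" by(rule bij_betw_col_comp[OF tc])
 let ?f = "%x. merge i (rm w x)"
 have inv: "?f (tabloid D (tableau_act D (\<pi> \<circ> \<tau>) T)) = ?f (tabloid D (tableau_act D \<pi> T))" if \<pi>: "\<pi> : col T" for \<pi>
 proof -
  have p: "\<pi> : perms n" by(rule col_perms[OF \<pi>])
  have p': "\<pi> \<circ> \<tau> : perms n" using p tp by simp
  define U where "U = tableau_act D \<pi> T"
  define U' where "U' = tableau_act D (\<pi> \<circ> \<tau>) T"
  have U: "U : tableaux D" "U' : tableaux D" unfolding U_def U'_def by(rule act_tab[OF p T] act_tab[OF p' T])+
  have same: "U' c = U c" if "c : D" "c ~= c1" "c ~= c2" for c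
  proof -
   have "T c ~= T c1" "T c ~= T c2"
   using inj_onD[OF tabD(2)[OF T] _ that(1) cD(1)] inj_onD[OF tabD(2)[OF T] _ that(1) cD(2)] that by auto
   thus ?thesis using that by(simp add: U_def U'_def act_apply \<tau>_def)
  qed
  have sw: "U' c1 = U c2" "U' c2 = U c1" using cD by(simp_all add: U_def U'_def act_apply \<tau>_def)
  have other: "rm w (tabloid D U') j = rm w (tabloid D U) j" if j: "j <= m" "j ~= i" "j ~= Suc i" for j
   unfolding rm_tabloid[OF U(1) j(1)] rm_tabloid[OF U(2) j(1)]
  proof (rule image_mset_cong)
   fix p assume "p \<in># mset_set {..<len j}"
   hence "(m - j, j + p) : D" using cell_D[OF j(1)] by simp
   moreover have "(m - j, j + p) ~= c1" "(m - j, j + p) ~= c2" using j i by(auto simp: c1_def c2_def)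
   ultimately show "w (U' (m - j, j + p)) = w (U (m - j, j + p))" using same by simp
  qed
  have ri: "rm w (tabloid D U0) i = {#w (U0 (m - i, i))#} + {#w (U0 c1)#}" if "U0 : tableaux D" for U0
   using rm_tabloid[OF that, of i w] i by(simp add: len_lt[OF i] lessThan_Suc numeral_2_eq_2 c1_def)
  define Z where "Z U0 = image_mset (%p. w (U0 (m - Suc i, Suc i + p))) (mset_set ({..<len (Suc i)} - {0}))" for U0
  have rs: "rm w (tabloid D U0) (Suc i) = {#w (U0 c2)#} + Z U0" if "U0 : tableaux D" for U0
  proof -
   have "mset_set {..<len (Suc i)} = add_mset 0 (mset_set ({..<len (Suc i)} - {0}))"
   using mset_set.remove[of "{..<len (Suc i)}" 0] len_pos by simp
   thus ?thesis using rm_tabloid[OF that, of "Suc i" w] i by(simp add: Z_def c2_def)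
  qed
  have "Z U' = Z U" unfolding Z_def
  proof (rule image_mset_cong)
   fix p assume p: "p \<in># mset_set ({..<len (Suc i)} - {0})"
   hence "(m - Suc i, Suc i + p) : D" using cell_D[of "Suc i"] i by simp
   moreover have "(m - Suc i, Suc i + p) ~= c1" "(m - Suc i, Suc i + p) ~= c2" using p i by(auto simp: c1_def c2_def)
   ultimately show "w (U' (m - Suc i, Suc i + p)) = w (U (m - Suc i, Suc i + p))" using same by simp
  qed
  moreover have "U' (m - i, i) = U (m - i, i)"
   using same[of "(m - i, i)"] cell_D[of i 0] i len_pos by(auto simp: c1_def c2_def)
  ultimately have "rm w (tabloid D U') i + rm w (tabloid D U') (Suc i) = rm w (tabloid D U) i + rm w (tabloid D U) (Suc i)"
   unfolding ri[OF U(1)] ri[OF U(2)] rs[OF U(1)] rs[OF U(2)] sw by(simp add: union_ac)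
  hence "?f (tabloid D U') = ?f (tabloid D U)" using other by(auto simp: merge_def fun_eq_iff)
  thus ?thesis by(simp only: U_def U'_def)
 qed
 define P where "P = push_keys ?f (polytabloid D T)"
 have P: "P = (\<Sum>\<pi>\<in>col T. single (?f (tabloid D (tableau_act D \<pi> T))) (sg \<pi>))"
  unfolding P_def polytabloid_def col_def[symmetric] by(simp add: push_keys_sum sg_def)
 also have "... = (\<Sum>\<pi>\<in>col T. single (?f (tabloid D (tableau_act D (\<pi> \<circ> \<tau>) T))) (sg (\<pi> \<circ> \<tau>)))"
  by(rule sum.reindex_bij_betw[OF bij, symmetric])
 also have "... = (\<Sum>\<pi>\<in>col T. - single (?f (tabloid D (tableau_act D \<pi> T))) (sg \<pi>))"
  by(rule sum.cong[OF refl]) (simp add: inv sg_comp[OF col_perms tp] sg single_uminus)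
 also have "... = - P" unfolding P by(rule sum_negf)
 finally have "pm_scale 2 P = 0"
  by(metis PM.scale_left_distrib PM.scale_one add.right_inverse one_add_one)
 thus ?thesis by(simp add: P_def)
qed

lemma merge_S:
 assumes "i < m" "v : S"
 shows "push_keys (%x. merge i (rm w x)) v = 0"
proof -
 have "S \<subseteq> {v. push_keys (%x. merge i (rm w x)) v = 0}"
  unfolding S_def
  by(rule PM.span_minimal)
   (auto simp: merge_polytabloid[OF assms(1)] intro: PMP.linear_subspace_kernel[OF plin_push_keys])
 thus ?thesis using assms(2) by blast
qed

lemma key_facts:
 assumes x: "x : X"
 shows "!!j. j <= m ==> sorted (key w x ! j)" "!!j. j <= m ==> mset (key w x ! j) = rm w x j"
  "!!j. j <= m ==> length (key w x ! j) = len j" "mset (concat (key w x)) = cw n w"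
proof -
 obtain T where T: "T : tableaux D" "x = tabloid D T" using x by(auto simp: X_def)
 show "sorted (key w x ! j)" if "j <= m" for j using that by(simp add: key_nth)
 show ms: "mset (key w x ! j) = rm w x j" if "j <= m" for j using that by(simp add: key_nth)
 show "length (key w x ! j) = len j" if "j <= m" for j
 proof -
  have "length (key w x ! j) = size (rm w x j)" using ms[OF that] size_mset by metis
  also have "... = len j" unfolding T(2) rm_tabloid[OF T(1) that] by simp
  finally show ?thesis .
 qed
 have "mset (concat (key w x)) = (\<Sum>j\<leftarrow>[0..<Suc m]. rm w x j)"
  by(simp add: key_def mset_concat comp_def del: upt_Suc)
 also have "... = mset (concat (blocks (%c. w (T c))))"
 proof -
  have "rm w x j = mset (map (%p. w (T (m - j, j + p))) [0..<len j])" if "j <= m" for j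
   unfolding T(2) rm_tabloid[OF T(1) that] by(simp add: lessThan_atLeast0 mset_set_upto_eq_mset_upto)
  thus ?thesis
   unfolding blocks_def mset_concat map_map comp_def
   by(intro arg_cong[of _ _ sum_list] map_cong) (auto simp del: upt_Suc)
 qed
 also have "... = image_mset w (image_mset T (mset_set D))"
  unfolding mset_concat_blocks by(simp add: image_mset.compositionality comp_def)
 also have "image_mset T (mset_set D) = mset_set {1..n}"
  using tabD(2,3)[OF T(1)] by(simp add: image_mset_mset_set)
 finally show "mset (concat (key w x)) = cw n w" by(simp add: cw_def)
qed

text \<open>Suppose a row and the next one violate the strict inequality. Then the two rows are the
least way to distribute their letters, so after merging them the leading term is not hit by any
other term, although the merged vector is zero.\<close>

lemma leading_in_SSL:
 assumes v: "v : S" and u: "u = push_keys (key w) v" "u ~= 0"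
 shows "Max (keys u) : SSL m (cw n w)"
proof -
 define y where "y = Max (keys u)"
 have vX: "keys v \<subseteq> X" using S_supp v by(auto simp: supp_in_def)
 have "keys u ~= {}" using u(2) by simp
 hence yu: "y : keys u" unfolding y_def by(intro Max_in) auto
 have uX: "keys u \<subseteq> key w ` X" using keys_push_keys[of "key w" v] vX u(1) by blast
 obtain x where x: "x : X" "y = key w x" using yu uX by blast
 have "y ! Suc i ! 0 < y ! i ! 1" if i: "i < m" for i
 proof (rule ccontr)
  assume "\<not> ?thesis"
  hence le: "y ! i ! 1 <= y ! Suc i ! 0" by simp
  define F where "F y' = merge i (%j. mset (y' ! j))" for y' :: "nat list list"
  have Fk: "F (key w x') = merge i (rm w x')" if "x' : X" for x'
   using key_facts(2)[OF that] i by(auto simp: F_def merge_def fun_eq_iff)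
  have "push_keys F u = push_keys (%x. merge i (rm w x)) v"
   unfolding u(1) push_keys_comp using Fk vX by(intro push_keys_cong) blast
  hence F0: "push_keys F u = 0" using merge_S[OF i v] by simp
  have finK: "finite (keys u)" by simp
  have only: "y' = y" if y': "y' : keys u" "F y' = F y" for y'
  proof (rule ccontr)
   assume ne: "y' ~= y"
   obtain x' where x': "x' : X" "y' = key w x'" using y'(1) uX by blast
   have jeq: "y' ! j = y ! j" if "j <= m" "j ~= i" "j ~= Suc i" for j
   proof -
   have "mset (y' ! j) = mset (y ! j)" using fun_cong[OF y'(2), of j] that by(simp add: F_def merge_def)
   thus ?thesis using key_facts(1)[OF x(1) that(1)] key_facts(1)[OF x'(1) that(1)]
   unfolding x(2) x'(2) by(metis properties_for_sort)
   qed
   have sum: "mset (y' ! i) + mset (y' ! Suc i) = mset (y ! i) + mset (y ! Suc i)"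
   using fun_cong[OF y'(2), of i] by(simp add: F_def merge_def)
   have l2: "length (y ! i) = 2" "length (y' ! i) = 2"
   using key_facts(3)[OF x(1), of i w] key_facts(3)[OF x'(1), of i w] i by(simp_all add: x(2) x'(2) len_lt)
   have yi: "y ! i = [y ! i ! 0, y ! i ! 1]" "y' ! i = [y' ! i ! 0, y' ! i ! 1]"
   using l2 sorted_pair by blast+
   have so: "sorted (y ! i)" "sorted (y' ! i)" "sorted (y ! Suc i)"
   using key_facts(1)[OF x(1), of i w] key_facts(1)[OF x'(1), of i w] key_facts(1)[OF x(1), of "Suc i" w] i
   by(simp_all add: x(2) x'(2))
   have ab: "y ! i ! 0 <= y ! i ! 1" "y' ! i ! 0 <= y' ! i ! 1"
   using so(1,2) by(metis yi sorted2)+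
   have Z: "\<forall>z\<in>#mset (y ! Suc i). y ! i ! 1 <= z"
   proof
   fix z assume "z \<in># mset (y ! Suc i)"
   then obtain q where "q < length (y ! Suc i)" "z = y ! Suc i ! q" by(auto simp: in_set_conv_nth)
   hence "y ! Suc i ! 0 <= z" using so(3) by(simp add: sorted_nth_mono)
   thus "y ! i ! 1 <= z" using le by simp
   qed
   have "y ! i ~= y' ! i"
   proof
   assume e: "y ! i = y' ! i"
   hence "mset (y' ! Suc i) = mset (y ! Suc i)" using sum by simp
   hence e2: "y' ! Suc i = y ! Suc i"
   using key_facts(1)[OF x(1), of "Suc i" w] key_facts(1)[OF x'(1), of "Suc i" w] i
   unfolding x(2) x'(2) by(metis Suc_leI properties_for_sort)
   have "y' = y"
   proof (rule nth_equalityI)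
   show "length y' = length y" by(simp add: x(2) x'(2))
   fix j assume "j < length y'"
   hence "j <= m" by(simp add: x'(2))
   thus "y' ! j = y ! j" using jeq e e2 by metis
   qed
   thus False using ne by simp
   qed
   hence lt: "y ! i < y' ! i"
   using least_pair[OF ab(1) Z, of "y' ! i ! 0" "y' ! i ! 1" "mset (y' ! Suc i)"] sum ab(2) yi
   by(metis mset.simps(1,2) add_mset_add_single union_mset_add_mset_right)
   have "y < y'"
   by(rule lex_less_at[of y y' i]) (use i jeq lt in "auto simp: x(2) x'(2)")
   moreover have "y' <= y" unfolding y_def using y'(1) by(intro Max_ge) auto
   ultimately show False by simp
  qed
  have "0 = lookup (push_keys F u) (F y)" using F0 by simp
  also have "... = (\<Sum>k\<in>{k\<in>keys u. F k = F y}. lookup u k)"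
   by(rule lookup_push_keys) auto
  also have "{k\<in>keys u. F k = F y} = {y}" using only yu by auto
  finally show False using yu by(simp add: in_keys_iff)
 qed
 moreover have "\<forall>j<m. length (y ! j) = 2" using key_facts(3)[OF x(1), of _ w] by(simp add: x(2) len_lt)
 moreover have "\<forall>j<Suc m. sorted (y ! j)" using key_facts(1)[OF x(1)] by(simp add: x(2))
 ultimately show ?thesis
  using key_facts(4)[OF x(1)] unfolding y_def[symmetric] by(simp add: SSL_def x(2))
qed

lemma column_cells:
 assumes "c : D" "snd c = Suc i" "i < m"
 shows "c = (m - i, Suc i) \<or> c = (m - Suc i, Suc i)"
proof -
 from assms(1) obtain j p where c: "j <= m" "p < len j" "c = (m - j, j + p)" by(rule D_cases)
 have jp: "j + p = Suc i" using assms(2) c(3) by simp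
 hence "p < 2" using c(2) assms(3) by(auto simp: len_def split: if_splits)
 hence "(j = i & p = 1) \<or> (j = Suc i & p = 0)" using jp by auto
 thus ?thesis using c(3) by auto
qed

lemma column_single:
 assumes "c : D" "c' : D" "snd c = snd c'" "snd c = 0 \<or> m < snd c"
 shows "c = c'"
proof -
 from assms(1) obtain j p where c: "j <= m" "p < len j" "c = (m - j, j + p)" by(rule D_cases)
 from assms(2) obtain j' p' where c': "j' <= m" "p' < len j'" "c' = (m - j', j' + p')" by(rule D_cases)
 have "p < 2" if "j < m" using c(2) that by(simp add: len_def)
 moreover have "p' < 2" if "j' < m" using c'(2) that by(simp add: len_def)
 ultimately have "j = j'" using assms(3,4) c c' by(cases "j < m"; cases "j' < m") auto
 thus ?thesis using assms(3) c c' by simp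
qed

lemma col_act_cell:
 assumes T: "T : tableaux D" and \<pi>: "\<pi> : col T" and c: "c : D"
 obtains c' where "c' : D" "snd c' = snd c" "tableau_act D \<pi> T c = T c'"
proof -
 have "\<pi> (T c) : \<pi> ` T ` {d : D. snd d = snd c}" using c by auto
 hence "\<pi> (T c) : T ` {d : D. snd d = snd c}" using \<pi> by(simp add: col_iff)
 then obtain c' where "c' : D" "snd c' = snd c" "\<pi> (T c) = T c'" by auto
 thus thesis using that act_apply[OF c] by metis
qed

lemma pair_less:
 fixes a b c :: nat
 assumes "c < b" "a <= b"
 shows "sorted_list_of_multiset {#a, c#} < [a, b]"
proof -
 have "{#a, c#} = mset [a, c]" by simp
 hence "sorted_list_of_multiset {#a, c#} = sort [a, c]" by(metis sorted_list_of_multiset_mset)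
 thus ?thesis using assms by(cases "a <= c") auto
qed

text \<open>At the first column whose two cells are exchanged, the lower row receives the smaller
letter of the upper one.\<close>

lemma key_semistandard_max:
 assumes y: "y : SSL m (cw n w)" and T: "T : tableaux D"
  and Ty: "!!j p. j <= m ==> p < len j ==> w (T (m - j, j + p)) = y ! j ! p"
  and \<pi>: "\<pi> : col T" "\<pi> ~= id"
 shows "key w (tabloid D (tableau_act D \<pi> T)) < y"
proof -
 define U where "U = tableau_act D \<pi> T"
 have p: "\<pi> : perms n" by(rule col_perms[OF \<pi>(1)])
 have U: "U : tableaux D" unfolding U_def by(rule act_tab[OF p T])
 have leny: "length (y ! j) = len j" if "j <= m" for j by(rule SSL_length_last[OF y _ that]) simp
 have so: "sorted (y ! j)" if "j <= m" for j using y that by(simp add: SSL_def)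
 have cD: "(m - i, Suc i) : D" "(m - Suc i, Suc i) : D" if "i < m" for i
  using cell_D[of i 1] cell_D[of "Suc i" 0] that len_pos len_lt[OF that] by auto
 define sw where "sw i \<longleftrightarrow> i < m & U (m - i, Suc i) ~= T (m - i, Suc i)" for i
 have swap1: "U (m - i, Suc i) = T (m - Suc i, Suc i)" if "sw i" for i
 proof -
  have i: "i < m" using that by(simp add: sw_def)
  obtain c' where c': "c' : D" "snd c' = Suc i" "U (m - i, Suc i) = T c'"
   using col_act_cell[OF T \<pi>(1) cD(1)[OF i]] unfolding U_def by(metis snd_conv)
  hence "c' ~= (m - i, Suc i)" using that by(auto simp: sw_def)
  thus ?thesis using column_cells[OF c'(1,2) i] c'(3) by blast
 qed
 have fix2: "U (m - Suc i, Suc i) = T (m - Suc i, Suc i)" if i: "i < m" and ns: "\<not> sw i" for i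
 proof -
  have u1: "U (m - i, Suc i) = T (m - i, Suc i)" using i ns by(simp add: sw_def)
  obtain c' where c': "c' : D" "snd c' = Suc i" "U (m - Suc i, Suc i) = T c'"
   using col_act_cell[OF T \<pi>(1) cD(2)[OF i]] unfolding U_def by(metis snd_conv)
  have "c' ~= (m - i, Suc i)"
  proof
   assume "c' = (m - i, Suc i)"
   hence "U (m - Suc i, Suc i) = U (m - i, Suc i)" using c'(3) u1 by simp
   hence "(m - Suc i, Suc i) = (m - i, Suc i)" by(rule inj_onD[OF tabD(2)[OF U] _ cD(2)[OF i] cD(1)[OF i]])
   thus False using i by simp
  qed
  thus ?thesis using column_cells[OF c'(1,2) i] c'(3) by blast
 qed
 have fixs: "U c = T c" if c: "c : D" "snd c = 0 \<or> m < snd c" for c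
 proof -
  obtain c' where c': "c' : D" "snd c' = snd c" "U c = T c'"
   using col_act_cell[OF T \<pi>(1) c(1)] unfolding U_def by metis
  thus ?thesis using column_single[OF c(1) c'(1) c'(2)[symmetric] c(2)] by simp
 qed
 have "\<exists>i. sw i"
 proof (rule ccontr)
  assume no: "\<nexists>i. sw i"
  have "U c = T c" if c: "c : D" for c
  proof (cases "snd c = 0 \<or> m < snd c")
   case False
   then obtain i where i: "snd c = Suc i" "i < m" by(cases "snd c") auto
   have "\<not> sw i" using no by simp
   hence "U (m - i, Suc i) = T (m - i, Suc i)" "U (m - Suc i, Suc i) = T (m - Suc i, Suc i)"
   using fix2[OF i(2)] i(2) by(auto simp: sw_def)
   thus ?thesis using column_cells[OF c i] by auto
  qed (rule fixs[OF c])
  hence pi: "\<pi> (T c) = T c" if "c : D" for c using act_apply[OF that, of \<pi> T] that by(simp add: U_def)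
  have "\<pi> k = k" for k
  proof (cases "k : {1..n}")
   case True
   then obtain c where "c : D" "T c = k" using tab_cell[OF T] by metis
   thus ?thesis using pi by blast
  next
   case False
   thus ?thesis using p by(auto simp: perms_def permutes_def)
  qed
  thus False using \<pi>(2) by(simp add: fun_eq_iff)
 qed
 define i where "i = (LEAST i. sw i)"
 have si: "sw i" unfolding i_def using \<open>\<exists>i. sw i\<close> by(rule LeastI_ex)
 have im: "i < m" using si by(simp add: sw_def)
 have ns: "\<not> sw j" if "j < i" for j using that not_less_Least unfolding i_def by blast
 have first: "U (m - j, j) = T (m - j, j)" if "j <= i" for j
 proof (cases j)
  case 0
  thus ?thesis using fixs[of "(m, 0)"] cell_D[of 0 0] len_pos[of 0] by simp
 next
  case (Suc j')
  thus ?thesis using fix2[of j'] ns[of j'] that im by simp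
 qed
 have rm2: "rm w (tabloid D U) j = {#w (U (m - j, j)), w (U (m - j, Suc j))#}" if "j < m" for j
  using rm_tabloid[OF U, of j w] that by(simp add: len_lt[OF that] lessThan_Suc numeral_2_eq_2 add_mset_commute)
 have ab: "w (T (m - j, j)) = y ! j ! 0" "w (T (m - j, Suc j)) = y ! j ! 1" if "j < m" for j
  using Ty[of j 0] Ty[of j 1] that by(simp_all add: len_lt)
 have yj: "y ! j = [y ! j ! 0, y ! j ! 1]" if "j < m" for j
  by(rule sorted_pair) (use leny[of j] that in "simp add: len_lt")
 have le: "y ! j ! 0 <= y ! j ! 1" if "j < m" for j
  using so[of j] yj[OF that] that by(metis less_imp_le_nat sorted2)
 show ?thesis unfolding U_def[symmetric]
 proof (rule lex_less_at[of _ y i])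
  show "length (key w (tabloid D U)) = length y" using y by(simp add: SSL_def)
  show "i < length (key w (tabloid D U))" using im by simp
  show "key w (tabloid D U) ! j = y ! j" if "j < i" for j
  proof -
   have jm: "j < m" using that im by simp
   have u: "U (m - j, Suc j) = T (m - j, Suc j)" using ns[OF that] jm by(simp add: sw_def)
   have "rm w (tabloid D U) j = {#y ! j ! 0, y ! j ! 1#}"
   unfolding rm2[OF jm] u using first[of j] that ab[OF jm] by simp
   also have "... = mset (y ! j)" by(subst (3) yj[OF jm]) simp
   finally have "rm w (tabloid D U) j = mset (y ! j)" .
   thus ?thesis using key_nth[of j w "tabloid D U"] jm so[of j] by(simp add: sorted_sort_id)
  qed
  have "rm w (tabloid D U) i = {#y ! i ! 0, y ! Suc i ! 0#}"
   unfolding rm2[OF im] swap1[OF si] using first[of i] ab(1)[OF im] Ty[of "Suc i" 0] im len_pos by simp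
  moreover have "y ! Suc i ! 0 < y ! i ! 1" using y im by(simp add: SSL_def)
  ultimately show "key w (tabloid D U) ! i < y ! i"
   using pair_less[of "y ! Suc i ! 0" "y ! i ! 1" "y ! i ! 0"] le[OF im] key_nth[of i w "tabloid D U"] im yj[OF im]
   by(metis less_imp_le_nat)
 qed
qed

text \<open>The polytabloid of a semistandard filling has that filling as its leading term, with
coefficient one.\<close>

lemma SSL_leading:
 assumes y: "y : SSL m (cw n w)"
 shows "\<exists>p\<in>push_keys (key w) ` S. p ~= 0 & Max (keys p) = y"
proof -
 obtain T0 where T0: "T0 : semistandard D" "blocks T0 = y" by(rule blocks_surj[OF y]) simp
 have "image_mset T0 (mset_set D) = (ct w {1..n})"
  using mset_concat_blocks[of T0] y T0(2) by(simp add: SSL_def cw_def)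
 then obtain h where h: "bij_betw h D {1..n}" "!!c. c : D ==> T0 c = w (h c)"
  using image_mset_eq_bij[OF finD, of "{1..n}" T0 w] by auto
 define T where "T = restrict h D"
 have Tb: "bij_betw T D {1..n}" using h(1) by(simp add: T_def cong: bij_betw_cong)
 have T: "T : tableaux D" using Tb bij_betwE[OF h(1)] by(auto simp: tableaux_def cardD T_def)
 have Ty: "w (T (m - j, j + p)) = y ! j ! p" if "j <= m" "p < len j" for j p
  using h(2)[OF cell_D[OF that]] cell_D[OF that] T0(2)[symmetric] that by(simp add: T_def blocks_nth)
 have so: "sorted (y ! j)" if "j <= m" for j using y that by(simp add: SSL_def)
 have kT: "key w (tabloid D T) = y"
 proof (rule nth_equalityI)
  show "length (key w (tabloid D T)) = length y" using y by(simp add: SSL_def)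
  fix j assume "j < length (key w (tabloid D T))"
  hence j: "j <= m" by simp
  have "rm w (tabloid D T) j = image_mset (%p. y ! j ! p) (mset_set {..<len j})"
   unfolding rm_tabloid[OF T j] by(rule image_mset_cong) (simp add: Ty[OF j])
  also have "... = mset (map ((!) (y ! j)) [0..<len j])" by(simp add: lessThan_atLeast0 mset_set_upto_eq_mset_upto)
  also have "map ((!) (y ! j)) [0..<len j] = y ! j" using SSL_length_last[OF y _ j] by(metis map_nth size_cw)
  finally show "key w (tabloid D T) ! j = y ! j" using key_nth[OF j, of w "tabloid D T"] so[OF j] by(simp add: sorted_sort_id)
 qed
 define kk where "kk \<pi> = key w (tabloid D (tableau_act D \<pi> T))" for \<pi>
 have kid: "kk id = y" using kT act_id[OF T] by(simp add: kk_def)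
 have klt: "kk \<pi> < y" if "\<pi> : col T" "\<pi> ~= id" for \<pi>
  unfolding kk_def by(rule key_semistandard_max[OF y T Ty that])
 define P where "P = push_keys (key w) (polytabloid D T)"
 have P: "P = (\<Sum>\<pi>\<in>col T. single (kk \<pi>) (sg \<pi>))"
  unfolding P_def polytabloid_def col_def[symmetric] kk_def by(simp add: push_keys_sum sg_def)
 have "lookup P y = (\<Sum>\<pi>\<in>col T. if \<pi> = id then 1 else 0)"
  unfolding P lookup_sum
 proof (rule sum.cong[OF refl])
  fix \<pi> assume p: "\<pi> : col T"
  show "lookup (single (kk \<pi>) (sg \<pi>)) y = (if \<pi> = id then 1 else 0)"
  proof (cases "\<pi> = id")
   case False
   hence "kk \<pi> ~= y" using klt[OF p] by auto
   thus ?thesis using False by(simp add: lookup_single)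
  qed (simp add: kid sg_def)
 qed
 also have "... = 1" using col_id by(simp add: finite_col)
 finally have ly: "lookup P y = 1" .
 have up: "y' <= y" if "y' : keys P" for y'
 proof (rule ccontr)
  assume "\<not> y' <= y"
  hence "kk \<pi> ~= y'" if "\<pi> : col T" for \<pi> using klt[OF that] kid by(cases "\<pi> = id") auto
  hence "lookup P y' = 0"
   unfolding P lookup_sum by(intro sum.neutral) (auto simp: lookup_single)
  thus False using that by(simp add: in_keys_iff)
 qed
 have "Max (keys P) = y"
  by(rule Max_eqI) (use up ly in "auto simp: in_keys_iff")
 moreover have "P ~= 0" using ly by auto
 moreover have "P : push_keys (key w) ` S" unfolding P_def S_def using T by(intro imageI PM.span_base) auto
 ultimately show ?thesis by blast
qed

theorem fdim_S: "fdim n (prho a) w S = card (SSL m (cw n w))"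
proof -
 let ?W = "push_keys (key w) ` S"
 have sub: "PM.subspace ?W"
  by(rule PMP.linear_subspace_image[OF plin_push_keys]) (simp add: S_def)
 have supp: "?W \<subseteq> supp_in (key w ` X)" using S_supp push_keys_supp_in[of "key w"] by blast
 have fin: "finite (key w ` X)" using fin_X by simp
 have "PM.dim ?W <= card (SSL m (cw n w))"
 proof (rule dim_le_leading[OF fin supp sub finite_SSL])
  fix p assume "p : ?W" "p ~= 0"
  thus "Max (keys p) : SSL m (cw n w)" using leading_in_SSL by blast
 qed
 moreover have "card (SSL m (cw n w)) <= PM.dim ?W"
  by(rule dim_ge_leading[OF fin supp finite_SSL SSL_leading])
 ultimately show ?thesis
  using fdim_eq_dim_push[OF key_sep sym_rep_S S_supp] by simp
qed

end

section \<open>Signed counts\<close>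

definition head_fill :: "nat => nat multiset => nat => (nat list \<times> nat list list) set" where
 "head_fill m W j = {(z, y). sorted z & length z = 2 * j & mset z \<subseteq># W & y : SSL (m - j) (W - mset z)}"
lemma finite_submset_size: "finite {M. M \<subseteq># W & size M = k}"
 by(rule finite_subset[OF _ finite_submultisets[of W]]) auto
lemma length_sorted: "length (sorted_list_of_multiset M) = size M"
 by(metis mset_sorted_list_of_multiset size_mset)

lemma card_head_fill:
 "card (head_fill m W j) = (\<Sum>M | M \<subseteq># W & size M = 2 * j. card (SSL (m - j) (W - M)))"
proof -
 let ?A = "SIGMA M:{M. M \<subseteq># W & size M = 2 * j}. SSL (m - j) (W - M)"
 have "bij_betw (%(M, y). (sorted_list_of_multiset M, y)) ?A (head_fill m W j)"
 proof (rule bij_betw_byWitness[where f' = "%(z, y). (mset z, y)"])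
  show "\<forall>s\<in>head_fill m W j. (%(M, y). (sorted_list_of_multiset M, y)) ((%(z, y). (mset z, y)) s) = s"
   by(auto simp: head_fill_def sorted_sort_id)
  show "(%(M, y). (sorted_list_of_multiset M, y)) ` ?A \<subseteq> head_fill m W j"
   by(auto simp: head_fill_def length_sorted)
  show "(%(z, y). (mset z, y)) ` head_fill m W j \<subseteq> ?A" by(auto simp: head_fill_def)
 qed simp
 hence "card (head_fill m W j) = card ?A" by(rule bij_betw_same_card[symmetric])
 also have "... = (\<Sum>M | M \<subseteq># W & size M = 2 * j. card (SSL (m - j) (W - M)))"
  by(rule card_SigmaI) (auto simp: finite_submset_size finite_SSL)
 finally show ?thesis .
qed

lemma finite_head_fill: "finite (head_fill m W j)"
proof (rule finite_subset)
 show "head_fill m W j \<subseteq> (\<Union>M\<in>{M. M \<subseteq># W & size M = 2 * j}. {sorted_list_of_multiset M} \<times> SSL (m - j) (W - M))"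
 proof
  fix s assume s: "s : head_fill m W j"
  obtain z y where e: "s = (z, y)" by fastforce
  have "z = sorted_list_of_multiset (mset z)" "size (mset z) = 2 * j" "mset z \<subseteq># W" "y : SSL (m - j) (W - mset z)"
   using s by(auto simp: e head_fill_def sorted_sort_id)
  thus "s : (\<Union>M\<in>{M. M \<subseteq># W & size M = 2 * j}. {sorted_list_of_multiset M} \<times> SSL (m - j) (W - M))"
   unfolding e by blast
 qed
 show "finite (\<Union>M\<in>{M. M \<subseteq># W & size M = 2 * j}. {sorted_list_of_multiset M} \<times> SSL (m - j) (W - M))"
  by(intro finite_UN_I finite_cartesian_product) (auto simp: finite_submset_size finite_SSL)
qed

definition join_ok :: "nat list \<times> nat list list => bool" where
 "join_ok = (%(z, y). sorted (z @ y ! 0))"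

lemma SSL_Suc:
 "y : SSL (Suc m) W \<longleftrightarrow> (\<exists>p q y'. y = [p, q] # y' & p <= q & {#p, q#} \<subseteq># W & y' : SSL m (W - {#p, q#}) & y' ! 0 ! 0 < q)"
proof
 assume y: "y : SSL (Suc m) W"
 hence l: "length y = Suc (Suc m)" "length (y ! 0) = 2" by(auto simp: SSL_def)
 then obtain p q y' where e: "y = [p, q] # y'"
  by(cases y) (auto simp: length_Suc_conv numeral_2_eq_2)
 have "p <= q" using y by(auto simp: SSL_def e All_less_Suc2)
 moreover have W: "W = {#p, q#} + mset (concat y')" using y by(simp add: SSL_def e)
 moreover have "y' ! 0 ! 0 < q" using y by(auto simp: SSL_def e All_less_Suc2)
 moreover have "y' : SSL m (mset (concat y'))" using y by(auto simp: SSL_def e All_less_Suc2)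
 ultimately show "\<exists>p q y'. y = [p, q] # y' & p <= q & {#p, q#} \<subseteq># W & y' : SSL m (W - {#p, q#}) & y' ! 0 ! 0 < q"
  using e by(intro exI[of _ p] exI[of _ q] exI[of _ y']) simp
next
 assume "\<exists>p q y'. y = [p, q] # y' & p <= q & {#p, q#} \<subseteq># W & y' : SSL m (W - {#p, q#}) & y' ! 0 ! 0 < q"
 then obtain p q y' where e: "y = [p, q] # y'" "p <= q" "{#p, q#} \<subseteq># W" "y' : SSL m (W - {#p, q#})" "y' ! 0 ! 0 < q"
  by blast
 have "{#p, q#} + (W - {#p, q#}) = W" using e(3) by(rule subset_mset.add_diff_inverse)
 thus "y : SSL (Suc m) W"
  using e by(auto simp: SSL_def All_less_Suc2)
qed

lemma sorted_append_pair:
 "sorted (z @ [p, q]) \<longleftrightarrow> sorted (z @ [p]) & p <= (q::nat)"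
 by(auto simp: sorted_append)

text \<open>Moving the first block behind the head turns a filling whose head can be joined to it into
 one whose head, now two longer, cannot be joined.\<close>

lemma bij_join:
 assumes j: "j < m" and W: "2 * m < size W"
 shows "bij_betw (%(z, y). (z @ y ! 0, tl y)) {s : head_fill m W j. join_ok s}
  {s : head_fill m W (Suc j). \<not> join_ok s}"
proof -
 obtain k where k: "m - j = Suc k" "m - Suc j = k" using j by(cases "m - j") auto
 have ne: "y ! 0 ~= [] & y ! 0 = hd (y ! 0) # tl (y ! 0)" if "y : SSL k V" "size V > 2 * k" for y V
 proof (cases k)
  case 0
  hence "length y = 1" "mset (concat y) = V" using that by(auto simp: SSL_def)
  then obtain x where "y = [x]" "mset x = V" by(auto simp: length_Suc_conv)
  thus ?thesis using that 0 by auto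
 next
  case (Suc k')
  hence "length (y ! 0) = 2" using that by(simp add: SSL_def)
  thus ?thesis by(cases "y ! 0") auto
 qed
 show ?thesis
 proof (rule bij_betw_byWitness[where f' = "%(z, y). (take (2 * j) z, drop (2 * j) z # y)"])
  show "\<forall>s\<in>{s : head_fill m W j. join_ok s}.
   (%(z, y). (take (2 * j) z, drop (2 * j) z # y)) ((%(z, y). (z @ y ! 0, tl y)) s) = s"
   by(auto simp: head_fill_def k SSL_Suc)
  show "\<forall>s\<in>{s : head_fill m W (Suc j). \<not> join_ok s}.
   (%(z, y). (z @ y ! 0, tl y)) ((%(z, y). (take (2 * j) z, drop (2 * j) z # y)) s) = s"
   by auto
  show "(%(z, y). (z @ y ! 0, tl y)) ` {s : head_fill m W j. join_ok s} \<subseteq> {s : head_fill m W (Suc j). \<not> join_ok s}"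
  proof (rule image_subsetI)
   fix s assume s: "s : {s : head_fill m W j. join_ok s}"
   obtain z y where e: "s = (z, y)" by fastforce
   have z: "sorted (z @ y ! 0)" "length z = 2 * j" "mset z \<subseteq># W" "y : SSL (Suc k) (W - mset z)"
   using s by(auto simp: head_fill_def e k join_ok_def)
   obtain p q y' where y: "y = [p, q] # y'" "p <= q" "{#p, q#} \<subseteq># W - mset z"
   "y' : SSL k (W - mset z - {#p, q#})" "y' ! 0 ! 0 < q" using z(4) unfolding SSL_Suc by blast
   have sub: "mset z + {#p, q#} \<subseteq># W" using y(3) z(3)
   by(metis subset_mset.le_diff_conv2 add.commute)
   have sz: "size (W - mset z - {#p, q#}) = size W - 2 * j - 2"
   unfolding size_Diff_submset[OF y(3)] size_Diff_submset[OF z(3)] using z(2) by simp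
   have n0: "y' ! 0 ~= []" using ne[OF y(4)] sz W k j by linarith
   have "\<not> sorted ((z @ [p, q]) @ y' ! 0)"
   using n0 y(5) by(cases "y' ! 0") (auto simp: sorted_append)
   thus "(%(z, y). (z @ y ! 0, tl y)) s : {s : head_fill m W (Suc j). \<not> join_ok s}"
   using z y sub by(simp add: e head_fill_def k join_ok_def diff_diff_add_mset)
  qed
  show "(%(z, y). (take (2 * j) z, drop (2 * j) z # y)) ` {s : head_fill m W (Suc j). \<not> join_ok s}
   \<subseteq> {s : head_fill m W j. join_ok s}"
  proof (rule image_subsetI)
   fix s assume s: "s : {s : head_fill m W (Suc j). \<not> join_ok s}"
   obtain z y where e: "s = (z, y)" by fastforce
   have z: "sorted z" "length z = 2 * Suc j" "mset z \<subseteq># W" "y : SSL k (W - mset z)" "\<not> sorted (z @ y ! 0)"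
   using s by(auto simp: head_fill_def e k join_ok_def)
   define z0 where "z0 = take (2 * j) z"
   have "length (drop (2 * j) z) = 2" using z(2) by simp
   hence pq0: "drop (2 * j) z = [drop (2 * j) z ! 0, drop (2 * j) z ! 1]" by(rule sorted_pair)
   obtain p q where pq: "drop (2 * j) z = [p, q]" using pq0 by blast
   have zz: "z = z0 @ [p, q]" unfolding z0_def pq[symmetric] by simp
   have so: "sorted (z0 @ [p])" "p <= q" using z(1) unfolding zz sorted_append_pair by auto
   have sz: "size (W - mset z) = size W - (2 * j + 2)" using z(2,3) by(simp add: size_Diff_submset)
   have n0: "y ! 0 = hd (y ! 0) # tl (y ! 0)" using ne[OF z(4)] sz W k j by linarith
   have ysort: "sorted (y ! 0)" using z(4) by(simp add: SSL_def)
   have "\<not> q <= hd (y ! 0)"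
   proof
   assume le: "q <= hd (y ! 0)"
   have "hd (y ! 0) <= x" if "x : set (y ! 0)" for x
   using that ysort n0 by(metis set_ConsD sorted_simps(2) order_refl)
   moreover have "x <= q" if "x : set z" for x using that z(1) so(2) unfolding zz by(auto simp: sorted_append)
   ultimately have "sorted (z @ y ! 0)" using z(1) ysort le by(fastforce simp: sorted_append)
   thus False using z(5) by simp
   qed
   hence lt: "y ! 0 ! 0 < q" using n0 by(metis hd_conv_nth list.distinct(1) linorder_not_le)
   have sub: "mset z0 \<subseteq># W" "{#p, q#} \<subseteq># W - mset z0"
   proof -
   have "mset z = mset z0 + {#p, q#}" by(simp add: zz)
   hence W: "W = mset z0 + ({#p, q#} + (W - mset z))"
   using subset_mset.add_diff_inverse[OF z(3)] by(simp add: add.assoc)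
   hence "W - mset z0 = {#p, q#} + (W - mset z)" by(metis add_diff_cancel_left')
   thus "{#p, q#} \<subseteq># W - mset z0" by(metis mset_subset_eq_add_left)
   show "mset z0 \<subseteq># W" using W by(metis mset_subset_eq_add_left)
   qed
   have "y : SSL k (W - mset z0 - {#p, q#})" using z(4) by(simp add: zz diff_diff_add_mset)
   hence "[p, q] # y : SSL (Suc k) (W - mset z0)" unfolding SSL_Suc using so(2) sub(2) lt by blast
   moreover have "length z0 = 2 * j" using z(2) by(simp add: z0_def)
   ultimately show "(%(z, y). (take (2 * j) z, drop (2 * j) z # y)) s : {s : head_fill m W j. join_ok s}"
   using so sub(1) z(1) unfolding e z0_def[symmetric] pq
   by(simp add: head_fill_def k join_ok_def pq z0_def[symmetric] sorted_append_pair) (simp add: sorted_append)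
  qed
 qed
qed

lemma card_head_full:
 assumes W: "2 * m < size W"
 shows "card {s : head_fill m W m. join_ok s} = 1"
proof -
 let ?l = "sorted_list_of_multiset W"
 have l: "mset ?l = W" "sorted ?l" "length ?l = size W" by(simp_all add: length_sorted)
 have one: "y : SSL 0 V \<longleftrightarrow> (\<exists>x. y = [x] & sorted x & mset x = V)" for y V
  by(auto simp: SSL_def length_Suc_conv)
 have "{s : head_fill m W m. join_ok s} = {(take (2 * m) ?l, [drop (2 * m) ?l])}"
 proof (intro equalityI subsetI)
  fix s assume s: "s : {s : head_fill m W m. join_ok s}"
  obtain z y where e: "s = (z, y)" by fastforce
  have z: "length z = 2 * m" "mset z \<subseteq># W" "y : SSL 0 (W - mset z)" "sorted (z @ y ! 0)"
   using s by(auto simp: head_fill_def e join_ok_def)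
  obtain x where x: "y = [x]" "mset x = W - mset z" using z(3) unfolding one by blast
  have "mset (z @ x) = W" using z(2) x(2) by simp
  hence "z @ x = ?l" using z(4) x(1) l by(metis nth_Cons_0 properties_for_sort)
  thus "s : {(take (2 * m) ?l, [drop (2 * m) ?l])}" using z(1) x(1) e by(simp flip: \<open>z @ x = ?l\<close>)
 next
  fix s assume "s : {(take (2 * m) ?l, [drop (2 * m) ?l])}"
  hence e: "s = (take (2 * m) ?l, [drop (2 * m) ?l])" by simp
  have "mset (take (2 * m) ?l) + mset (drop (2 * m) ?l) = W"
   using l(1) by(metis append_take_drop_id mset_append)
  hence "W - mset (take (2 * m) ?l) = mset (drop (2 * m) ?l)" "mset (take (2 * m) ?l) \<subseteq># W"
   by(metis add_diff_cancel_left', metis mset_subset_eq_add_left)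
  thus "s : {s : head_fill m W m. join_ok s}"
   using l(2,3) W by(simp add: e head_fill_def one join_ok_def sorted_wrt_take sorted_wrt_drop)
 qed
 thus ?thesis by simp
qed

lemma card_head_start: "card {s : head_fill m W 0. \<not> join_ok s} = 0"
proof -
 have "{s : head_fill m W 0. \<not> join_ok s} = {}" by(auto simp: head_fill_def join_ok_def SSL_def)
 thus ?thesis by(simp only: card.empty)
qed

text \<open>The joinable heads of length \<open>2 * j\<close> cancel the unjoinable ones of length
\<open>2 * j + 2\<close>; only the sorted word as a whole survives.\<close>

theorem signed_ribbon_count:
 assumes W: "2 * m < size W"
 shows "(\<Sum>j\<le>m. \<Sum>M | M \<subseteq># W & size M = 2 * j. (-1) ^ (m - j) * int (card (SSL (m - j) (W - M)))) = 1"
proof -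
 define c d where "c j = int (card {s : head_fill m W j. join_ok s})"
  and "d j = int (card {s : head_fill m W j. \<not> join_ok s})" for j
 have cd: "int (card (head_fill m W j)) = c j + d j" for j
 proof -
  have "head_fill m W j = {s : head_fill m W j. join_ok s} \<union> {s : head_fill m W j. \<not> join_ok s}" by blast
  moreover have "card ({s : head_fill m W j. join_ok s} \<union> {s : head_fill m W j. \<not> join_ok s})
   = card {s : head_fill m W j. join_ok s} + card {s : head_fill m W j. \<not> join_ok s}"
   by(rule card_Un_disjoint) (use finite_head_fill[of m W j] in auto)
  ultimately show ?thesis by(simp add: c_def d_def)
 qed
 have dc: "d (Suc j) = c j" if "j < m" for j
  using bij_betw_same_card[OF bij_join[OF that W]] by(simp add: c_def d_def)
 have part: "(\<Sum>j\<le>k. (-1) ^ (m - j) * (c j + d j)) = (-1) ^ (m - k) * c k" if "k <= m" for k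
  using that
 proof (induction k)
  case 0
  thus ?case using card_head_start[of m W] by(simp add: d_def)
 next
  case (Suc k)
  obtain q where q: "m - k = Suc q" "m - Suc k = q" using Suc.prems by(cases "m - k") auto
  show ?case using Suc.IH Suc.prems dc[of k] by(simp add: q algebra_simps)
 qed
 have "(\<Sum>j\<le>m. \<Sum>M | M \<subseteq># W & size M = 2 * j. (-1) ^ (m - j) * int (card (SSL (m - j) (W - M))))
   = (\<Sum>j\<le>m. (-1) ^ (m - j) * (c j + d j))"
  by(simp add: sum_distrib_left[symmetric] cd[symmetric] card_head_fill)
 also have "... = c m" using part[of m] by simp
 finally show ?thesis using card_head_full[OF W] by(simp add: c_def)
qed

text \<open>Orbit types of Feichtner--Yuzvinsky monomials: each block is recorded by the multiset of
its letters.\<close>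

fun fym :: "nat => nat multiset => (nat multiset \<times> nat) list => nat => bool" where
 "fym r W [] b \<longleftrightarrow> b < r"
| "fym r W ((M, a) # L) b \<longleftrightarrow> M \<subseteq># W & size M < r & 1 <= a & a < size M & fym (r - size M) (W - M) L b"

definition fy_degree :: "('g \<times> nat) list \<times> nat => nat" where
 "fy_degree = (%(L, b). sum_list (map snd L) + b)"

definition FYM where "FYM r W = {(L, b). fym r W L b}"

lemma FYM_split:
 "FYM r W = Pair [] ` {..<r} \<union>
  (%((M, a), L, b). ((M, a) # L, b)) ` (SIGMA (M, a) : (SIGMA M:{M. M \<subseteq># W & 2 <= size M & size M < r}. {1..<size M}). FYM (r - size M) (W - M))"
 (is "_ = ?A \<union> ?B")
proof (intro equalityI subsetI)
 fix x assume "x : FYM r W"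
 then obtain L b where x: "x = (L, b)" "fym r W L b" by(auto simp: FYM_def)
 show "x : ?A \<union> ?B"
 proof (cases L)
  case (Cons Ma L')
  obtain M a where Ma: "Ma = (M, a)" by fastforce
  have f: "M \<subseteq># W" "size M < r" "1 <= a" "a < size M" "fym (r - size M) (W - M) L' b"
   using x(2) by(auto simp: Cons Ma)
  have "((M, a), L', b) : (SIGMA (M, a) : (SIGMA M:{M. M \<subseteq># W & 2 <= size M & size M < r}. {1..<size M}). FYM (r - size M) (W - M))"
   using f by(simp add: FYM_def)
  hence "(%((M, a), L, b). ((M, a) # L, b)) ((M, a), L', b) : ?B" by(rule imageI)
  thus ?thesis by(simp add: x Cons Ma)
 qed (use x in auto)
qed (auto simp: FYM_def)

lemma finite_FYM: "finite (FYM r W)"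
proof (induction r arbitrary: W rule: less_induct)
 case (less r)
 have "finite (SIGMA (M, a) : (SIGMA M:{M. M \<subseteq># W & 2 <= size M & size M < r}. {1..<size M}). FYM (r - size M) (W - M))"
 proof (rule finite_SigmaI)
  show "finite (SIGMA M:{M. M \<subseteq># W & 2 <= size M & size M < r}. {1..<size M})"
   by(rule finite_SigmaI) (auto intro: finite_subset[OF _ finite_submultisets[of W]])
  fix Ma assume "Ma : (SIGMA M:{M. M \<subseteq># W & 2 <= size M & size M < r}. {1..<size M})"
  thus "finite (case Ma of (M, a) => FYM (r - size M) (W - M))" by(auto intro!: less.IH)
 qed
 thus ?case unfolding FYM_split[of r W] by(intro finite_UnI finite_imageI) auto
qed

definition fy_sign :: "nat => nat multiset => int" where
 "fy_sign r W = (\<Sum>x\<in>FYM r W. (-1) ^ fy_degree x)"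

lemma alternating_geometric:
 "(\<Sum>b<r. (-1) ^ b :: int) = (if odd r then 1 else 0)"
 by(induction r) auto
lemma alternating_from_one: "1 <= g ==> (\<Sum>a\<in>{1..<g}. (-1) ^ a :: int) = (if even g then -1 else 0)"
 by(induction g rule: dec_induct) auto

text \<open>Split off the first block; its admissible exponents contribute an alternating sum that
vanishes for odd size.\<close>

lemma fy_sign_rec:
 "fy_sign r W = (if odd r then 1 else 0) -
   (\<Sum>M | M \<subseteq># W & 2 <= size M & size M < r & even (size M). fy_sign (r - size M) (W - M))"
proof -
 let ?S = "{M. M \<subseteq># W & 2 <= size M & size M < r}"
 have finS: "finite ?S" by(rule finite_subset[OF _ finite_submultisets[of W]]) auto
 have "fy_sign r W = (\<Sum>x\<in>Pair ([] :: (nat multiset \<times> nat) list) ` {..<r}. (-1) ^ fy_degree x) +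
  (\<Sum>x\<in>(%((M, a), L, b). ((M, a) # L, b)) ` (SIGMA (M, a) : (SIGMA M:?S. {1..<size M}). FYM (r - size M) (W - M)). (-1) ^ fy_degree x)"
  unfolding fy_sign_def FYM_split[of r W]
 proof (rule sum.union_disjoint)
  show "finite (Pair ([] :: (nat multiset \<times> nat) list) ` {..<r})" by simp
  show "finite ((%((M, a), L, b). ((M, a) # L, b)) ` (SIGMA (M, a) : (SIGMA M:?S. {1..<size M}). FYM (r - size M) (W - M)))"
   by(rule finite_subset[OF _ finite_FYM[of r W]]) (subst FYM_split[of r W], blast)
 qed auto
 also have "(\<Sum>x\<in>Pair ([] :: (nat multiset \<times> nat) list) ` {..<r}. (-1) ^ fy_degree x :: int) = (if odd r then 1 else 0)"
  by(subst sum.reindex) (auto simp: inj_on_def fy_degree_def alternating_geometric)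
 also have "(\<Sum>x\<in>(%((M, a), L, b). ((M, a) # L, b)) ` (SIGMA (M, a) : (SIGMA M:?S. {1..<size M}). FYM (r - size M) (W - M)). (-1) ^ fy_degree x :: int)
  = (\<Sum>x\<in>(SIGMA (M, a) : (SIGMA M:?S. {1..<size M}). FYM (r - size M) (W - M)). case x of ((M, a), Lb) => (-1) ^ a * (-1) ^ fy_degree Lb)"
  by(subst sum.reindex) (auto simp: inj_on_def fy_degree_def power_add intro!: sum.cong)
 also have "... = (\<Sum>Ma\<in>(SIGMA M:?S. {1..<size M}). \<Sum>Lb\<in>(case Ma of (M, a) => FYM (r - size M) (W - M)). case Ma of (M, a) => (-1) ^ a * (-1) ^ fy_degree Lb)"
  by(subst sum.Sigma) (auto simp: finite_FYM finS intro!: sum.cong finite_SigmaI)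
 also have "... = (\<Sum>(M, a)\<in>(SIGMA M:?S. {1..<size M}). (-1) ^ a * fy_sign (r - size M) (W - M))"
  by(intro sum.cong) (auto simp: fy_sign_def sum_distrib_left)
 also have "... = (\<Sum>M\<in>?S. \<Sum>a\<in>{1..<size M}. (-1) ^ a * fy_sign (r - size M) (W - M))"
  by(subst sum.Sigma) (auto simp: finS)
 also have "... = (\<Sum>M\<in>?S. if even (size M) then - fy_sign (r - size M) (W - M) else 0)"
 proof (rule sum.cong[OF refl])
  fix M assume "M : ?S"
  hence "1 <= size M" by simp
  have "(\<Sum>a\<in>{1..<size M}. (-1) ^ a * fy_sign (r - size M) (W - M)) = (\<Sum>a\<in>{1..<size M}. (-1) ^ a) * fy_sign (r - size M) (W - M)"
   by(rule sum_distrib_right[symmetric])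
  thus "(\<Sum>a\<in>{1..<size M}. (-1) ^ a * fy_sign (r - size M) (W - M)) = (if even (size M) then - fy_sign (r - size M) (W - M) else 0)"
   unfolding alternating_from_one[OF \<open>1 <= size M\<close>] by simp
 qed
 also have "... = (\<Sum>M | M \<subseteq># W & 2 <= size M & size M < r & even (size M). - fy_sign (r - size M) (W - M))"
  by(rule sum.mono_neutral_cong_right) (auto simp: finS)
 finally show ?thesis by(simp add: sum_negf)
qed

theorem fy_sign_ribbon:
 assumes "r <= size W"
 shows "fy_sign r W = (if even r then 0 else (-1) ^ ((r - 1) div 2) * int (card (SSL ((r - 1) div 2) W)))"
 using assms
proof (induction r arbitrary: W rule: less_induct)
 case (less r)
 show ?case
 proof (cases "even r")
  case True
  have "fy_sign (r - size M) (W - M) = 0" if "M \<subseteq># W & 2 <= size M & size M < r & even (size M)" for M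
   using less.IH[of "r - size M" "W - M"] that True less.prems by(simp add: size_Diff_submset)
  thus ?thesis unfolding fy_sign_rec[of r W] using True by simp
 next
  case False
  then obtain m where r: "r = 2 * m + 1" by(metis oddE)
  have W: "2 * m < size W" using less.prems r by simp
  let ?s = "%M. (-1) ^ (m - size M div 2) * int (card (SSL (m - size M div 2) (W - M)))"
  have ih: "fy_sign (r - size M) (W - M) = ?s M" if M: "M \<subseteq># W & 2 <= size M & size M < r & even (size M)" for M
  proof -
   obtain j where j: "size M = 2 * j" using M by blast
   have rr: "r - size M = 2 * (m - j) + 1" using M j r by linarith
   have "r - size M < r" "r - size M <= size (W - M)" using M less.prems by(auto simp: size_Diff_submset)
   from less.IH[OF this] show ?thesis unfolding rr using j by simp
  qed
  have "(\<Sum>j\<le>m. \<Sum>M | M \<subseteq># W & size M = 2 * j. ?s M)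
   = (\<Sum>j\<le>m. \<Sum>M | M \<subseteq># W & size M = 2 * j. (-1) ^ (m - j) * int (card (SSL (m - j) (W - M))))"
   by(intro sum.cong refl) simp
  hence "1 = (\<Sum>j\<le>m. \<Sum>M | M \<subseteq># W & size M = 2 * j. ?s M)"
   using signed_ribbon_count[OF W] by linarith
  also have "... = (\<Sum>M\<in>(\<Union>j\<in>{..m}. {M. M \<subseteq># W & size M = 2 * j}). ?s M)"
   by(rule sum.UNION_disjoint[symmetric]) (auto simp: finite_submset_size)
  also have "(\<Union>j\<in>{..m}. {M. M \<subseteq># W & size M = 2 * j}) = insert {#} {M. M \<subseteq># W & 2 <= size M & size M < r & even (size M)}"
  proof (intro equalityI subsetI)
   fix M assume "M : (\<Union>j\<in>{..m}. {M. M \<subseteq># W & size M = 2 * j})"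
   then obtain j where "j <= m" "M \<subseteq># W" "size M = 2 * j" by blast
   thus "M : insert {#} {M. M \<subseteq># W & 2 <= size M & size M < r & even (size M)}"
   using r by(cases "j = 0") auto
  next
   fix M assume M: "M : insert {#} {M. M \<subseteq># W & 2 <= size M & size M < r & even (size M)}"
   hence "M \<subseteq># W" "size M = 2 * (size M div 2)" "size M div 2 <= m" using r by auto
   thus "M : (\<Union>j\<in>{..m}. {M. M \<subseteq># W & size M = 2 * j})" by blast
  qed
  also have "(\<Sum>M\<in>insert {#} {M. M \<subseteq># W & 2 <= size M & size M < r & even (size M)}. ?s M)
   = ?s {#} + (\<Sum>M | M \<subseteq># W & 2 <= size M & size M < r & even (size M). ?s M)"
   by(rule sum.insert) (auto intro: finite_subset[OF _ finite_submultisets[of W]])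
  also have "(\<Sum>M | M \<subseteq># W & 2 <= size M & size M < r & even (size M). ?s M)
   = (\<Sum>M | M \<subseteq># W & 2 <= size M & size M < r & even (size M). fy_sign (r - size M) (W - M))"
   by(intro sum.cong refl) (simp add: ih)
  finally have "fy_sign r W = ?s {#}" unfolding fy_sign_rec[of r W] using False by simp
  thus ?thesis using False r by simp
 qed
qed

section \<open>Monomials and evaluation\<close>

definition mon :: "'k => ('k::comm_monoid_add \<Rightarrow>\<^sub>0 rat)" where "mon m = single m 1"
definition const :: "rat => ('k::comm_monoid_add \<Rightarrow>\<^sub>0 rat)" where "const c = single 0 c"
lemma mon_add: "mon (m + k) = mon m * mon k"
 by(simp add: mon_def mult_single)
lemma const_mon: "const c * mon m = single m c"
 by(simp add: mon_def const_def mult_single)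
lemma mon_0: "mon 0 = 1"
 by(simp add: mon_def)

lemma mon_single_power: "mon (single F a) = Var F ^ a"
proof (induction a)
 case (Suc a)
 have "single F (Suc a) = single F 1 + single F a"
  by(simp add: single_add[symmetric])
 thus ?case using Suc by(simp add: mon_add) (simp add: mon_def Var_def)
qed (simp add: mon_0)

lemma poly_as_sum: "p = (\<Sum>m\<in>keys p. const (lookup p m) * mon m)"
 unfolding const_mon by(rule poly_mapping_as_sum) auto

definition msum :: "('a => nat) => ('a \<Rightarrow>\<^sub>0 nat) => nat" where
 "msum f m = (\<Sum>F\<in>keys m. lookup m F * f F)"

lemma msum_superset: "finite X ==> keys m \<subseteq> X ==> msum f m = (\<Sum>F\<in>X. lookup m F * f F)"
 unfolding msum_def by(rule sum.mono_neutral_left) (auto simp: in_keys_iff)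

lemma msum_add: "msum f (m + k) = msum f m + msum f k"
proof -
 let ?X = "keys m \<union> keys k"
 have "keys (m + k) \<subseteq> ?X" by(rule Poly_Mapping.keys_add)
 thus ?thesis
  by(simp add: msum_superset[of ?X] lookup_add algebra_simps sum.distrib)
qed
lemma msum_single [simp]: "msum f (single F a) = a * f F"
 by(subst msum_superset[of "{F}"]) auto

lemma msum_zero [simp]: "msum f 0 = 0"
 by(simp add: msum_def)

abbreviation deg where "deg \<equiv> msum (% _. 1)"

lemma monom_degree_deg: "monom_degree m = deg m"
 by(simp add: monom_degree_def msum_def)

abbreviation wt :: "nat set_monom => nat" where "wt \<equiv> msum card"

definition mev :: "('a => rat) => ('a \<Rightarrow>\<^sub>0 nat) => rat" where
 "mev v m = (\<Prod>F\<in>keys m. v F ^ lookup m F)"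

lemma mev_superset: "finite X ==> keys m \<subseteq> X ==> mev v m = (\<Prod>F\<in>X. v F ^ lookup m F)"
 unfolding mev_def by(rule prod.mono_neutral_left) (auto simp: in_keys_iff)

lemma mev_add: "mev v (m + k) = mev v m * mev v k"
proof -
 let ?X = "keys m \<union> keys k"
 have "keys (m + k) \<subseteq> ?X" by(rule Poly_Mapping.keys_add)
 thus ?thesis
  by(simp add: mev_superset[of ?X] lookup_add power_add prod.distrib)
qed
lemma mev_single [simp]: "mev v (single F a) = v F ^ a"
 by(subst mev_superset[of "{F}"]) auto

lemma mev_zero [simp]: "mev v 0 = 1"
 by(simp add: mev_def)

definition ev :: "('a => rat) => (('a \<Rightarrow>\<^sub>0 nat) \<Rightarrow>\<^sub>0 rat) => rat" where
 "ev v p = (\<Sum>m\<in>keys p. lookup p m * mev v m)"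

lemma ev_superset: "finite X ==> keys p \<subseteq> X ==> ev v p = (\<Sum>m\<in>X. lookup p m * mev v m)"
 unfolding ev_def by(rule sum.mono_neutral_left) (auto simp: in_keys_iff)

lemma ev_add: "ev v (p + q) = ev v p + ev v q"
proof -
 let ?X = "keys p \<union> keys q"
 have "keys (p + q) \<subseteq> ?X" by(rule Poly_Mapping.keys_add)
 thus ?thesis
  by(simp add: ev_superset[of ?X] lookup_add algebra_simps sum.distrib)
qed
lemma ev_single [simp]: "ev v (single m c) = c * mev v m"
 by(subst ev_superset[of "{m}"]) auto
lemma ev_zero [simp]: "ev v 0 = 0"
 by(simp add: ev_def)
lemma ev_sum: "ev v (sum f A) = (\<Sum>a\<in>A. ev v (f a))"
 by(induction A rule: infinite_finite_induct) (auto simp: ev_add)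

lemma ev_diff: "ev v (p - q) = ev v p - ev v q"
 using ev_add[of v "p - q" q] by simp

lemma ev_mult: "ev v (p * q) = ev v p * ev v q"
proof -
 have "p * q = (\<Sum>m\<in>keys p. single m (lookup p m)) *
   (\<Sum>k\<in>keys q. single k (lookup q k))"
  using poly_mapping_as_sum[of "keys p" p] poly_mapping_as_sum[of "keys q" q] by simp
 also have "ev v ... = ev v p * ev v q"
  unfolding ev_def[of v p] ev_def[of v q]
  by(simp add: sum_product mult_single ev_sum mev_add mult_ac)
 finally show ?thesis .
qed

lemma push_keys_mult:
 assumes "!!m k. f (m + k) = f m + f k"
 shows "push_keys f (p * q :: _ \<Rightarrow>\<^sub>0 rat) = push_keys f p * push_keys f q"
proof -
 have "p * q = (\<Sum>m\<in>keys p. single m (lookup p m)) *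
   (\<Sum>k\<in>keys q. single k (lookup q k))"
  using poly_mapping_as_sum[of "keys p" p] poly_mapping_as_sum[of "keys q" q] by simp
 also have "push_keys f ... = push_keys f p * push_keys f q"
  unfolding push_keys_def[of f p] push_keys_def[of f q]
  by(simp add: sum_product mult_single push_keys_sum assms)
 finally show ?thesis .
qed

section \<open>Chow rings of uniform matroids\<close>

lemma flat_poly_ring_simps [simp]:
 "ring.zero (flat_poly_ring L) = 0" "ring.add (flat_poly_ring L) = (+)"
 "monoid.mult (flat_poly_ring L) = (*)" "monoid.one (flat_poly_ring L) = 1"
 by(simp_all add: flat_poly_ring_def)
lemma carrier_flat_poly: "p : carrier (flat_poly_ring L) \<longleftrightarrow> (\<forall>m\<in>keys p. keys m \<subseteq> L - {{}})"
 by(simp add: flat_poly_ring_def)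

lemma C_mult:
 assumes "p : carrier (flat_poly_ring L)" "q : carrier (flat_poly_ring L)"
 shows "p * q : carrier (flat_poly_ring L)"
 unfolding carrier_flat_poly
proof
 fix m assume "m : keys (p * q)"
 then obtain a b where ab: "m = a + b" "a : keys p" "b : keys q"
  using keys_mult[of p q] by blast
 show "keys m \<subseteq> L - {{}}"
  using keys_add[of a b] ab assms unfolding carrier_flat_poly by blast
qed

lemma C_add:
 assumes "p : carrier (flat_poly_ring L)" "q : carrier (flat_poly_ring L)"
 shows "p + q : carrier (flat_poly_ring L)"
 using keys_add[of p q] assms unfolding carrier_flat_poly by blast
lemma keys_uminus: "keys (- p) = keys (p :: _ \<Rightarrow>\<^sub>0 rat)"
 by(auto simp: in_keys_iff)
lemma keys_minus_nat: "keys (m - k) \<subseteq> keys (m :: _ \<Rightarrow>\<^sub>0 nat)"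
 by(auto simp: in_keys_iff lookup_minus)

lemma C_uminus: "p : carrier (flat_poly_ring L) ==> - p : carrier (flat_poly_ring L)"
 unfolding carrier_flat_poly by(simp add: keys_uminus)

lemma C_diff: "p : carrier (flat_poly_ring L) ==> q : carrier (flat_poly_ring L) ==> p - q : carrier (flat_poly_ring L)"
 using C_add[of p L "- q"] C_uminus[of q L] by simp

lemma C_0: "0 : carrier (flat_poly_ring L)" and C_1: "1 : carrier (flat_poly_ring L)"
 and C_const: "const c : carrier (flat_poly_ring L)"
 by(auto simp: carrier_flat_poly const_def)
lemma C_mon: "keys m \<subseteq> L - {{}} ==> mon m : carrier (flat_poly_ring L)"
 by(simp add: carrier_flat_poly mon_def)
lemma C_Var: "F : L ==> F ~= {} ==> Var F : carrier (flat_poly_ring L)"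
 by(simp add: carrier_flat_poly Var_def)
lemma C_sum: "(!!a. a : A ==> f a : carrier (flat_poly_ring L)) ==> sum f A : carrier (flat_poly_ring L)"
 by(induction A rule: infinite_finite_induct) (auto simp: C_0 C_add)
lemma C_power: "p : carrier (flat_poly_ring L) ==> p ^ k : carrier (flat_poly_ring L)"
 by(induction k) (auto simp: C_1 C_mult)

lemma ring_flat_poly: "cring (flat_poly_ring L)"
proof (rule cringI)
 show "abelian_group (flat_poly_ring L)"
 proof (rule abelian_groupI)
  fix x assume x: "x : carrier (flat_poly_ring L)"
  show "\<exists>y\<in>carrier (flat_poly_ring L). y \<oplus>\<^bsub>flat_poly_ring L\<^esub> x = \<zero>\<^bsub>flat_poly_ring L\<^esub>"
   using C_uminus[OF x] by(intro bexI[of _ "- x"]) auto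
 qed (auto simp: C_add C_0 add_ac)
 show "comm_monoid (flat_poly_ring L)"
  by(rule comm_monoidI) (auto simp: C_mult C_1 mult_ac)
qed (auto simp: algebra_simps)

text \<open>Additive inverses come from multiplication by constants.\<close>

lemma ideal_flat_polyI:
 assumes Z: "Z \<subseteq> carrier (flat_poly_ring L)" "0 : Z" "!!p q. p : Z ==> q : Z ==> p + q : Z"
  "!!p q. p : carrier (flat_poly_ring L) ==> q : Z ==> p * q : Z"
 shows "ideal Z (flat_poly_ring L)"
proof -
 interpret R: cring "flat_poly_ring L" by(rule ring_flat_poly)
 show ?thesis
 proof (rule idealI)
  show "ring (flat_poly_ring L)" by unfold_locales
  show "subgroup Z (add_monoid (flat_poly_ring L))"
  proof (rule R.add.subgroupI)
   fix p assume p: "p : Z"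
   have "\<ominus>\<^bsub>flat_poly_ring L\<^esub> p = - p"
   using p Z(1) C_uminus by(intro R.minus_equality) auto
   moreover have "- 1 * p : Z" by(rule Z(4)[OF C_uminus[OF C_1] p])
   ultimately show "\<ominus>\<^bsub>flat_poly_ring L\<^esub> p : Z" by simp
  qed (use Z in auto)
 next
  fix q p assume qp: "q : Z" "p : carrier (flat_poly_ring L)"
  have "p * q : Z" by(rule Z(4)[OF qp(2,1)])
  thus "p \<otimes>\<^bsub>flat_poly_ring L\<^esub> q : Z" "q \<otimes>\<^bsub>flat_poly_ring L\<^esub> p : Z"
   by(simp_all add: mult.commute)
 qed
qed

locale chow =
 fixes n r :: nat
 assumes r1: "1 <= r" and rn: "r <= n"
begin

abbreviation "E \<equiv> {1..n}"
abbreviation "FL \<equiv> uniform_flats r n"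
abbreviation "C \<equiv> carrier (flat_poly_ring FL)"
definition I where "I = chow_ideal E FL"

definition \<theta> where "\<theta> i = (\<Sum>F \<in> {F : FL. i : F}. Var F :: nat set_poly)"

definition gens where
 "gens = {Var F * Var F' | F F'. F : FL - {{}} & F' : FL - {{}} & \<not> F \<subseteq> F' & \<not> F' \<subseteq> F} \<union> \<theta> ` E"

lemma I_gens: "I = Idl\<^bsub>flat_poly_ring FL\<^esub> gens"
 unfolding I_def chow_ideal_def gens_def \<theta>_def ..
lemma finite_FL: "finite FL"
 by(rule finite_subset[of _ "Pow E"]) (auto simp: uniform_flats_def)

lemma FL_sub: "F : FL ==> F \<subseteq> E" and E_FL: "E : FL" and E_ne: "E ~= {}"
 using r1 rn by(auto simp: uniform_flats_def)

lemma FL_card: "F : FL ==> F ~= E ==> card F < r"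
 using r1 by(auto simp: uniform_flats_def)

lemma FL_fin: "F : FL ==> finite F"
 using FL_sub finite_subset by blast

lemma gens_C: "gens \<subseteq> C"
 unfolding gens_def \<theta>_def by(auto intro!: C_mult C_Var C_sum)

sublocale R: cring "flat_poly_ring FL" by(rule ring_flat_poly)

sublocale I: ideal I "flat_poly_ring FL"
 unfolding I_gens by(rule R.genideal_ideal[OF gens_C])

lemma I_0: "0 : I" using I.zero_closed by simp
lemma I_add: "p : I ==> q : I ==> p + q : I" using I.a_closed[of p q] by simp
lemma I_mult: "p : C ==> q : I ==> p * q : I" using I.I_l_closed[of q p] by simp
lemma I_uminus: "p : I ==> - p : I" using I_mult[OF C_uminus[OF C_1], of p] by simp
lemma I_diff: "p : I ==> q : I ==> p - q : I" using I_add[of p "- q"] I_uminus[of q] by simp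
lemma I_sum: "(!!a. a : A ==> f a : I) ==> sum f A : I"
 by(induction A rule: infinite_finite_induct) (auto simp: I_0 I_add)

lemma I_gen: "g : gens ==> g : I"
 using R.genideal_self[OF gens_C] unfolding I_gens by blast

lemma I_minimal:
 assumes "Z \<subseteq> C" "0 : Z" "!!p q. p : Z ==> q : Z ==> p + q : Z"
  "!!p q. p : C ==> q : Z ==> p * q : Z" "gens \<subseteq> Z"
 shows "I \<subseteq> Z"
 unfolding I_gens by(rule R.genideal_minimal[OF ideal_flat_polyI[OF assms(1-4)] assms(5)])
lemma I_incomparable: "F : FL ==> F' : FL ==> \<not> F \<subseteq> F' ==> \<not> F' \<subseteq> F ==> Var F * Var F' : I"
 by(rule I_gen) (auto simp: gens_def)

lemma I_theta: "i : E ==> \<theta> i : I"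
 by(rule I_gen) (simp add: gens_def)

definition above where "above G = (\<Sum>H \<in> {H : FL. G \<subseteq> H & H ~= {}}. Var H :: nat set_poly)"
definition xv :: "nat set => nat set_poly" where "xv F = (if F = {} then 1 else Var F)"

lemma above_C: "above G : C"
 unfolding above_def by(auto intro!: C_sum C_Var)

lemma xv_C: "F : FL ==> xv F : C"
 by(auto simp: xv_def C_1 C_Var)

text \<open>The induction exchanges the sum over the flats above \<open>G\<close> for flats that lie above
 \<open>F\<close> and a further element of \<open>G\<close>, which are closer to \<open>G\<close>.\<close>

lemma xv_above_power:
 assumes "F : FL" "F ~= E" "G \<subseteq> E" "\<not> G \<subseteq> F" "min (card (G \<union> F)) r <= card F + g"
 shows "xv F * above G ^ g : I"
 using assms
proof (induction g arbitrary: F)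
 case 0
 have "card F < r" by(rule FL_card[OF 0(1,2)])
 moreover have "finite (G \<union> F)" using FL_fin[OF 0(1)] 0(3) finite_subset by blast
 hence "card F < card (G \<union> F)" using 0(4) by(intro psubset_card_mono) auto
 ultimately show ?case using 0(5) by simp
next
 case (Suc g)
 obtain i where i: "i : G" "i \<notin> F" using Suc.prems(4) by blast
 define S where "S = {H : FL. i : H & \<not> G \<subseteq> H}"
 have "{H : FL. i : H} = {H : FL. G \<subseteq> H & H ~= {}} \<union> S" using i(1) by(auto simp: S_def)
 hence "\<theta> i = above G + (\<Sum>H\<in>S. Var H)"
  unfolding \<theta>_def above_def
  by(simp only:) (rule sum.union_disjoint, use finite_FL in "auto simp: S_def")
 hence th: "above G = \<theta> i - (\<Sum>H\<in>S. Var H)" by simp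
 have e: "xv F * above G ^ Suc g = xv F * above G ^ g * \<theta> i - (\<Sum>H\<in>S. xv F * (Var H * above G ^ g))"
  by(subst power_Suc2, subst (2) th) (simp add: right_diff_distrib sum_distrib_left sum_distrib_right mult_ac)
 have "xv F * above G ^ g * \<theta> i : I"
  using i(1) Suc.prems(3) by(intro I_mult C_mult xv_C C_power above_C I_theta Suc.prems(1)) auto
 moreover have "xv F * (Var H * above G ^ g) : I" if H: "H : S" for H
 proof -
  have HL: "H : FL" "i : H" "\<not> G \<subseteq> H" "H ~= {}" using H by(auto simp: S_def)
  have HE: "H ~= E" using HL(3) Suc.prems(3) by blast
  show ?thesis
  proof (cases "F \<subseteq> H")
   case True
   have finG: "finite G" using Suc.prems(3) finite_subset by blast
   have fin: "finite F" "finite H" by(rule FL_fin[OF Suc.prems(1)], rule FL_fin[OF HL(1)])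
   have FH: "card F < card H" using True HL(2) i(2) fin by(intro psubset_card_mono) auto
   have "card (G \<union> F) = card F + card (G - F)" "card (G \<union> H) = card H + card (G - H)"
   using card_Un_disjoint[of F "G - F"] card_Un_disjoint[of H "G - H"] fin finG
   by(simp_all add: Un_commute)
   moreover have "card (G - H) < card (G - F)"
   using True HL(2) i finG by(intro psubset_card_mono) auto
   ultimately have "min (card (G \<union> H)) r <= card H + g" using Suc.prems(5) FH by linarith
   hence "xv H * above G ^ g : I" by(rule Suc.IH[OF HL(1) HE Suc.prems(3) HL(3)])
   hence "Var H * above G ^ g : I" using HL(4) by(simp add: xv_def)
   thus ?thesis by(rule I_mult[OF xv_C[OF Suc.prems(1)]])
  next
   case False
   moreover have "\<not> H \<subseteq> F" using HL(2) i(2) by blast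
   ultimately have "Var F * Var H : I" by(intro I_incomparable Suc.prems(1) HL(1))
   hence "above G ^ g * (Var F * Var H) : I" by(rule I_mult[OF C_power[OF above_C]])
   moreover have "F ~= {}" using False by blast
   ultimately show ?thesis by(simp add: xv_def mult_ac)
  qed
 qed
 ultimately show ?case unfolding e by(intro I_diff I_sum)
qed

definition HH where "HH d e = {p : C. \<forall>m\<in>keys p. deg m = d & e <= wt m}"

lemma HH_mult:
 assumes "p : HH d e" "q : HH d' e'"
 shows "p * q : HH (d + d') (e + e')"
proof -
 have "deg m = d + d' & e + e' <= wt m" if m: "m : keys (p * q)" for m
 proof -
  obtain a b where ab: "m = a + b" "a : keys p" "b : keys q"
   using keys_mult[of p q] m by blast
  hence "deg a = d" "e <= wt a" "deg b = d'" "e' <= wt b" using assms by(auto simp: HH_def)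
  thus ?thesis unfolding ab(1) msum_add by simp
 qed
 thus ?thesis using assms C_mult by(auto simp: HH_def)
qed

lemma HH_add:
 assumes "p : HH d e" "q : HH d e"
 shows "p + q : HH d e"
proof -
 have "p + q : C" using assms C_add by(auto simp: HH_def)
 thus ?thesis using assms keys_add[of p q] unfolding HH_def by blast
qed

lemma HH_0: "0 : HH d e" by(simp add: HH_def C_0)
lemma HH_sum: "(!!a. a : A ==> f a : HH d e) ==> sum f A : HH d e"
 by(induction A rule: infinite_finite_induct) (auto simp: HH_0 HH_add)

lemma HH_Var: "F : FL ==> F ~= {} ==> e <= card F ==> Var F : HH 1 e"
 using C_Var[of F FL] by(auto simp: HH_def Var_def)

lemma HH_mon: "keys m \<subseteq> FL - {{}} ==> mon m : HH (deg m) (wt m)"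
 using C_mon[of m FL] by(auto simp: HH_def mon_def)
lemma HH_mono: "p : HH d e ==> e' <= e ==> p : HH d e'"
 by(auto simp: HH_def)

lemma HH_power: "p : HH d e ==> p ^ k : HH (k * d) (k * e)"
proof (induction k)
 case 0
 show ?case using HH_mon[of 0] by(simp add: mon_0)
next
 case (Suc k)
 thus ?case using HH_mult[of p d e "p ^ k"] by simp
qed

text \<open>Expanding the power, all terms but one involve a flat strictly above
\<open>G\<close>.\<close>

lemma above_power:
 assumes G: "G : FL" "G ~= {}"
 shows "\<exists>q\<in>HH a (a * card G + 1). above G ^ a = Var G ^ a + q"
proof (induction a)
 case 0
 show ?case using HH_0 by(intro bexI[of _ 0]) auto
next
 case (Suc a)
 then obtain q where q: "q : HH a (a * card G + 1)" "above G ^ a = Var G ^ a + q" by blast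
 define z where "z = (\<Sum>H \<in> {H : FL. G \<subset> H}. Var H :: nat set_poly)"
 have "{H : FL. G \<subseteq> H & H ~= {}} = insert G {H : FL. G \<subset> H}" using G by auto
 hence ab: "above G = Var G + z" unfolding above_def z_def using finite_FL by simp
 have z: "z : HH 1 (card G + 1)" unfolding z_def
 proof (rule HH_sum)
  fix H assume H: "H : {H : FL. G \<subset> H}"
  hence "card G < card H" using FL_fin by(intro psubset_card_mono) auto
  thus "Var H : HH 1 (card G + 1)" using H by(intro HH_Var) auto
 qed
 have VG: "Var G : HH 1 (card G)" using G by(intro HH_Var) auto
 have abH: "above G : HH 1 (card G)" unfolding ab by(intro HH_add VG HH_mono[OF z]) simp
 have "above G ^ Suc a = Var G ^ Suc a + (above G * q + z * Var G ^ a)"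
  unfolding power_Suc q(2) by(simp add: ab algebra_simps)
 moreover have "above G * q : HH (Suc a) (Suc a * card G + 1)"
  using HH_mult[OF abH q(1)] by(simp add: add_ac)
 moreover have "z * Var G ^ a : HH (Suc a) (Suc a * card G + 1)"
  using HH_mult[OF z HH_power[OF VG, of a]] by(simp add: add_ac)
 ultimately show ?case using HH_add by blast
qed

definition standard :: "nat set_monom => bool" where
 "standard m \<longleftrightarrow> keys m \<subseteq> FL - {{}} \<and>
   (\<forall>F\<in>keys m. \<forall>G\<in>keys m. F \<subseteq> G \<or> G \<subseteq> F) \<and>
   (\<forall>G\<in>keys m. \<forall>F\<in>insert {} (keys m). F \<subset> G \<longrightarrow> card F + lookup m G < min (card G) r)"

text \<open>Either two flats are incomparable, or the exponent of some flat is too large; in the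
second case \<open>xv_above_power\<close> expresses the monomial by monomials with larger
flats.\<close>

lemma nonstandard:
 assumes m: "keys m \<subseteq> FL - {{}}" and ns: "\<not> standard m"
 shows "\<exists>p\<in>HH (deg m) (wt m + 1). mon m - p : I"
proof (cases "\<forall>F\<in>keys m. \<forall>G\<in>keys m. F \<subseteq> G \<or> G \<subseteq> F")
 case False
 then obtain F G where FG: "F : keys m" "G : keys m" "\<not> F \<subseteq> G" "\<not> G \<subseteq> F" by blast
 define m0 where "m0 = m - (single F 1 + single G 1)"
 have "F ~= G" using FG(3) by blast
 hence em: "m = m0 + (single F 1 + single G 1)"
  using FG(1,2) by(intro poly_mapping_eqI) (auto simp: m0_def lookup_add lookup_minus lookup_single when_def in_keys_iff)
 have "keys m0 \<subseteq> keys m"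
  unfolding m0_def by(rule keys_minus_nat)
 hence "mon m0 : C" using m by(intro C_mon) auto
 moreover have "Var F * Var G : I" using FG m by(intro I_incomparable) auto
 ultimately have "mon m0 * (Var F * Var G) : I" by(rule I_mult)
 moreover have "mon m = mon m0 * (Var F * Var G)"
  by(subst em) (simp only: mon_add mon_single_power power_one_right)
 ultimately show ?thesis using HH_0 by(intro bexI[of _ 0]) simp_all
next
 case True
 then obtain F G where FG: "G : keys m" "F : insert {} (keys m)" "F \<subset> G"
  and viol: "min (card G) r <= card F + lookup m G"
  using ns m unfolding standard_def by(meson not_le)
 define a where "a = lookup m G"
 define sF where "sF = (if F = {} then 0 else single F (1::nat))"
 define m0 where "m0 = m - (sF + single G a)"
 have em: "m = m0 + (sF + single G a)"
  using FG by(intro poly_mapping_eqI)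
   (auto simp: m0_def sF_def a_def lookup_add lookup_minus lookup_single when_def in_keys_iff)
 have k0: "keys m0 \<subseteq> FL - {{}}"
  using m keys_minus_nat[of m] unfolding m0_def by blast
 have GL: "G : FL" "G ~= {}" "G \<subseteq> E" using FG(1) m FL_sub by auto
 have FLF: "F : FL" using FG(2) m by(auto simp: uniform_flats_def)
 have FE: "F ~= E" using FG(3) GL(3) by blast
 have GF: "G \<union> F = G" using FG(3) by blast
 have "xv F * above G ^ a : I"
 proof (rule xv_above_power[OF FLF FE GL(3)])
  show "\<not> G \<subseteq> F" using FG(3) by blast
  show "min (card (G \<union> F)) r <= card F + a" unfolding GF a_def by(rule viol)
 qed
 hence inI: "mon m0 * (xv F * above G ^ a) : I" by(rule I_mult[OF C_mon[OF k0]])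
 obtain q where q: "q : HH a (a * card G + 1)" "above G ^ a = Var G ^ a + q"
  using above_power[OF GL(1,2)] by blast
 have xvF: "xv F = mon sF" by(simp add: xv_def sF_def mon_0 mon_single_power[of F 1, simplified])
 have ksF: "keys sF \<subseteq> FL - {{}}" using FLF by(simp add: sF_def)
 have "mon m = mon m0 * (xv F * Var G ^ a)"
  by(subst em) (simp only: mon_add mon_single_power xvF)
 hence "mon m - (- (mon m0 * (xv F * q))) = mon m0 * (xv F * above G ^ a)"
  unfolding q(2) by(simp add: algebra_simps)
 hence "mon m - (- (mon m0 * (xv F * q))) : I" using inI by simp
 moreover have "mon m0 * (xv F * q) : HH (deg m) (wt m + 1)"
 proof -
  have "deg m = deg m0 + (deg sF + a)" "wt m + 1 = wt m0 + (wt sF + (a * card G + 1))"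
   by(subst em, simp add: msum_add)+
  thus ?thesis unfolding xvF
   using HH_mult[OF HH_mon[OF k0] HH_mult[OF HH_mon[OF ksF] q(1)]] by simp
 qed
 hence "- (mon m0 * (xv F * q)) : HH (deg m) (wt m + 1)"
  using C_uminus by(auto simp: HH_def keys_uminus)
 ultimately show ?thesis by blast
qed

lemma wt_le: "keys m \<subseteq> FL - {{}} ==> wt m <= deg m * n"
proof -
 assume m: "keys m \<subseteq> FL - {{}}"
 have "card F <= n" if "F : keys m" for F
  using card_mono[of E F] FL_sub[of F] that m by auto
 thus ?thesis unfolding msum_def sum_distrib_right by(intro sum_mono) simp
qed

definition reducible where
 "reducible d p \<longleftrightarrow> (\<exists>q. keys q \<subseteq> {m. standard m & deg m = d} & p - q : I)"

lemma reducible_add: "reducible d p ==> reducible d p' ==> reducible d (p + p')"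
proof -
 assume "reducible d p" "reducible d p'"
 then obtain q q' where q: "keys q \<subseteq> {m. standard m & deg m = d}" "p - q : I"
  "keys q' \<subseteq> {m. standard m & deg m = d}" "p' - q' : I" unfolding reducible_def by blast
 have "p + p' - (q + q') : I" using I_add[OF q(2,4)] by(simp add: algebra_simps)
 moreover have "keys (q + q') \<subseteq> {m. standard m & deg m = d}"
  using keys_add[of q q'] q(1,3) by blast
 ultimately show ?thesis unfolding reducible_def by blast
qed

lemma reducible_const: "reducible d p ==> reducible d (const c * p)"
proof -
 assume "reducible d p"
 then obtain q where q: "keys q \<subseteq> {m. standard m & deg m = d}" "p - q : I"
  unfolding reducible_def by blast
 have "const c * p - const c * q : I" using I_mult[OF C_const q(2)] by(simp add: algebra_simps)
 moreover have "keys (const c * q) \<subseteq> keys q"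
  using keys_mult[of "const c" q] by(auto simp: const_def split: if_splits)
 ultimately show ?thesis unfolding reducible_def using q(1) by blast
qed

lemma reducible_I: "p : I ==> reducible d p"
 unfolding reducible_def by(intro exI[of _ 0]) simp
lemma reducible_0: "reducible d 0"
 by(rule reducible_I[OF I_0])
lemma reducible_sum: "(!!a. a : A ==> reducible d (f a)) ==> reducible d (sum f A)"
 by(induction A rule: infinite_finite_induct) (auto simp: reducible_add reducible_0)

text \<open>The total size of the flats is bounded in each degree, so the rewriting ends.\<close>

lemma reducible_mon:
 assumes "keys m \<subseteq> FL - {{}}"
 shows "reducible (deg m) (mon m)"
 using assms
proof (induction "deg m * n - wt m" arbitrary: m rule: less_induct)
 case less
 show ?case
 proof (cases "standard m")
  case True
  thus ?thesis unfolding reducible_def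
   by(intro exI[of _ "mon m"]) (simp add: I_0, simp add: mon_def)
 next
  case False
  obtain p where p: "p : HH (deg m) (wt m + 1)" "mon m - p : I"
   using nonstandard[OF less.prems False] by blast
  have "reducible (deg m) (mon k)" if k: "k : keys p" for k
  proof -
   have kk: "keys k \<subseteq> FL - {{}}" "deg k = deg m" "wt m < wt k"
   using p(1) k by(auto simp: HH_def carrier_flat_poly)
   have "deg k * n - wt k < deg m * n - wt m" using wt_le[OF kk(1)] kk(2,3) by simp
   from less.hyps[OF this kk(1)] show ?thesis using kk(2) by simp
  qed
  hence "reducible (deg m) p"
   by(subst poly_as_sum[of p]) (intro reducible_sum reducible_const)
  from reducible_add[OF reducible_I[OF p(2)] this] show ?thesis by simp
 qed
qed

lemma standard_spans:
 assumes "p : C" "\<forall>m\<in>keys p. deg m = d"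
 shows "reducible d p"
proof -
 have "reducible d (mon m)" if m: "m : keys p" for m
  using reducible_mon[of m] assms m by(auto simp: carrier_flat_poly)
 thus ?thesis by(subst poly_as_sum[of p]) (intro reducible_sum reducible_const)
qed

end

section \<open>Feichtner--Yuzvinsky lists\<close>

fun fy :: "nat => nat set => (nat set \<times> nat) list => nat => bool" where
 "fy r E [] b \<longleftrightarrow> b < r"
| "fy r E ((G, a) # L) b \<longleftrightarrow> G \<subseteq> E & card G < r & 1 <= a & a < card G & fy (r - card G) (E - G) L b"

definition FY where "FY r E = {(L, b). fy r E L b}"

lemma FY_split:
 "FY r E = Pair [] ` {..<r} \<union>
  (%((G, a), L, b). ((G, a) # L, b)) ` (SIGMA (G, a) : (SIGMA G:{G. G \<subseteq> E & 2 <= card G & card G < r}. {1..<card G}). FY (r - card G) (E - G))"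
 (is "_ = ?A \<union> ?B")
proof (intro equalityI subsetI)
 fix x assume "x : FY r E"
 then obtain L b where x: "x = (L, b)" "fy r E L b" by(auto simp: FY_def)
 show "x : ?A \<union> ?B"
 proof (cases L)
  case (Cons Ga L')
  obtain G a where Ga: "Ga = (G, a)" by fastforce
  have f: "G \<subseteq> E" "card G < r" "1 <= a" "a < card G" "fy (r - card G) (E - G) L' b"
   using x(2) by(auto simp: Cons Ga)
  have "((G, a), L', b) : (SIGMA (G, a) : (SIGMA G:{G. G \<subseteq> E & 2 <= card G & card G < r}. {1..<card G}). FY (r - card G) (E - G))"
   using f by(simp add: FY_def)
  hence "(%((G, a), L, b). ((G, a) # L, b)) ((G, a), L', b) : ?B" by(rule imageI)
  thus ?thesis by(simp add: x Cons Ga)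
 qed (use x in auto)
qed (auto simp: FY_def)

lemma finite_FY: "finite E ==> finite (FY r E)"
proof (induction r arbitrary: E rule: less_induct)
 case (less r)
 have "finite (SIGMA (G, a) : (SIGMA G:{G. G \<subseteq> E & 2 <= card G & card G < r}. {1..<card G}). FY (r - card G) (E - G))"
 proof (rule finite_SigmaI)
  show "finite (SIGMA G:{G. G \<subseteq> E & 2 <= card G & card G < r}. {1..<card G})"
   by(rule finite_SigmaI) (use less.prems in auto)
  fix Ga assume "Ga : (SIGMA G:{G. G \<subseteq> E & 2 <= card G & card G < r}. {1..<card G})"
  thus "finite (case Ga of (G, a) => FY (r - card G) (E - G))" using less.prems by(auto intro!: less.IH)
 qed
 thus ?case unfolding FY_split[of r E] by(intro finite_UnI finite_imageI) auto
qed

fun fmono :: "nat set => nat set => (nat set \<times> nat) list => nat => nat set_monom" where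
 "fmono E P [] b = single E b"
| "fmono E P ((G, a) # L) b = single (P \<union> G) a + fmono E (P \<union> G) L b"

lemma deg_fmono: "deg (fmono E P L b) = fy_degree (L, b)"
 by(induction E P L b rule: fmono.induct) (auto simp: fy_degree_def msum_add)

text \<open>The value at a full flag, given by an ordering of the remaining elements.\<close>

fun fval :: "(nat set \<times> nat) list => nat => nat list => rat" where
 "fval [] b w = of_nat (last w) ^ b"
| "fval ((G, a) # L) b w = (if set (take (card G) w) = G
   then (of_nat (w ! (card G - 1)) - of_nat (w ! card G)) ^ a * fval L b (drop (card G) w) else 0)"

lemma coefficients_vanish:
 fixes c :: "nat => rat" and S :: "rat set"
 assumes "finite S" "k < card S" "!!x. x : S ==> (\<Sum>i\<le>k. c i * x ^ i) = 0" "i <= k"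
 shows "c i = 0"
proof (rule ccontr)
 assume "c i ~= 0"
 hence "(of_rat (c i) :: real) ~= 0" by simp
 from polyfun_rootbound[of "%i. of_rat (c i) :: real", OF this assms(4)]
 have R: "finite {z::real. (\<Sum>i\<le>k. of_rat (c i) * z ^ i) = 0}" "card {z::real. (\<Sum>i\<le>k. of_rat (c i) * z ^ i) = 0} <= k"
  by auto
 have "(of_rat ` S :: real set) \<subseteq> {z. (\<Sum>i\<le>k. of_rat (c i) * z ^ i) = 0}"
 proof (rule image_subsetI)
  fix x assume "x : S"
  hence "of_rat (\<Sum>i\<le>k. c i * x ^ i) = (0 :: real)" using assms(3) by simp
  thus "of_rat x : {z::real. (\<Sum>i\<le>k. of_rat (c i) * z ^ i) = 0}"
   by(simp add: of_rat_sum of_rat_mult of_rat_power)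
 qed
 hence "card (of_rat ` S :: real set) <= k" using R card_mono le_trans by blast
 moreover have "card (of_rat ` S :: real set) = card S" by(rule card_image) (simp add: inj_on_def)
 ultimately show False using assms(2) by simp
qed

text \<open>The last element of the first block \<open>G\<close> can be any of its \<open>card G\<close> elements, while the
 exponent of \<open>G\<close> is smaller than \<open>card G\<close>; so the contributions of all exponents of \<open>G\<close> separate.\<close>

theorem fval_independent:
 assumes "finite E" "E ~= {}"
  "!!w. distinct w ==> set w = E ==> (\<Sum>x\<in>FY (card E) E. c x * fval (fst x) (snd x) w) = 0"
  "x : FY (card E) E"
 shows "c x = 0"
 using assms
proof (induction "card E" arbitrary: E c x rule: less_induct)
 case less
 define n where "n = card E"
 have finE: "finite E" by fact
 define hG where "hG G a v = (\<Sum>x\<in>FY (n - card G) (E - G). c ((G, a) # fst x, snd x) * fval (fst x) (snd x) v)" for G a v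
 define fG where "fG G w = (if set (take (card G) w) = G
  then (\<Sum>a\<in>{1..<card G}. (of_nat (w ! (card G - 1)) - of_nat (w ! card G)) ^ a * hG G a (drop (card G) w)) else 0)" for G w
 define A where "A z = (\<Sum>b<n. c ([], b) * of_nat z ^ b)" for z
 define S where "S = {G. G \<subseteq> E & 2 <= card G & card G < n}"
 have finS: "finite S" unfolding S_def using finE by simp
 have n0: "0 < n" using less.prems(1,2) by(simp add: n_def card_gt_0_iff)
 have dec: "(\<Sum>x\<in>FY n E. c x * fval (fst x) (snd x) w) = A (last w) + (\<Sum>G\<in>S. fG G w)" for w
 proof -
  let ?J = "SIGMA (G, a) : (SIGMA G:S. {1..<card G}). FY (n - card G) (E - G)"
  have sp: "FY n E = Pair [] ` {..<n} \<union> (%((G, a), L, b). ((G, a) # L, b)) ` ?J"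
   unfolding S_def by(rule FY_split)
  have "(\<Sum>x\<in>FY n E. c x * fval (fst x) (snd x) w) =
   (\<Sum>x\<in>Pair ([] :: (nat set \<times> nat) list) ` {..<n}. c x * fval (fst x) (snd x) w) +
   (\<Sum>x\<in>(%((G, a), L, b). ((G, a) # L, b)) ` ?J. c x * fval (fst x) (snd x) w)"
   unfolding sp
  proof (rule sum.union_disjoint)
   show "finite ((%((G, a), L, b). ((G, a) # L, b)) ` ?J)"
   by(rule finite_subset[OF _ finite_FY[OF finE, of n]]) (subst sp, blast)
  qed auto
  also have "(\<Sum>x\<in>Pair ([] :: (nat set \<times> nat) list) ` {..<n}. c x * fval (fst x) (snd x) w) = A (last w)"
   by(subst sum.reindex) (auto simp: inj_on_def A_def)
  also have "(\<Sum>x\<in>(%((G, a), L, b). ((G, a) # L, b)) ` ?J. c x * fval (fst x) (snd x) w)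
   = (\<Sum>x\<in>?J. case x of ((G, a), y) => c ((G, a) # fst y, snd y) * fval ((G, a) # fst y) (snd y) w)"
   by(subst sum.reindex) (auto simp: inj_on_def intro!: sum.cong)
  also have "... = (\<Sum>Ga\<in>(SIGMA G:S. {1..<card G}). \<Sum>y\<in>(case Ga of (G, a) => FY (n - card G) (E - G)).
   case Ga of (G, a) => c ((G, a) # fst y, snd y) * fval ((G, a) # fst y) (snd y) w)"
   by(subst sum.Sigma) (auto simp: finite_FY finE finS intro!: sum.cong finite_SigmaI)
  also have "... = (\<Sum>(G, a)\<in>(SIGMA G:S. {1..<card G}). \<Sum>y\<in>FY (n - card G) (E - G).
   c ((G, a) # fst y, snd y) * fval ((G, a) # fst y) (snd y) w)"
   by(intro sum.cong) auto
  also have "... = (\<Sum>G\<in>S. \<Sum>a\<in>{1..<card G}. \<Sum>y\<in>FY (n - card G) (E - G).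
   c ((G, a) # fst y, snd y) * fval ((G, a) # fst y) (snd y) w)"
   by(subst sum.Sigma) (auto simp: finS)
  also have "... = (\<Sum>G\<in>S. fG G w)"
   by(intro sum.cong refl) (simp add: fG_def hG_def sum_distrib_left mult_ac)
  finally show ?thesis .
 qed
 have zero: "A (last w) + (\<Sum>G\<in>S. fG G w) = 0" if "distinct w" "set w = E" for w
  using less.prems(3)[OF that] dec[of w] by(simp add: n_def)
 have claim: "hG G a v = 0" if "G : S" "a : {1..<card G}" "distinct v" "set v = E - G" for G a v
  using that
 proof (induction "card G" arbitrary: G a v rule: less_induct)
  case (less G)
  define g where "g = card G"
  have G: "G \<subseteq> E" "2 <= g" "g < n" using less.prems(1) by(auto simp: S_def g_def)
  have finG: "finite G" using G(1) finE finite_subset by blast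
  have "G ~= E" using G(3) by(auto simp: g_def n_def)
  hence vne: "v ~= []" using less.prems(4) G(1) by auto
  define u where "u z = sorted_list_of_set (G - {z}) @ [z]" for z
  have u: "distinct (u z)" "set (u z) = G" "length (u z) = g" "last (u z) = z" "u z ! (g - 1) = z" if "z : G" for z
  proof -
   show "distinct (u z)" "set (u z) = G" "last (u z) = z" using finG that by(auto simp: u_def)
   have l: "length (sorted_list_of_set (G - {z})) = g - 1" using finG that by(simp add: g_def)
   thus "length (u z) = g" "u z ! (g - 1) = z" using G(2) by(simp_all add: u_def nth_append)
  qed
  have w: "distinct (u z @ v)" "set (u z @ v) = E" if "z : G" for z
   using u(1,2)[OF that] less.prems(3,4) G(1) by auto
  obtain z0 where z0: "z0 : G" using G(2) by(fastforce simp: g_def)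
  have lower: "fG G' (u z @ v) = 0" if z: "z : G" and G': "G' : S" "card G' < g" for z G'
  proof (cases "set (take (card G') (u z @ v)) = G'")
   case True
   have sd: "set (drop (card G') (u z @ v)) = E - G'"
   proof -
   have "set (take (card G') (u z @ v)) \<union> set (drop (card G') (u z @ v)) = E"
   using w(2)[OF z] by(metis append_take_drop_id set_append)
   moreover have "set (take (card G') (u z @ v)) \<inter> set (drop (card G') (u z @ v)) = {}"
   using w(1)[OF z] by(metis append_take_drop_id distinct_append)
   ultimately show ?thesis using True by blast
   qed
   have "hG G' a (drop (card G') (u z @ v)) = 0" if "a : {1..<card G'}" for a
   by(rule less.hyps[OF _ G'(1) that distinct_drop[OF w(1)[OF z]] sd]) (use G'(2) in "simp add: g_def")
   hence "(\<Sum>a\<in>{1..<card G'}. (of_nat ((u z @ v) ! (card G' - 1)) - of_nat ((u z @ v) ! card G')) ^ a * hG G' a (drop (card G') (u z @ v))) = 0"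
   by(intro sum.neutral) simp
   thus ?thesis unfolding fG_def by simp
  qed (simp add: fG_def)
  have same: "fG G' (u z @ v) = (if G' = G then fG G (u z @ v) else 0)" if z: "z : G" and G': "card G' = g" for z G'
  proof (cases "G' = G")
   case False
   have "set (take (card G') (u z @ v)) = G" using G' u(2,3)[OF z] by simp
   thus ?thesis using False by(simp add: fG_def)
  qed simp
  have upper: "fG G' (u z @ v) = fG G' (u z0 @ v)" if z: "z : G" and G': "g < card G'" for z G'
  proof -
   obtain k where k: "card G' = g + Suc k" using less_imp_Suc_add[OF G'] by auto
   show ?thesis using u(2,3)[OF z] u(2,3)[OF z0] by(simp add: fG_def k nth_append)
  qed
  have GS: "G : S" by fact
  define K where "K = A (last v) + (\<Sum>G'\<in>S. if g < card G' then fG G' (u z0 @ v) else 0)"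
  have eqz: "K + (\<Sum>a\<in>{1..<g}. hG G a v * (of_nat z - of_nat (v ! 0)) ^ a) = 0" if z: "z : G" for z
  proof -
   have "(\<Sum>G'\<in>S. fG G' (u z @ v)) = (\<Sum>G'\<in>S. (if g < card G' then fG G' (u z0 @ v) else 0) + (if G' = G then fG G (u z @ v) else 0))"
   proof (rule sum.cong[OF refl])
   fix G' assume G': "G' : S"
   consider "card G' < g" | "card G' = g" | "g < card G'" by linarith
   thus "fG G' (u z @ v) = (if g < card G' then fG G' (u z0 @ v) else 0) + (if G' = G then fG G (u z @ v) else 0)"
   proof cases
   case 1
   thus ?thesis using lower[OF z G' 1] by(auto simp: g_def)
   next
   case 2
   thus ?thesis using same[OF z 2] by simp
   next
   case 3
   thus ?thesis using upper[OF z 3] by(auto simp: g_def)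
   qed
   qed
   also have "... = (\<Sum>G'\<in>S. if g < card G' then fG G' (u z0 @ v) else 0) + fG G (u z @ v)"
   using GS finS by(simp add: sum.distrib)
   finally have "K + fG G (u z @ v) = 0"
   using zero[OF w[OF z]] vne by(simp add: K_def)
   moreover have "fG G (u z @ v) = (\<Sum>a\<in>{1..<g}. hG G a v * (of_nat z - of_nat (v ! 0)) ^ a)"
   proof -
   have "(u z @ v) ! (g - 1) = z" using u(3,5)[OF z] G(2) by(simp add: nth_append)
   thus ?thesis using u(2,3,5)[OF z] by(simp add: fG_def g_def[symmetric] nth_append mult.commute)
   qed
   ultimately show ?thesis by simp
  qed
  define cc where "cc i = (if i = 0 then K else hG G i v)" for i
  define X where "X = (%z. of_nat z - of_nat (v ! 0) :: rat) ` G"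
  have "card X = g" unfolding X_def g_def by(rule card_image) (simp add: inj_on_def)
  moreover have "(\<Sum>i\<le>g - 1. cc i * x ^ i) = 0" if xX: "x : X" for x
  proof -
   obtain z where z: "z : G" "x = of_nat z - of_nat (v ! 0)" using xX unfolding X_def by blast
   have "{..g - 1} = insert 0 {1..<g}" using G(2) by auto
   hence "(\<Sum>i\<le>g - 1. cc i * x ^ i) = K + (\<Sum>i\<in>{1..<g}. hG G i v * x ^ i)" by(simp add: cc_def)
   thus ?thesis using eqz[OF z(1)] z(2) by simp
  qed
  moreover have "finite X" using finG by(simp add: X_def)
  ultimately have "cc a = 0"
   using coefficients_vanish[of X "g - 1" cc a] less.prems(2) G(2) by(auto simp: g_def)
  thus ?case using less.prems(2) by(simp add: cc_def)
 qed
 have cons: "c ((G, a) # L, b) = 0" if G: "G : S" "a : {1..<card G}" and Lb: "(L, b) : FY (n - card G) (E - G)" for G a L b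
 proof -
  have G': "G \<subseteq> E" "card G < n" "2 <= card G" using G(1) by(auto simp: S_def)
  have cd: "card (E - G) = n - card G" unfolding n_def using G'(1) finE finite_subset by(intro card_Diff_subset) auto
  have "c ((G, a) # fst (L, b), snd (L, b)) = 0"
  proof (rule less.hyps[of "E - G" "%y. c ((G, a) # fst y, snd y)" "(L, b)"])
   show "card (E - G) < card E" using cd G' by(simp add: n_def)
   show "E - G ~= {}" using cd G' by(metis card.empty zero_less_diff less_irrefl)
   fix v assume v: "distinct v" "set v = E - G"
   show "(\<Sum>y\<in>FY (card (E - G)) (E - G). c ((G, a) # fst y, snd y) * fval (fst y) (snd y) v) = 0"
   using claim[OF G v] unfolding hG_def cd .
  qed (use finE Lb cd in auto)
  thus ?thesis by simp
 qed
 have nil: "c ([], b) = 0" if b: "b < n" for b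
 proof -
  have "fG G w = 0" if "G : S" "distinct w" "set w = E" for G w
  proof (cases "set (take (card G) w) = G")
   case True
   have "set (take (card G) w) \<union> set (drop (card G) w) = E" "set (take (card G) w) \<inter> set (drop (card G) w) = {}"
   using that(2,3) by(metis append_take_drop_id set_append, metis append_take_drop_id distinct_append)
   hence "set (drop (card G) w) = E - G" using True by blast
   hence "hG G a (drop (card G) w) = 0" if "a : {1..<card G}" for a
   using claim[OF \<open>G : S\<close> that distinct_drop[OF \<open>distinct w\<close>]] by simp
   thus ?thesis unfolding fG_def by(simp add: sum.neutral)
  qed (simp add: fG_def)
  hence Al: "A (last w) = 0" if "distinct w" "set w = E" for w using zero[OF that] that by simp
  have "c ([], b) = 0"
  proof (rule coefficients_vanish[of "of_nat ` E" "n - 1" "%b. c ([], b)"])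
   show "n - 1 < card (of_nat ` E :: rat set)" using n0 by(subst card_image) (auto simp: inj_on_def n_def)
   fix x :: rat assume "x : of_nat ` E"
   then obtain z where z: "z : E" "x = of_nat z" by blast
   have "A (last (sorted_list_of_set (E - {z}) @ [z])) = 0" by(rule Al) (use z finE in auto)
   moreover have "{..n - 1} = {..<n}" using n0 by auto
   ultimately show "(\<Sum>i\<le>n - 1. c ([], i) * x ^ i) = 0" by(simp add: A_def z(2))
  qed (use finE b in auto)
  thus ?thesis .
 qed
 obtain L b where x: "x = (L, b)" "fy n E L b" using less.prems(4) by(auto simp: FY_def n_def)
 show ?case
 proof (cases L)
  case Nil
  thus ?thesis using nil x by simp
 next
  case (Cons Ga L')
  obtain G a where Ga: "Ga = (G, a)" by fastforce
  have "G : S" "a : {1..<card G}" "(L', b) : FY (n - card G) (E - G)"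
   using x(2) by(auto simp: Cons Ga S_def FY_def)
  from cons[OF this] show ?thesis by(simp add: x(1) Cons Ga)
 qed
qed

text \<open>The point of the deformed ring belonging to the ordering \<open>w\<close>: along the
flag of initial segments of \<open>w\<close> the values are differences of consecutive letters, so
that they telescope.\<close>

definition xval :: "nat list => nat set => rat" where
 "xval w F = (if F = set (take (card F) w)
   then (if card F < length w then of_nat (w ! (card F - 1)) - of_nat (w ! card F) else of_nat (last w)) else 0)"

text \<open>The flats of the monomial must be initial segments of the ordering, which can be tested
block by block.\<close>

lemma mev_fmono:
 assumes "distinct (u @ v)" "set (u @ v) = E" "set u = P" "fy r (E - P) L b" "r <= card (E - P)"
 shows "mev (xval (u @ v)) (fmono E P L b) = fval L b v"
 using assms
proof (induction L arbitrary: u v P r)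
 case Nil
 have "card (E - P) ~= 0" using Nil(4,5) by simp
 hence "E - P ~= {}" by(metis card.empty)
 hence "v ~= []" using Nil by auto
 moreover have "card E = length (u @ v)" using Nil(1,2) distinct_card by metis
 ultimately show ?case using Nil(2) by(simp add: xval_def)
next
 case (Cons Ga L)
 obtain G a where Ga: "Ga = (G, a)" by fastforce
 have f: "G \<subseteq> E - P" "card G < r" "1 <= a" "a < card G" "fy (r - card G) (E - P - G) L b"
  using Cons.prems(4) by(auto simp: Ga)
 have sv: "set v = E - P" "set v \<inter> P = {}" using Cons.prems(1-3) by auto
 have fin: "finite E" "finite P" using Cons.prems(2,3) by auto
 have finG: "finite G" using f(1) fin(1) finite_subset by blast
 have lu: "length u = card P" using Cons.prems(1,3) distinct_card by fastforce
 have lv: "length v = card (E - P)" using Cons.prems(1) sv(1) distinct_card by fastforce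
 have cPG: "card (P \<union> G) = length u + card G"
  unfolding lu using f(1) fin(2) finG by(intro card_Un_disjoint) auto
 have lt: "card G < length v" using f(2) Cons.prems(5) lv by simp
 have eqv: "P \<union> G = set (take (card (P \<union> G)) (u @ v)) \<longleftrightarrow> set (take (card G) v) = G"
 proof -
  have e: "set (take (card (P \<union> G)) (u @ v)) = P \<union> set (take (card G) v)"
   unfolding cPG using Cons.prems(3) by simp
  have d: "P \<union> G = P \<union> Y \<longleftrightarrow> Y = G" if "Y \<inter> P = {}" "G \<inter> P = {}" for Y
   using that by blast
  have "set (take (card G) v) \<inter> P = {}" using sv(2) set_take_subset[of "card G" v] by blast
  moreover have "G \<inter> P = {}" using f(1) by blast
  ultimately show ?thesis unfolding e by(rule d)
 qed
 have val: "xval (u @ v) (P \<union> G) = (if set (take (card G) v) = G then of_nat (v ! (card G - 1)) - of_nat (v ! card G) else 0)"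
 proof -
  obtain h where h: "card G = Suc h" using f(4) by(cases "card G") auto
  have i1: "(u @ v) ! (length u + card G - 1) = v ! (card G - 1)"
   unfolding h using nth_append_length_plus[of u v h] by simp
  have i2: "(u @ v) ! (length u + card G) = v ! card G" by simp
  show ?thesis unfolding xval_def eqv unfolding cPG i1 i2 by(simp only: lt length_append nat_add_left_cancel_less if_True)
 qed
 show ?case
 proof (cases "set (take (card G) v) = G")
  case True
  have uv: "u @ v = (u @ take (card G) v) @ drop (card G) v" by simp
  have "mev (xval ((u @ take (card G) v) @ drop (card G) v)) (fmono E (P \<union> G) L b) = fval L b (drop (card G) v)"
  proof (rule Cons.IH[where r = "r - card G"])
   show "distinct ((u @ take (card G) v) @ drop (card G) v)" "set ((u @ take (card G) v) @ drop (card G) v) = E"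
   unfolding uv[symmetric] by(rule Cons.prems(1,2))+
   show "set (u @ take (card G) v) = P \<union> G" using True Cons.prems(3) by simp
   have e: "E - (P \<union> G) = E - P - G" by blast
   show "fy (r - card G) (E - (P \<union> G)) L b" unfolding e by(rule f(5))
   have "card (E - P - G) = card (E - P) - card G" using f(1) finG by(rule card_Diff_subset[rotated])
   thus "r - card G <= card (E - (P \<union> G))" unfolding e using Cons.prems(5) by simp
  qed
  thus ?thesis unfolding uv[symmetric]
   by(simp only: Ga fmono.simps mev_add mev_single val fval.simps True if_True simp_thms)
 next
  case False
  moreover have "(0::rat) ^ a = 0" using f(3) by simp
  ultimately show ?thesis
   by(simp only: Ga fmono.simps mev_add mev_single val fval.simps if_False mult_zero_left)
 qed
qed

section \<open>The Feichtner--Yuzvinsky basis\<close>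

definition hpart :: "nat => nat set_poly => nat set_poly" where
 "hpart d p = (\<Sum>m\<in>{m : keys p. deg m = d}. single m (lookup p m))"

lemma lookup_hpart: "lookup (hpart d p) m = (if deg m = d then lookup p m else 0)"
 unfolding hpart_def lookup_sum lookup_single when_def by(simp add: in_keys_iff)
lemma keys_hpart: "keys (hpart d p) = {m : keys p. deg m = d}"
 by(auto simp: in_keys_iff lookup_hpart split: if_splits)
lemma hpart_add: "hpart d (p + q) = hpart d p + hpart d q"
 by(rule poly_mapping_eqI) (simp add: lookup_hpart lookup_add)
lemma hpart_0 [simp]: "hpart d 0 = 0"
 by(rule poly_mapping_eqI) (simp add: lookup_hpart)
lemma hpart_sum: "hpart d (sum f A) = (\<Sum>a\<in>A. hpart d (f a))"
 by(induction A rule: infinite_finite_induct) (auto simp: hpart_add)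
lemma hpart_single: "hpart d (single m c) = (if deg m = d then single m c else 0)"
 by(rule poly_mapping_eqI) (auto simp: lookup_hpart lookup_single when_def)
lemma hpart_homogeneous: "\<forall>m\<in>keys p. deg m = e ==> hpart d p = (if d = e then p else 0)"
 by(rule poly_mapping_eqI) (auto simp: lookup_hpart in_keys_iff)

lemma hpart_single_mult:
 "hpart d (single m c * p) = (if deg m <= d then single m c * hpart (d - deg m) p else 0)"
proof -
 have p: "p = (\<Sum>k\<in>keys p. single k (lookup p k))"
  by(rule poly_mapping_as_sum) auto
 have l: "hpart d (single m c * p) = (\<Sum>k\<in>keys p. if deg m + deg k = d then single (m + k) (c * lookup p k) else 0)"
  by(subst p) (simp add: sum_distrib_left mult_single hpart_sum hpart_single msum_add)
 have r: "single m c * hpart (d - deg m) p = (\<Sum>k\<in>keys p. if deg k = d - deg m then single (m + k) (c * lookup p k) else 0)"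
  by(subst p) (auto simp: sum_distrib_left mult_single hpart_sum hpart_single intro!: sum.cong)
 show ?thesis
 proof (cases "deg m <= d")
  case True
  thus ?thesis unfolding l r by(auto intro!: sum.cong)
 next
  case False
  thus ?thesis unfolding l by(auto intro!: sum.neutral)
 qed
qed

definition orderings where "orderings n = {w. distinct w & set w = {1..n}}"

lemma above_top:
 assumes "A : L" "A ~= {}" "!!H. H : L ==> H \<subseteq> A"
 shows "{H : L. A \<subseteq> H & H ~= {}} = {A}"
 using assms by auto

lemma const_facts: "ev v (const c) = c" "m : keys (const c) ==> msum f m < Suc 0"
 by(auto simp: const_def split: if_splits)

locale boolean_chow = chow n n for n
begin

lemma FL_iff: "F : FL \<longleftrightarrow> F \<subseteq> E"
proof
 assume F: "F \<subseteq> E"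
 show "F : FL"
 proof (cases "F = E")
  case False
  hence "card F < card E" using F by(intro psubset_card_mono) auto
  hence "card F <= n - 1" by simp
  thus ?thesis using F unfolding uniform_flats_def by blast
 qed (simp add: uniform_flats_def)
qed (rule FL_sub)

lemma ev_theta:
 assumes w: "w : orderings n" and i: "i : E"
 shows "ev (xval w) (\<theta> i) = of_nat i"
proof -
 have ww: "distinct w" "set w = E" "length w = n" using w distinct_card[of w] by(auto simp: orderings_def)
 obtain p where p: "p < n" "w ! p = i" using i ww by(metis in_set_conv_nth)
 have ct: "card (set (take k w)) = k" if "k <= n" for k using ww(1,3) that by(simp add: distinct_card)
 have iin: "i : set (take k w) \<longleftrightarrow> p < k" if "k <= n" for k
 proof
  assume "i : set (take k w)"
  then obtain q where "q < k" "q < n" "w ! q = i" using that ww(3) by(auto simp: in_set_conv_nth)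
  hence "q = p" using p ww(1,3) nth_eq_iff_index_eq by blast
  thus "p < k" using \<open>q < k\<close> by simp
 next
  assume "p < k"
  thus "i : set (take k w)" using p that ww(3) by(auto simp: in_set_conv_nth intro!: exI[of _ p])
 qed
 define T where "T k = (if k < n then of_nat (w ! k) else 0 :: rat)" for k
 have val: "xval w (set (take k w)) = T (k - 1) - T k" if "k : {Suc p..n}" for k
 proof -
  have k: "k <= n" "1 <= k" using that by auto
  have "w ~= []" using p ww(3) by auto
  thus ?thesis using k unfolding xval_def ct[OF k(1)] T_def
   by(auto simp: ww(3) last_conv_nth)
 qed
 have "ev (xval w) (\<theta> i) = (\<Sum>F\<in>{F : FL. i : F}. xval w F)"
  by(simp add: \<theta>_def ev_sum Var_def)
 also have "... = (\<Sum>F\<in>(%k. set (take k w)) ` {Suc p..n}. xval w F)"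
 proof (rule sum.mono_neutral_right)
  show "finite {F : FL. i : F}" using finite_FL by simp
  show "(%k. set (take k w)) ` {Suc p..n} \<subseteq> {F : FL. i : F}"
   using iin ww(2) set_take_subset by(fastforce simp: FL_iff)
  show "\<forall>F\<in>{F : FL. i : F} - (%k. set (take k w)) ` {Suc p..n}. xval w F = 0"
  proof
   fix F assume F: "F : {F : FL. i : F} - (%k. set (take k w)) ` {Suc p..n}"
   have "F ~= set (take (card F) w)"
   proof
   assume e: "F = set (take (card F) w)"
   have "card F <= n" using F card_mono[of E F] by(auto simp: FL_iff)
   moreover have "p < card F" using iin[OF \<open>card F <= n\<close>] e F by auto
   ultimately have "F : (%k. set (take k w)) ` {Suc p..n}" using e by(intro image_eqI[of _ _ "card F"]) auto
   thus False using F by simp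
   qed
   thus "xval w F = 0" by(simp add: xval_def)
  qed
 qed
 also have "... = (\<Sum>k\<in>{Suc p..n}. xval w (set (take k w)))"
 proof (subst sum.reindex)
  show "inj_on (%k. set (take k w)) {Suc p..n}"
   by(rule inj_on_inverseI[of _ card]) (simp add: ct)
 qed simp
 also have "... = (\<Sum>k\<in>{Suc p..n}. T (k - 1) - T k)" by(rule sum.cong[OF refl val])
 also have "... = T p - T n"
 proof -
  have "(\<Sum>k\<in>{Suc p..q}. T (k - 1) - T k) = T p - T q" if "p <= q" for q
   using that by(induction q rule: dec_induct) auto
  thus ?thesis using p(1) by simp
 qed
 finally show ?thesis using p by(simp add: T_def)
qed

lemma ev_incomparable:
 assumes "\<not> F \<subseteq> F'" "\<not> F' \<subseteq> F"
 shows "ev (xval w) (Var F * Var F') = 0"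
proof -
 have "xval w F = 0 \<or> xval w F' = 0"
 proof (rule ccontr)
  assume "\<not> ?thesis"
  hence "F = set (take (card F) w)" "F' = set (take (card F') w)" unfolding xval_def by metis+
  moreover have "set (take a w) \<subseteq> set (take b w)" if "a <= b" for a b by(rule set_take_subset_set_take[OF that])
  ultimately show False using assms by(metis nat_le_linear)
 qed
 thus ?thesis by(auto simp: ev_mult Var_def)
qed

text \<open>On the flags, \<open>p\<close> agrees with a polynomial of degree less than
\<open>d\<close>.\<close>

definition low where
 "low d p \<longleftrightarrow> (\<exists>q\<in>C. (\<forall>m\<in>keys q. deg m < d) & (\<forall>w\<in>orderings n. ev (xval w) p = ev (xval w) q))"

lemma low_0: "low d 0"
 unfolding low_def by(intro bexI[of _ 0]) (auto simp: C_0)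

lemma low_add: "low d p ==> low d p' ==> low d (p + p')"
proof -
 assume "low d p" "low d p'"
 then obtain q q' where q: "q : C" "\<forall>m\<in>keys q. deg m < d" "\<forall>w\<in>orderings n. ev (xval w) p = ev (xval w) q"
  "q' : C" "\<forall>m\<in>keys q'. deg m < d" "\<forall>w\<in>orderings n. ev (xval w) p' = ev (xval w) q'"
  unfolding low_def by blast
 have "\<forall>m\<in>keys (q + q'). deg m < d" using q(2,5) keys_add[of q q'] by blast
 thus "low d (p + p')" unfolding low_def using q by(intro bexI[of _ "q + q'"]) (auto simp: ev_add C_add)
qed
lemma low_sum: "(!!a. a : A ==> low d (f a)) ==> low d (sum f A)"
 by(induction A rule: infinite_finite_induct) (auto simp: low_0 low_add)

lemma low_mult:
 assumes "low (d - deg m) p" "deg m <= d" "single m c : C"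
 shows "low d (single m c * p)"
proof -
 obtain q where q: "q : C" "\<forall>m'\<in>keys q. deg m' < d - deg m" "\<forall>w\<in>orderings n. ev (xval w) p = ev (xval w) q"
  using assms(1) unfolding low_def by blast
 have "deg k < d" if "k : keys (single m c * q)" for k
 proof -
  obtain a b where ab: "k = a + b" "a : keys (single m c)" "b : keys q"
   using keys_mult[of "single m c" q] \<open>k : _\<close> by blast
  hence "a = m" by(simp split: if_splits)
  hence "deg k = deg m + deg b" using ab(1) msum_add by simp
  thus ?thesis using q(2) ab(3) by fastforce
 qed
 thus ?thesis unfolding low_def using q assms(3)
  by(intro bexI[of _ "single m c * q"]) (auto simp: ev_mult C_mult simp del: ev_single)
qed

text \<open>At every flag the linear relations become numbers: on the ideal, a homogeneous polynomial
 takes the same values as a polynomial of smaller degree.\<close>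

lemma I_low:
 assumes "p : I"
 shows "low d (hpart d p)"
proof -
 define Z where "Z = {p : C. \<forall>d. low d (hpart d p)}"
 have "I \<subseteq> Z"
 proof (rule I_minimal)
  show "Z \<subseteq> C" by(auto simp: Z_def)
  show "0 : Z" by(simp add: Z_def C_0 low_0)
  show "p + q : Z" if "p : Z" "q : Z" for p q using that by(auto simp: Z_def C_add hpart_add low_add)
  show "p * q : Z" if p: "p : C" and q: "q : Z" for p q
  proof -
   have "low d (hpart d (p * q))" for d
   proof -
   have "p * q = (\<Sum>k\<in>keys p. single k (lookup p k) * q)"
   using poly_mapping_as_sum[of "keys p" p] by(simp add: sum_distrib_right[symmetric])
   also have "hpart d ... = (\<Sum>k\<in>keys p. hpart d (single k (lookup p k) * q))"
   by(rule hpart_sum)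
   finally have e: "hpart d (p * q) = (\<Sum>k\<in>keys p. hpart d (single k (lookup p k) * q))" .
   have "low d (hpart d (single k (lookup p k) * q))" if k: "k : keys p" for k
   proof (cases "deg k <= d")
   case True
   have "single k (lookup p k) : C" using p k by(simp add: carrier_flat_poly)
   hence "low d (single k (lookup p k) * hpart (d - deg k) q)"
   using q True by(intro low_mult) (auto simp: Z_def)
   thus ?thesis unfolding hpart_single_mult using True by simp
   next
   case False
   thus ?thesis unfolding hpart_single_mult by(simp add: low_0)
   qed
   thus ?thesis unfolding e by(rule low_sum)
   qed
   thus ?thesis using C_mult[OF p] q by(auto simp: Z_def)
  qed
  show "gens \<subseteq> Z"
  proof
   fix g assume g: "g : gens"
   have gC: "g : C" using g gens_C by blast
   from g consider F F' where "g = Var F * Var F'" "\<not> F \<subseteq> F'" "\<not> F' \<subseteq> F" | i where "i : E" "g = \<theta> i"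
   unfolding gens_def by blast
   hence "low d (hpart d g)" for d
   proof cases
   case 1
   have "\<forall>m\<in>keys g. deg m = 2" by(simp add: 1(1) Var_def mult_single msum_add)
   hence "hpart d g = (if d = 2 then g else 0)" by(rule hpart_homogeneous)
   moreover have "low d g" unfolding low_def using ev_incomparable[OF 1(2,3)]
   by(intro bexI[of _ 0]) (auto simp: C_0 1(1))
   ultimately show ?thesis by(auto simp: low_0)
   next
   case 2
   have "\<forall>m\<in>keys g. deg m = 1"
   proof
   fix m assume "m : keys g"
   hence "m : keys (sum Var {F : FL. i : F})" unfolding 2(2) \<theta>_def .
   hence "m : (\<Union>F\<in>{F : FL. i : F}. keys (Var F))"
   by(rule subsetD[OF keys_sum_subset])
   then obtain F where "m : keys (Var F)" by(rule UN_E)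
   thus "deg m = 1" by(simp add: Var_def)
   qed
   hence "hpart d g = (if d = 1 then g else 0)" by(rule hpart_homogeneous)
   moreover have "low (Suc 0) g" unfolding low_def using ev_theta[OF _ 2(1)]
   by(intro bexI[of _ "const (of_nat i)", OF _ C_const] conjI ballI) (simp_all only: const_facts 2(2) One_nat_def)
   ultimately show ?thesis by(auto simp: low_0)
   qed
   thus "g : Z" using gC by(simp add: Z_def)
  qed
 qed
 thus ?thesis using assms by(auto simp: Z_def)
qed

text \<open>Reduce the top degree to standard monomials; by \<open>I_low\<close> the error is of
lower degree on the flags.\<close>

lemma ev_standard:
 assumes "q : C" "\<forall>m\<in>keys q. deg m < e"
 shows "\<exists>u. keys u \<subseteq> {m. standard m & deg m < e} & (\<forall>w\<in>orderings n. ev (xval w) q = ev (xval w) u)"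
 using assms
proof (induction e arbitrary: q)
 case 0
 hence "q = 0" by auto
 thus ?case by(intro exI[of _ 0]) simp
next
 case (Suc e)
 define q0 where "q0 = q - hpart e q"
 have kq0: "keys q0 \<subseteq> {m : keys q. deg m < e}"
  using Suc.prems(2) by(auto simp: q0_def in_keys_iff lookup_minus lookup_hpart less_Suc_eq split: if_splits)
 have cC: "hpart e q : C" using Suc.prems(1) by(auto simp: carrier_flat_poly keys_hpart)
 have chom: "\<forall>m\<in>keys (hpart e q). deg m = e" by(simp add: keys_hpart)
 obtain s where s: "keys s \<subseteq> {m. standard m & deg m = e}" "hpart e q - s : I"
  using standard_spans[OF cC chom] unfolding reducible_def by blast
 have "\<forall>m\<in>keys (hpart e q - s). deg m = e"
  using s(1) keys_diff[of "hpart e q" s] chom by blast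
 hence "hpart e (hpart e q - s) = hpart e q - s" using hpart_homogeneous by metis
 hence "low e (hpart e q - s)" using I_low[OF s(2), of e] by simp
 then obtain q1 where q1: "q1 : C" "\<forall>m\<in>keys q1. deg m < e"
  "\<forall>w\<in>orderings n. ev (xval w) (hpart e q - s) = ev (xval w) q1" unfolding low_def by blast
 have c1: "q0 + q1 : C" unfolding q0_def by(intro C_add C_diff Suc.prems(1) cC q1(1))
 have c2: "\<forall>m\<in>keys (q0 + q1). deg m < e" using kq0 q1(2) keys_add[of q0 q1] by blast
 from Suc.IH[OF c1 c2] obtain u where u: "keys u \<subseteq> {m. standard m & deg m < e}"
  "\<forall>w\<in>orderings n. ev (xval w) (q0 + q1) = ev (xval w) u" by(elim exE conjE)
 have "keys (s + u) \<subseteq> {m. standard m & deg m < Suc e}"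
  using keys_add[of s u] s(1) u(1) by fastforce
 moreover have "ev (xval w) q = ev (xval w) (s + u)" if w: "w : orderings n" for w
 proof -
  have "ev (xval w) (hpart e q) - ev (xval w) s = ev (xval w) q1" using bspec[OF q1(3) w] unfolding ev_diff .
  moreover have "ev (xval w) q - ev (xval w) (hpart e q) + ev (xval w) q1 = ev (xval w) u"
   using bspec[OF u(2) w] unfolding q0_def ev_add ev_diff .
  ultimately show ?thesis unfolding ev_add by linarith
 qed
 ultimately show ?case by blast
qed

end

context chow
begin

definition fm where "fm = (%(L, b). fmono E {} L b)"
lemma deg_fm: "deg (fm x) = fy_degree x"
 by(cases x) (simp only: fm_def prod.case deg_fmono)

lemma keys_fmono:
 assumes "P \<subseteq> E" "card P < r" "fy (r - card P) (E - P) L b"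
 shows "keys (fmono E P L b) \<subseteq> FL - {{}}"
 using assms
proof (induction L arbitrary: P)
 case Nil
 thus ?case using E_FL E_ne by simp
next
 case (Cons Ga L)
 obtain G a where Ga: "Ga = (G, a)" by fastforce
 have f: "G \<subseteq> E - P" "card G < r - card P" "1 <= a" "a < card G" "fy (r - card P - card G) (E - P - G) L b"
  using Cons.prems(3) by(auto simp: Ga)
 have "G \<subseteq> E" using f(1) by(rule subset_trans) (rule Diff_subset)
 hence fin: "finite P" "finite G" using finite_subset[OF Cons.prems(1)] finite_subset[of G E] by simp_all
 have c: "card (P \<union> G) = card P + card G" using f(1) fin by(intro card_Un_disjoint) auto
 have PG: "P \<union> G \<subseteq> E" using Cons.prems(1) f(1) by blast
 have "card (P \<union> G) <= r - 1" using c f(2) by linarith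
 hence "P \<union> G : FL" unfolding uniform_flats_def using PG by blast
 moreover have "P \<union> G ~= {}" using f(4) by auto
 moreover have "keys (fmono E (P \<union> G) L b) \<subseteq> FL - {{}}"
 proof (rule Cons.IH[OF PG])
  show "card (P \<union> G) < r" using c f(2) by simp
  have "E - (P \<union> G) = E - P - G" by blast
  thus "fy (r - card (P \<union> G)) (E - (P \<union> G)) L b" using f(5) c by simp
 qed
 ultimately show ?case
  using keys_add[of "single (P \<union> G) a" "fmono E (P \<union> G) L b"] by(auto simp: Ga split: if_splits)
qed

lemma keys_fm: "x : FY r E ==> keys (fm x) \<subseteq> FL - {{}}"
 using keys_fmono[of "{}"] r1 by(auto simp: FY_def fm_def)

text \<open>The smallest flat of the chain becomes the first block.\<close>

lemma chain_list:
 assumes P: "P \<subseteq> E" "card P < r" and m: "keys m \<subseteq> FL"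
  and above: "\<forall>G\<in>keys m. P \<subset> G"
  and ch: "\<forall>F\<in>keys m. \<forall>G\<in>keys m. F \<subseteq> G \<or> G \<subseteq> F"
  and st: "\<forall>G\<in>keys m. \<forall>F\<in>insert P (keys m). F \<subset> G \<longrightarrow> card F + lookup m G < min (card G) r"
 shows "\<exists>L b. fy (r - card P) (E - P) L b & fmono E P L b = m"
 using assms
proof (induction "card (keys m)" arbitrary: m P rule: less_induct)
 case less
 show ?case
 proof (cases "keys m \<subseteq> {E}")
  case True
  define b where "b = lookup m E"
  have keyE: "k : keys m ==> k = E" for k using subsetD[OF True] singletonD by metis
  have "m = single E b"
  proof (rule poly_mapping_eqI)
   fix k
   show "lookup m k = lookup (single E b) k"
   proof (cases "k = E")
   case False
   hence "k \<notin> keys m" using keyE by metis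
   thus ?thesis using False by(simp only: in_keys_iff not_not lookup_single_not_eq)
   qed (simp add: b_def)
  qed
  moreover have "b < r - card P"
  proof (cases "E : keys m")
   case True
   hence "P \<subset> E" using less.prems(4) by blast
   hence "card P + b < min (card E) r" using less.prems(6) True unfolding b_def by blast
   hence "card P + b < r" by(simp only: min_less_iff_conj)
   thus ?thesis by linarith
  next
   case False
   thus ?thesis using less.prems(2) by(simp add: b_def in_keys_iff)
  qed
  ultimately show ?thesis by(intro exI[of _ "[]"] exI[of _ b]) simp
 next
  case False
  define K where "K = arg_min_on card (keys m)"
  have ne: "keys m ~= {}" using False by blast
  have K: "K : keys m" unfolding K_def by(rule arg_min_if_finite(1)[OF finite_keys ne])
  have Kmin: "card K <= card H" if "H : keys m" for H
   unfolding K_def by(rule arg_min_least[OF finite_keys ne that])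
  have finH: "finite H" if "H : keys m" for H by(rule FL_fin[OF subsetD[OF less.prems(3) that]])
  have Ksub: "K \<subset> H" if H: "H : keys m" "H ~= K" for H
  proof -
   have "K \<subseteq> H \<or> H \<subseteq> K" using less.prems(5) K H(1) by blast
   moreover have "\<not> H \<subset> K" using Kmin[OF H(1)] psubset_card_mono[OF finH[OF K]] by(meson not_le)
   ultimately show ?thesis using H(2) by blast
  qed
  have KE: "K ~= E"
  proof
   assume e: "K = E"
   obtain H where H: "H : keys m" "H ~= E" using False by blast
   hence "E \<subset> H" using Ksub[OF H(1)] e by simp
   moreover have "H \<subseteq> E" by(rule FL_sub[OF subsetD[OF less.prems(3) H(1)]])
   ultimately show False by blast
  qed
  have KL: "K : FL" using K less.prems(3) by blast
  have Kr: "card K < r" by(rule FL_card[OF KL KE])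
  have PK: "P \<subset> K" using less.prems(4) K by blast
  define a where "a = lookup m K"
  have a: "1 <= a" using K by(simp add: a_def in_keys_iff)
  have pa: "card P + a < min (card K) r" using less.prems(6) K PK unfolding a_def by blast
  define G where "G = K - P"
  have finP: "finite P" using less.prems(1) finite_subset by auto
  have cG: "card G = card K - card P" unfolding G_def using PK finP by(intro card_Diff_subset) auto
  have PG: "P \<union> G = K" using PK by(auto simp: G_def)
  define m' where "m' = m - single K a"
  have km': "keys m' = keys m - {K}"
   by(auto simp: m'_def a_def in_keys_iff lookup_minus lookup_single when_def split: if_splits)
  have kk: "H : keys m & H ~= K" if "H : keys m'" for H
   using that unfolding km' by simp
  have lm': "lookup m' H = lookup m H" if "H ~= K" for H
   using that by(simp add: m'_def lookup_minus lookup_single when_def)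
  have em: "m = single K a + m'"
   by(rule poly_mapping_eqI) (auto simp: m'_def a_def lookup_add lookup_minus lookup_single when_def)
  have "\<exists>L b. fy (r - card K) (E - K) L b & fmono E K L b = m'"
  proof (rule less.hyps)
   show "card (keys m') < card (keys m)" unfolding km' by(rule card_Diff1_less[OF finite_keys K])
   show "K \<subseteq> E" by(rule FL_sub[OF KL])
   show "card K < r" by(rule Kr)
   show "keys m' \<subseteq> FL" unfolding km' by(rule subset_trans[OF Diff_subset less.prems(3)])
   show "\<forall>G\<in>keys m'. K \<subset> G"
   proof
   fix H assume "H : keys m'"
   thus "K \<subset> H" using kk Ksub by simp
   qed
   show "\<forall>F\<in>keys m'. \<forall>G\<in>keys m'. F \<subseteq> G \<or> G \<subseteq> F"
   proof (intro ballI)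
   fix F H assume "F : keys m'" "H : keys m'"
   thus "F \<subseteq> H \<or> H \<subseteq> F" using less.prems(5)[rule_format, of F H] kk by simp
   qed
   show "\<forall>G\<in>keys m'. \<forall>F\<in>insert K (keys m'). F \<subset> G \<longrightarrow> card F + lookup m' G < min (card G) r"
   proof (intro ballI impI)
   fix H F assume HF: "H : keys m'" "F : insert K (keys m')" "F \<subset> H"
   have H: "H : keys m" "H ~= K" using kk HF(1) by simp_all
   have "F : insert P (keys m)" using kk HF(2) K by auto
   thus "card F + lookup m' H < min (card H) r"
   unfolding lm'[OF H(2)] by(rule less.prems(6)[rule_format, OF H(1) _ HF(3)])
   qed
  qed
  then obtain L b where Lb: "fy (r - card K) (E - K) L b" "fmono E K L b = m'" by(elim exE conjE)
  have "fy (r - card P) (E - P) ((G, a) # L) b"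
  proof -
   have e1: "G \<subseteq> E - P" unfolding G_def by(rule Diff_mono[OF FL_sub[OF KL] subset_refl])
   have cPK: "card P < card K" using PK finH[OF K] by(rule psubset_card_mono[rotated])
   have e3: "E - P - G = E - K" unfolding PG[symmetric] by blast
   have e4: "r - card P - card G = r - card K" using cG cPK by simp
   have q1: "card G < r - card P" using cG Kr cPK by linarith
   have "card P + a < card K" using pa by(simp only: min_less_iff_conj)
   hence q2: "a < card G" using cG by linarith
   show ?thesis unfolding fy.simps e3 e4 by(intro conjI e1 q1 a q2 Lb(1))
  qed
  moreover have "fmono E P ((G, a) # L) b = m" using Lb(2) em PG by simp
  ultimately show ?thesis by blast
 qed
qed

lemma standard_fm:
 assumes "standard m"
 shows "\<exists>x\<in>FY r E. fm x = m"
proof -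
 note s = assms[unfolded standard_def]
 have f: "keys m \<subseteq> FL" by(rule subset_trans[OF conjunct1[OF s] Diff_subset])
 have ab: "\<forall>G\<in>keys m. {} \<subset> G"
 proof
  fix G assume "G : keys m"
  hence "G : FL - {{}}" by(rule subsetD[OF conjunct1[OF s]])
  thus "{} \<subset> G" by blast
 qed
 have "\<exists>L b. fy (r - card ({} :: nat set)) (E - {}) L b & fmono E {} L b = m"
  by(rule chain_list[OF empty_subsetI _ f ab conjunct1[OF conjunct2[OF s]] conjunct2[OF conjunct2[OF s]]]) (use r1 in simp)
 then obtain L b where Lb: "fy r E L b" "fmono E {} L b = m"
  unfolding card.empty diff_zero Diff_empty by(elim exE conjE)
 have "(L, b) : FY r E" "fm (L, b) = m" using Lb by(simp_all only: FY_def fm_def mem_Collect_eq prod.case)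
 thus ?thesis by(rule bexI[rotated])
qed

lemma push_fm_exists:
 assumes "keys q \<subseteq> {m. standard m & Q (deg m)}"
 shows "\<exists>v. keys v \<subseteq> {x : FY r E. Q (fy_degree x)} & push_keys fm v = (q :: nat set_poly)"
proof -
 obtain g where g: "!!m. standard m ==> g m : FY r E & fm (g m) = m" using standard_fm by metis
 have "push_keys fm (push_keys g q) = push_keys (%m. m) q"
  unfolding push_keys_comp using assms g by(intro push_keys_cong) blast
 moreover have "keys (push_keys g q) \<subseteq> {x : FY r E. Q (fy_degree x)}"
 proof
  fix x assume "x : keys (push_keys g q)"
  then obtain m where "m : keys q" "x = g m" using keys_push_keys[of g q] by blast
  thus "x : {x : FY r E. Q (fy_degree x)}" using assms g[of m] deg_fm[of "g m"] by auto
 qed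
 ultimately show ?thesis unfolding push_keys_id by blast
qed

theorem fy_spans:
 assumes "p : C" "\<forall>m\<in>keys p. deg m = d"
 shows "\<exists>v. keys v \<subseteq> {x : FY r E. fy_degree x = d} & p - push_keys fm v : I"
proof -
 obtain q where "keys q \<subseteq> {m. standard m & deg m = d}" "p - q : I"
  using standard_spans[OF assms] unfolding reducible_def by blast
 thus ?thesis using push_fm_exists[of q "%e. e = d"] by blast
qed

end

context boolean_chow
begin

lemma ev_push_fm:
 assumes w: "w : orderings n" and v: "keys v \<subseteq> FY n E"
 shows "ev (xval w) (push_keys fm v) = (\<Sum>x\<in>FY n E. lookup v x * fval (fst x) (snd x) w)"
proof -
 have "ev (xval w) (push_keys fm v) = (\<Sum>x\<in>FY n E. lookup v x * mev (xval w) (fm x))"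
  by(subst push_keys_superset[OF finite_FY v]) (auto simp: ev_sum)
 also have "... = (\<Sum>x\<in>FY n E. lookup v x * fval (fst x) (snd x) w)"
 proof (rule sum.cong[OF refl])
  fix x assume "x : FY n E"
  hence "mev (xval ([] @ w)) (fmono E {} (fst x) (snd x)) = fval (fst x) (snd x) w"
   using w by(intro mev_fmono[where r = n]) (auto simp: FY_def orderings_def)
  thus "lookup v x * mev (xval w) (fm x) = lookup v x * fval (fst x) (snd x) w"
   by(simp add: fm_def case_prod_beta)
 qed
 finally show ?thesis .
qed

text \<open>A homogeneous relation becomes, on the flags, a relation with lower standard monomials,
which is excluded by \<open>fval_independent\<close>.\<close>

lemma boolean_independent:
 assumes v: "keys v \<subseteq> {x : FY n E. fy_degree x = d}" and I: "push_keys fm v : I"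
 shows "v = 0"
proof -
 have hom: "\<forall>m\<in>keys (push_keys fm v). deg m = d"
  using keys_push_keys[of fm v] v deg_fm by fastforce
 hence "hpart d (push_keys fm v) = push_keys fm v" using hpart_homogeneous by metis
 hence "low d (push_keys fm v)" using I_low[OF I, of d] by simp
 then obtain q where q: "q : C" "\<forall>m\<in>keys q. deg m < d"
  "\<forall>w\<in>orderings n. ev (xval w) (push_keys fm v) = ev (xval w) q" unfolding low_def by blast
 obtain u where u: "keys u \<subseteq> {m. standard m & deg m < d}" "\<forall>w\<in>orderings n. ev (xval w) q = ev (xval w) u"
  using ev_standard[OF q(1,2)] by blast
 obtain v' where v': "keys v' \<subseteq> {x : FY n E. fy_degree x < d}" "push_keys fm v' = u"
  using push_fm_exists[of u "%e. e < d"] u(1) by blast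
 have kd: "keys (v - v') \<subseteq> FY n E" using keys_diff[of v v'] v v'(1) by blast
 have z: "lookup (v - v') x = 0" for x
 proof (cases "x : FY n E")
  case True
  show ?thesis
  proof (rule fval_independent[of E "lookup (v - v')" x])
   fix w assume "distinct w" "set w = E"
   hence w: "w : orderings n" by(simp add: orderings_def)
   have "ev (xval w) (push_keys fm (v - v')) = 0"
   using q(3) u(2) v'(2) w by(simp add: push_keys_diff ev_diff)
   thus "(\<Sum>x\<in>FY (card E) E. lookup (v - v') x * fval (fst x) (snd x) w) = 0"
   using ev_push_fm[OF w kd] by simp
  qed (use True E_ne in auto)
 next
  case False
  thus ?thesis using kd by(auto simp: in_keys_iff)
 qed
 show ?thesis
 proof (rule poly_mapping_eqI)
  fix x
  have e: "lookup v x = lookup v' x" using z[of x] by(simp add: lookup_minus)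
  show "lookup v x = lookup 0 x"
  proof (rule ccontr)
   assume "lookup v x ~= lookup 0 x"
   hence "x : keys v" "x : keys v'" using e by(auto simp: in_keys_iff)
   thus False using v v'(1) by fastforce
  qed
 qed
qed

end

context chow
begin

text \<open>Multiplication by the power \<open>n - r\<close> of the variable of the ground set maps the Chow ring of
 the uniform matroid into that of the Boolean matroid, and basis elements to basis elements.\<close>

lemma I_boolean:
 assumes "p : I"
 shows "mon (single E (n - r)) * p : chow.I n n"
proof -
 interpret B: chow n n by unfold_locales (use r1 rn in auto)
 interpret B': boolean_chow n by unfold_locales
 define x where "x = mon (single E (n - r))"
 have sub: "FL \<subseteq> B.FL" using rn by(auto simp: uniform_flats_def)
 have CC: "C \<subseteq> B.C"
 proof
  fix p assume "p : C"
  hence p: "\<forall>m\<in>keys p. keys m \<subseteq> FL - {{}}" unfolding carrier_flat_poly .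
  show "p : B.C" unfolding carrier_flat_poly
  proof
   fix m assume "m : keys p"
   thus "keys m \<subseteq> B.FL - {{}}"
   by(rule subset_trans[OF bspec[OF p] Diff_mono[OF sub subset_refl]])
  qed
 qed
 have xC: "x : B.C" unfolding x_def using B.E_FL B.E_ne by(intro C_mon) auto
 define Z where "Z = {p : C. x * p : B.I}"
 have "I \<subseteq> Z"
 proof (rule I_minimal)
  show "Z \<subseteq> C" by(auto simp: Z_def)
  show "0 : Z" by(simp add: Z_def C_0 B.I_0)
  show "p + q : Z" if "p : Z" "q : Z" for p q using that by(auto simp: Z_def C_add B.I_add distrib_left)
  show "p * q : Z" if p: "p : C" and q: "q : Z" for p q
  proof -
   have q': "q : C" "x * q : B.I" using q by(simp_all add: Z_def)
   have "p * (x * q) : B.I" by(rule B.I_mult[OF subsetD[OF CC p] q'(2)])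
   hence "x * (p * q) : B.I" by(simp only: mult.left_commute)
   thus ?thesis unfolding Z_def using C_mult[OF p q'(1)] by blast
  qed
  show "gens \<subseteq> Z"
  proof
   fix g assume g: "g : gens"
   have gC: "g : C" using g gens_C by blast
   from g consider F F' where "g = Var F * Var F'" "F : FL" "F' : FL" "\<not> F \<subseteq> F'" "\<not> F' \<subseteq> F" | i where "i : E" "g = \<theta> i"
   unfolding gens_def by blast
   hence "x * g : B.I"
   proof cases
   case 1
   show ?thesis unfolding 1(1)
   by(rule B.I_mult[OF xC B.I_incomparable[OF subsetD[OF sub 1(2)] subsetD[OF sub 1(3)] 1(4,5)]])
   next
   case 2
   define S where "S = {F : B.FL. i : F} - {F : FL. i : F}"
   have "B.\<theta> i = \<theta> i + (\<Sum>F\<in>S. Var F)"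
   proof -
   have "{F : B.FL. i : F} = {F : FL. i : F} \<union> S" using sub by(auto simp: S_def)
   thus ?thesis unfolding \<theta>_def B.\<theta>_def
   by(simp only:) (rule sum.union_disjoint, use finite_FL B.finite_FL in "auto simp: S_def")
   qed
   hence e: "x * g = x * B.\<theta> i - (\<Sum>F\<in>S. x * Var F)" unfolding 2(2) by(simp add: distrib_left sum_distrib_left)
   have sF: "x * Var F : B.I" if F: "F : S" for F
   proof -
   have FB: "F : B.FL" "F \<notin> FL" "i : F" using F by(auto simp: S_def)
   have FE: "F \<subseteq> E" by(rule B.FL_sub[OF FB(1)])
   have "F ~= E" using FB(2) E_FL by blast
   moreover have "r <= card F" using FB(2) FE r1 by(auto simp: uniform_flats_def)
   ultimately have "B.xv F * B.above E ^ (n - r) : B.I"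
   using FE by(intro B.xv_above_power[OF FB(1)]) (auto simp: min_def)
   moreover have "{H : B.FL. E \<subseteq> H & H ~= {}} = {E}" by(rule above_top[OF B.E_FL B.E_ne B.FL_sub])
   hence "B.above E = Var E" by(simp add: B.above_def)
   moreover have "B.xv F = Var F" using FB(3) by(auto simp: B.xv_def)
   ultimately show ?thesis by(simp add: x_def mon_single_power mult.commute)
   qed
   have "(\<Sum>F\<in>S. x * Var F) : B.I" by(rule B.I_sum) (rule sF)
   thus ?thesis unfolding e by(rule B.I_diff[OF B.I_mult[OF xC B.I_theta[OF 2(1)]]])
   qed
   thus "g : Z" using gC by(simp add: Z_def)
  qed
 qed
 thus ?thesis using assms by(auto simp: Z_def x_def)
qed

lemma fy_shift: "fy s A L b ==> fy (s + k) A L (b + k)"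
proof (induction L arbitrary: s A)
 case (Cons Ga L)
 obtain G a where Ga: "Ga = (G, a)" by fastforce
 have "fy (s - card G + k) (A - G) L (b + k)" by(rule Cons.IH) (use Cons.prems in "simp add: Ga")
 moreover have "s - card G + k = s + k - card G" using Cons.prems by(simp add: Ga)
 ultimately show ?case using Cons.prems by(simp add: Ga)
qed simp

lemma fmono_shift: "fmono E P L (b + k) = single E k + fmono E P L b"
 by(induction L arbitrary: P) (auto simp: single_add add_ac)

theorem fy_independent:
 assumes v: "keys v \<subseteq> {x : FY r E. fy_degree x = d}" and I: "push_keys fm v : I"
 shows "v = 0"
proof -
 interpret B: chow n n by unfold_locales (use r1 rn in auto)
 interpret B': boolean_chow n by unfold_locales
 define s :: "(nat set \<times> nat) list \<times> nat => (nat set \<times> nat) list \<times> nat" where "s = (%(L, b). (L, b + (n - r)))"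
 have fms: "B.fm (s x) = single E (n - r) + fm x" for x
  by(cases x) (simp only: s_def fm_def prod.case fmono_shift)
 have "mon (single E (n - r)) * push_keys fm v = push_keys B.fm (push_keys s v)"
 proof -
  have "mon (single E (n - r)) * push_keys fm v
   = (\<Sum>x\<in>keys v. single (single E (n - r) + fm x) (lookup v x))"
   by(simp add: push_keys_def mon_def sum_distrib_left mult_single)
  also have "... = push_keys B.fm (push_keys s v)" unfolding push_keys_comp fms by(simp only: push_keys_def)
  finally show ?thesis .
 qed
 hence "push_keys B.fm (push_keys s v) : B.I" using I_boolean[OF I] by simp
 moreover have "keys (push_keys s v) \<subseteq> {x : FY n E. fy_degree x = d + (n - r)}"
 proof
  fix y assume "y : keys (push_keys s v)"
  then obtain x where x: "x : keys v" "y = s x" using keys_push_keys[of s v] by blast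
  obtain L b where Lb: "x = (L, b)" by fastforce
  have "fy r E L b" "fy_degree (L, b) = d" using x(1) v by(auto simp: Lb FY_def)
  thus "y : {x : FY n E. fy_degree x = d + (n - r)}"
   using fy_shift[of r E L b "n - r"] rn by(simp add: x(2) Lb s_def FY_def fy_degree_def)
 qed
 ultimately have "push_keys s v = 0" by(intro B'.boolean_independent)
 hence "push_keys (%(L, b). (L, b - (n - r))) (push_keys s v) = 0" by simp
 moreover have "push_keys (%(L, b). (L, b - (n - r))) (push_keys s v) = push_keys (%x. x) v"
  unfolding push_keys_comp by(rule push_keys_cong) (simp add: s_def case_prod_beta)
 ultimately show ?thesis by(simp add: push_keys_id)
qed

end

section \<open>Extension of scalars\<close>

text \<open>A rational representation with a basis that is permuted by the symmetric group: \<open>\<Phi>\<close> maps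
 coordinate vectors to the representation.\<close>

locale perm_basis = perm_set n X a for n and X :: "'x set" and a +
 fixes V :: "(rat, 'v) rep" and \<Phi> :: "('x \<Rightarrow>\<^sub>0 rat) => 'v"
 assumes bij: "bij_betw \<Phi> {u. keys u \<subseteq> X} (carrier V)"
  and add: "keys u \<subseteq> X ==> keys u' \<subseteq> X ==> \<Phi> (u + u') = \<Phi> u \<oplus>\<^bsub>V\<^esub> \<Phi> u'"
  and scale: "keys u \<subseteq> X ==> \<Phi> (Poly_Mapping.map ((*) q) u) = q \<odot>\<^bsub>V\<^esub> \<Phi> u"
  and actV: "si : perms n ==> keys u \<subseteq> X ==> \<Phi> (push_keys (a si) u) = act V si (\<Phi> u)"
begin

definition G where "G = tensor_free V"
definition N where "N = tensor_relations V"
abbreviation "CG \<equiv> carrier G"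
lemma G_simps [simp]: "x \<otimes>\<^bsub>G\<^esub> y = x + y" "\<one>\<^bsub>G\<^esub> = 0"
 by(simp_all add: G_def tensor_free_def)

lemma CG_iff: "z : CG \<longleftrightarrow> keys z \<subseteq> UNIV \<times> carrier V"
 by(simp add: G_def tensor_free_def)

sublocale G: comm_group G
 unfolding G_def tensor_free_def by(rule abelian_free_Abelian_group)
lemma CG_of: "v : carrier V ==> frag_of (c, v) : CG"
 by(simp add: CG_iff)

lemma CG_add: "z : CG ==> z' : CG ==> z + z' : CG" using G.m_closed[of z z'] by simp
lemma CG_0: "0 : CG" by(simp add: CG_iff)
lemma CG_uminus: "z : CG ==> - z : CG" by(simp add: CG_iff)
lemma CG_diff: "z : CG ==> z' : CG ==> z - z' : CG" using CG_add[of z "- z'"] CG_uminus by simp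
lemma CG_inv: "z : CG ==> inv\<^bsub>G\<^esub> z = - z" by(simp add: G_def tensor_free_def)
lemma CG_sum: "(!!i. i : A ==> f i : CG) ==> sum f A : CG"
 by(induction A rule: infinite_finite_induct) (auto simp: CG_0 CG_add)

definition coord where "coord = inv_into {u. keys u \<subseteq> X} \<Phi>"

lemma coord_\<Phi>: "keys u \<subseteq> X ==> coord (\<Phi> u) = u"
 unfolding coord_def using bij by(intro inv_into_f_f) (auto simp: bij_betw_def)

lemma \<Phi>_in: "keys u \<subseteq> X ==> \<Phi> u : carrier V"
 using bij by(auto simp: bij_betw_def)

lemma \<Phi>_cases:
 assumes "v : carrier V"
 obtains u where "keys u \<subseteq> X" "v = \<Phi> u"
proof -
 have "v : \<Phi> ` {u. keys u \<subseteq> X}" using bij assms by(simp add: bij_betw_def)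
 thus thesis using that by blast
qed

definition cx :: "('x \<Rightarrow>\<^sub>0 rat) => ('x \<Rightarrow>\<^sub>0 complex)" where "cx = Poly_Mapping.map of_rat"
lemma lookup_cx: "lookup (cx u) x = of_rat (lookup u x)"
 by(simp add: cx_def Poly_Mapping.map.rep_eq when_def)
lemma lookup_map_mult: "lookup (Poly_Mapping.map ((*) q) u) x = q * lookup u x" for q :: rat
 by(simp add: Poly_Mapping.map.rep_eq when_def)
lemma keys_map_mult: "keys (Poly_Mapping.map ((*) q) u) \<subseteq> keys u" for q :: rat
 by(auto simp: in_keys_iff lookup_map_mult)
lemma keys_cx: "keys (cx u) = keys u"
 by(auto simp: in_keys_iff lookup_cx)

lemma cx_push:
 "cx (push_keys f u) = push_keys f (cx u)"
 by(rule poly_mapping_eqI)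
  (simp add: lookup_cx lookup_push_keys[OF finite_keys subset_refl, of f u]
   lookup_push_keys[OF finite_keys[of u], of "cx u" f] keys_cx of_rat_sum)

definition tau where "tau = (%(c, v). pm_scale c (cx (coord v)))"
text \<open>The isomorphism sends \<open>c \<otimes> v\<close> to \<open>c\<close> times the
coordinate vector of \<open>v\<close>.\<close>

definition Psi where
 "Psi z = (\<Sum>k\<in>keys z. pm_scale (of_int (lookup z k)) (tau k))"

lemma Psi_superset: "finite Y ==> keys z \<subseteq> Y ==> Psi z = (\<Sum>k\<in>Y. pm_scale (of_int (lookup z k)) (tau k))"
 unfolding Psi_def by(rule sum.mono_neutral_left) (auto simp: in_keys_iff)

lemma Psi_add: "Psi (z + z') = Psi z + Psi z'"
proof -
 let ?K = "keys z \<union> keys z'"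
 have "keys (z + z') \<subseteq> ?K" by(rule Poly_Mapping.keys_add)
 thus ?thesis
  by(simp add: Psi_superset[of ?K] lookup_add PM.scale_left_distrib sum.distrib)
qed

lemma Psi_diff: "Psi (z - z') = Psi z - Psi z'"
 using Psi_add[of "z - z'" z'] by(simp add: algebra_simps)
lemma Psi_0: "Psi 0 = 0"
 by(simp add: Psi_def)

lemma Psi_uminus: "Psi (- z) = - Psi z"
 using Psi_diff[of 0 z] by(simp add: Psi_0)
lemma Psi_sum: "Psi (sum f A) = (\<Sum>i\<in>A. Psi (f i))"
 by(induction A rule: infinite_finite_induct) (auto simp: Psi_add Psi_0)
lemma Psi_of: "Psi (frag_of k) = tau k"
 by(subst Psi_superset[of "{k}"]) auto
lemma Psi_of_\<Phi>: "keys u \<subseteq> X ==> Psi (frag_of (c, \<Phi> u)) = pm_scale c (cx u)"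
 by(simp add: Psi_of tau_def coord_\<Phi>)
lemma pm_scale_supp: "p : supp_in X ==> pm_scale c p : supp_in X"
 by(simp add: PM.subspace_scale subspace_supp_in)
lemma tau_supp: "v : carrier V ==> tau (c, v) : supp_in X"
 by(erule \<Phi>_cases) (auto simp: tau_def coord_\<Phi> supp_in_def keys_cx intro!: pm_scale_supp[unfolded supp_in_def, simplified])

lemma Psi_supp: "z : CG ==> Psi z : supp_in X"
 unfolding Psi_def by(intro PM.subspace_sum[OF subspace_supp_in] pm_scale_supp) (auto simp: CG_iff intro!: tau_supp)

definition Rel :: "((complex \<times> 'v) \<Rightarrow>\<^sub>0 int) set" where
 "Rel = {frag_of (c + d, v) - frag_of (c, v) - frag_of (d, v) | c d v. v : carrier V} \<union>
   {frag_of (c, v \<oplus>\<^bsub>V\<^esub> w) - frag_of (c, v) - frag_of (c, w) | c v w. v : carrier V & w : carrier V} \<union>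
   {frag_of (c * of_rat q, v) - frag_of (c, q \<odot>\<^bsub>V\<^esub> v) | c q v. v : carrier V}"
lemma N_Rel: "N = generate G Rel"
 by(simp add: N_def tensor_relations_def G_def Rel_def)
lemma V_add: "v : carrier V ==> w : carrier V ==> v \<oplus>\<^bsub>V\<^esub> w : carrier V"
 by(elim \<Phi>_cases) (metis (no_types, lifting) \<Phi>_in add keys_add le_sup_iff subset_trans)
lemma V_smult: "v : carrier V ==> q \<odot>\<^bsub>V\<^esub> v : carrier V"
 by(elim \<Phi>_cases) (metis \<Phi>_in scale keys_map_mult subset_trans)

lemma V_act: "si : perms n ==> v : carrier V ==> act V si v : carrier V"
proof (elim \<Phi>_cases)
 fix u assume s: "si : perms n" and u: "keys u \<subseteq> X" "v = \<Phi> u"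
 have "keys (push_keys (a si) u) \<subseteq> X"
  using keys_push_keys[of "a si" u] u(1) a_closed[OF s] by blast
 thus "act V si v : carrier V" using actV[OF s u(1)] \<Phi>_in u(2) by metis
qed

lemma Rel_CG: "Rel \<subseteq> CG"
 unfolding Rel_def by(auto intro!: CG_diff CG_of V_add V_smult)

lemma subgroup_N: "subgroup N G"
 unfolding N_Rel by(rule G.generate_is_subgroup[OF Rel_CG])

lemma N_CG: "z : N ==> z : CG" using subgroup.mem_carrier[OF subgroup_N] .
lemma N_add: "z : N ==> z' : N ==> z + z' : N" using subgroup.m_closed[OF subgroup_N] by fastforce
lemma N_0: "0 : N" using subgroup.one_closed[OF subgroup_N] by simp
lemma N_uminus: "z : N ==> - z : N" using subgroup.m_inv_closed[OF subgroup_N, of z] CG_inv[OF N_CG] by simp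
lemma N_diff: "z : N ==> z' : N ==> z - z' : N" using N_add[of z "- z'"] N_uminus by simp
lemma N_sum: "(!!i. i : A ==> f i : N) ==> sum f A : N"
 by(induction A rule: infinite_finite_induct) (auto simp: N_0 N_add)

lemma N_rel: "z : Rel ==> z : N"
 unfolding N_Rel by(rule generate.incl)
lemma rel_add_left: "v : carrier V ==> frag_of (c + d, v) - frag_of (c, v) - frag_of (d, v) : N"
 by(rule N_rel) (auto simp: Rel_def)
lemma rel_add_right: "v : carrier V ==> w : carrier V ==> frag_of (c, v \<oplus>\<^bsub>V\<^esub> w) - frag_of (c, v) - frag_of (c, w) : N"
 by(rule N_rel) (auto simp: Rel_def)
lemma rel_scale: "v : carrier V ==> frag_of (c * of_rat q, v) - frag_of (c, q \<odot>\<^bsub>V\<^esub> v) : N"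
 by(rule N_rel) (auto simp: Rel_def)

lemma Psi_N:
 assumes "z : N"
 shows "Psi z = 0"
proof -
 have "subgroup {z : CG. Psi z = 0} G"
 proof (rule G.subgroupI)
  show "inv\<^bsub>G\<^esub> z : {z : CG. Psi z = 0}" if "z : {z : CG. Psi z = 0}" for z
   using that CG_uminus by(simp add: CG_inv Psi_uminus)
 qed (auto simp: CG_0 Psi_0 CG_add Psi_add)
 moreover have "Rel \<subseteq> {z : CG. Psi z = 0}"
 proof
  fix z assume z: "z : Rel"
  hence zC: "z : CG" using Rel_CG by blast
  from z consider c d v where "z = frag_of (c + d, v) - frag_of (c, v) - frag_of (d, v)" "v : carrier V"
   | c v w where "z = frag_of (c, v \<oplus>\<^bsub>V\<^esub> w) - frag_of (c, v) - frag_of (c, w)" "v : carrier V" "w : carrier V"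
   | c q v where "z = frag_of (c * of_rat q, v) - frag_of (c, q \<odot>\<^bsub>V\<^esub> v)" "v : carrier V"
   unfolding Rel_def by blast
  hence "Psi z = 0"
  proof cases
   case 1
   thus ?thesis by(simp add: Psi_diff Psi_of tau_def PM.scale_left_distrib)
  next
   case 2
   obtain u u' where u: "keys u \<subseteq> X" "v = \<Phi> u" "keys u' \<subseteq> X" "w = \<Phi> u'"
   using 2(2,3) \<Phi>_cases by metis
   have k: "keys (u + u') \<subseteq> X" using u(1,3) keys_add[of u u'] by blast
   have "cx (u + u') = cx u + cx u'" by(rule poly_mapping_eqI) (simp add: lookup_cx lookup_add of_rat_add)
   thus ?thesis unfolding 2(1) u(2,4) add[OF u(1,3), symmetric]
   by(simp add: Psi_diff Psi_of_\<Phi>[OF k] Psi_of_\<Phi>[OF u(1)] Psi_of_\<Phi>[OF u(3)] PM.scale_right_distrib)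
  next
   case 3
   obtain u where u: "keys u \<subseteq> X" "v = \<Phi> u" using 3(2) \<Phi>_cases by metis
   have k: "keys (Poly_Mapping.map ((*) q) u) \<subseteq> X" using u(1) keys_map_mult[of q u] by blast
   have "cx (Poly_Mapping.map ((*) q) u) = pm_scale (of_rat q) (cx u)"
   by(rule poly_mapping_eqI) (simp add: lookup_cx lookup_map_mult lookup_pm_scale of_rat_mult)
   thus ?thesis unfolding 3(1) u(2) scale[OF u(1), symmetric]
   by(simp add: Psi_diff Psi_of_\<Phi>[OF k] Psi_of_\<Phi>[OF u(1)])
  qed
  thus "z : {z : CG. Psi z = 0}" using zC by simp
 qed
 ultimately have "N \<subseteq> {z : CG. Psi z = 0}" unfolding N_Rel by(intro G.generate_subgroup_incl)
 thus ?thesis using assms by blast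
qed

definition e where "e x = \<Phi> (single x 1)"
definition FF where "FF p = (\<Sum>x\<in>X. frag_of (lookup p x, e x))"

lemma e_in: "x : X ==> e x : carrier V"
 unfolding e_def by(rule \<Phi>_in) simp

lemma FF_CG: "FF p : CG"
 unfolding FF_def by(intro CG_sum CG_of e_in)

lemma FF_add: "FF (p + q) - FF p - FF q : N"
 unfolding FF_def sum_subtractf[symmetric] lookup_add by(intro N_sum rel_add_left e_in)

lemma FF_0: "FF 0 : N"
proof -
 have "- (FF (0 + 0) - FF 0 - FF 0) : N" by(rule N_uminus[OF FF_add])
 thus ?thesis by simp
qed

lemma FF_diff: "FF p - FF q - FF (p - q) : N"
 using FF_add[of "p - q" q] by(simp add: algebra_simps)

lemma Psi_FF: "p : supp_in X ==> Psi (FF p) = p"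
proof -
 assume p: "p : supp_in X"
 have "cx (single x 1) = single x 1" for x
  by(rule poly_mapping_eqI) (simp add: lookup_cx lookup_single when_def)
 hence "Psi (frag_of (c, e x)) = single x c" if "x : X" for c x
  using that unfolding e_def by(subst Psi_of_\<Phi>) (auto simp: pm_scale_single)
 hence "Psi (FF p) = (\<Sum>x\<in>X. single x (lookup p x))"
  unfolding FF_def Psi_sum by(intro sum.cong) auto
 thus ?thesis using poly_mapping_as_sum[OF fin_X, of p, symmetric] p by(simp add: supp_in_def)
qed

lemma frag_expand:
 assumes "finite Y" "Y \<subseteq> X"
 shows "frag_of (c, \<Phi> (\<Sum>x\<in>Y. single x (f x))) - (\<Sum>x\<in>Y. frag_of (c * of_rat (f x), e x)) : N"
 using assms
proof (induction Y rule: finite_induct)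
 case empty
 have z: "\<Phi> 0 \<oplus>\<^bsub>V\<^esub> \<Phi> 0 = \<Phi> 0" using add[of 0 0] by simp
 have "- (frag_of (c, \<Phi> 0 \<oplus>\<^bsub>V\<^esub> \<Phi> 0) - frag_of (c, \<Phi> 0) - frag_of (c, \<Phi> 0)) : N"
  by(intro N_uminus rel_add_right \<Phi>_in) simp_all
 thus ?case unfolding z by simp
next
 case (insert y Y)
 let ?s = "\<Sum>x\<in>Y. single x (f x)"
 have y: "y : X" using insert.prems by blast
 have ks: "keys ?s \<subseteq> X"
  using keys_sum_subset[of "%x. single x (f x)" Y] insert.prems by(force split: if_splits)
 have ky: "keys (single y (f y)) \<subseteq> X" "keys (single y (1::rat)) \<subseteq> X" using y by auto
 have "single y (f y) = Poly_Mapping.map ((*) (f y)) (single y 1)"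
  by(rule poly_mapping_eqI) (simp add: lookup_map_mult lookup_single when_def)
 hence ey: "\<Phi> (single y (f y)) = f y \<odot>\<^bsub>V\<^esub> e y" using scale[OF ky(2), of "f y"] by(simp add: e_def)
 have r1: "frag_of (c, \<Phi> (single y (f y)) \<oplus>\<^bsub>V\<^esub> \<Phi> ?s) - frag_of (c, \<Phi> (single y (f y))) - frag_of (c, \<Phi> ?s) : N"
  by(rule rel_add_right[OF \<Phi>_in[OF ky(1)] \<Phi>_in[OF ks]])
 have r2: "frag_of (c * of_rat (f y), e y) - frag_of (c, f y \<odot>\<^bsub>V\<^esub> e y) : N" by(rule rel_scale[OF e_in[OF y]])
 have r3: "frag_of (c, \<Phi> ?s) - (\<Sum>x\<in>Y. frag_of (c * of_rat (f x), e x)) : N" using insert by blast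
 have s1: "(\<Sum>x\<in>insert y Y. single x (f x)) = single y (f y) + ?s"
  and s2: "(\<Sum>x\<in>insert y Y. frag_of (c * of_rat (f x), e x)) = frag_of (c * of_rat (f y), e y) + (\<Sum>x\<in>Y. frag_of (c * of_rat (f x), e x))"
  using insert.hyps by simp_all
 have r2': "frag_of (c * of_rat (f y), e y) - frag_of (c, \<Phi> (single y (f y))) : N" unfolding ey by(rule r2)
 have alg: "(A - B - S') - (F - B) + (S' - T) = A - (F + T)" for A B F S' T :: "(complex \<times> 'v) \<Rightarrow>\<^sub>0 int"
  by(simp add: algebra_simps)
 show ?case unfolding s1 s2 add[OF ky(1) ks]
  using N_add[OF N_diff[OF r1 r2'] r3] unfolding alg .
qed

text \<open>Modulo the relations every element is a combination of the basis vectors, with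
coefficients read off by \<open>Psi\<close>; hence the relations are the whole kernel.\<close>

lemma FF_Psi: "z : CG ==> z - FF (Psi z) : N"
 unfolding CG_iff
proof (induction z rule: frag_induction)
 case zero
 thus ?case using N_uminus[OF FF_0] by(simp add: Psi_0)
next
 case (one k)
 obtain c v where k: "k = (c, v)" "v : carrier V" using one by auto
 obtain u where u: "keys u \<subseteq> X" "v = \<Phi> u" using k(2) \<Phi>_cases by metis
 have "FF (Psi (frag_of k)) = (\<Sum>x\<in>X. frag_of (c * of_rat (lookup u x), e x))"
  unfolding k u(2) Psi_of_\<Phi>[OF u(1)] FF_def by(simp add: lookup_pm_scale lookup_cx)
 moreover have "frag_of (c, \<Phi> (\<Sum>x\<in>X. single x (lookup u x))) - (\<Sum>x\<in>X. frag_of (c * of_rat (lookup u x), e x)) : N"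
  by(rule frag_expand[OF fin_X subset_refl])
 ultimately show ?case using poly_mapping_as_sum[OF fin_X u(1)] k(1) u(2) by simp
next
 case (diff z z')
 have "(z - FF (Psi z)) - (z' - FF (Psi z')) + (FF (Psi z) - FF (Psi z') - FF (Psi z - Psi z')) : N"
  by(intro N_add N_diff diff FF_diff)
 thus ?case by(simp add: Psi_diff algebra_simps)
qed

lemma Psi_kernel: "z : CG ==> z : N \<longleftrightarrow> Psi z = 0"
 using Psi_N FF_Psi[of z] N_add[of "z - FF 0" "FF 0"] FF_0 by auto

sublocale N: normal N G
 by(rule G.subgroup_imp_normal[OF subgroup_N])
lemma coset: "N #>\<^bsub>G\<^esub> z = (%h. h + z) ` N"
 by(auto simp: r_coset_def)

lemma coset_eq: "z : CG ==> z' : CG ==> N #>\<^bsub>G\<^esub> z = N #>\<^bsub>G\<^esub> z' \<longleftrightarrow> Psi z = Psi z'"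
proof
 assume z: "z : CG" "z' : CG"
 assume e: "N #>\<^bsub>G\<^esub> z = N #>\<^bsub>G\<^esub> z'"
 have "0 + z : N #>\<^bsub>G\<^esub> z" unfolding coset using N_0 by(rule imageI)
 then obtain h where h: "h : N" "0 + z = h + z'" unfolding e unfolding coset by(rule imageE) auto
 hence "z = h + z'" by simp
 thus "Psi z = Psi z'" using h(1) by(simp add: Psi_add Psi_N)
next
 have sub: "N #>\<^bsub>G\<^esub> z \<subseteq> N #>\<^bsub>G\<^esub> z'" if "z : CG" "z' : CG" "Psi z = Psi z'" for z z'
 proof -
  have d: "z - z' : N" using that Psi_kernel[OF CG_diff[OF that(1,2)]] by(simp add: Psi_diff)
  have "h + z : (%h. h + z') ` N" if "h : N" for h
   by(rule image_eqI[of _ _ "h + (z - z')"]) (use N_add[OF that d] in simp_all)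
  thus ?thesis unfolding coset by blast
 qed
 assume "z : CG" "z' : CG" "Psi z = Psi z'"
 thus "N #>\<^bsub>G\<^esub> z = N #>\<^bsub>G\<^esub> z'" using sub by(intro equalityI) auto
qed

lemma Psi_coset: "the_elem (Psi ` (N #>\<^bsub>G\<^esub> z)) = Psi z"
proof -
 have "Psi ` (N #>\<^bsub>G\<^esub> z) = {Psi z}" unfolding coset image_image using N_0 by(force simp: Psi_add Psi_N)
 thus ?thesis by simp
qed

lemma coset_map:
 assumes h: "!!c v. v : carrier V ==> \<exists>c' v'. g (c, v) = frag_of (c', v') & v' : carrier V & tau (c', v') = T (tau (c, v))"
  and T: "!!p q. T (p - q) = T p - T q" and z: "z : CG"
 shows "frag_extend g z : CG" "Psi (frag_extend g z) = T (Psi z)"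
  "N <#>\<^bsub>G\<^esub> (frag_extend g ` (N #>\<^bsub>G\<^esub> z)) = N #>\<^bsub>G\<^esub> frag_extend g z"
proof -
 have T0: "T 0 = 0" using T[of 0 0] by simp
 have main: "frag_extend g z : CG & Psi (frag_extend g z) = T (Psi z)" if "z : CG" for z
  using that unfolding CG_iff[of z]
 proof (induction z rule: frag_induction)
  case zero
  thus ?case by(simp add: CG_0 Psi_0 T0)
 next
  case (one k)
  obtain c v where k: "k = (c, v)" "v : carrier V" using one by auto
  obtain c' v' where "g (c, v) = frag_of (c', v')" "v' : carrier V" "tau (c', v') = T (tau (c, v))" using h[OF k(2)] by blast
  thus ?case by(simp add: k(1) CG_of Psi_of)
 next
  case (diff z z')
  thus ?case by(simp add: frag_extend_diff CG_diff Psi_diff T)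
 qed
 show "frag_extend g z : CG" "Psi (frag_extend g z) = T (Psi z)" using main[OF z] by auto
 have gN: "frag_extend g h : N" if "h : N" for h
  using main[OF N_CG[OF that]] Psi_kernel Psi_N[OF that] T0 by auto
 show "N <#>\<^bsub>G\<^esub> (frag_extend g ` (N #>\<^bsub>G\<^esub> z)) = N #>\<^bsub>G\<^esub> frag_extend g z"
 proof (intro equalityI subsetI)
  fix y assume "y : N <#>\<^bsub>G\<^esub> (frag_extend g ` (N #>\<^bsub>G\<^esub> z))"
  then obtain h h' where "h : N" "h' : N" "y = h + frag_extend g (h' + z)"
   unfolding set_mult_def coset by auto
  hence "y = (h + frag_extend g h') + frag_extend g z" "h + frag_extend g h' : N"
   using gN N_add by(auto simp: frag_extend_add add.assoc)
  thus "y : N #>\<^bsub>G\<^esub> frag_extend g z" unfolding coset by blast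
 next
  fix y assume "y : N #>\<^bsub>G\<^esub> frag_extend g z"
  then obtain h where "h : N" "y = h + frag_extend g (0 + z)" unfolding coset by auto
  thus "y : N <#>\<^bsub>G\<^esub> (frag_extend g ` (N #>\<^bsub>G\<^esub> z))"
   unfolding set_mult_def coset using N_0 by force
 qed
qed

lemma complexify_simps:
 "carrier (complexify V) = (%z. N #>\<^bsub>G\<^esub> z) ` CG" "ring.zero (complexify V) = N"
 "ring.add (complexify V) = (%Y Z. Y <#>\<^bsub>G\<^esub> Z)"
 "smult (complexify V) = (%y Z. N <#>\<^bsub>G\<^esub> (frag_extend (%(c, v). frag_of (y * c, v)) ` Z))"
 "act (complexify V) = (%si Z. N <#>\<^bsub>G\<^esub> (frag_extend (%(c, v). frag_of (c, act V si v)) ` Z))"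
 by(simp_all add: complexify_def Let_def G_def[symmetric] N_def[symmetric] carrier_FactGroup fun_eq_iff)

lemma smult_coset:
 assumes "z : CG"
 shows "\<exists>z'\<in>CG. y \<odot>\<^bsub>complexify V\<^esub> (N #>\<^bsub>G\<^esub> z) = N #>\<^bsub>G\<^esub> z' & Psi z' = pm_scale y (Psi z)"
proof -
 let ?g = "%(c, v). frag_of (y * c, v)"
 have h: "\<exists>c' v'. ?g (c, v) = frag_of (c', v') & v' : carrier V & tau (c', v') = pm_scale y (tau (c, v))"
  if "v : carrier V" for c v using that by(intro exI[of _ "y * c"] exI[of _ v]) (simp add: tau_def)
 show ?thesis
  using coset_map[OF h PM.scale_right_diff_distrib assms] by(intro bexI[of _ "frag_extend ?g z"]) (auto simp: complexify_simps)
qed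

lemma act_coset:
 assumes s: "si : perms n" and "z : CG"
 shows "\<exists>z'\<in>CG. act (complexify V) si (N #>\<^bsub>G\<^esub> z) = N #>\<^bsub>G\<^esub> z' & Psi z' = prho a si (Psi z)"
proof -
 let ?g = "%(c, v). frag_of (c, act V si v)"
 have h: "\<exists>c' v'. ?g (c, v) = frag_of (c', v') & v' : carrier V & tau (c', v') = prho a si (tau (c, v))"
  if v: "v : carrier V" for c v
 proof -
  obtain u where u: "keys u \<subseteq> X" "v = \<Phi> u" using v \<Phi>_cases by metis
  have k: "keys (push_keys (a si) u) \<subseteq> X"
   using keys_push_keys[of "a si" u] u(1) a_closed[OF s] by blast
  have "tau (c, act V si v) = prho a si (tau (c, v))"
   unfolding tau_def prod.case u(2) actV[OF s u(1), symmetric] coord_\<Phi>[OF k] coord_\<Phi>[OF u(1)] cx_push prho_def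
   by(rule plin_scale[OF plin_push_keys, symmetric])
  thus ?thesis using V_act[OF s v] by auto
 qed
 have d: "prho a si (p - q) = prho a si p - prho a si q" for p q unfolding prho_def by(rule push_keys_diff)
 show ?thesis
  using coset_map[OF h d assms(2)] by(intro bexI[of _ "frag_extend ?g z"]) (auto simp: complexify_simps)
qed

lemma add_coset: "z : CG ==> z' : CG ==> (N #>\<^bsub>G\<^esub> z) \<oplus>\<^bsub>complexify V\<^esub> (N #>\<^bsub>G\<^esub> z') = N #>\<^bsub>G\<^esub> (z + z')"
 unfolding complexify_simps using N.rcos_sum[of z z'] by simp

theorem rep_iso_complexify: "rep_iso n (complexify V) (conc (prho a) (supp_in X))"
proof (rule rep_isoI[of "%Z. the_elem (Psi ` Z)"])
 show "bij_betw (%Z. the_elem (Psi ` Z)) (carrier (complexify V)) (carrier (conc (prho a) (supp_in X)))"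
  unfolding bij_betw_def
 proof
  show "inj_on (%Z. the_elem (Psi ` Z)) (carrier (complexify V))"
   by(auto simp: inj_on_def complexify_simps Psi_coset coset_eq)
  have "p : (%Z. the_elem (Psi ` Z)) ` carrier (complexify V)" if "p : supp_in X" for p
  proof -
   have "p = the_elem (Psi ` (N #>\<^bsub>G\<^esub> FF p))" unfolding Psi_coset Psi_FF[OF that] ..
   moreover have "N #>\<^bsub>G\<^esub> FF p : carrier (complexify V)" unfolding complexify_simps by(rule imageI[OF FF_CG])
   ultimately show ?thesis by(rule image_eqI)
  qed
  moreover have "(%Z. the_elem (Psi ` Z)) ` carrier (complexify V) \<subseteq> supp_in X"
   by(auto simp: complexify_simps Psi_coset Psi_supp)
  ultimately show "(%Z. the_elem (Psi ` Z)) ` carrier (complexify V) = carrier (conc (prho a) (supp_in X))"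
   by auto
 qed
next
 fix Y Z assume "Y : carrier (complexify V)" "Z : carrier (complexify V)"
 then obtain y z where yz: "y : CG" "Y = N #>\<^bsub>G\<^esub> y" "z : CG" "Z = N #>\<^bsub>G\<^esub> z" by(auto simp: complexify_simps(1))
 show "the_elem (Psi ` (Y \<oplus>\<^bsub>complexify V\<^esub> Z)) = the_elem (Psi ` Y) \<oplus>\<^bsub>conc (prho a) (supp_in X)\<^esub> the_elem (Psi ` Z)"
  unfolding yz(2,4) add_coset[OF yz(1,3)] Psi_coset by(simp add: Psi_add)
next
 fix c Z assume "Z : carrier (complexify V)"
 then obtain z where z: "z : CG" "Z = N #>\<^bsub>G\<^esub> z" by(auto simp: complexify_simps(1))
 obtain z' where z': "c \<odot>\<^bsub>complexify V\<^esub> (N #>\<^bsub>G\<^esub> z) = N #>\<^bsub>G\<^esub> z'" "Psi z' = pm_scale c (Psi z)" using smult_coset[OF z(1)] by blast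
 show "the_elem (Psi ` (c \<odot>\<^bsub>complexify V\<^esub> Z)) = c \<odot>\<^bsub>conc (prho a) (supp_in X)\<^esub> the_elem (Psi ` Z)"
  unfolding z(2) z'(1) Psi_coset z'(2) by simp
next
 fix si Z assume s: "si : perms n" and "Z : carrier (complexify V)"
 then obtain z where z: "z : CG" "Z = N #>\<^bsub>G\<^esub> z" by(auto simp: complexify_simps(1))
 obtain z' where z': "act (complexify V) si (N #>\<^bsub>G\<^esub> z) = N #>\<^bsub>G\<^esub> z'" "Psi z' = prho a si (Psi z)" using act_coset[OF s z(1)] by blast
 show "the_elem (Psi ` (act (complexify V) si Z)) = act (conc (prho a) (supp_in X)) si (the_elem (Psi ` Z))"
  unfolding z(2) z'(1) Psi_coset z'(2) by simp
qed

lemma closed_complexify: "closed_rep n (complexify V)"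
 unfolding closed_rep_def
proof (intro conjI allI ballI)
 fix c Z assume "Z : carrier (complexify V)"
 then obtain z where z: "z : CG" "Z = N #>\<^bsub>G\<^esub> z" by(auto simp: complexify_simps(1))
 show "c \<odot>\<^bsub>complexify V\<^esub> Z : carrier (complexify V)"
  using smult_coset[OF z(1), of c] by(auto simp: z(2) complexify_simps(1))
next
 fix si Z assume s: "si : perms n" and "Z : carrier (complexify V)"
 then obtain z where z: "z : CG" "Z = N #>\<^bsub>G\<^esub> z" by(auto simp: complexify_simps(1))
 show "act (complexify V) si Z : carrier (complexify V)"
  using act_coset[OF s z(1)] by(auto simp: z(2) complexify_simps(1))
next
 fix Y Z assume "Y : carrier (complexify V)" "Z : carrier (complexify V)"
 then obtain y z where yz: "y : CG" "Y = N #>\<^bsub>G\<^esub> y" "z : CG" "Z = N #>\<^bsub>G\<^esub> z" by(auto simp: complexify_simps(1))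
 show "Y \<oplus>\<^bsub>complexify V\<^esub> Z : carrier (complexify V)"
  unfolding yz(2,4) add_coset[OF yz(1,3)] using CG_add[OF yz(1,3)] by(simp add: complexify_simps(1))
qed

lemma carrier_complexify_trivial: "carrier (complexify V) = {\<zero>\<^bsub>complexify V\<^esub>} \<longleftrightarrow> X = {}"
proof
 assume t: "carrier (complexify V) = {\<zero>\<^bsub>complexify V\<^esub>}"
 show "X = {}"
 proof (rule ccontr)
  assume "X ~= {}"
  then obtain x where x: "x : X" by blast
  have "N #>\<^bsub>G\<^esub> FF (single x 1) = N #>\<^bsub>G\<^esub> FF 0"
   using t FF_CG unfolding complexify_simps(1) by(metis imageI singletonD)
  hence "Psi (FF (single x 1)) = Psi (FF 0)" using coset_eq FF_CG by blast
  hence "single x (1::complex) = 0" using x by(simp add: Psi_FF supp_in_def)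
  thus False by(metis lookup_single_eq lookup_zero zero_neq_one)
 qed
next
 assume X: "X = {}"
 have N: "N #>\<^bsub>G\<^esub> z = N" if "z : CG" for z
 proof -
  have "keys (Psi z) \<subseteq> X" using Psi_supp[OF that] by(simp add: supp_in_def)
  hence "keys (Psi z) = {}" using X by blast
  hence "Psi z = Psi 0" by(simp add: Psi_0)
  hence "N #>\<^bsub>G\<^esub> z = N #>\<^bsub>G\<^esub> 0" using coset_eq[OF that CG_0] by blast
  thus ?thesis by(simp add: coset)
 qed
 thus "carrier (complexify V) = {\<zero>\<^bsub>complexify V\<^esub>}"
  unfolding complexify_simps(1,2) using CG_0 by(auto simp: image_iff)
qed

end

section \<open>The action on the basis\<close>

definition fyact :: "(nat => nat) => (nat set \<times> nat) list \<times> nat => (nat set \<times> nat) list \<times> nat" where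
 "fyact t = (%(L, b). (map (%(G, a). (t ` G, a)) L, b))"

lemma fy_image:
 assumes "inj_on h A" "fy r A L b"
 shows "fy r (h ` A) (map (%(G, a). (h ` G, a)) L) b"
 using assms
proof (induction L arbitrary: r A)
 case (Cons Ga L)
 obtain G a where Ga: "Ga = (G, a)" by fastforce
 have f: "G \<subseteq> A" "card G < r" "1 <= a" "a < card G" "fy (r - card G) (A - G) L b"
  using Cons.prems(2) by(auto simp: Ga)
 have c: "card (h ` G) = card G" by(rule card_image[OF inj_on_subset[OF Cons.prems(1) f(1)]])
 have d: "h ` A - h ` G = h ` (A - G)" using inj_on_image_set_diff[OF Cons.prems(1), of A G] f(1) by blast
 have "fy (r - card G) (h ` (A - G)) (map (%(G, a). (h ` G, a)) L) b"
  by(rule Cons.IH[OF inj_on_subset[OF Cons.prems(1)] f(5)]) blast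
 thus ?case using f by(simp add: Ga c d image_mono)
qed simp

lemma fy_degree_act: "fy_degree (fyact t x) = fy_degree x"
proof -
 have e: "map snd (map (%(G, a). (t ` G, a)) L) = map snd L" for L :: "(nat set \<times> nat) list"
  by(induction L) auto
 thus ?thesis by(cases x) (simp only: fyact_def fy_degree_def prod.case e)
qed
lemma perms_inj: "t : perms n ==> inj t"
 by(metis injI perms_inv_apply(1))

lemma perms_image: "t : perms n ==> t ` {1..n} = {1..n}"
 unfolding perms_def mem_Collect_eq by(rule permutes_image)

lemma fyact_FY:
 assumes "t : perms n" "x : FY r {1..n}"
 shows "fyact t x : FY r {1..n}"
proof -
 obtain L b where x: "x = (L, b)" "fy r {1..n} L b" using assms(2) by(auto simp: FY_def)
 have "inj_on t {1..n}" using perms_inj[OF assms(1)] by(rule inj_on_subset) simp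
 from fy_image[OF this x(2)] show ?thesis unfolding perms_image[OF assms(1)] by(simp add: x(1) fyact_def FY_def)
qed

definition FYd where "FYd n r i = {x : FY r {1..n}. fy_degree x = i}"

lemma perm_set_FYd: "perm_set n (FYd n r i) fyact"
proof
 show "finite (FYd n r i)" unfolding FYd_def by(rule finite_subset[OF _ finite_FY[of "{1..n}" r]]) auto
 show "fyact t x : FYd n r i" if "t : perms n" "x : FYd n r i" for t x
  using that fyact_FY by(simp add: FYd_def fy_degree_act)
 show "fyact id x = x" for x by(cases x) (simp add: fyact_def)
 show "fyact (t \<circ> \<tau>) x = fyact t (fyact \<tau> x)" for t \<tau> x
  by(cases x) (auto simp: fyact_def image_comp)
qed

lemma fmono_act:
 assumes "t ` A = A"
 shows "fmono A (t ` P) (map (%(G, a). (t ` G, a)) L) b = push_keys ((`) t) (fmono A P L b)"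
proof (induction L arbitrary: P)
 case Nil
 thus ?case using assms by simp
next
 case (Cons Ga L)
 obtain G a where Ga: "Ga = (G, a)" by fastforce
 show ?case using Cons.IH[of "P \<union> G"] by(simp add: Ga image_Un push_keys_add)
qed

context chow
begin

definition ph :: "(nat => nat) => nat set_poly => nat set_poly" where "ph t = push_keys (push_keys ((`) t))"

lemma ph_add: "ph t (p + q) = ph t p + ph t q" by(simp add: ph_def push_keys_add)
lemma ph_mult: "ph t (p * q) = ph t p * ph t q" unfolding ph_def by(rule push_keys_mult) (rule push_keys_add)
lemma ph_0: "ph t 0 = 0" by(simp add: ph_def)
lemma ph_sum: "ph t (sum f A) = (\<Sum>a\<in>A. ph t (f a))" by(simp add: ph_def push_keys_sum)
lemma ph_Var: "ph t (Var F) = Var (t ` F)" by(simp add: ph_def Var_def)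

lemma ph_inverse: "t : perms n ==> ph t (ph (pinv t) p) = p"
proof -
 assume s: "t : perms n"
 have "(%F. t ` pinv t ` F) = (%F. F)" using perms_inv_apply(2)[OF s] by(simp add: image_image)
 thus ?thesis by(simp add: ph_def push_keys_comp push_keys_id)
qed

lemma FL_image:
 assumes s: "t : perms n" and F: "F : FL"
 shows "t ` F : FL"
proof (cases "F = E")
 case True
 thus ?thesis using perms_image[OF s] E_FL by simp
next
 case False
 have "card (t ` F) <= card F" by(rule card_image_le[OF FL_fin[OF F]])
 hence "card (t ` F) <= r - 1" using FL_card[OF F False] by linarith
 moreover have "t ` F \<subseteq> E" using perms_image[OF s] FL_sub[OF F] by blast
 ultimately show ?thesis unfolding uniform_flats_def by blast
qed

lemma ph_C:
 assumes s: "t : perms n" and p: "p : C"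
 shows "ph t p : C"
 unfolding carrier_flat_poly
proof
 fix m assume "m : keys (ph t p)"
 then obtain k where k: "k : keys p" "m = push_keys ((`) t) k"
  using keys_push_keys[of "push_keys ((`) t)" p] unfolding ph_def by blast
 show "keys m \<subseteq> FL - {{}}"
 proof
  fix F assume "F : keys m"
  then obtain H where H: "H : keys k" "F = t ` H" using keys_push_keys[of "(`) t" k] k(2) by blast
  hence "H : FL" "H ~= {}" using p k(1) unfolding carrier_flat_poly by blast+
  thus "F : FL - {{}}" using FL_image[OF s] H(2) by simp
 qed
qed

lemma ph_theta:
 assumes s: "t : perms n"
 shows "ph t (\<theta> i) = \<theta> (t i)"
proof -
 have inj: "inj_on ((`) t) {F : FL. i : F}" using perms_inj[OF s] by(simp add: inj_on_def inj_image_eq_iff)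
 have "(`) t ` {F : FL. i : F} = {F : FL. t i : F}"
 proof (intro equalityI subsetI)
  fix F assume F: "F : {F : FL. t i : F}"
  have e: "F = t ` (pinv t ` F)" using perms_inv_apply(2)[OF s] by(simp add: image_image)
  have "pinv t ` F : FL" using F FL_image[OF perms_inv[OF s]] by simp
  moreover have "i : pinv t ` F" using F perms_inv_apply(1)[OF s] by(metis (lifting) mem_Collect_eq image_eqI)
  ultimately show "F : (`) t ` {F : FL. i : F}" using e by blast
 qed (use FL_image[OF s] in auto)
 thus ?thesis unfolding \<theta>_def ph_sum ph_Var
  by(metis (no_types, lifting) sum.reindex_cong[OF inj])
qed

lemma ph_I:
 assumes s: "t : perms n" and p: "p : I"
 shows "ph t p : I"
proof -
 define Z where "Z = {p : C. ph t p : I}"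
 have "I \<subseteq> Z"
 proof (rule I_minimal)
  show "Z \<subseteq> C" by(auto simp: Z_def)
  show "0 : Z" by(simp add: Z_def C_0 I_0 ph_0)
  show "p + q : Z" if "p : Z" "q : Z" for p q using that by(simp add: Z_def C_add I_add ph_add)
  show "p * q : Z" if "p : C" "q : Z" for p q using that by(simp add: Z_def C_mult I_mult ph_mult ph_C[OF s])
  show "gens \<subseteq> Z"
  proof
   fix g assume g: "g : gens"
   hence gC: "g : C" by(rule subsetD[OF gens_C])
   from g consider F F' where "g = Var F * Var F'" "F : FL" "F' : FL" "\<not> F \<subseteq> F'" "\<not> F' \<subseteq> F" | i where "i : E" "g = \<theta> i"
   unfolding gens_def by blast
   hence "ph t g : I"
   proof cases
   case 1
   have "\<not> t ` F \<subseteq> t ` F'" "\<not> t ` F' \<subseteq> t ` F"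
   using 1(4,5) inj_image_subset_iff[OF perms_inj[OF s]] by simp_all
   thus ?thesis unfolding 1(1) ph_mult ph_Var by(intro I_incomparable FL_image[OF s] 1(2,3))
   next
   case 2
   thus ?thesis unfolding 2(2) ph_theta[OF s] using perms_in[OF s, of i] by(intro I_theta) simp
   qed
   thus "g : Z" using gC by(simp add: Z_def)
  qed
 qed
 thus ?thesis using p unfolding Z_def by blast
qed

definition cls where "cls = chow_class E FL"
lemma cls_def': "cls p = (%h. h + p) ` I"
 by(auto simp: cls_def chow_class_def a_r_coset_def' I_def)
lemma cls_coset: "cls p = I +>\<^bsub>flat_poly_ring FL\<^esub> p"
 by(simp add: cls_def chow_class_def I_def)

lemma cls_eq: "cls p = cls q \<longleftrightarrow> p - q : I"
proof
 assume e: "cls p = cls q"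
 have "0 + p : cls p" unfolding cls_def' by(rule imageI[OF I_0])
 hence "0 + p : (%h. h + q) ` I" unfolding e unfolding cls_def' .
 then obtain h where h: "0 + p = h + q" "h : I" by(rule imageE)
 have "p - q = h" using h(1) by simp
 thus "p - q : I" using h(2) by simp
next
 have sub: "cls p \<subseteq> cls q" if d: "p - q : I" for p q
 proof
  fix y assume "y : cls p"
  then obtain h where h: "h : I" "y = h + p" unfolding cls_def' by(elim imageE)
  have "y = (h + (p - q)) + q" using h(2) by simp
  thus "y : cls q" unfolding cls_def' by(rule image_eqI) (rule I_add[OF h(1) d])
 qed
 assume d: "p - q : I"
 have "q - p : I" using I_uminus[OF d] by simp
 thus "cls p = cls q" using sub d by(intro equalityI) auto
qed

lemma graded_simps:
 "carrier (chow_graded E FL i) = cls ` {p : C. \<forall>m \<in> keys p. deg m = i}"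
 "ring.add (chow_graded E FL i) = (%X Y. X <+>\<^bsub>flat_poly_ring FL\<^esub> Y)"
 "smult (chow_graded E FL i) = (%q X. rcoset_mult (flat_poly_ring FL) I (cls (const q)) X)"
 "act (chow_graded E FL i) = (%t X. ph t ` X)"
 by(simp_all add: chow_graded_def Let_def cls_def chow_ring_def FactRing_def monom_degree_deg const_def I_def ph_def)

lemma push_fm_C: "keys v \<subseteq> FYd n r i ==> push_keys fm v : C & (\<forall>m\<in>keys (push_keys fm v). deg m = i)"
proof -
 assume v: "keys v \<subseteq> FYd n r i"
 have "keys m \<subseteq> FL - {{}} & deg m = i" if m: "m : keys (push_keys fm v)" for m
 proof -
  obtain x where x: "x : keys v" "m = fm x" using keys_push_keys[of fm v] m by blast
  have "x : FYd n r i" by(rule subsetD[OF v x(1)])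
  hence xx: "x : FY r E" "fy_degree x = i" by(simp_all add: FYd_def)
  show ?thesis unfolding x(2) deg_fm using keys_fm[OF xx(1)] xx(2) by simp
 qed
 thus ?thesis unfolding carrier_flat_poly by blast
qed

lemma fm_act: "t : perms n ==> fm (fyact t x) = push_keys ((`) t) (fm x)"
 using fmono_act[OF perms_image, of t n "{}"] by(cases x) (simp add: fm_def fyact_def)

text \<open>Spanning gives surjectivity and independence injectivity of the coordinate map.\<close>

theorem perm_basis_chow: "perm_basis n (FYd n r i) fyact (chow_graded E FL i) (%v. cls (push_keys fm v))"
proof -
 interpret A: perm_set n "FYd n r i" fyact by(rule perm_set_FYd)
 show ?thesis
 proof (intro perm_basis.intro perm_basis_axioms.intro)
  show "perm_set n (FYd n r i) fyact" by(rule perm_set_FYd)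
  show "bij_betw (%v. cls (push_keys fm v)) {u. keys u \<subseteq> FYd n r i} (carrier (chow_graded E FL i))"
   unfolding bij_betw_def
  proof (intro conjI equalityI subsetI)
   show "inj_on (%v. cls (push_keys fm v)) {u. keys u \<subseteq> FYd n r i}"
   proof (rule inj_onI)
   fix u v assume u: "u : {u. keys u \<subseteq> FYd n r i}" and v: "v : {u. keys u \<subseteq> FYd n r i}"
   and e: "cls (push_keys fm u) = cls (push_keys fm v)"
   have k: "keys (u - v) \<subseteq> {x : FY r E. fy_degree x = i}"
   using keys_diff[of u v] u v unfolding FYd_def by blast
   have "push_keys fm (u - v) : I" using e unfolding cls_eq push_keys_diff .
   hence "u - v = 0" by(rule fy_independent[OF k])
   thus "u = v" by simp
   qed
  next
   fix Y assume "Y : (%v. cls (push_keys fm v)) ` {u. keys u \<subseteq> FYd n r i}"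
   then obtain v where v: "keys v \<subseteq> FYd n r i" "Y = cls (push_keys fm v)" by blast
   show "Y : carrier (chow_graded E FL i)" unfolding v(2) graded_simps(1) by(rule imageI) (use push_fm_C[OF v(1)] in simp)
  next
   fix Y assume "Y : carrier (chow_graded E FL i)"
   then obtain p where p: "p : C" "\<forall>m \<in> keys p. deg m = i" "Y = cls p" unfolding graded_simps(1) by blast
   obtain v where v: "keys v \<subseteq> {x : FY r E. fy_degree x = i}" "p - push_keys fm v : I"
   using fy_spans[OF p(1,2)] by(elim exE conjE)
   have "Y = cls (push_keys fm v)" unfolding p(3) cls_eq by(rule v(2))
   thus "Y : (%v. cls (push_keys fm v)) ` {u. keys u \<subseteq> FYd n r i}"
   by(rule image_eqI) (use v(1) in "simp add: FYd_def")
  qed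
 next
  fix u u' :: "(nat set \<times> nat) list \<times> nat \<Rightarrow>\<^sub>0 rat"
  assume u: "keys u \<subseteq> FYd n r i" "keys u' \<subseteq> FYd n r i"
  show "cls (push_keys fm (u + u')) = cls (push_keys fm u) \<oplus>\<^bsub>chow_graded E FL i\<^esub> cls (push_keys fm u')"
   unfolding graded_simps(2) cls_coset push_keys_add
   using I.a_rcos_sum[of "push_keys fm u" "push_keys fm u'"] push_fm_C[OF u(1)] push_fm_C[OF u(2)] by simp
 next
  fix u :: "(nat set \<times> nat) list \<times> nat \<Rightarrow>\<^sub>0 rat" and q :: rat
  assume u: "keys u \<subseteq> FYd n r i"
  have "push_keys fm (Poly_Mapping.map ((*) q) u) = const q * push_keys fm u"
  proof -
   have "keys (Poly_Mapping.map ((*) q) u) \<subseteq> keys u"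
   by(auto simp: in_keys_iff Poly_Mapping.map.rep_eq when_def)
   hence "push_keys fm (Poly_Mapping.map ((*) q) u) = (\<Sum>k\<in>keys u. single (fm k) (lookup (Poly_Mapping.map ((*) q) u) k))"
   by(rule push_keys_superset[OF finite_keys])
   also have "... = (\<Sum>k\<in>keys u. const q * single (fm k) (lookup u k))"
   by(intro sum.cong refl) (simp add: const_def mult_single Poly_Mapping.map.rep_eq when_def in_keys_iff)
   finally show ?thesis by(simp add: push_keys_def sum_distrib_left)
  qed
  thus "cls (push_keys fm (Poly_Mapping.map ((*) q) u)) = q \<odot>\<^bsub>chow_graded E FL i\<^esub> cls (push_keys fm u)"
   unfolding graded_simps(3) cls_coset using I.rcoset_mult_add[OF C_const, of "push_keys fm u" q] push_fm_C[OF u] by simp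
 next
  fix t :: "nat => nat" and u :: "(nat set \<times> nat) list \<times> nat \<Rightarrow>\<^sub>0 rat"
  assume s: "t : perms n" and u: "keys u \<subseteq> FYd n r i"
  have e: "push_keys fm (push_keys (fyact t) u) = ph t (push_keys fm u)"
   unfolding ph_def push_keys_comp by(rule push_keys_cong) (rule fm_act[OF s])
  have "ph t ` cls p = cls (ph t p)" for p
  proof (intro equalityI subsetI)
   fix y assume "y : ph t ` cls p"
   then obtain h where h: "h : I" "y = ph t (h + p)" unfolding cls_def' image_image by(elim imageE)
   show "y : cls (ph t p)" unfolding h(2) ph_add cls_def' by(rule imageI[OF ph_I[OF s h(1)]])
  next
   fix y assume "y : cls (ph t p)"
   then obtain h where h: "h : I" "y = h + ph t p" unfolding cls_def' by(elim imageE)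
   have "y = ph t (ph (pinv t) h + p)" unfolding ph_add ph_inverse[OF s] by(rule h(2))
   moreover have "ph (pinv t) h + p : cls p" unfolding cls_def' by(rule imageI[OF ph_I[OF perms_inv[OF s] h(1)]])
   ultimately show "y : ph t ` cls p" by(rule image_eqI)
  qed
  thus "cls (push_keys fm (push_keys (fyact t) u)) = act (chow_graded E FL i) t (cls (push_keys fm u))"
   unfolding e graded_simps(4) by simp
 qed
qed

end

definition fycw :: "(nat => nat) => (nat set \<times> nat) list \<times> nat => (nat multiset \<times> nat) list \<times> nat" where
 "fycw w = (%(L, b). (map (%(G, a). ((ct w G), a)) L, b))"

lemma fy_degree_cw: "fy_degree (fycw w x) = fy_degree x"
proof -
 have e: "map snd (map (%(G, a). ((ct w G), a)) L) = map snd L" for L :: "(nat set \<times> nat) list"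
  by(induction L) auto
 thus ?thesis by(cases x) (simp only: fycw_def fy_degree_def prod.case e)
qed

lemma image_mset_diff_set:
 assumes "finite A" "G \<subseteq> A"
 shows "(ct w A) = (ct w G) + (ct w (A - G))"
proof -
 have "mset_set A = mset_set G + mset_set (A - G)"
  using mset_set_Union[of G "A - G"] assms finite_subset[OF assms(2,1)] by(simp add: Un_absorb1)
 thus ?thesis by simp
qed

lemma fycw_FYM:
 assumes "finite A" "fy r A L b"
 shows "fym r ((ct w A)) (map (%(G, a). ((ct w G), a)) L) b"
 using assms
proof (induction L arbitrary: r A)
 case (Cons Ga L)
 obtain G a where Ga: "Ga = (G, a)" by fastforce
 have f: "G \<subseteq> A" "card G < r" "1 <= a" "a < card G" "fy (r - card G) (A - G) L b"
  using Cons.prems(2) by(auto simp: Ga)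
 note d = image_mset_diff_set[OF Cons.prems(1) f(1), of w]
 have "fym (r - card G) ((ct w (A - G))) (map (%(G, a). ((ct w G), a)) L) b"
  by(rule Cons.IH[OF _ f(5)]) (use Cons.prems(1) in simp)
 thus ?case using f unfolding d by(simp add: Ga)
qed simp

lemma submset_image:
 assumes "finite A" "M \<subseteq># (ct w A)"
 obtains G where "G \<subseteq> A" "(ct w G) = M"
proof -
 have "\<exists>G\<subseteq>A. (ct w G) = M"
  using assms
 proof (induction A arbitrary: M rule: finite_induct)
  case (insert x A)
  show ?case
  proof (cases "w x \<in># M")
   case True
   then obtain M' where M': "M = add_mset (w x) M'" by(metis multi_member_split)
   have "M' \<subseteq># (ct w A)" using insert.prems insert.hyps by(simp add: M')
   then obtain G where G: "G \<subseteq> A" "(ct w G) = M'" using insert.IH by blast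
   have "x \<notin> G" "finite G" using G(1) insert.hyps finite_subset by auto
   thus ?thesis using G by(intro exI[of _ "insert x G"]) (auto simp: M')
  next
   case False
   have "M \<subseteq># add_mset (w x) ((ct w A))" using insert by simp
   hence "M \<subseteq># (ct w A)" using False
   by(metis add_mset_remove_trivial diff_single_trivial subset_eq_diff_conv add_mset_add_single)
   then obtain G where "G \<subseteq> A" "(ct w G) = M" using insert.IH by blast
   thus ?thesis by blast
  qed
 qed simp
 thus thesis using that by blast
qed

lemma fym_lift:
 assumes "finite A" "fym r ((ct w A)) M b"
 shows "\<exists>L. fy r A L b & map (%(G, a). ((ct w G), a)) L = M"
 using assms
proof (induction M arbitrary: r A)
 case Nil
 thus ?case by(intro exI[of _ "[]"]) simp
next
 case (Cons Na M)
 obtain N a where Na: "Na = (N, a)" by fastforce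
 have f: "N \<subseteq># (ct w A)" "size N < r" "1 <= a" "a < size N"
  "fym (r - size N) ((ct w A) - N) M b" using Cons.prems(2) by(auto simp: Na)
 obtain G where G: "G \<subseteq> A" "(ct w G) = N" using submset_image[OF Cons.prems(1) f(1)] by metis
 have c: "size N = card G" using G(2) by auto
 have "(ct w A) - N = (ct w (A - G))"
  unfolding image_mset_diff_set[OF Cons.prems(1) G(1), of w] G(2) by simp
 hence "fym (r - card G) ((ct w (A - G))) M b" using f(5) c by simp
 from Cons.IH[OF finite_Diff[OF Cons.prems(1)] this]
 obtain L where L: "fy (r - card G) (A - G) L b" "map (%(G, a). ((ct w G), a)) L = M" by(elim exE conjE)
 have "fy r A ((G, a) # L) b" using G(1) f(2-4) c L(1) by simp
 moreover have "map (%(G, a). ((ct w G), a)) ((G, a) # L) = Na # M" using L(2) G(2) by(simp add: Na)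
 ultimately show ?case by(intro exI[of _ "(G, a) # L"] conjI)
qed

lemma fycw_image: "fycw w ` FYd n r i = {x : FYM r (cw n w). fy_degree x = i}"
proof (intro equalityI subsetI)
 fix x assume "x : fycw w ` FYd n r i"
 then obtain y where y: "y : FYd n r i" "x = fycw w y" by blast
 obtain L b where Lb: "y = (L, b)" by fastforce
 have "fy r {1..n} L b" "fy_degree y = i" using y(1) by(simp_all add: FYd_def FY_def Lb)
 thus "x : {x : FYM r (cw n w). fy_degree x = i}"
  using fycw_FYM[of "{1..n}" r L b w] fy_degree_cw[of w y] by(simp add: y(2) Lb fycw_def FYM_def cw_def)
next
 fix x assume "x : {x : FYM r (cw n w). fy_degree x = i}"
 then obtain M b where x: "x = (M, b)" "fym r (cw n w) M b" "fy_degree x = i" by(auto simp: FYM_def)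
 obtain L where L: "fy r {1..n} L b" "map (%(G, a). ((ct w G), a)) L = M"
  using fym_lift[of "{1..n}" r w M b] x(2) unfolding cw_def by auto
 have e: "x = fycw w (L, b)" using L(2) by(simp add: x(1) fycw_def)
 moreover have "(L, b) : FYd n r i" using L(1) x(3) fy_degree_cw[of w "(L, b)"] by(simp add: e FYd_def FY_def)
 ultimately show "x : fycw w ` FYd n r i" by(rule image_eqI)
qed

text \<open>Blocks with the same letters are matched one after the other.\<close>

lemma same_type_bij:
 assumes "finite A" "finite A'" "fy r A L b" "fy r A' L' b"
  "(ct w A) = (ct w A')"
  "map (%(G, a). ((ct w G), a)) L = map (%(G, a). ((ct w G), a)) L'"
 shows "\<exists>h. bij_betw h A A' & (\<forall>x\<in>A. w x = w (h x)) & L' = map (%(G, a). (h ` G, a)) L"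
 using assms
proof (induction L arbitrary: L' r A A')
 case Nil
 obtain h where "bij_betw h A A'" "!!x. x : A ==> w x = w (h x)"
  using image_mset_eq_bij[OF Nil.prems(1,2,5)] by metis
 thus ?case using Nil.prems(6) by(intro exI[of _ h]) simp
next
 case (Cons Ga L)
 obtain G a where Ga: "Ga = (G, a)" by fastforce
 obtain G' L0 where L': "L' = (G', a) # L0" "(ct w G) = (ct w G')"
  "map (%(G, a). ((ct w G), a)) L = map (%(G, a). ((ct w G), a)) L0"
  using Cons.prems(6) by(cases L') (auto simp: Ga)
 have f: "G \<subseteq> A" "fy (r - card G) (A - G) L b" "G' \<subseteq> A'" "fy (r - card G') (A' - G') L0 b"
  using Cons.prems(3,4) by(auto simp: Ga L'(1))
 have fin: "finite G" "finite G'" using f(1,3) Cons.prems(1,2) finite_subset by auto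
 have c: "card G' = card G" using arg_cong[OF L'(2), of size] by simp
 have "(ct w (A - G)) = (ct w (A' - G'))"
  using Cons.prems(5) unfolding image_mset_diff_set[OF Cons.prems(1) f(1), of w] image_mset_diff_set[OF Cons.prems(2) f(3), of w] L'(2) by simp
 from Cons.IH[OF finite_Diff[OF Cons.prems(1)] finite_Diff[OF Cons.prems(2)] f(2) f(4)[unfolded c] this L'(3)]
 obtain h2 where h2: "bij_betw h2 (A - G) (A' - G')" "\<forall>x\<in>A - G. w x = w (h2 x)" "L0 = map (%(G, a). (h2 ` G, a)) L" by(elim exE conjE)
 obtain h1 where h1: "bij_betw h1 G G'" "!!x. x : G ==> w x = w (h1 x)"
  using image_mset_eq_bij[OF fin L'(2)] by metis
 define h where "h x = (if x : G then h1 x else h2 x)" for x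
 have b1: "bij_betw h G G'" using h1(1) by(rule bij_betw_cong[THEN iffD1, rotated]) (simp add: h_def)
 have b2: "bij_betw h (A - G) (A' - G')" using h2(1) by(rule bij_betw_cong[THEN iffD1, rotated]) (simp add: h_def)
 have "bij_betw h (G \<union> (A - G)) (G' \<union> (A' - G'))" by(rule bij_betw_combine[OF b1 b2]) blast
 hence b: "bij_betw h A A'" using f(1,3) by(simp add: Un_absorb1)
 have sub: "H \<subseteq> A - G" if "(H, k) : set L" for H k
 proof -
  have "fy s B L b ==> (H, k) : set L ==> H \<subseteq> B" for s B L
   by(induction L arbitrary: s B) fastforce+
  thus ?thesis using f(2) that by blast
 qed
 have hL: "map (%(G, a). (h ` G, a)) L = map (%(G, a). (h2 ` G, a)) L"
 proof (rule map_cong[OF refl])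
  fix y assume y: "y : set L"
  obtain H k where Hk: "y = (H, k)" by fastforce
  have "h ` H = h2 ` H" using sub[of H k] y Hk by(intro image_cong) (auto simp: h_def)
  thus "(case y of (G, a) => (h ` G, a)) = (case y of (G, a) => (h2 ` G, a))" by(simp add: Hk)
 qed
 have hG: "h ` G = G'" using b1 by(simp add: bij_betw_def)
 have "L' = map (%(G, a). (h ` G, a)) (Ga # L)" using hL hG h2(3) by(simp add: L'(1) Ga)
 moreover have "\<forall>x\<in>A. w x = w (h x)" using h1(2) h2(2) by(auto simp: h_def)
 ultimately show ?case using b by(intro exI[of _ h] conjI)
qed

lemma fycw_sep:
 assumes x: "x : FYd n r i" and y: "y : FYd n r i"
 shows "fycw w x = fycw w y \<longleftrightarrow> (\<exists>t\<in>stab n w. y = fyact t x)"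
proof
 obtain L b where Lb: "x = (L, b)" by fastforce
 obtain L' b' where Lb': "y = (L', b')" by fastforce
 assume e: "fycw w x = fycw w y"
 have b: "b' = b" and m: "map (%(G, a). ((ct w G), a)) L = map (%(G, a). ((ct w G), a)) L'"
  using e by(simp_all add: Lb Lb' fycw_def)
 have f: "fy r {1..n} L b" "fy r {1..n} L' b" using x y by(simp_all add: Lb Lb' b FYd_def FY_def)
 obtain h where h: "bij_betw h {1..n} {1..n}" "\<forall>k\<in>{1..n}. w k = w (h k)" "L' = map (%(G, a). (h ` G, a)) L"
  using same_type_bij[OF finite_atLeastAtMost finite_atLeastAtMost f refl m] by(elim exE conjE)
 define t where "t k = (if k : {1..n} then h k else k)" for k
 have "bij_betw t {1..n} {1..n}" using h(1) by(rule bij_betw_cong[THEN iffD1, rotated]) (simp add: t_def)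
 hence s: "t : perms n" unfolding perms_def mem_Collect_eq by(rule bij_imp_permutes) (simp only: t_def if_False)
 have "t : stab n w" using s h(2) by(auto simp: stab_def fun_eq_iff t_def)
 moreover have "map (%(G, a). (t ` G, a)) L = L'" unfolding h(3)
 proof (rule map_cong[OF refl])
  fix z assume z: "z : set L"
  obtain H k where Hk: "z = (H, k)" by fastforce
  have "fy s B L b ==> (H, k) : set L ==> H \<subseteq> B" for s B L
   by(induction L arbitrary: s B) fastforce+
  hence "H \<subseteq> {1..n}" using f(1) z Hk by blast
  hence "t ` H = h ` H" by(intro image_cong refl) (auto simp: t_def)
  thus "(case z of (G, a) => (t ` G, a)) = (case z of (G, a) => (h ` G, a))" by(simp add: Hk)
 qed
 ultimately show "\<exists>t\<in>stab n w. y = fyact t x" by(intro bexI[of _ t]) (simp_all add: Lb Lb' b fyact_def)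
next
 assume "\<exists>t\<in>stab n w. y = fyact t x"
 then obtain t where s: "t : stab n w" "y = fyact t x" by blast
 have inj: "inj t" by(rule perms_inj[OF stab_perms[OF s(1)]])
 have ws: "w (t k) = w k" for k
 proof (cases "k : {1..n}")
  case True
  thus ?thesis using s(1) unfolding stab_def by blast
 next
  case False
  have "t permutes {1..n}" using stab_perms[OF s(1)] unfolding perms_def mem_Collect_eq .
  thus ?thesis by(simp only: permutes_not_in[OF _ False])
 qed
 have "(ct w (t ` G)) = (ct w G)" for G
 proof -
  have "mset_set (t ` G) = image_mset t (mset_set G)" by(rule image_mset_mset_set[symmetric]) (rule inj_on_subset[OF inj subset_UNIV])
  thus ?thesis by(simp add: image_mset.compositionality comp_def ws)
 qed
 thus "fycw w x = fycw w y" unfolding s(2) by(cases x) (auto simp: fycw_def fyact_def)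
qed

theorem fdim_FYd: "fdim n (prho fyact) w (supp_in (FYd n r i)) = card {x : FYM r (cw n w). fy_degree x = i}"
 using perm_set.fdim_supp_in[OF perm_set_FYd fycw_sep] by(simp add: fycw_image)

lemma FYM_degree:
 assumes "x : FYM r W"
 shows "fy_degree x < r"
proof -
 have "fym r W L b ==> sum_list (map snd L) + b < r" for L b
  by(induction L arbitrary: r W) fastforce+
 thus ?thesis using assms by(auto simp: FYM_def fy_degree_def)
qed

text \<open>All degrees are less than \<open>r\<close>.\<close>

lemma fy_sign_degrees:
 "fy_sign r W = (\<Sum>i<r. (-1) ^ i * int (card {x : FYM r W. fy_degree x = i}))"
proof -
 have "FYM r W = (\<Union>i\<in>{..<r}. {x : FYM r W. fy_degree x = i})" using FYM_degree by blast
 hence "fy_sign r W = (\<Sum>x\<in>(\<Union>i\<in>{..<r}. {x : FYM r W. fy_degree x = i}). (-1) ^ fy_degree x)"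
  unfolding fy_sign_def by simp
 also have "... = (\<Sum>i<r. \<Sum>x | x : FYM r W & fy_degree x = i. (-1) ^ fy_degree x)"
  using finite_FYM[of r W] by(intro sum.UNION_disjoint) auto
 also have "... = (\<Sum>i<r. (-1) ^ i * int (card {x : FYM r W. fy_degree x = i}))"
  by(intro sum.cong refl) (simp add: mult.commute)
 finally show ?thesis .
qed

section \<open>The equivariant Charney--Davis quantity\<close>

lemma mult_unique:
 assumes "!!w. (ksum n m w) = (ksum n m' w)"
  and "l : partitions_of n"
 shows "m l = (m' l :: nat)"
 by(rule kostka_cancel[where c = "Suc (bw l)"]) (use assms in auto)

text \<open>Equality in the representation ring is tested on fixed vectors.\<close>

lemma virt_eqI:
 assumes "has_mult n A a" "has_mult n B b" "has_mult n A' a'" "has_mult n B' b'"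
  and cl: "closed_rep n A'" "closed_rep n B"
  and eq: "!!w. (ksum n a w) + (ksum n b' w)
   = (ksum n a' w) + (ksum n b w)"
 shows "virt_eq n (A, B) (A', B')"
 unfolding virt_eq_def fst_conv snd_conv
proof (rule has_mult_unique_iso)
 show "has_mult n (rep_plus A B') (%l. a l + b' l)" by(rule has_mult_plus[OF assms(1,4)])
 show "has_mult n (rep_plus A' B) (%l. a' l + b l)" by(rule has_mult_plus[OF assms(3,2)])
 show "closed_rep n (rep_plus A' B)" by(rule closed_rep_plus[OF cl])
 show "a l + b' l = a' l + b l" if "l : partitions_of n" for l
 proof (rule mult_unique[where m = "%l. a l + b' l" and m' = "%l. a' l + b l", OF _ that])
  show "(\<Sum>l\<in>partitions_of n. (a l + b' l) * K (row l) (cw n w)) = (\<Sum>l\<in>partitions_of n. (a' l + b l) * K (row l) (cw n w))" for w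
   using eq[of w] by(simp add: distrib_right sum.distrib)
 qed
qed
lemma has_mult_zero_rep: "has_mult n zero_rep (% _. 0)"
 by(rule has_mult_zero[where z = 0]) (simp_all add: closed_rep_zero, simp add: zero_rep_def)

lemma difference_of_nats:
 "int a - int b = int c ==> a + 0 = c + b" "int a - int b = - int c ==> a + c = 0 + b"
 by linarith+

lemma virt_uminus_power: "(virt_uminus ^^ k) (P, Q) = (if even k then (P, Q) else (Q, P))"
 by(induction k) (auto simp: virt_uminus_def)

context chow
begin

abbreviation "Vr \<equiv> uniform_chow r n"

lemma chow_iso: "rep_iso n (Vr i) (conc (prho fyact) (supp_in (FYd n r i)))"
 and chow_closed: "closed_rep n (Vr i)"
 and chow_trivial: "carrier (Vr i) = {\<zero>\<^bsub>Vr i\<^esub>} \<longleftrightarrow> FYd n r i = {}"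
 unfolding uniform_chow_def
 by(rule perm_basis.rep_iso_complexify[OF perm_basis_chow] perm_basis.closed_complexify[OF perm_basis_chow]
   perm_basis.carrier_complexify_trivial[OF perm_basis_chow])+

definition cnt where "cnt i W = card {x : FYM r W. fy_degree x = i}"

lemma chow_mult: "\<exists>m. has_mult n (Vr i) m & (\<forall>w. cnt i (cw n w) = (ksum n m w))"
proof -
 obtain m where m: "has_mult n (conc (prho fyact) (supp_in (FYd n r i))) m"
  "!!w. fdim n (prho fyact) w (supp_in (FYd n r i)) = (ksum n m w)"
  by(rule specht_decomposition[OF perm_set.sym_rep_supp_in[OF perm_set_FYd[of n r i]]]) blast
 have "has_mult n (Vr i) m" by(rule has_mult_iso[OF chow_iso m(1)])
 thus ?thesis using m(2) unfolding fdim_FYd cnt_def by(intro exI[of _ m]) simp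
qed

definition EV where "EV = {i. i <= r - 1 & even i}"
definition OD where "OD = {i. i <= r - 1 & odd i}"

lemma fin_EV: "finite EV" "finite OD"
 unfolding EV_def OD_def by(rule finite_subset[of _ "{..r - 1}"]; auto)+

lemma part_sums:
 obtains mE mO where "has_mult n (rep_Sum EV Vr) mE" "has_mult n (rep_Sum OD Vr) mO"
  "!!w. int (ksum n mE w) - int (ksum n mO w) = fy_sign r (cw n w)"
proof -
 have "\<forall>i. \<exists>m. has_mult n (Vr i) m & (\<forall>w. cnt i (cw n w) = (ksum n m w))"
  using chow_mult by blast
 from choice[OF this] obtain m where m: "\<forall>i. has_mult n (Vr i) (m i) & (\<forall>w. cnt i (cw n w) = (\<Sum>l\<in>partitions_of n. m i l * K (row l) (cw n w)))" by(elim exE)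
 have su: "(\<Sum>l\<in>partitions_of n. (\<Sum>i\<in>J. m i l) * K (row l) (cw n w)) = (\<Sum>i\<in>J. cnt i (cw n w))" for J w
 proof -
  have "(\<Sum>l\<in>partitions_of n. (\<Sum>i\<in>J. m i l) * K (row l) (cw n w)) = (\<Sum>l\<in>partitions_of n. \<Sum>i\<in>J. m i l * K (row l) (cw n w))"
   by(simp add: sum_distrib_right)
  also have "... = (\<Sum>i\<in>J. \<Sum>l\<in>partitions_of n. m i l * K (row l) (cw n w))" by(rule sum.swap)
  finally show ?thesis using m by simp
 qed
 have E: "has_mult n (rep_Sum EV Vr) (%l. \<Sum>i\<in>EV. m i l)" by(rule has_mult_Sum[OF fin_EV(1)]) (use m in blast)
 have O: "has_mult n (rep_Sum OD Vr) (%l. \<Sum>i\<in>OD. m i l)" by(rule has_mult_Sum[OF fin_EV(2)]) (use m in blast)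
 have sg: "fy_sign r W = int (\<Sum>i\<in>EV. cnt i W) - int (\<Sum>i\<in>OD. cnt i W)" for W
 proof -
  have u: "{..<r} = EV \<union> OD" "EV \<inter> OD = {}" using r1 by(auto simp: EV_def OD_def)
  have "fy_sign r W = (\<Sum>i\<in>EV \<union> OD. (-1) ^ i * int (cnt i W))" unfolding fy_sign_degrees u(1) cnt_def ..
  also have "... = (\<Sum>i\<in>EV. (-1) ^ i * int (cnt i W)) + (\<Sum>i\<in>OD. (-1) ^ i * int (cnt i W))"
   by(rule sum.union_disjoint[OF fin_EV u(2)])
  also have "(\<Sum>i\<in>EV. (-1) ^ i * int (cnt i W)) = (\<Sum>i\<in>EV. int (cnt i W))" by(intro sum.cong refl) (simp add: EV_def)
  also have "(\<Sum>i\<in>OD. (-1) ^ i * int (cnt i W)) = (\<Sum>i\<in>OD. - int (cnt i W))" by(intro sum.cong refl) (simp add: OD_def)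
  finally show ?thesis by(simp add: sum_negf)
 qed
 show thesis by(rule that[OF E O]) (simp only: su sg)
qed

lemma frob_chow: "frob_char n (Vr i) \<alpha> = (if size (mset_of \<alpha>) = n then int (cnt i (mset_of \<alpha>)) else 0)"
proof -
 have f: "frob_char n (Vr i) \<alpha> = (if size (mset_of \<alpha>) = n
   then int (fdim n (prho fyact) (SOME w. cw n w = mset_of \<alpha>) (supp_in (FYd n r i))) else 0)"
  by(rule frob_char_fdim[OF chow_iso chow_closed perm_set.sym_rep_supp_in[OF perm_set_FYd]])
 show ?thesis
 proof (cases "size (mset_of \<alpha>) = n")
  case True
  have "\<exists>w. cw n w = mset_of \<alpha>" using cw_exists[OF True] by metis
  hence "cw n (SOME w. cw n w = mset_of \<alpha>) = mset_of \<alpha>" by(rule someI_ex)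
  thus ?thesis unfolding f fdim_FYd cnt_def by simp
 next
  case False
  thus ?thesis unfolding f by(simp only: if_False)
 qed
qed

lemma grFrob_chow: "grFrob n Vr (-1) \<alpha> = (if size (mset_of \<alpha>) = n then fy_sign r (mset_of \<alpha>) else 0)"
proof -
 define T where "T = {i. carrier (Vr i) ~= {\<zero>\<^bsub>Vr i\<^esub>}}"
 have T: "i : T \<longleftrightarrow> FYd n r i ~= {}" for i by(simp add: T_def chow_trivial)
 have "T \<subseteq> {..<r}"
 proof
  fix i assume "i : T"
  then obtain x where "x : FYd n r i" using T by blast
  hence "fycw id x : {x : FYM r (cw n id). fy_degree x = i}" unfolding fycw_image[symmetric] by(rule imageI)
  thus "i : {..<r}" using FYM_degree by blast
 qed
 have zero: "frob_char n (Vr i) \<alpha> = 0" if "i \<notin> T" for i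
 proof (cases "size (mset_of \<alpha>) = n")
  case True
  obtain w where w: "cw n w = mset_of \<alpha>" by(rule cw_exists[OF True])
  have "cnt i (mset_of \<alpha>) = card (fycw w ` FYd n r i)" unfolding cnt_def fycw_image w ..
  hence "cnt i (mset_of \<alpha>) = 0" using that T by simp
  thus ?thesis unfolding frob_chow by simp
 qed (simp add: frob_chow)
 have "grFrob n Vr (-1) \<alpha> = (\<Sum>i\<in>T. frob_char n (Vr i) \<alpha> * (-1) ^ i)" by(simp add: grFrob_def T_def)
 also have "... = (\<Sum>i<r. frob_char n (Vr i) \<alpha> * (-1) ^ i)"
  by(rule sum.mono_neutral_left) (use \<open>T \<subseteq> {..<r}\<close> zero in auto)
 also have "... = (if size (mset_of \<alpha>) = n then fy_sign r (mset_of \<alpha>) else 0)"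
  unfolding frob_chow fy_sign_degrees cnt_def by(simp add: mult.commute)
 finally show ?thesis .
qed

end

theorem theorem5p1:
  fixes n r :: nat
  assumes "n \<ge> 1" and "1 \<le> r" and "r \<le> n"
  shows "virt_eq n (alternating_sum (r - 1) (uniform_chow r n))
           (if even r then virt_of zero_rep
            else (virt_uminus ^^ ((r - 1) div 2)) (virt_of (specht (ribbon (Even (r - 1)) n))))
       \<and> grFrob n (uniform_chow r n) (-1) =
           (if even r then (\<lambda>\<alpha>. 0)
            else (\<lambda>\<alpha>. (-1) ^ ((r - 1) div 2) * schur (ribbon (Even (r - 1)) n) \<alpha>))"
proof -
 interpret chow n r by unfold_locales (use assms in auto)
 obtain mE mO where mE: "has_mult n (rep_Sum EV Vr) mE" and mO: "has_mult n (rep_Sum OD Vr) mO"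
  and sg: "!!w. int (ksum n mE w) - int (ksum n mO w) = fy_sign r (cw n w)"
  by(rule part_sums) blast
 have alt: "alternating_sum (r - 1) Vr = (rep_Sum EV Vr, rep_Sum OD Vr)"
  unfolding alternating_sum_def EV_def OD_def ..
 have clO: "closed_rep n (rep_Sum OD Vr)" by(rule closed_rep_Sum) (rule chow_closed)
 show ?thesis
 proof (cases "even r")
  case True
  have s0: "fy_sign r W = 0" if "size W = n" for W
   using fy_sign_ribbon[of r W] that assms(3) True by simp
  have "virt_eq n (rep_Sum EV Vr, rep_Sum OD Vr) (zero_rep :: (complex, 'v::zero) rep, zero_rep)"
  proof (rule virt_eqI[OF mE mO has_mult_zero_rep has_mult_zero_rep closed_rep_zero clO])
   show "(ksum n mE w) + (\<Sum>l\<in>partitions_of n. 0 * K (row l) (cw n w))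
   = (\<Sum>l\<in>partitions_of n. 0 * K (row l) (cw n w)) + (ksum n mO w)" for w
   unfolding mult_zero_left sum.neutral_const
   by(rule difference_of_nats(1)) (use sg[of w] s0[OF size_cw, of w] in "simp only: of_nat_0")
  qed
  moreover have "grFrob n Vr (-1) = (%\<alpha>. 0)" by(rule ext) (simp add: grFrob_chow s0)
  ultimately show ?thesis using True unfolding alt virt_of_def by simp
 next
  case False
  define k where "k = (r - 1) div 2"
  have r: "r - 1 = 2 * k" "2 * k < n" using False assms unfolding k_def by(auto elim!: oddE)
  interpret S: even_ribbon n k by unfold_locales (rule r(2))
  have sk: "fy_sign r W = (-1) ^ k * int (card (SSL k W))" if "size W = n" for W
   using fy_sign_ribbon[of r W] that assms(3) False by(simp add: k_def)
  obtain mS where "has_mult n (conc (prho S.a) S.S) mS"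
   and mS: "!!w. fdim n (prho S.a) w S.S = (ksum n mS w)"
   by(rule specht_decomposition[OF S.sym_rep_S]) blast
  hence hS: "has_mult n (specht S.D) mS" by(simp add: S.specht_S)
  have clS: "closed_rep n (specht S.D)" unfolding S.specht_S by(rule closed_rep_conc[OF S.sym_rep_S])
  have e: "int (ksum n mE w) - int (ksum n mO w)
   = (-1) ^ k * int (ksum n mS w)" for w
   using sg[of w] sk[of "cw n w"] unfolding mS[symmetric] S.fdim_S by simp
  have "virt_eq n (rep_Sum EV Vr, rep_Sum OD Vr) ((virt_uminus ^^ k) (virt_of (specht S.D)))"
  proof (cases "even k")
   case True
   hence p: "(-1) ^ k = (1::int)" by simp
   have "virt_eq n (rep_Sum EV Vr, rep_Sum OD Vr) (specht S.D, zero_rep)"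
   proof (rule virt_eqI[OF mE mO hS has_mult_zero_rep clS clO])
   show "(ksum n mE w) + (\<Sum>l\<in>partitions_of n. 0 * K (row l) (cw n w))
   = (ksum n mS w) + (ksum n mO w)" for w
   unfolding mult_zero_left sum.neutral_const
   by(rule difference_of_nats(1)) (use e[of w] p in "simp only: mult_1_left")
   qed
   thus ?thesis using True by(simp add: virt_of_def virt_uminus_power)
  next
   case False
   hence p: "(-1) ^ k = (-1::int)" by simp
   have "virt_eq n (rep_Sum EV Vr, rep_Sum OD Vr) (zero_rep, specht S.D)"
   proof (rule virt_eqI[OF mE mO has_mult_zero_rep hS closed_rep_zero clO])
   show "(ksum n mE w) + (ksum n mS w)
   = (\<Sum>l\<in>partitions_of n. 0 * K (row l) (cw n w)) + (ksum n mO w)" for w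
   unfolding mult_zero_left sum.neutral_const
   by(rule difference_of_nats(2)) (use e[of w] p in "simp only: mult_minus1")
   qed
   thus ?thesis using False by(simp add: virt_of_def virt_uminus_power)
  qed
  moreover have "grFrob n Vr (-1) = (%\<alpha>. (-1) ^ k * schur S.D \<alpha>)"
   by(rule ext) (simp add: grFrob_chow S.schur_ribbon sk)
  ultimately show ?thesis using False unfolding alt unfolding k_def[symmetric] unfolding r(1) by simp
 qed
qed

end
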